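(* For any $q\ge0$, $a>0$ and $x\le a$, $$\mathbb{E}_x\left(\int_0^{T_a^+}e^{-qt}\,dL_t\right)=\delta\,\overline{\mathbb{W}}^{(q)}(a-b)\frac{r^{(q)}(x)}{r^{(q)}(a)}-\delta\,\overline{\mathbb{W}}^{(q)}(x-b),$$ where $r^{(q)}(x):=Z^{(q)}(x)+q\delta\int_b^x\mathbb{W}^{(q)}(x-y)W^{(q)}(y)\,dy$, $x\in\mathbb{R}$.
   Context: Let $X=(X_t)_{t\ge0}$ be a spectrally negative Lévy process (no positive jumps, not the negative of a subordinator); $\mathbb{P}_x$ is its law when $X_0=x$, with expectation $\mathbb{E}_x$. Its Laplace exponent is $\psi(\theta)=\log\mathbb{E}_0[e^{\theta X_1}]=\gamma\theta+\frac{\sigma^2}{2}\theta^2+\int_{(-\infty,0)}(e^{\theta x}-1-\theta x1_{\{x>-1\}})\Pi(dx)$, $\theta\ge0$, with $\gamma\in\mathbb{R}$, $\sigma\ge0$ and Lévy measure $\Pi$ on $(-\infty,0)$, $\int(1\wedge x^2)\Pi(dx)<\infty$. If $X$ has paths of bounded variation, then $X_t=X_0+ct-S_t$ with $c:=\gamma-\int_{(-1,0)}x\,\Pi(dx)>0$ and $S$ a driftless subordinator. Fix $b>0$ and $\delta\ge0$, and assume $\delta<c$ whenever $X$ has paths of bounded variation. Put $Y_t:=X_t-\delta t$, a spectrally negative Lévy process with Laplace exponent $\psi_Y(\theta)=\psi(\theta)-\delta\theta$. Refracted-reflected process $V$ under $\mathbb{P}_x$ (reflected at $0$, refracted above $b$):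 Step 0: set $V_{0-}=x$; if $x\ge0$ set $\underline\tau:=0$ and go to Step 1, otherwise set $\overline\tau:=0$ and go to Step 2. Step 1: let $(\widetilde A_t)_{t\ge\underline\tau}$ be the refracted Lévy process started at time $\underline\tau$ at level $x$, i.e. the unique strong solution of $d\widetilde A_t=dX_t-\delta1_{\{\widetilde A_t>b\}}dt$ with $\widetilde A_{\underline\tau}=x$; let $\overline\tau:=\inf\{t>\underline\tau:\widetilde A_t<0\}$, set $V_t=\widetilde A_t$ for $\underline\tau\le t<\overline\tau$, and go to Step 2. Step 2: let $\widetilde U_t=(X_t-X_{\overline\tau})+\sup_{\overline\tau\le s\le t}(-(X_s-X_{\overline\tau}))\vee0$, $t\ge\overline\tau$, be the process reflected at $0$ started at time $\overline\tau$ at $0$; let $\underline\tau:=\inf\{t>\overline\tau:\widetilde U_t>b\}$, set $V_t=\widetilde U_t$ for $\overline\tau\le t<\underline\tau$, set $x=b$, and go to Step 1. For $a>0$, $T_a^+:=\inf\{t>0:V_t>a\}$ ($\inf\varnothing=\infty$). Define $L_t:=\delta\int_0^t1_{\{V_s>b\}}ds$, $t\ge0$. Scale functions: for $q\ge0$, $\Phi(q):=\sup\{\lambda\ge0:\psi(\lambda)=q\}$ and $\varphi(q):=\sup\{\lambda\ge0:\psi_Y(\lambda)=q\}$. $W^{(q)}$ (resp. $\mathbb{W}^{(q)}$) is the scale function of $X$ (resp. $Y$): zero on $(-\infty,0)$, continuous and increasing on $[0,\infty)$, with $\int_0^\infty e^{-\theta x}W^{(q)}(x)dx=1/(\psi(\theta)-q)$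 for $\theta>\Phi(q)$ (resp. $\int_0^\infty e^{-\theta x}\mathbb{W}^{(q)}(x)dx=1/(\psi_Y(\theta)-q)$ for $\theta>\varphi(q)$). Also, for $x\in\mathbb{R}$, $Z^{(q)}(x):=1+q\int_0^xW^{(q)}(y)dy$ and $\overline{\mathbb{W}}^{(q)}(x):=\int_0^x\mathbb{W}^{(q)}(y)dy$. Integrals $\int_b^x\mathbb{W}^{(q)}(x-y)\cdots dy$ vanish for $x\le b$. *)

theory Defs
  imports "HOL-Probability.Probability"
begin

section \<open>Spectrally negative Levy processes\<close>

text \<open>Processes have type \<^typ>\<open>real \<Rightarrow> 'a \<Rightarrow> real\<close>; only times \<open>t \<ge> 0\<close> are relevant.\<close>

definition cadlag :: "(real \<Rightarrow> real) \<Rightarrow> bool" where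
  "cadlag f \<longleftrightarrow>
     (\<forall>t\<ge>0. (f \<longlongrightarrow> f t) (at_right t)) \<and> (\<forall>t>0. \<exists>l. (f \<longlongrightarrow> l) (at_left t))"

definition no_positive_jumps :: "(real \<Rightarrow> real) \<Rightarrow> bool" where
  "no_positive_jumps f \<longleftrightarrow> (\<forall>t>0. \<forall>l. (f \<longlongrightarrow> l) (at_left t) \<longrightarrow> f t \<le> l)"

definition levy_process :: "'a measure \<Rightarrow> real \<Rightarrow> (real \<Rightarrow> 'a \<Rightarrow> real) \<Rightarrow> bool" where
  "levy_process M x X \<longleftrightarrow>
     prob_space M \<and>
     (\<forall>t\<ge>0. X t \<in> borel_measurable M) \<and>
     (AE \<omega> in M. X 0 \<omega> = x) \<and>
     (AE \<omega> in M. cadlag (\<lambda>t. X t \<omega>)) \<and>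
     (\<forall>(n::nat) u. 0 \<le> u 0 \<and> mono u \<longrightarrow>
        prob_space.indep_vars M (\<lambda>_. borel) (\<lambda>i \<omega>. X (u (Suc i)) \<omega> - X (u i) \<omega>) {..<n}) \<and>
     (\<forall>s\<ge>0. \<forall>t\<ge>0. distr M borel (\<lambda>\<omega>. X (s + t) \<omega> - X s \<omega>) = distr M borel (\<lambda>\<omega>. X t \<omega> - X 0 \<omega>))"

text \<open>The last conjunct says that \<open>X - x\<close> is not the negative of a subordinator, a subordinator
  being a Levy process with almost surely nondecreasing paths.\<close>

definition spectrally_negative_levy :: "'a measure \<Rightarrow> real \<Rightarrow> (real \<Rightarrow> 'a \<Rightarrow> real) \<Rightarrow> bool" where
  "spectrally_negative_levy M x X \<longleftrightarrow>
     levy_process M x X \<and>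
     (AE \<omega> in M. no_positive_jumps (\<lambda>t. X t \<omega>)) \<and>
     \<not> (AE \<omega> in M. antimono_on {0..} (\<lambda>t. X t \<omega>))"

definition locally_bounded_variation :: "(real \<Rightarrow> real) \<Rightarrow> bool" where
  "locally_bounded_variation f \<longleftrightarrow>
     (\<forall>t\<ge>0. \<exists>B. \<forall>(n::nat) u. 0 \<le> u 0 \<and> mono u \<and> u n \<le> t \<longrightarrow>
        (\<Sum>i<n. \<bar>f (u (Suc i)) - f (u i)\<bar>) \<le> B)"

definition bounded_variation_paths :: "'a measure \<Rightarrow> (real \<Rightarrow> 'a \<Rightarrow> real) \<Rightarrow> bool" where
  "bounded_variation_paths M X \<longleftrightarrow> (AE \<omega> in M. locally_bounded_variation (\<lambda>t. X t \<omega>))"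

text \<open>Under the law with \<open>X 0 = x\<close>, the increment \<open>X 1 - X 0\<close> has the law of \<open>X 1\<close> started at \<open>0\<close>.\<close>

definition laplace_exponent :: "'a measure \<Rightarrow> (real \<Rightarrow> 'a \<Rightarrow> real) \<Rightarrow> real \<Rightarrow> real" where
  "laplace_exponent M X \<theta> = ln (LINT \<omega>|M. exp (\<theta> * (X 1 \<omega> - X 0 \<omega>)))"

text \<open>\<open>\<nu>\<close> is the Levy measure (usually written with a capital Pi, which is reserved syntax here).\<close>

definition levy_measure_neg :: "real measure \<Rightarrow> bool" where
  "levy_measure_neg \<nu> \<longleftrightarrow>
     sets \<nu> = sets borel \<and> emeasure \<nu> {0..} = 0 \<and> (\<integral>\<^sup>+ y. ennreal (min 1 (y\<^sup>2)) \<partial>\<nu>) < \<infinity>"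

definition levy_khintchine :: "real \<Rightarrow> real \<Rightarrow> real measure \<Rightarrow> real \<Rightarrow> real" where
  "levy_khintchine \<gamma> \<sigma> \<nu> \<theta> =
     \<gamma> * \<theta> + \<sigma>\<^sup>2 / 2 * \<theta>\<^sup>2
     + (LINT y:{..<0}|\<nu>. exp (\<theta> * y) - 1 - \<theta> * y * indicator {-1<..} y)"

definition levy_triplet ::
    "'a measure \<Rightarrow> (real \<Rightarrow> 'a \<Rightarrow> real) \<Rightarrow> real \<Rightarrow> real \<Rightarrow> real measure \<Rightarrow> bool" where
  "levy_triplet M X \<gamma> \<sigma> \<nu> \<longleftrightarrow>
     0 \<le> \<sigma> \<and> levy_measure_neg \<nu> \<and>
     (\<forall>\<theta>\<ge>0. laplace_exponent M X \<theta> = levy_khintchine \<gamma> \<sigma> \<nu> \<theta>)"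

definition bv_drift :: "real \<Rightarrow> real measure \<Rightarrow> real" where
  "bv_drift \<gamma> \<nu> = \<gamma> - (LINT y:{-1<..<0}|\<nu>. y)"


section \<open>The refracted-reflected process\<close>

text \<open>The construction is pathwise: below, \<open>X\<close> is a single path of the driving process.
  The infimum is taken in \<^typ>\<open>ereal\<close>, so that it is \<open>\<infinity>\<close> when the event never happens.\<close>

definition first_after :: "real \<Rightarrow> (real \<Rightarrow> bool) \<Rightarrow> ereal" where
  "first_after s P = Inf (ereal ` {t. s < t \<and> P t})"

text \<open>\<open>A\<close>, on \<open>[s, \<infinity>)\<close>, solves \<open>dA = dX - \<delta> 1{A > b} dt\<close> with \<open>A s = y\<close>.\<close>

definition refracted_solution ::
    "(real \<Rightarrow> real) \<Rightarrow> real \<Rightarrow> real \<Rightarrow> real \<Rightarrow> real \<Rightarrow> (real \<Rightarrow> real) \<Rightarrow> bool" where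
  "refracted_solution X \<delta> b s y A \<longleftrightarrow>
     {t. s \<le> t \<and> b < A t} \<in> sets borel \<and>
     (\<forall>t\<ge>s. A t = y + (X t - X s) - \<delta> * (LBINT u:{s..t}. indicator {b<..} (A u)))"

definition reflected_path :: "(real \<Rightarrow> real) \<Rightarrow> real \<Rightarrow> real \<Rightarrow> real" where
  "reflected_path X s t = (X t - X s) + max (SUP u\<in>{s..t}. - (X u - X s)) 0"

text \<open>\<open>enters_step1 X \<delta> b x s y\<close>: Step 1 is entered at time \<open>s\<close> with starting level \<open>y\<close>;
  \<open>enters_step2 X \<delta> b x s\<close>: Step 2 is entered at time \<open>s\<close>. A step whose exit time is \<open>\<infinity>\<close>
  has no successor.\<close>

inductive
  enters_step1 :: "(real \<Rightarrow> real) \<Rightarrow> real \<Rightarrow> real \<Rightarrow> real \<Rightarrow> real \<Rightarrow> real \<Rightarrow> bool" and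
  enters_step2 :: "(real \<Rightarrow> real) \<Rightarrow> real \<Rightarrow> real \<Rightarrow> real \<Rightarrow> real \<Rightarrow> bool"
  for X :: "real \<Rightarrow> real" and \<delta> b x :: real
where
  start_nonneg: "0 \<le> x \<Longrightarrow> enters_step1 X \<delta> b x 0 x"
| start_neg: "x < 0 \<Longrightarrow> enters_step2 X \<delta> b x 0"
| from_step1: "enters_step1 X \<delta> b x s y \<Longrightarrow> refracted_solution X \<delta> b s y A \<Longrightarrow>
    first_after s (\<lambda>t. A t < 0) = ereal s' \<Longrightarrow> enters_step2 X \<delta> b x s'"
| from_step2: "enters_step2 X \<delta> b x s \<Longrightarrow>
    first_after s (\<lambda>t. b < reflected_path X s t) = ereal s' \<Longrightarrow> enters_step1 X \<delta> b x s' b"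

text \<open>For a cadlag path \<open>X\<close> only finitely many steps are entered in bounded time, so the steps
  cover \<open>[0, \<infinity>)\<close>, and solutions of the refracted equation are unique; hence \<open>V\<close> is
  determined on \<open>[0, \<infinity>)\<close>.\<close>

definition refracted_reflected_path ::
    "(real \<Rightarrow> real) \<Rightarrow> real \<Rightarrow> real \<Rightarrow> real \<Rightarrow> (real \<Rightarrow> real) \<Rightarrow> bool" where
  "refracted_reflected_path X \<delta> b x V \<longleftrightarrow>
     (\<forall>s y. enters_step1 X \<delta> b x s y \<longrightarrow>
        (\<exists>A. refracted_solution X \<delta> b s y A \<and>
             (\<forall>t\<ge>s. ereal t < first_after s (\<lambda>u. A u < 0) \<longrightarrow> V t = A t))) \<and>
     (\<forall>s. enters_step2 X \<delta> b x s \<longrightarrow>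
        (\<forall>t\<ge>s. ereal t < first_after s (\<lambda>u. b < reflected_path X s u) \<longrightarrow>
             V t = reflected_path X s t))"

definition refracted_reflected ::
    "'a measure \<Rightarrow> (real \<Rightarrow> 'a \<Rightarrow> real) \<Rightarrow> real \<Rightarrow> real \<Rightarrow> real \<Rightarrow> (real \<Rightarrow> 'a \<Rightarrow> real) \<Rightarrow> bool" where
  "refracted_reflected M X \<delta> b x V \<longleftrightarrow>
     (AE \<omega> in M. refracted_reflected_path (\<lambda>t. X t \<omega>) \<delta> b x (\<lambda>t. V t \<omega>))"

definition passage_above :: "(real \<Rightarrow> 'a \<Rightarrow> real) \<Rightarrow> real \<Rightarrow> 'a \<Rightarrow> ereal" where
  "passage_above V a \<omega> = first_after 0 (\<lambda>t. a < V t \<omega>)"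

text \<open>Extended by \<open>0\<close> to negative times, so that \<^const>\<open>interval_measure\<close> applies to it.\<close>

definition refraction_loss :: "real \<Rightarrow> real \<Rightarrow> (real \<Rightarrow> 'a \<Rightarrow> real) \<Rightarrow> 'a \<Rightarrow> real \<Rightarrow> real" where
  "refraction_loss \<delta> b V \<omega> t = \<delta> * (LBINT s:{0..t}. indicator {b<..} (V s \<omega>))"


section \<open>Scale functions\<close>

definition right_inverse :: "(real \<Rightarrow> real) \<Rightarrow> real \<Rightarrow> real" where
  "right_inverse \<psi> q = Sup {l. 0 \<le> l \<and> \<psi> l = q}"

text \<open>Increasing is meant in the weak sense: for a pure drift \<open>X t = c t\<close> and \<open>q = 0\<close> the scale
  function is the constant \<open>1 / c\<close> on \<open>[0, \<infinity>)\<close>.\<close>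

definition is_scale_function :: "(real \<Rightarrow> real) \<Rightarrow> real \<Rightarrow> (real \<Rightarrow> real) \<Rightarrow> bool" where
  "is_scale_function \<psi> q W \<longleftrightarrow>
     (\<forall>x<0. W x = 0) \<and> continuous_on {0..} W \<and> mono_on {0..} W \<and>
     (\<forall>\<theta>>right_inverse \<psi> q.
        has_bochner_integral lborel
          (\<lambda>x. indicator {0..} x *\<^sub>R (exp (- \<theta> * x) * W x)) (1 / (\<psi> \<theta> - q)))"

definition scale_Z :: "real \<Rightarrow> (real \<Rightarrow> real) \<Rightarrow> real \<Rightarrow> real" where
  "scale_Z q W x = 1 + q * (LBINT y=0..x. W y)"

definition scale_W_bar :: "(real \<Rightarrow> real) \<Rightarrow> real \<Rightarrow> real" where
  "scale_W_bar W x = (LBINT y=0..x. W y)"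

text \<open>For \<open>x < b\<close> the (oriented) integral vanishes, because \<open>WY (x - y) = 0\<close> for \<open>y > x\<close>.\<close>

definition scale_r ::
    "real \<Rightarrow> real \<Rightarrow> real \<Rightarrow> (real \<Rightarrow> real) \<Rightarrow> (real \<Rightarrow> real) \<Rightarrow> real \<Rightarrow> real" where
  "scale_r q \<delta> b W WY x = scale_Z q W x + q * \<delta> * (LBINT y=b..x. WY (x - y) * W y)"

end

theory Submission
 imports Defs "HOL-Complex_Analysis.Complex_Analysis" "HOL-Real_Asymp.Real_Asymp"
begin

text \<open>Discretise with step \<open>h\<close>: each step adds the increment of \<open>X\<close>, reflects at \<open>0\<close> and, when it ends above \<open>b\<close>, subtracts
 \<open>\<delta> h\<close>; along almost every path this converges to \<open>V\<close>. Let \<open>w(x)\<close> be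
 the integral of the scale function of \<open>Y\<close> up to \<open>x - b\<close>, and \<open>I\<close> the antiderivative of \<open>r\<close> or \<open>w\<close>. Uniqueness of Laplace transforms yields Dynkin's
 formula for \<open>I\<close> and \<open>X\<close> with an explicit \<open>G\<close> in place of the generator minus \<open>q\<close>, without any smoothness of scale functions. Applied to
 difference quotients of \<open>I\<close>, forward for lower and backward for upper bounds, it shows in the limit that up to
 passage above \<open>a\<close> the discounted \<open>r(V)\<close> has constant expectation while that of \<open>w(V)\<close> gains the discounted time above \<open>b\<close>.
 Since \<open>w(a) / r(a) * r - w\<close> vanishes at \<open>a\<close> and there are no positive jumps, this gives the formula; passage is approximated from
 both sides by varying \<open>a\<close>.\<close>

section \<open>Cadlag paths\<close>

text \<open>\<open>V\<close> is given only path by path, with no measurability in \<open>om\<close>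
  and no Markov property attached. On a grid both obstacles disappear: independent stationary
  increments suffice there, and measurability is inherited from the chain. Three difficulties then
  shape the estimates. First, at level \<open>b\<close> the discrete loss has no known limit; hence
  one-sided estimates, each with the difference quotient whose error falls on the harmless side.
  Second, about \<open>T / h\<close> errors are summed, so they must be \<open>o(h)\<close> with a
  weight \<open>exp (be * x)\<close>; the exponential moments and the rarity of upward overshoots
  are not hypotheses but follow from the absence of positive jumps and the growth of the Laplace
  exponent. Third, for \<open>q = 0\<close> discounting does not remove the horizon; a bound on the
  expected time before passage does. The condition relating \<open>\<delta>\<close> to the drift
  serves only to make \<open>\<psi> th - \<delta> * th\<close> exceed every constant; this makes the
  transforms of both scale functions positive at large arguments and enters the overshoot
  bound.\<close>

lemma cadlag_partition:
 fixes f :: "real => real"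
 assumes f: "cadlag f" and "0 < e" "0 <= T"
 obtains Q where "finite Q"
  "\<And>s t. 0 <= s ==> s <= t ==> t <= T ==> {s<..t} \<inter> Q = {} ==> \<bar>f t - f s\<bar> < e"
proof -
 define P where "P = (\<lambda>u w. \<exists>Q. finite Q \<and> (\<forall>s t. 0 <= s --> u <= s --> s <= t --> t <= w -->
   {s<..t} \<inter> Q = {} --> \<bar>f t - f s\<bar> < e))"
 \<comment> \<open>Bisection: the property glues across a common endpoint and holds near every time,
   where right continuity and the left limit leave only that time as an exception.\<close>
 have "P 0 T"
 proof (rule Bolzano[where P = P])
  show "0 <= T" by fact
 next
  fix a b c assume "P a b" "P b c" "a <= b" "b <= c"
  then obtain Q1 Q2 where Q: "finite Q1" "finite Q2"
   "\<And>s t. 0 <= s ==> a <= s ==> s <= t ==> t <= b ==> {s<..t} \<inter> Q1 = {} ==> \<bar>f t - f s\<bar> < e"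
   "\<And>s t. 0 <= s ==> b <= s ==> s <= t ==> t <= c ==> {s<..t} \<inter> Q2 = {} ==> \<bar>f t - f s\<bar> < e"
   unfolding P_def by metis
  show "P a c" unfolding P_def
  \<comment> \<open>The gluing point joins the exceptional set, so that no admissible interval
    crosses it. Left endpoints are exempt: a jump at \<open>s\<close> does not affect increments
    from \<open>s\<close>.\<close>
  proof (intro exI[of _ "insert b (Q1 \<union> Q2)"] conjI allI impI)
   show "finite (insert b (Q1 \<union> Q2))" using Q by simp
   fix s t assume st: "0 <= s" "a <= s" "s <= t" "t <= c" "{s<..t} \<inter> insert b (Q1 \<union> Q2) = {}"
   then have "t < b \<or> b <= s" by force
   moreover have "{s<..t} \<inter> Q1 = {}" "{s<..t} \<inter> Q2 = {}" using st(5) by blast+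
   ultimately show "\<bar>f t - f s\<bar> < e" using Q(3)[of s t] Q(4)[of s t] st by force
  qed
 next
  fix x :: real assume x: "0 <= x" "x <= T"
  have "eventually (\<lambda>t. dist (f t) (f x) < e / 2) (at_right x)"
   using f x \<open>0 < e\<close> tendstoD unfolding cadlag_def by (metis half_gt_zero)
  then obtain r where r: "r > x" "\<And>t. x < t ==> t < r ==> dist (f t) (f x) < e / 2"
   unfolding eventually_at_right_field by blast
  have "\<exists>l y. y < x \<and> (\<forall>t. 0 <= t --> y < t --> t < x --> dist (f t) l < e / 2)"
  proof (cases "x = 0")
   case True then show ?thesis by (intro exI[of _ 0] exI[of _ "-1"]) auto
  next
   case False
   then obtain l where "(f \<longlongrightarrow> l) (at_left x)" using f x unfolding cadlag_def by force
   then have "eventually (\<lambda>t. dist (f t) l < e / 2) (at_left x)" using \<open>0 < e\<close> tendstoD by (metis half_gt_zero)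
   then show ?thesis unfolding eventually_at_left_field by blast
  qed
  then obtain l y where y: "y < x" "\<And>t. 0 <= t ==> y < t ==> t < x ==> dist (f t) l < e / 2" by blast
  show "\<exists>d>0. \<forall>a b. a <= x \<and> x <= b \<and> b - a < d --> P a b"
  proof (intro exI[of _ "min (r - x) (x - y)"] conjI allI impI)
   show "0 < min (r - x) (x - y)" using r y by simp
   fix a b assume ab: "a <= x \<and> x <= b \<and> b - a < min (r - x) (x - y)"
   show "P a b" unfolding P_def
   proof (intro exI[of _ "{x}"] conjI allI impI)
    fix s t assume st: "0 <= s" "a <= s" "s <= t" "t <= b" "{s<..t} \<inter> {x} = {}"
    then consider "t < x" | "x <= s" by force
    then show "\<bar>f t - f s\<bar> < e"
    proof cases
     case 1
     then have "dist (f t) l < e / 2" "dist (f s) l < e / 2" using y(2)[of t] y(2)[of s] st ab by auto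
     then show ?thesis unfolding dist_real_def by linarith
    next
     case 2
     then have "dist (f t) (f x) < e / 2" "dist (f s) (f x) < e / 2"
      using r(2)[of t] r(2)[of s] st ab \<open>0 < e\<close> by (cases "t = x"; cases "s = x"; force)+
     then show ?thesis unfolding dist_real_def by linarith
    qed
   qed simp
  qed
 qed
 then show ?thesis using that unfolding P_def by auto
qed

text \<open>Without positive jumps, rises over short times are uniformly small even though drops are
  not. An interval shorter than every gap of the exceptional set meets at most one exceptional time,
  so a rise splits into the part before it, a jump that only goes down, and the part after
  it.\<close>

lemma small_drawup:
 fixes f :: "real => real"
 assumes f: "cadlag f" "no_positive_jumps f" and "0 < e" "0 <= T"
 obtains d where "d > 0"
  "\<And>s t. 0 <= s ==> s <= t ==> t <= T ==> t < s + d ==> f t - f s < e"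
proof -
 define P where "P = (\<lambda>u w. \<exists>d>0. (\<forall>s t. 0 <= s --> u <= s --> s <= t --> t <= w --> t < s + d --> f t - f s < e))"
 obtain Q where Q: "finite Q" 
  "\<And>s t. 0 <= s ==> s <= t ==> t <= T ==> {s<..t} \<inter> Q = {} ==> \<bar>f t - f s\<bar> < e / 3"
  using cadlag_partition[OF f(1), of "e/3" T] assms by auto
 have jump: "f q - f s < e * 2 / 3" if "0 <= s" "s < q" "q <= T" "{s<..<q} \<inter> Q = {}" for s q
 proof -
  have "0 < q" using that by linarith
  then obtain l where l: "(f \<longlongrightarrow> l) (at_left q)" using f(1) unfolding cadlag_def by blast
  then have le: "f q <= l" using f(2) \<open>0 < q\<close> unfolding no_positive_jumps_def by blast
  have "eventually (\<lambda>t. t < q) (at_left q)" by (simp add: eventually_at_filter)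
  moreover have "eventually (\<lambda>t. s < t) (at_left q)" using that eventually_at_left_field by blast
  ultimately have "eventually (\<lambda>t. f t <= f s + e / 3) (at_left q)"
  proof eventually_elim
   case (elim t)
   then have "{s<..t} \<inter> Q = {}" using that by force
   then show ?case using Q(2)[of s t] elim that by linarith
  qed
  then have "l <= f s + e / 3" by (rule tendsto_upperbound[OF l]) simp
  then show ?thesis using le \<open>0 < e\<close> by linarith
 qed
 have "\<exists>d>0. \<forall>p\<in>Q. \<forall>q\<in>Q. p < q --> d <= q - p"
 proof (cases "{q - p | p q. p \<in> Q \<and> q \<in> Q \<and> p < q} = {}")
  case True then show ?thesis by (intro exI[of _ 1]) auto
 next
  case False
  have fin: "finite {q - p | p q. p \<in> Q \<and> q \<in> Q \<and> p < q}"
   by (rule finite_subset[of _ "(\<lambda>(p,q). q - p) ` (Q \<times> Q)"]) (use Q in auto)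
  show ?thesis
  proof (intro exI[of _ "Min {q - p | p q. p \<in> Q \<and> q \<in> Q \<and> p < q}"] conjI ballI impI)
   show "0 < Min {q - p | p q. p \<in> Q \<and> q \<in> Q \<and> p < q}" using fin False by (subst Min_gr_iff) auto
   fix p q assume "p \<in> Q" "q \<in> Q" "p < q"
   then show "Min {q - p | p q. p \<in> Q \<and> q \<in> Q \<and> p < q} <= q - p" using fin by (intro Min_le) auto
  qed
 qed
 then obtain d where d: "d > 0" "\<And>p q. p \<in> Q ==> q \<in> Q ==> p < q ==> d <= q - p" by blast
 show ?thesis
 proof (rule that[OF d(1)])
  fix s t assume st: "0 <= s" "s <= t" "t <= T" "t < s + d"
  show "f t - f s < e"
  proof (cases "{s<..t} \<inter> Q = {}")
   case True then show ?thesis using Q(2)[of s t] st \<open>0 < e\<close> by force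
  next
   case False
   then obtain q where q: "q \<in> Q" "s < q" "q <= t" by force
   have uniq: "p = q" if "p \<in> Q" "s < p" "p <= t" for p
    using d(2)[of p q] d(2)[of q p] q that st by linarith
   have "{s<..<q} \<inter> Q = {}"
   proof (rule ccontr)
    assume "{s<..<q} \<inter> Q \<noteq> {}"
    then obtain p where p: "p \<in> Q" "s < p" "p < q" by auto
    then have "p = q" by (intro uniq) (use q in linarith)+
    then show False using p by simp
   qed
   then have "f q - f s < e * 2 / 3" by (intro jump) (use q st in linarith)+
   have "{q<..t} \<inter> Q = {}"
   proof (rule ccontr)
    assume "{q<..t} \<inter> Q \<noteq> {}"
    then obtain p where p: "p \<in> Q" "q < p" "p <= t" by auto
    then have "p = q" by (intro uniq) (use q in linarith)+
    then show False using p by simp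
   qed
   then have "\<bar>f t - f q\<bar> < e / 3" by (intro Q(2)) (use q st in linarith)+
   then show ?thesis using \<open>f q - f s < e * 2 / 3\<close> by linarith
  qed
 qed
qed

text \<open>The exceptional times are those of all partitions with accuracy
  \<open>1 / (n + 1)\<close> on \<open>[0, n]\<close>. Continuity is stated as a Cauchy condition
  around \<open>s\<close>, the form in which \<open>V_osc\<close> transfers it to
  \<open>V\<close>.\<close>

lemma cadlag_continuous_off_countable:
 fixes f :: "real => real"
 assumes f: "cadlag f"
 obtains C where "countable C"
  "\<And>s e. 0 < s ==> s \<notin> C ==> 0 < e ==> \<exists>d>0. \<forall>u w. 0 <= u --> s - d < u --> u < s + d --> 0 <= w --> s - d < w --> w < s + d
    --> \<bar>f u - f w\<bar> < e"
proof -
 have "\<exists>Q. finite Q \<and> (\<forall>s t. 0 <= s --> s <= t --> t <= real n --> {s<..t} \<inter> Q = {} --> \<bar>f t - f s\<bar> < 1 / real (Suc n))" for n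
  by (rule cadlag_partition[OF f, of "1 / real (Suc n)" "real n"]) auto
 then obtain Q where Q: "\<And>n. finite (Q n)"
  "\<And>n s t. 0 <= s ==> s <= t ==> t <= real n ==> {s<..t} \<inter> Q n = {} ==> \<bar>f t - f s\<bar> < 1 / real (Suc n)"
  by metis
 show ?thesis
 proof (rule that[of "\<Union>n. Q n"])
  show "countable (\<Union>n. Q n)" using Q by (auto intro: countable_finite)
  fix s e :: real assume s: "0 < s" "s \<notin> (\<Union>n. Q n)" "0 < e"
  obtain n1 where n1: "1 / real (Suc n1) < e" using nat_approx_posE[OF s(3)] by auto
  obtain n2 where n2: "s + 1 < real n2" using reals_Archimedean2 by blast
  define n where "n = max n1 n2"
  have ne: "1 / real (Suc n) < e" using n1 
   by (rule le_less_trans[rotated]) (simp add: n_def frac_le)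
  have ns: "s + 1 < real n" using n2 unfolding n_def by simp
  have "\<exists>d>0. \<forall>y\<in>Q n. d <= dist s y"
  proof (cases "Q n = {}")
   case True then show ?thesis by (auto intro: exI[of _ 1])
  next
   case False

   have "0 < Min (dist s ` Q n)" by (subst Min_gr_iff) (use Q(1)[of n] s False in auto)
   moreover have "\<forall>y\<in>Q n. Min (dist s ` Q n) <= dist s y" using Q(1)[of n] by simp
   ultimately show ?thesis by blast
  qed
  then obtain d where d: "d > 0" "\<And>y. y \<in> Q n ==> d <= dist s y" by blast
  show "\<exists>d>0. \<forall>u w. 0 <= u --> s - d < u --> u < s + d --> 0 <= w --> s - d < w --> w < s + d --> \<bar>f u - f w\<bar> < e"
  proof (intro exI[of _ "min d 1"] conjI allI impI)
   fix u w assume uw: "0 <= u" "s - min d 1 < u" "u < s + min d 1" "0 <= w" "s - min d 1 < w" "w < s + min d 1"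
   have *: "\<bar>f y - f x\<bar> < e" if "0 <= x" "x <= y" "s - min d 1 < x" "y < s + min d 1" for x y
   proof -
    have "z \<notin> Q n" if "z \<in> {x<..y}" for z
    proof
     assume "z \<in> Q n"
     then have "d <= \<bar>s - z\<bar>" using d(2)[of z] by (simp add: dist_real_def)
     then show False using that \<open>s - min d 1 < x\<close> \<open>y < s + min d 1\<close> by (auto simp: abs_if split: if_splits)
    qed
    then have "{x<..y} \<inter> Q n = {}" by blast
    then have "\<bar>f y - f x\<bar> < 1 / real (Suc n)" using Q(2)[of x y n] that ns by linarith
    then show ?thesis using ne by linarith
   qed
   show "\<bar>f u - f w\<bar> < e" using *[of u w] *[of w u] uw by linarith
  qed (use d in simp)
 qed
qed

section \<open>The refracted-reflected path as a regulated path\<close>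

definition path_loss :: "real => real => (real => real) => real => real" where
 "path_loss \<delta> b V t = \<delta> * (LBINT u:{0..t}. indicator {b<..} (V u))"

text \<open>The path before any push at 0. A start below 0 is moved to 0 at once, hence
  \<open>max x 0\<close>. The loss is computed from \<open>V\<close> itself, so the equation for
  \<open>V\<close> is implicit.\<close>

definition free_path :: "(real => real) => real => real => real => (real => real) => real => real" where
 "free_path X \<delta> b x V t = max x 0 + (X t - X 0) - path_loss \<delta> b V t"

text \<open>\<open>r\<close> is the Skorokhod regulator, the positive part of the supremum of
  \<open>- \<eta>\<close> over \<open>[0, t]\<close>, described by its order property so that proofs
  handle bounds instead of suprema.\<close>

definition least_push :: "(real => real) => real => real => bool" where
 "least_push \<eta> t r \<longleftrightarrow> 0 <= r \<and> (\<forall>u. 0 <= u --> u <= t --> - \<eta> u <= r) \<and>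
   (\<forall>c\<ge>0. (\<forall>u. 0 <= u --> u <= t --> - \<eta> u <= c) --> r <= c)"

text \<open>One equation, \<open>V\<close> is the free path plus its regulator, replaces the
  alternation of two steps in the construction. The strict bound \<open>t < T\<close> lets a step be
  appended before the value at its end time is known.\<close>

definition regulated :: "(real => real) => real => real => real => (real => real) => real => bool" where
 "regulated X \<delta> b x V T \<longleftrightarrow> {u. 0 <= u \<and> u < T \<and> b < V u} \<in> sets borel \<and>
   (\<forall>t. 0 <= t --> t < T --> least_push (free_path X \<delta> b x V) t (V t - free_path X \<delta> b x V t))"

section \<open>Time spent above a level, and suprema along cadlag paths\<close>

lemma set_integral_level:
 fixes V :: "real => real"
 assumes "{u \<in> A. b < V u} \<in> sets borel"
 shows "(LBINT u:A. indicator {b<..} (V u)) = measure lborel {u \<in> A. b < V u}"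
proof -
 have "(LBINT u:A. indicator {b<..} (V u)) = (LINT u|lborel. indicator {u \<in> A. b < V u} u :: real)"
  unfolding set_lebesgue_integral_def by (intro Bochner_Integration.integral_cong) (auto simp: indicator_def)
 also have "\<dots> = measure lborel {u \<in> A. b < V u}" using assms by simp
 finally show ?thesis .
qed

lemma emeasure_level_finite: "emeasure lborel {v::real. s <= v \<and> v < u \<and> P v} \<noteq> \<infinity>"
proof -
 have "emeasure lborel {v. s <= v \<and> v < u \<and> P v} <= emeasure lborel {s..u}" by (intro emeasure_mono) auto
 also have "\<dots> < \<infinity>" by (cases "s <= u") simp_all
 finally show ?thesis by simp
qed

lemma measure_level_le:
 assumes "s <= u" "{v::real. s <= v \<and> v < u \<and> P v} \<in> sets borel"
 shows "measure lborel {v. s <= v \<and> v < u \<and> P v} <= u - s"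
proof -
 have "measure lborel {v. s <= v \<and> v < u \<and> P v} <= measure lborel {s..u}"
  by (rule measure_mono_fmeasurable) (use assms in "auto simp: fmeasurable_def")
 then show ?thesis using assms(1) by simp
qed

lemma measure_level_add:
 assumes m: "{v::real. s <= v \<and> v < t \<and> P v} \<in> sets borel" "{v. t <= v \<and> v < u \<and> P v} \<in> sets borel" and le: "s <= t" "t <= u"
 shows "measure lborel {v. s <= v \<and> v < u \<and> P v} =
   measure lborel {v. s <= v \<and> v < t \<and> P v} + measure lborel {v. t <= v \<and> v < u \<and> P v}"
proof -
 have eq: "{v. s <= v \<and> v < u \<and> P v} = {v. s <= v \<and> v < t \<and> P v} \<union> {v. t <= v \<and> v < u \<and> P v}"
  using le by auto
 show ?thesis unfolding eq
 proof (rule measure_Union[OF emeasure_level_finite emeasure_level_finite])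
  show "{v. s <= v \<and> v < t \<and> P v} \<inter> {v. t <= v \<and> v < u \<and> P v} = {}" by auto
 qed (use m in simp_all)
qed

text \<open>\<open>path_loss\<close> integrates over closed intervals, while the path between two
  steps is described on half-open ones; the sets differ at most by an endpoint, a null set.\<close>

lemma level_split:
 fixes V :: "real => real"
 assumes m: "{u. 0 <= u \<and> u < s \<and> b < V u} \<in> sets borel" "{u. s <= u \<and> u < t \<and> b < V u} \<in> sets borel" "0 <= s" "s <= t"
 shows "{u. 0 <= u \<and> u < t \<and> b < V u} \<in> sets borel"
  "path_loss \<delta> b V t = path_loss \<delta> b V s + \<delta> * measure lborel {u. s <= u \<and> u < t \<and> b < V u}"
proof -
 have eq: "{u. 0 <= u \<and> u < t \<and> b < V u} = {u. 0 <= u \<and> u < s \<and> b < V u} \<union> {u. s <= u \<and> u < t \<and> b < V u}"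
  using assms(3,4) by auto
 show m3: "{u. 0 <= u \<and> u < t \<and> b < V u} \<in> sets borel" unfolding eq by (rule sets.Un[OF m(1,2)])
 have closed: "measure lborel {u \<in> {0..r}. b < V u} = measure lborel {u. 0 <= u \<and> u < r \<and> b < V u} \<and>
   {u \<in> {0..r}. b < V u} \<in> sets borel" if "{u. 0 <= u \<and> u < r \<and> b < V u} \<in> sets borel" for r
 proof -
  have "{u \<in> {0..r}. b < V u} = {u. 0 <= u \<and> u < r \<and> b < V u} \<or> {u \<in> {0..r}. b < V u} = insert r {u. 0 <= u \<and> u < r \<and> b < V u}"
   by (cases "0 <= r \<and> b < V r") (auto simp: order.order_iff_strict)
  then have "{u \<in> {0..r}. b < V u} = {u. 0 <= u \<and> u < r \<and> b < V u} \<or> {u \<in> {0..r}. b < V u} = {u. 0 <= u \<and> u < r \<and> b < V u} \<union> {r}"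
   by blast
  then show ?thesis
  proof
   assume *: "{u \<in> {0..r}. b < V u} = {u. 0 <= u \<and> u < r \<and> b < V u} \<union> {r}"
   have "measure lborel ({u. 0 <= u \<and> u < r \<and> b < V u} \<union> {r}) = measure lborel {u. 0 <= u \<and> u < r \<and> b < V u}"
    by (rule measure_Un_null_set) (use that in auto)
   then show ?thesis unfolding * using that by auto
  qed (use that in auto)
 qed
 note measure_level_add[OF m]
 then show "path_loss \<delta> b V t = path_loss \<delta> b V s + \<delta> * measure lborel {u. s <= u \<and> u < t \<and> b < V u}"
  unfolding path_loss_def using closed[OF m(1)] closed[OF m3] by (simp add: set_integral_level distrib_left)
qed

text \<open>Without this bound the \<open>SUP\<close> in \<open>reflected_path\<close> would be an
  unspecified real number. Every value is within 1 of the value at the start or at the last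
  exceptional time, and these are finitely many.\<close>

lemma cadlag_bounded:
 assumes "cadlag X" "0 <= s"
 shows "bdd_above ((\<lambda>u. - (X u - X s)) ` {s..t})"
proof (cases "s <= t")
 case True
 obtain Q where Q: "finite Q"
  "\<And>s u. 0 <= s ==> s <= u ==> u <= t ==> {s<..u} \<inter> Q = {} ==> \<bar>X u - X s\<bar> < 1"
  by (rule cadlag_partition[OF assms(1), of 1 t]) (use assms True in auto)
 have "\<bar>X u\<bar> <= (\<Sum>q\<in>insert s Q. \<bar>X q\<bar>) + 1" if u: "u \<in> {s..t}" for u
 proof -
  define q where "q = Max (insert s {q \<in> Q. s <= q \<and> q <= u})"
  have fin: "finite (insert s {q \<in> Q. s <= q \<and> q <= u})" using Q by simp
  have q: "q \<in> insert s {q \<in> Q. s <= q \<and> q <= u}" unfolding q_def using fin by (intro Max_in) auto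
  have "p \<notin> Q" if "p \<in> {q<..u}" for p
  proof
   assume "p \<in> Q"
   then have "p <= q" unfolding q_def using fin that q u by (intro Max_ge) auto
   then show False using that by simp
  qed
  then have "{q<..u} \<inter> Q = {}" by blast
  then have "\<bar>X u - X q\<bar> < 1" using Q(2)[of q u] q u assms by force
  moreover have "\<bar>X q\<bar> <= (\<Sum>q\<in>insert s Q. \<bar>X q\<bar>)" by (rule member_le_sum) (use q Q in auto)
  ultimately show ?thesis by linarith
 qed
 then show ?thesis
  by (intro bdd_aboveI2[of _ _ "(\<Sum>q\<in>insert s Q. \<bar>X q\<bar>) + 1 + X s"]) force
qed auto

text \<open>Seen as the largest rise \<open>X t - X u\<close> over \<open>u\<close> in
  \<open>[s, t]\<close>, the reflected path inherits every bound on the rises of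
  \<open>X\<close>.\<close>

lemma reflected_path_lub:
 assumes "cadlag X" "0 <= s" "s <= t"
 shows "X t - X s <= reflected_path X s t"
  "s <= u ==> u <= t ==> X t - X u <= reflected_path X s t"
  "X t - X s <= c ==> (\<And>u. s <= u ==> u <= t ==> X t - X u <= c) ==> reflected_path X s t <= c"
proof -
 note bd = cadlag_bounded[OF assms(1,2), of t]
 show "X t - X s <= reflected_path X s t" unfolding reflected_path_def by simp
 show "X t - X u <= reflected_path X s t" if "s <= u" "u <= t"
 proof -
  have "- (X u - X s) <= (SUP u\<in>{s..t}. - (X u - X s))" by (rule cSUP_upper2[OF bd]) (use that in auto)
  then show ?thesis unfolding reflected_path_def by simp
 qed
 show "reflected_path X s t <= c" if c: "X t - X s <= c" "\<And>u. s <= u ==> u <= t ==> X t - X u <= c"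
 proof -
  have "(SUP u\<in>{s..t}. - (X u - X s)) <= c - (X t - X s)"
   by (rule cSUP_least) (use c(2) assms in "force+")
  then show ?thesis unfolding reflected_path_def using c(1) by simp
 qed
qed

lemma reflected_path_nonneg: "cadlag X ==> 0 <= s ==> s <= t ==> 0 <= reflected_path X s t"
 using reflected_path_lub(2)[of X s t t] by simp

lemma reflected_path_start: "cadlag X ==> 0 <= s ==> reflected_path X s s = 0"
 using reflected_path_lub(3)[of X s s 0] reflected_path_nonneg[of X s s] by force

lemma reflected_path_step:
 assumes "cadlag X" "0 <= s" "s <= t" "t <= t'" "\<And>u. t <= u ==> u <= t' ==> X t' - X u <= e"
 shows "reflected_path X s t' <= reflected_path X s t + e"
proof (rule reflected_path_lub(3))
 note lub = reflected_path_lub[OF assms(1-3)]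
 show "X t' - X s <= reflected_path X s t + e" using lub(1) assms(5)[OF order_refl assms(4)] by linarith
 fix u assume u: "s <= u" "u <= t'"
 show "X t' - X u <= reflected_path X s t + e"
 proof (cases "u <= t")
  case True then show ?thesis using lub(2)[OF u(1)] assms(5)[OF order_refl assms(4)] by linarith
 next
  case False then show ?thesis
   using assms(5)[of u] u reflected_path_nonneg[OF assms(1-3)] by simp
 qed
qed (use assms in auto)

section \<open>First times, and the exit of the reflected path at \<open>b\<close>\<close>

lemma first_after_less: "ereal t < first_after s P ==> s < t ==> \<not> P t"
proof
 assume "ereal t < first_after s P" "s < t" "P t"
 have "Inf (ereal ` {t. s < t \<and> P t}) <= ereal t" by (rule Inf_lower) (use \<open>s < t\<close> \<open>P t\<close> in blast)
 then show False using \<open>ereal t < first_after s P\<close> unfolding first_after_def by simp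
qed

lemma first_after_ge: "ereal s <= first_after s P"
 unfolding first_after_def by (intro Inf_greatest) auto

lemma first_after_approx:
 assumes "first_after s P = ereal t" "0 < e"
 obtains u where "s < u" "t <= u" "u < t + e" "P u"
proof -
 have "Inf (ereal ` {t. s < t \<and> P t}) < ereal (t + e)" using assms unfolding first_after_def by simp
 then obtain u where u: "s < u" "P u" "ereal u < ereal (t + e)" unfolding Inf_less_iff by auto
 moreover have "first_after s P <= ereal u" unfolding first_after_def by (rule Inf_lower) (use u in blast)
 then have "t <= u" using assms(1) by simp
 ultimately show ?thesis using that by simp
qed

lemma first_after_cases: obtains t where "s <= t" "first_after s P = ereal t" | "first_after s P = \<infinity>"
 using first_after_ge[of s P] by (cases "first_after s P") auto

text \<open>Small rises over short times prevent the reflected path from jumping over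
  \<open>b\<close>, so Step 1 is entered exactly at \<open>b\<close>. The last conclusion says that
  Step 2 lasts at least as long as \<open>X\<close> needs to rise by \<open>b\<close>; this keeps
  steps from accumulating. The horizon \<open>s' + 1\<close> leaves room because the infimum
  \<open>s'\<close> is not itself a time above \<open>b\<close>.\<close>

lemma reflected_path_hits:
 assumes X: "cadlag X" "no_positive_jumps X" and "0 <= s" "0 < b" "first_after s (\<lambda>t. b < reflected_path X s t) = ereal s'"
 shows "s < s'" "reflected_path X s s' = b"
  "\<And>d. (\<And>u w. 0 <= u ==> u <= w ==> w <= s' + 1 ==> w < u + d ==> X w - X u < b) ==> s + d <= s'"
proof -
 have ss': "s <= s'" using first_after_ge[of s "\<lambda>t. b < reflected_path X s t"] assms(5) by simp
 note app = first_after_approx[OF assms(5)]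
 show *: "s + d <= s'" if d: "\<And>u w. 0 <= u ==> u <= w ==> w <= s' + 1 ==> w < u + d ==> X w - X u < b" for d
 proof (rule ccontr)
  assume "\<not> s + d <= s'"
  then have "0 < min 1 (s + d - s')" by simp
  then obtain u where u: "s < u" "s' <= u" "u < s' + min 1 (s + d - s')" "b < reflected_path X s u" using app by blast
  have "reflected_path X s u <= reflected_path X s s + b"
   by (rule reflected_path_step) (use X u assms(3) in "auto intro!: less_imp_le[OF d]")
  then show False using u reflected_path_start[OF X(1) assms(3)] by simp
 qed
 obtain d where d: "d > 0" "\<And>u w. 0 <= u ==> u <= w ==> w <= s' + 1 ==> w < u + d ==> X w - X u < b"
  by (rule small_drawup[OF X, of b "s' + 1"]) (use assms ss' in auto)
 show ss: "s < s'" using *[OF d(2)] d(1) by force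
 have le: "reflected_path X s s' <= b + e" if e: "0 < e" for e
 proof -
  obtain d where d: "d > 0" "\<And>u w. 0 <= u ==> u <= w ==> w <= s' + 1 ==> w < u + d ==> X w - X u < e"
   by (rule small_drawup[OF X, of e "s' + 1"]) (use assms ss' e in auto)
  define t where "t = max ((s + s') / 2) (s' - d / 2)"
  have t: "s < t" "t < s'" "s' < t + d" using ss d(1) unfolding t_def by (auto simp: max_def field_simps)
  have "\<not> b < reflected_path X s t" using first_after_less[of t s "\<lambda>t. b < reflected_path X s t"] t assms(5) by simp
  moreover have "reflected_path X s s' <= reflected_path X s t + e"
   by (rule reflected_path_step) (use X t assms(3) in "auto intro!: less_imp_le[OF d(2)]")
  ultimately show ?thesis by simp
 qed
 have ge: "\<not> reflected_path X s s' < b"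
 proof
  assume less: "reflected_path X s s' < b"
  define e where "e = b - reflected_path X s s'"
  obtain d where d: "d > 0" "\<And>u w. 0 <= u ==> u <= w ==> w <= s' + 1 ==> w < u + d ==> X w - X u < e"
   by (rule small_drawup[OF X, of e "s' + 1"]) (use assms ss' less e_def in auto)
  obtain u where u: "s < u" "s' <= u" "u < s' + min 1 d" "b < reflected_path X s u" by (rule app[of "min 1 d"]) (use d in auto)
  have "reflected_path X s u <= reflected_path X s s' + e"
   by (rule reflected_path_step) (use X u assms(3) ss in "auto intro!: less_imp_le[OF d(2)]")
  then show False using u e_def by simp
 qed
 show "reflected_path X s s' = b" using field_le_epsilon[OF le] ge by simp
qed

lemma regulated_mono:
 assumes "regulated X \<delta> b x V T'" "T <= T'"
 shows "regulated X \<delta> b x V T"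
 unfolding regulated_def
proof (intro conjI allI impI)
 have "{u. 0 <= u \<and> u < T \<and> b < V u} = {u. 0 <= u \<and> u < T' \<and> b < V u} \<inter> {..<T}" using assms(2) by auto
 moreover have "{u. 0 <= u \<and> u < T' \<and> b < V u} \<inter> {..<T} \<in> sets borel"
  by (rule sets.Int) (use assms(1) in "unfold regulated_def, blast, simp")
 ultimately show "{u. 0 <= u \<and> u < T \<and> b < V u} \<in> sets borel" by argo
 fix t assume "0 <= t" "t < T"
 then show "least_push (free_path X \<delta> b x V) t (V t - (free_path X \<delta> b x V) t)" using assms unfolding regulated_def by auto
qed

section \<open>From the alternating construction to the regulated equation\<close>

context
 fixes X :: "real => real" and \<delta> b x :: real and V :: "real => real"
 assumes X: "cadlag X" "no_positive_jumps X" and b: "0 < b"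
  and V: "refracted_reflected_path X \<delta> b x V"
begin

text \<open>What is known when Step 1 is entered: the equation holds before \<open>s\<close>, and
  the entry level \<open>y\<close> solves it at \<open>s\<close>. It is phrased with
  \<open>y\<close> because \<open>V s\<close> is fixed only by the step that follows.\<close>

definition step1_state :: "real => real => bool" where
 "step1_state s y \<longleftrightarrow> enters_step1 X \<delta> b x s y \<and> 0 <= s \<and> 0 <= y \<and> regulated X \<delta> b x V s \<and>
   least_push (free_path X \<delta> b x V) s (y - free_path X \<delta> b x V s)"

definition step2_state :: "real => bool" where
 "step2_state s \<longleftrightarrow> enters_step2 X \<delta> b x s \<and> 0 <= s \<and> regulated X \<delta> b x V s \<and>
   least_push (free_path X \<delta> b x V) s (0 - free_path X \<delta> b x V s)"

text \<open>During Step 1 the path is nonnegative and follows the refracted equation, so the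
  regulator keeps its entry value \<open>\<rho>\<close>. At the exit time the free path is at most
  \<open>- \<rho>\<close>; the regulator rises to match it, which puts the path at 0, where Step 2
  begins.\<close>

lemma after_step1:
 assumes "step1_state s y"
 shows "(\<forall>T. regulated X \<delta> b x V T) \<or> (\<exists>s'\<ge>s. step2_state s')"
proof -
 let ?\<eta> = "free_path X \<delta> b x V"
 define \<rho> where "\<rho> = y - ?\<eta> s"
 have st: "enters_step1 X \<delta> b x s y" "0 <= s" "0 <= y" "regulated X \<delta> b x V s" "least_push ?\<eta> s \<rho>"
  using assms unfolding step1_state_def \<rho>_def by blast+
 from V st(1) obtain A where A: "refracted_solution X \<delta> b s y A"
  "\<And>t. s <= t ==> ereal t < first_after s (\<lambda>u. A u < 0) ==> V t = A t"
  unfolding refracted_reflected_path_def by blast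
 define \<tau> where "\<tau> = first_after s (\<lambda>u. A u < 0)"
 have mA: "{t. s <= t \<and> b < A t} \<in> sets borel"
  and eqA: "A t = y + (X t - X s) - \<delta> * (LBINT u:{s..t}. indicator {b<..} (A u))" if "s <= t" for t
  using A(1) that unfolding refracted_solution_def by blast+
 have mA': "{u. s <= u \<and> u < t \<and> b < A u} \<in> sets borel" "{u \<in> {s..t}. b < A u} \<in> sets borel" for t
 proof -
  have "{u. s <= u \<and> u < t \<and> b < A u} = {t. s <= t \<and> b < A t} \<inter> {..<t}" by auto
  then show "{u. s <= u \<and> u < t \<and> b < A u} \<in> sets borel" using sets.Int[OF mA[of s]] by simp
  have "{u \<in> {s..t}. b < A u} = {t. s <= t \<and> b < A t} \<inter> {..t}" by auto
  then show "{u \<in> {s..t}. b < A u} \<in> sets borel" using sets.Int[OF mA[of s]] by simp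
 qed
 have int: "(LBINT u:{s..t}. indicator {b<..} (A u)) = measure lborel {u. s <= u \<and> u < t \<and> b < A u}" for t
 proof -
  have eq: "{u \<in> {s..t}. b < A u} = {u. s <= u \<and> u < t \<and> b < A u} \<or> {u \<in> {s..t}. b < A u} = {u. s <= u \<and> u < t \<and> b < A u} \<union> {t}"
   by (cases "s <= t \<and> b < A t") (auto simp: order.order_iff_strict)
  have un: "measure lborel ({u. s <= u \<and> u < t \<and> b < A u} \<union> {t}) = measure lborel {u. s <= u \<and> u < t \<and> b < A u}"
   by (rule measure_Un_null_set) (use mA'(1)[of t] in auto)
  from eq show ?thesis unfolding set_integral_level[OF mA'(2)]
  proof
   assume *: "{u \<in> {s..t}. b < A u} = {u. s <= u \<and> u < t \<and> b < A u} \<union> {t}"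
   show "measure lborel {u \<in> {s..t}. b < A u} = measure lborel {u. s <= u \<and> u < t \<and> b < A u}" unfolding * by (rule un)
  qed simp
 qed
 have As: "A s = y"
 proof -
  have "{u. s <= u \<and> u < s \<and> b < A u} = {}" by auto
  then have "(LBINT u:{s..s}. indicator {b<..} (A u)) = (0::real)" unfolding int[of s] by (simp only: measure_empty)
  then have "\<delta> * (LBINT u:{s..s}. indicator {b<..} (A u)) = 0" by (rule ssubst) simp
  moreover have "A s = y + (X s - X s) - \<delta> * (LBINT u:{s..s}. indicator {b<..} (A u))" by (rule eqA) simp
  ultimately show ?thesis by linarith
 qed
 have VA: "{u. s <= u \<and> u < t \<and> b < V u} = {u. s <= u \<and> u < t \<and> b < A u}" if "ereal t <= \<tau>" for t
 proof -
  have "V u = A u" if "s <= u" "u < t" for u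
  proof (rule A(2)[OF that(1)])
   show "ereal u < first_after s (\<lambda>u. A u < 0)" using \<open>ereal t <= \<tau>\<close> that(2) unfolding \<tau>_def
    by (meson less_ereal.simps(1) less_le_trans)
  qed
  then show ?thesis by auto
 qed
 have st4: "{u. 0 <= u \<and> u < s \<and> b < V u} \<in> sets borel" using st(4) unfolding regulated_def by blast
 have m: "{u. 0 <= u \<and> u < t \<and> b < V u} \<in> sets borel" if "s <= t" "ereal t <= \<tau>" for t
  by (rule level_split(1)[OF st4 _ st(2) that(1)]) (use VA[OF that(2)] mA' in simp)
 have \<eta>: "?\<eta> t = A t - \<rho>" if t: "s <= t" "ereal t <= \<tau>" for t
 proof -
  have "path_loss \<delta> b V t = path_loss \<delta> b V s + \<delta> * measure lborel {u. s <= u \<and> u < t \<and> b < A u}"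
   unfolding VA[OF t(2), symmetric]
   by (rule level_split(2)[OF st4 _ st(2) t(1)]) (use VA[OF t(2)] mA' in simp)
  then show ?thesis using eqA[OF t(1)] int[of t] unfolding \<rho>_def free_path_def by simp
 qed
 have A0: "0 <= A t" if "s <= t" "ereal t < \<tau>" for t
  using first_after_less[of t s "\<lambda>u. A u < 0"] that As st(3) unfolding \<tau>_def by (cases "t = s") auto
 have lp: "least_push ?\<eta> t \<rho>" if t: "s <= t" "ereal t < \<tau>" for t
 proof -
  have "- ?\<eta> u <= \<rho>" if u: "0 <= u" "u <= t" for u
  proof (cases "u <= s")
   case True then show ?thesis using st(5) u unfolding least_push_def by blast
  next
   case False
   have "ereal u < \<tau>" using u t by (meson ereal_less_eq(3) le_less_trans)
   then show ?thesis using \<eta>[of u] A0[of u] False by simp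
  qed
  then show ?thesis using st(5) t unfolding least_push_def by (meson order.trans)
 qed
 have reg: "regulated X \<delta> b x V T" if T: "s <= T" "ereal T <= \<tau>" for T
  unfolding regulated_def
 proof (intro conjI allI impI)
  show "{u. 0 <= u \<and> u < T \<and> b < V u} \<in> sets borel" using m[OF T] .
  fix t assume t: "0 <= t" "t < T"
  show "least_push ?\<eta> t (V t - ?\<eta> t)"
  proof (cases "t < s")
   case True then show ?thesis using st(4) t unfolding regulated_def by blast
  next
   case False
   have tt: "s <= t" "ereal t < \<tau>" using False t T by (auto intro: less_le_trans[of _ "ereal T"])
   then have "V t - ?\<eta> t = \<rho>" using \<eta>[of t] A(2)[of t] unfolding \<tau>_def by simp
   then show ?thesis using lp[OF tt] by simp
  qed
 qed
 show ?thesis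
 proof (rule first_after_cases[of s "\<lambda>u. A u < 0"])
  assume "first_after s (\<lambda>u. A u < 0) = \<infinity>"
  then have "regulated X \<delta> b x V (max s T)" for T using reg[of "max s T"] unfolding \<tau>_def by simp
  then show ?thesis using regulated_mono by (meson max.cobounded2)
 next
  fix s' assume s': "s <= s'" "first_after s (\<lambda>u. A u < 0) = ereal s'"
  have "enters_step2 X \<delta> b x s'" by (rule enters_step1_enters_step2.from_step1[OF st(1) A(1) s'(2)])
  \<comment> \<open>The exit time is an infimum, so negativity is known only at times
    \<open>u\<close> just after \<open>s'\<close> or at \<open>s'\<close>; right continuity of
    \<open>X\<close> and the bounded drift carry it back.\<close>
  moreover have "A s' <= 0"
  proof (rule field_le_epsilon)
   fix e :: real assume "0 < e"
   have "(X \<longlongrightarrow> X s') (at_right s')" using X(1) s'(1) st(2) unfolding cadlag_def by auto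
   then have "eventually (\<lambda>u. dist (X u) (X s') < e / 2) (at_right s')" using \<open>0 < e\<close> by (intro tendstoD) auto
   then obtain r where r: "r > s'" "\<And>u. s' < u ==> u < r ==> dist (X u) (X s') < e / 2"
    unfolding eventually_at_right_field by blast
   \<comment> \<open>Half of \<open>e\<close> is for \<open>X\<close>, half for the drift. The sign
     of \<open>\<delta>\<close> is unknown in this context, hence the absolute value; adding 1
     avoids a zero denominator.\<close>
   define d where "d = min (r - s') (e / (2 * (\<bar>\<delta>\<bar> + 1)))"
   have d0: "0 < d" using r \<open>0 < e\<close> unfolding d_def by auto
   obtain u where u: "s < u" "s' <= u" "u < s' + d" "A u < 0" by (rule first_after_approx[OF s'(2) d0])
   have "\<bar>X u - X s'\<bar> < e / 2"
    using r(2)[of u] u \<open>0 < e\<close> unfolding d_def by (cases "u = s'") (auto simp: dist_real_def)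
   moreover have "\<bar>\<delta> * (measure lborel {v. s <= v \<and> v < u \<and> b < A v} - measure lborel {v. s <= v \<and> v < s' \<and> b < A v})\<bar> <= e / 2"
   proof -
    have ms: "{v. s' <= v \<and> v < u \<and> b < A v} \<in> sets borel"
    proof -
     have "{v. s' <= v \<and> v < u \<and> b < A v} = {u. s <= u \<and> b < A u} \<inter> {s'..<u}" using s'(1) by auto
     moreover have "{u. s <= u \<and> b < A u} \<inter> {s'..<u} \<in> sets borel" by (rule sets.Int[OF mA[OF order_refl]]) simp
     ultimately show ?thesis by argo
    qed
    note add = measure_level_add[OF mA'(1) ms s'(1) u(2)]
    have "measure lborel {v. s' <= v \<and> v < u \<and> b < A v} <= u - s'" by (rule measure_level_le[OF u(2) ms])
    then have "measure lborel {v. s' <= v \<and> v < u \<and> b < A v} <= e / (2 * (\<bar>\<delta>\<bar> + 1))" using u unfolding d_def by simp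
    then have "\<bar>\<delta>\<bar> * measure lborel {v. s' <= v \<and> v < u \<and> b < A v} <= (\<bar>\<delta>\<bar> + 1) * (e / (2 * (\<bar>\<delta>\<bar> + 1)))"
     by (intro mult_mono) auto
    moreover have "(\<bar>\<delta>\<bar> + 1) * (e / (2 * (\<bar>\<delta>\<bar> + 1))) = e / 2" by (simp add: divide_simps)
    ultimately have "\<bar>\<delta>\<bar> * measure lborel {v. s' <= v \<and> v < u \<and> b < A v} <= e / 2" by argo
    then show ?thesis unfolding add by (simp add: abs_mult)
   qed
   ultimately show "A s' <= 0 + e" using u(4) eqA[of u] eqA[OF s'(1)] u int[of u] int[of s']
    by (simp add: algebra_simps) argo
  qed
  moreover have \<eta>s: "?\<eta> s' = A s' - \<rho>" using \<eta>[of s'] s' unfolding \<tau>_def by simp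
  moreover have "least_push ?\<eta> s' (0 - ?\<eta> s')"
   unfolding least_push_def
  proof (intro conjI allI impI)
   have \<rho>: "0 <= \<rho>" "\<rho> <= - ?\<eta> s'" using st(5) \<open>A s' <= 0\<close> \<eta>s unfolding least_push_def by auto
   then show "0 <= 0 - ?\<eta> s'" by simp
   fix u assume u: "0 <= u" "u <= s'"
   show "- ?\<eta> u <= 0 - ?\<eta> s'"
   proof (cases "u = s'")
    case False
    have "- ?\<eta> u <= \<rho>"
    proof (cases "u <= s")
     case True then show ?thesis using st(5) u unfolding least_push_def by blast
    next
     case 2: False
     then show ?thesis using \<eta>[of u] A0[of u] False u s' unfolding \<tau>_def by simp
    qed
    then show ?thesis using \<rho> by simp
   qed simp
  qed (use st(2) s'(1) in force)
  ultimately show ?thesis unfolding step2_state_def using st(2) s' reg[of s'] unfolding \<tau>_def by force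
 qed
qed

text \<open>During Step 2 the path stays at or below \<open>b\<close>, so no loss accrues, the free
  path moves with \<open>X\<close>, and the reflection is the regulator. The duration bound of
  \<open>reflected_path_hits\<close> is passed on for \<open>regulated_all\<close>.\<close>

lemma after_step2:
 assumes "step2_state s"
 shows "(\<forall>T. regulated X \<delta> b x V T) \<or> (\<exists>s'\<ge>s. step1_state s' b \<and>
   (\<forall>d. (\<forall>u w. 0 <= u --> u <= w --> w <= s' + 1 --> w < u + d --> X w - X u < b) --> s + d <= s'))"
proof -
 let ?\<eta> = "free_path X \<delta> b x V"
 have st: "enters_step2 X \<delta> b x s" "0 <= s" "regulated X \<delta> b x V s" "least_push ?\<eta> s (- ?\<eta> s)"
  using assms unfolding step2_state_def by simp_all
 define \<tau> where "\<tau> = first_after s (\<lambda>t. b < reflected_path X s t)"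
 have VU: "V t = reflected_path X s t" if "s <= t" "ereal t < \<tau>" for t
  using V st(1) that unfolding refracted_reflected_path_def \<tau>_def by blast
 have Ub: "reflected_path X s t <= b" if "s <= t" "ereal t < \<tau>" for t
  using first_after_less[of t s "\<lambda>t. b < reflected_path X s t"] that reflected_path_start[OF X(1) st(2)] b
  unfolding \<tau>_def by (cases "t = s") auto
 have em: "{u. s <= u \<and> u < t \<and> b < V u} = {}" if "ereal t <= \<tau>" for t
 proof -
  have "\<not> b < V u" if "s <= u" "u < t" for u
  proof -
   have "ereal u < \<tau>" using that \<open>ereal t <= \<tau>\<close> by (meson less_ereal.simps(1) less_le_trans)
   then show ?thesis using VU[OF that(1)] Ub[OF that(1)] by simp
  qed
  then show ?thesis by auto
 qed
 have st3: "{u. 0 <= u \<and> u < s \<and> b < V u} \<in> sets borel" using st(3) unfolding regulated_def by blast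
 have m: "{u. 0 <= u \<and> u < t \<and> b < V u} \<in> sets borel" if "s <= t" "ereal t <= \<tau>" for t
  by (rule level_split(1)[OF st3 _ st(2) that(1)]) (simp add: em[OF that(2)])
 have \<eta>: "?\<eta> t = ?\<eta> s + (X t - X s)" if t: "s <= t" "ereal t <= \<tau>" for t
 proof -
  have "path_loss \<delta> b V t = path_loss \<delta> b V s + \<delta> * measure lborel {u. s <= u \<and> u < t \<and> b < V u}"
   by (rule level_split(2)[OF st3 _ st(2) t(1)]) (simp add: em[OF t(2)])
  then show ?thesis unfolding em[OF t(2)] free_path_def by simp
 qed
 have lp: "least_push ?\<eta> t (reflected_path X s t - ?\<eta> t)" if t: "s <= t" "ereal t <= \<tau>" for t
  unfolding least_push_def
 proof (intro conjI allI impI)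
  note lub = reflected_path_lub[OF X(1) st(2) t(1)]
  have \<rho>: "0 <= - ?\<eta> s" using st(4) unfolding least_push_def by blast
  have ge: "- ?\<eta> s <= reflected_path X s t - ?\<eta> t" using lub(1) \<eta>[OF t] by simp
  then show "0 <= reflected_path X s t - ?\<eta> t" using \<rho> by simp
  fix u assume u: "0 <= u" "u <= t"
  show "- ?\<eta> u <= reflected_path X s t - ?\<eta> t"
  proof (cases "u <= s")
   case True then show ?thesis using st(4) u ge unfolding least_push_def by force
  next
   case False
   have "ereal u <= \<tau>" using u t by (meson ereal_less_eq(3) order.trans)
   then show ?thesis using lub(2)[of u] \<eta>[OF t] \<eta>[of u] False u by simp
  qed
 next
  fix c assume c: "0 <= c" "\<forall>u. 0 <= u --> u <= t --> - ?\<eta> u <= c"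
  have "reflected_path X s t <= c + ?\<eta> t"
  proof (rule reflected_path_lub(3)[OF X(1) st(2) t(1)])
   show "X t - X s <= c + ?\<eta> t" using c(2)[rule_format, of s] st(2) t \<eta>[OF t] by simp
   fix u assume u: "s <= u" "u <= t"
   have "ereal u <= \<tau>" using u t by (meson ereal_less_eq(3) order.trans)
   then show "X t - X u <= c + ?\<eta> t" using c(2)[rule_format, of u] st(2) u \<eta>[OF t] \<eta>[of u] by simp
  qed
  then show "reflected_path X s t - ?\<eta> t <= c" by simp
 qed
 have reg: "regulated X \<delta> b x V T" if T: "s <= T" "ereal T <= \<tau>" for T
  unfolding regulated_def
 proof (intro conjI allI impI)
  show "{u. 0 <= u \<and> u < T \<and> b < V u} \<in> sets borel" using m[OF T] .
  fix t assume t: "0 <= t" "t < T"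
  show "least_push ?\<eta> t (V t - ?\<eta> t)"
  proof (cases "t < s")
   case True then show ?thesis using st(3) t unfolding regulated_def by blast
  next
   case False
   have tt: "s <= t" "ereal t < \<tau>" using False t T by (auto intro: less_le_trans[of _ "ereal T"])
   then show ?thesis using lp[of t] VU[OF tt] by simp
  qed
 qed
 show ?thesis
 proof (rule first_after_cases[of s "\<lambda>t. b < reflected_path X s t"])
  assume "first_after s (\<lambda>t. b < reflected_path X s t) = \<infinity>"
  then have "regulated X \<delta> b x V (max s T)" for T using reg[of "max s T"] unfolding \<tau>_def by simp
  then show ?thesis using regulated_mono by (meson max.cobounded2)
 next
  fix s' assume s': "s <= s'" "first_after s (\<lambda>t. b < reflected_path X s t) = ereal s'"
  note hits = reflected_path_hits[OF X st(2) b s'(2)]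
  have "enters_step1 X \<delta> b x s' b" by (rule enters_step1_enters_step2.from_step2[OF st(1) s'(2)])
  moreover have "regulated X \<delta> b x V s'" "least_push ?\<eta> s' (b - ?\<eta> s')"
   using reg[of s'] lp[of s'] s' hits(2) unfolding \<tau>_def by simp_all
  ultimately have "step1_state s' b" unfolding step1_state_def using st(2) s'(1) b by simp
  then show ?thesis using hits(3) s'(1) by blast
 qed
qed

text \<open>Were the equation to fail by time \<open>T\<close>, every step would be entered before
  \<open>T\<close>. But each Step 2 lasts at least \<open>d\<close>, a time in which
  \<open>X\<close> cannot rise by \<open>b\<close> before \<open>T + 1\<close>, so finitely many
  rounds already pass \<open>T\<close>.\<close>

lemma regulated_all: "regulated X \<delta> b x V T"
proof (rule ccontr)
 assume nr: "\<not> regulated X \<delta> b x V T"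
 have neg: "T \<ge> 0"
 proof (rule ccontr)
  assume T: "\<not> 0 <= T"
  have "{u. 0 <= u \<and> u < T \<and> b < V u} = {}" using T by auto
  show False using nr T unfolding regulated_def \<open>{u. 0 <= u \<and> u < T \<and> b < V u} = {}\<close> by simp
 qed
 obtain d where d: "d > 0" "\<And>u w. 0 <= u ==> u <= w ==> w <= T + 1 ==> w < u + d ==> X w - X u < b"
  by (rule small_drawup[OF X b, of "T + 1"]) (use neg in auto)
 have le: "s < T" if "regulated X \<delta> b x V s" for s
  using nr regulated_mono[OF that, where T = T] by linarith
 have lp0: "least_push (free_path X \<delta> b x V) 0 (max x 0 - free_path X \<delta> b x V 0)" "free_path X \<delta> b x V 0 = max x 0"
  "regulated X \<delta> b x V 0"
 proof -
  have em: "{u. 0 <= u \<and> u < 0 \<and> b < V u} = {}" by auto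
  have "{u \<in> {0..0}. b < V u} = {} \<or> {u \<in> {0..0}. b < V u} = {0}" by auto
  then have "path_loss \<delta> b V 0 = 0"
  proof
   assume *: "{u \<in> {0..0}. b < V u} = {}"
   have "(LBINT u:{0..0}. indicator {b<..} (V u)) = measure lborel {u \<in> {0..0}. b < V u}"
    by (rule set_integral_level) (simp only: * sets.empty_sets)
   then show ?thesis unfolding path_loss_def * by simp
  next
   assume *: "{u \<in> {0..0}. b < V u} = {0}"
   have "(LBINT u:{0..0}. indicator {b<..} (V u)) = measure lborel {u \<in> {0..0}. b < V u}"
    by (rule set_integral_level) (simp only: *, simp)
   then show ?thesis unfolding path_loss_def * by simp
  qed
  then show 0: "free_path X \<delta> b x V 0 = max x 0" unfolding free_path_def by simp
  show "least_push (free_path X \<delta> b x V) 0 (max x 0 - free_path X \<delta> b x V 0)"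
   unfolding least_push_def 0
  proof (intro conjI allI impI)
   fix u :: real assume "0 <= u" "u <= 0"
   then have "u = 0" by simp
   then show "- free_path X \<delta> b x V u <= max x 0 - max x 0" using 0 by simp
  qed simp_all
  show "regulated X \<delta> b x V 0" unfolding regulated_def em by simp
 qed
 have "\<exists>s\<ge>real n * d. step2_state s" for n
 proof (induction n)
  case 0
  show ?case
  proof (cases "0 <= x")
   case True
   have "step1_state 0 x" unfolding step1_state_def
    using enters_step1_enters_step2.start_nonneg[OF True, of X \<delta> b] True lp0(1,3) by (simp add: max_def)
   then obtain s' where "0 <= s'" "step2_state s'" using after_step1 nr by blast
   then show ?thesis by auto
  next
   case False
   have "step2_state 0" unfolding step2_state_def
    using enters_step1_enters_step2.start_neg[of x X \<delta> b] False lp0(1,3) by (simp add: max_def)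
   then show ?thesis by auto
  qed
 next
  case (Suc n)
  then obtain s where s: "real n * d <= s" "step2_state s" by blast
  obtain s' where s': "s <= s'" "step1_state s' b"
   "\<And>d. (\<forall>u w. 0 <= u --> u <= w --> w <= s' + 1 --> w < u + d --> X w - X u < b) ==> s + d <= s'"
   using after_step2[OF s(2)] nr by blast
  have "s' < T" using le s'(2) unfolding step1_state_def by blast
  then have "s + d <= s'" using s'(3)[of d] d(2) by auto
  moreover obtain s'' where "s' <= s''" "step2_state s''" using after_step1[OF s'(2)] nr by blast
  ultimately show ?case using s by (intro exI[of _ s'']) (auto simp: algebra_simps)
 qed
 moreover obtain n where "T < real n * d" using d(1) reals_Archimedean3 by blast
 ultimately obtain s where "step2_state s" "T < s" by (metis less_le_trans)
 then show False using le[of s] unfolding step2_state_def by simp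
qed

end

section \<open>Discretisation of a regulated path\<close>

text \<open>The cap \<open>z - b\<close> keeps the loss from carrying a step below \<open>b\<close>:
  all values in \<open>[b, b + \<delta> * h]\<close> end at \<open>b\<close>. A step ending at
  \<open>b\<close> may thus have paid any part of the full amount, which is why \<open>b\<close>
  needs separate treatment in the limit.\<close>

definition step_loss :: "real => real => real => real => real" where
 "step_loss \<delta> b h z = min (max (z - b) 0) (\<delta> * h)"

definition step_map :: "real => real => real => real => real" where
 "step_map \<delta> b h z = max z 0 - step_loss \<delta> b h z"

text \<open>The refraction is applied implicitly, after the increment: a step ending above \<open>b\<close> pays the
 full amount \<open>\<delta> h\<close> and a step ending below \<open>b\<close> pays nothing.\<close>

fun chain :: "real => real => real => real => (nat => real) => nat => real" where
 "chain \<delta> b h v \<Delta> 0 = v"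
| "chain \<delta> b h v \<Delta> (Suc k) = step_map \<delta> b h (chain \<delta> b h v \<Delta> k + \<Delta> k)"

definition increments :: "(real => real) => real => nat => real" where
 "increments X h k = X (real (Suc k) * h) - X (real k * h)"

lemma step_loss_bounds:
 assumes "0 <= \<delta>" "0 < h" "0 < b"
 shows "0 <= step_loss \<delta> b h z" "step_loss \<delta> b h z <= \<delta> * h" "0 <= step_map \<delta> b h z"
  "b < step_map \<delta> b h z ==> step_loss \<delta> b h z = \<delta> * h"
  "step_map \<delta> b h z < b ==> step_loss \<delta> b h z = 0"
  "step_map \<delta> b h z <= max z 0"
 using assms by (auto simp: step_loss_def step_map_def min_def max_def split: if_splits)

definition grid_index :: "nat => real => nat" where "grid_index N s = nat \<lfloor>s * real (Suc N)\<rfloor>"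

lemma grid_index_bounds:
 assumes "0 <= s"
 shows "real (grid_index N s) * (1 / real (Suc N)) <= s" "s < real (Suc (grid_index N s)) * (1 / real (Suc N))"
  "real (Suc (grid_index N s)) * (1 / real (Suc N)) <= s + 1 / real (Suc N)"
proof -
 have "real (grid_index N s) = of_int \<lfloor>s * real (Suc N)\<rfloor>" using assms unfolding grid_index_def by simp
 then have "real (grid_index N s) <= s * real (Suc N)" "s * real (Suc N) < real (grid_index N s) + 1"
  by linarith+
 then show *: "real (grid_index N s) * (1 / real (Suc N)) <= s" "s < real (Suc (grid_index N s)) * (1 / real (Suc N))"
  by (simp_all add: field_simps)
 show "real (Suc (grid_index N s)) * (1 / real (Suc N)) <= s + 1 / real (Suc N)"
  using *(1) by (simp add: add_divide_distrib)
qed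

lemma mesh_tendsto: "(\<lambda>N. 1 / real (Suc N)) \<longlonglongrightarrow> 0"
 using LIMSEQ_inverse_real_of_nat by (simp add: inverse_eq_divide)

section \<open>Regularity of regulated paths, and comparison with the chain\<close>

locale regulated_process =
 fixes X :: "real => real" and \<delta> b x :: real and V :: "real => real"
 assumes cadlag: "cadlag X" and nojump: "no_positive_jumps X" and b: "0 < b" and \<delta>: "0 <= \<delta>"
  and reg: "\<And>T. regulated X \<delta> b x V T"
begin

abbreviation "\<eta> \<equiv> free_path X \<delta> b x V"
abbreviation "L \<equiv> path_loss \<delta> b V"
abbreviation "R t \<equiv> V t - \<eta> t"

lemma push: "0 <= t ==> least_push \<eta> t (R t)"
 using reg[of "t + 1"] unfolding regulated_def by simp

lemma level_meas: "{u. 0 <= u \<and> u < T \<and> b < V u} \<in> sets borel"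
 using reg[of T] unfolding regulated_def by blast

lemma level_meas2: "0 <= s ==> {u. s <= u \<and> u < T \<and> b < V u} \<in> sets borel"
proof -
 assume "0 <= s"
 then have "{u. s <= u \<and> u < T \<and> b < V u} = {u. 0 <= u \<and> u < T \<and> b < V u} \<inter> {s..}" by auto
 also have "\<dots> \<in> sets borel" by (rule sets.Int[OF level_meas]) simp
 finally show ?thesis .
qed

lemma V_nonneg: "0 <= t ==> 0 <= V t"
 using push[of t] unfolding least_push_def by force

lemma loss_split: "0 <= s ==> s <= t ==> L t = L s + \<delta> * measure lborel {u. s <= u \<and> u < t \<and> b < V u}"
 by (rule level_split(2)[OF level_meas level_meas2])

lemma loss_inc:
 assumes "0 <= s" "s <= t"
 shows "L s <= L t" "L t - L s <= \<delta> * (t - s)"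
  "(\<And>u. s <= u ==> u < t ==> b < V u) ==> L t - L s = \<delta> * (t - s)"
  "(\<And>u. s <= u ==> u < t ==> V u <= b) ==> L t = L s"
proof -
 note sp = loss_split[OF assms]
 show "L s <= L t" using sp \<delta> by simp
 have "measure lborel {u. s <= u \<and> u < t \<and> b < V u} <= t - s"
  by (rule measure_level_le[OF assms(2) level_meas2[OF assms(1)]])
 then show "L t - L s <= \<delta> * (t - s)" using sp \<delta> by (simp add: mult_left_mono)
 show "L t - L s = \<delta> * (t - s)" if "\<And>u. s <= u ==> u < t ==> b < V u"
 proof -
  have "{u. s <= u \<and> u < t \<and> b < V u} = {s..<t}" using that by auto
  then show ?thesis using sp assms by simp
 qed
 show "L t = L s" if "\<And>u. s <= u ==> u < t ==> V u <= b"
 proof -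
  have "{u. s <= u \<and> u < t \<and> b < V u} = {}" using that by force
  then show ?thesis using sp by (simp only: measure_empty mult_zero_right add_0_right)
 qed
qed

lemma free_inc: "\<eta> t - \<eta> s = X t - X s - (L t - L s)"
 unfolding free_path_def by simp

text \<open>The regulator is a least bound, so it grows past \<open>c\<close> only if
  \<open>- \<eta>\<close> does so after \<open>s\<close>.\<close>

lemma push_le:
 assumes "0 <= s" "s <= t" "R s <= c" "\<And>u. s < u ==> u <= t ==> - \<eta> u <= c"
 shows "R t <= c"
proof -
 have s: "0 <= R s" "\<And>u. 0 <= u ==> u <= s ==> - \<eta> u <= R s" using push[OF assms(1)] unfolding least_push_def by auto
 have "- \<eta> u <= c" if "0 <= u" "u <= t" for u
  using s(2)[of u] assms(3) assms(4)[of u] that by (cases "u <= s") auto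
 moreover have "0 <= c" using s(1) assms(3) by simp
 moreover have "0 <= t" using assms by simp
 ultimately show ?thesis using push[of t] unfolding least_push_def by blast
qed

lemma push_mono: "0 <= s ==> s <= t ==> R s <= R t"
proof -
 assume st: "0 <= s" "s <= t"
 have "\<forall>u. 0 <= u --> u <= s --> - \<eta> u <= R t" "0 <= R t"
  using push[of t] st unfolding least_push_def by auto
 then show "R s <= R t" using push[OF st(1)] unfolding least_push_def by blast
qed

lemma V_start: "V 0 = max x 0" "L 0 = 0"
proof -
 have "(LBINT u:{0..0}. indicator {b<..} (V u)) = (0::real)"
  unfolding set_lebesgue_integral_def
  by (rule integral_eq_zero_AE, rule AE_I[of _ _ "{0}"]) (auto simp: indicator_def)
 then show "L 0 = 0" unfolding path_loss_def by simp
 then have "\<eta> 0 = max x 0" unfolding free_path_def by simp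
 moreover have "R 0 <= 0"
 proof -
  have "\<forall>u. 0 <= u --> u <= 0 --> - \<eta> u <= 0"
  proof (intro allI impI)
   fix u :: real assume "0 <= u" "u <= 0"
   then have "u = 0" by simp
   then show "- \<eta> u <= 0" using \<open>\<eta> 0 = max x 0\<close> by simp
  qed
  then show ?thesis using push[of 0] unfolding least_push_def by blast
 qed
 moreover have "0 <= R 0" using push[of 0] unfolding least_push_def by blast
 ultimately show "V 0 = max x 0" by linarith
qed

text \<open>The loss only lowers the path and a push only brings it to 0, so neither adds to a rise
  of \<open>X\<close>.\<close>

lemma V_drawup:
 assumes "0 <= s" "s <= t" "\<And>u. s <= u ==> u <= t ==> X t - X u <= e"
 shows "V t <= V s + e"
proof -
 have *: "\<eta> t - \<eta> u <= e" if "s <= u" "u <= t" for u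
  using free_inc[of t u] loss_inc(1)[of u t] assms that by force
 have "R t <= V s + e - \<eta> t"
 proof (rule push_le[OF assms(1,2)])
  show "R s <= V s + e - \<eta> t" using *[of s] assms by simp
  show "- \<eta> u <= V s + e - \<eta> t" if "s < u" "u <= t" for u using *[of u] that V_nonneg[OF assms(1)] by simp
 qed
 then show ?thesis by simp
qed

lemma push_const:
 assumes "0 <= s" "s <= t" "0 < e" "\<And>u. s < u ==> u <= t ==> e <= V u"
 shows "R t = R s"
proof -
 \<comment> \<open>While \<open>V\<close> stays above \<open>e\<close>,
   \<open>- \<eta> u = R u - V u\<close> is at most \<open>R t - e\<close>, so the regulator cannot
   have grown to \<open>R t\<close> on this interval.\<close>
 have "R t <= max (R s) (R t - e)"
 proof (rule push_le[OF assms(1,2)])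
  show "- \<eta> u <= max (R s) (R t - e)" if "s < u" "u <= t" for u
   using assms(4)[OF that] push_mono[of u t] that assms(1) by force
 qed simp
 then show ?thesis using push_mono[OF assms(1,2)] assms(3) by linarith
qed

text \<open>The factor 2 counts the oscillation of the free path once for itself and once for the
  regulator.\<close>

lemma V_osc:
 assumes "0 <= s" "s <= t" "\<And>u. s <= u ==> u <= t ==> \<bar>X u - X s\<bar> <= e"
 shows "\<bar>V t - V s\<bar> <= 2 * (e + \<delta> * (t - s))"
proof -
 define q where "q = e + \<delta> * (t - s)"
 have *: "\<bar>\<eta> u - \<eta> s\<bar> <= q" if "s <= u" "u <= t" for u
 proof -
  have "\<delta> * (u - s) <= \<delta> * (t - s)" using that \<delta> by (intro mult_left_mono) auto
  then show ?thesis using free_inc[of u s] loss_inc(1,2)[OF assms(1) that(1)] assms(3)[OF that] unfolding q_def by linarith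
 qed
 have "0 <= q" using *[of s] assms by simp
 then have "R t <= R s + q"
 proof (intro push_le[OF assms(1,2)])
  show "- \<eta> u <= R s + q" if "s < u" "u <= t" for u
   using *[of u] that V_nonneg[OF assms(1)] by simp
 qed simp
 then show ?thesis using push_mono[OF assms(1,2)] *[of t] assms(2) unfolding q_def[symmetric] by linarith
qed

lemma V_right_cont:
 assumes "0 <= s" "0 < e"
 obtains d where "d > 0" "\<And>t. s <= t ==> t < s + d ==> \<bar>V t - V s\<bar> < e"
proof -
 have "(X \<longlongrightarrow> X s) (at_right s)" using cadlag assms(1) unfolding cadlag_def by auto
 then have "eventually (\<lambda>u. dist (X u) (X s) < e / 8) (at_right s)" using assms(2) by (intro tendstoD) auto
 then obtain r where r: "r > s" "\<And>u. s < u ==> u < r ==> dist (X u) (X s) < e / 8"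
  unfolding eventually_at_right_field by blast
 define d where "d = min (r - s) (e / (8 * (\<delta> + 1)))"
 have "d > 0" using r assms(2) \<delta> unfolding d_def by simp
 moreover have "\<bar>V t - V s\<bar> < e" if t: "s <= t" "t < s + d" for t
 proof -
  have osc: "\<bar>V t - V s\<bar> <= 2 * (e / 8 + \<delta> * (t - s))"
  proof (rule V_osc[OF assms(1) t(1)])
   fix u assume "s <= u" "u <= t"
   moreover have "t < r" using t unfolding d_def by linarith
   ultimately show "\<bar>X u - X s\<bar> <= e / 8"
    using r(2)[of u] assms(2) by (cases "u = s") (auto simp: dist_real_def)
  qed
  have "\<delta> * (t - s) <= (\<delta> + 1) * (e / (8 * (\<delta> + 1)))"
   using t \<delta> assms(2) unfolding d_def by (intro mult_mono) auto
  also have "(\<delta> + 1) * (e / (8 * (\<delta> + 1))) = e / 8" using \<delta> by (simp add: divide_simps)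
  finally have "\<delta> * (t - s) <= e / 8" .
  then have "2 * (e / 8 + \<delta> * (t - s)) <= 2 * (e / 8 + e / 8)" by simp
  from order_trans[OF osc this] show ?thesis using assms(2) by simp
 qed
 ultimately show ?thesis using that by blast
qed

lemma V_continuous_off_countable:
 obtains C where "countable C" "\<And>s e. 0 < s ==> s \<notin> C ==> 0 < e ==>
  \<exists>d>0. \<forall>t. 0 <= t --> s - d < t --> t < s + d --> \<bar>V t - V s\<bar> < e"
proof -
 obtain C where C: "countable C"
  "\<And>s e. 0 < s ==> s \<notin> C ==> 0 < e ==> \<exists>d>0. \<forall>u w. 0 <= u --> s - d < u --> u < s + d --> 0 <= w --> s - d < w --> w < s + d
    --> \<bar>X u - X w\<bar> < e"
  using cadlag_continuous_off_countable[OF cadlag] by blast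
 show ?thesis
 proof (rule that[OF C(1)])
  fix s e :: real assume s: "0 < s" "s \<notin> C" "0 < e"
  obtain d where d: "d > 0" "\<And>u w. 0 <= u ==> s - d < u ==> u < s + d ==> 0 <= w ==> s - d < w ==> w < s + d
    ==> \<bar>X u - X w\<bar> < e / 8"
   using C(2)[OF s(1,2), of "e/8"] s(3) by auto
  define d' where "d' = min d (e / (8 * (\<delta> + 1)))"
  have d': "d' > 0" using d s \<delta> unfolding d'_def by simp
  have *: "\<bar>V w - V u\<bar> < e" if uw: "0 <= u" "u <= w" "s - d' < u" "w < s + d'" "w - u < d'" for u w
  proof -
   have osc: "\<bar>V w - V u\<bar> <= 2 * (e / 8 + \<delta> * (w - u))"
    by (rule V_osc[OF uw(1,2)], rule less_imp_le, rule d(2)) (use uw in "auto simp: d'_def")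
   have "\<delta> * (w - u) <= (\<delta> + 1) * (e / (8 * (\<delta> + 1)))"
    using uw \<delta> s unfolding d'_def by (intro mult_mono) auto
   also have "(\<delta> + 1) * (e / (8 * (\<delta> + 1))) = e / 8" using \<delta> by (simp add: divide_simps)
   finally have "\<delta> * (w - u) <= e / 8" .
   then have "2 * (e / 8 + \<delta> * (w - u)) <= 2 * (e / 8 + e / 8)" by simp
   from order_trans[OF osc this] show ?thesis using s(3) by simp
  qed
  show "\<exists>d>0. \<forall>t. 0 <= t --> s - d < t --> t < s + d --> \<bar>V t - V s\<bar> < e"
  proof (intro exI[of _ d'] conjI allI impI d')
   fix t assume t: "0 <= t" "s - d' < t" "t < s + d'"
   show "\<bar>V t - V s\<bar> < e"
    using *[of s t] *[of t s] t s d' by (cases "s <= t") (auto simp: abs_minus_commute)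
  qed
 qed
qed

text \<open>Suppose the chain first falls more than \<open>e\<close> below \<open>V\<close> in some
  step. As rises of \<open>X\<close> within a step stay under \<open>e / 2\<close>, throughout the
  step \<open>V\<close> is at least \<open>e / 2\<close> and above the new value of the chain. So
  \<open>V\<close> is not pushed, and if the chain pays anything then \<open>V\<close> is above
  \<open>b\<close> and pays in full: the gap cannot have widened.\<close>

lemma chain_lower:
 assumes T: "0 <= T" and e: "0 < e"
 obtains d where "d > 0" "\<And>h k. 0 < h ==> h < d ==> real k * h <= T ==>
   V (real k * h) - e <= chain \<delta> b h (max x 0) (increments X h) k"
proof -
 obtain d where d: "d > 0" "\<And>s t. 0 <= s ==> s <= t ==> t <= T ==> t < s + d ==> X t - X s < e / 2"
  using small_drawup[OF cadlag nojump, of "e/2" T] T e by auto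
 show ?thesis
 proof (rule that[OF d(1)])
  fix h :: real and k assume h: "0 < h" "h < d"
  define v where "v = chain \<delta> b h (max x 0) (increments X h)"
  have "real k * h <= T ==> V (real k * h) - e <= v k"
  proof (induction k)
   case 0 then show ?case unfolding v_def using V_start e by simp
  next
   case (Suc k)
   define s t where "s = real k * h" and "t = real (Suc k) * h"
   have st: "0 <= s" "t = s + h" "t <= T" using h Suc.prems unfolding s_def t_def by (auto simp: algebra_simps)
   have IH: "V s - e <= v k" using Suc.IH st h unfolding s_def by (simp add: t_def)
   define z where "z = v k + (X t - X s)"
   have v: "v (Suc k) = step_map \<delta> b h z"
    unfolding v_def z_def s_def t_def by (simp add: increments_def)
   note sl = step_loss_bounds[OF \<delta> h(1) b, of z]
   show ?case
   proof (rule ccontr)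
    assume "\<not> V (real (Suc k) * h) - e <= v (Suc k)"
    then have less: "v (Suc k) + e < V t" unfolding t_def by simp
    have Vu: "V t <= V u + e / 2" if "s <= u" "u <= t" for u
     by (rule V_drawup, use that st in linarith, use that st in linarith, rule less_imp_le, rule d(2)) (use that st h in linarith)+
    have "0 <= v (Suc k)" using v sl by simp
    then have Vpos: "e / 2 <= V u \<and> v (Suc k) < V u" if "s <= u" "u <= t" for u
     using Vu[OF that] less e by linarith
    have "R t = R s"
     by (rule push_const[of s t "e/2"]) (use Vpos st h e in auto)
    moreover have "step_loss \<delta> b h z <= L t - L s"
    proof (cases "step_loss \<delta> b h z = 0")
     case True then show ?thesis using loss_inc(1)[of s t] st h by simp
    next
     case False
     then have "b <= v (Suc k)" using v sl(5) by force
     then have "L t - L s = \<delta> * (t - s)"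
      by (intro loss_inc(3)) (use Vpos st h in force)+
     then show ?thesis using sl(2) st by simp
    qed
    ultimately have "V t - V s <= (X t - X s) - step_loss \<delta> b h z" using free_inc[of t s] by simp
    moreover have "z - step_loss \<delta> b h z <= v (Suc k)" unfolding v step_map_def by simp
    ultimately show False using IH less unfolding z_def by linarith
   qed
  qed
  then show "real k * h <= T ==> V (real k * h) - e <= chain \<delta> b h (max x 0) (increments X h) k" unfolding v_def .
 qed
qed

text \<open>Once more than \<open>e / 2\<close> above \<open>V\<close>, the chain gains on
  \<open>V\<close> only in a step where \<open>V\<close> is above \<open>b\<close> at some time
  while the chain ends at or below \<open>b\<close>. Then \<open>X\<close> drops by more than
  \<open>e / 4\<close>, so the step contains an exceptional time of the partition; these are
  finitely many, each costing at most \<open>\<delta> * h\<close>.\<close>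

lemma chain_upper:
 assumes T: "0 <= T" and e: "0 < e"
 obtains d where "d > 0" "\<And>h k. 0 < h ==> h < d ==> real k * h <= T ==>
   chain \<delta> b h (max x 0) (increments X h) k <= V (real k * h) + e"
proof -
 obtain Q where Q: "finite Q"
  "\<And>s t. 0 <= s ==> s <= t ==> t <= T ==> {s<..t} \<inter> Q = {} ==> \<bar>X t - X s\<bar> < e / 4"
  by (rule cadlag_partition[OF cadlag, of "e/4" T]) (use T e in auto)
 \<comment> \<open>Makes \<open>\<delta> * h\<close> times the number of exceptional times at most
   \<open>e / 4\<close>; the added ones guard against a zero drift and an empty partition.\<close>
 define d where "d = e / (4 * (\<delta> + 1) * (real (card Q) + 1))"
 have d: "d > 0" unfolding d_def using e \<delta> by simp
 have dh: "\<delta> * h * real (card Q) <= e / 4" "\<delta> * h <= e / 4" if "0 < h" "h < d" for h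
 proof -
  have "\<delta> * h * real (card Q) <= (\<delta> + 1) * d * (real (card Q) + 1)" "\<delta> * h * 1 <= (\<delta> + 1) * d * (real (card Q) + 1)"
   using that \<delta> by (intro mult_mono; simp)+
  moreover have "(\<delta> + 1) * d * (real (card Q) + 1) = e / 4" unfolding d_def using \<delta> by (simp add: divide_simps)
  ultimately show "\<delta> * h * real (card Q) <= e / 4" "\<delta> * h <= e / 4" by simp_all
 qed
 show ?thesis
 proof (rule that[OF d])
  fix h :: real and k assume h: "0 < h" "h < d"
  define v where "v = chain \<delta> b h (max x 0) (increments X h)"
  have main: "real k * h <= T ==> v k <= V (real k * h) + e / 2 + \<delta> * h * card (Q \<inter> {0<..real k * h})"
  proof (induction k)
   case 0 then show ?case unfolding v_def using V_start e by simp
  next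
   case (Suc k)
   define s t where "s = real k * h" and "t = real (Suc k) * h"
   have st: "0 <= s" "t = s + h" "t <= T" using h Suc.prems unfolding s_def t_def by (auto simp: algebra_simps)
   have IH: "v k <= V s + e / 2 + \<delta> * h * card (Q \<inter> {0<..s})" using Suc.IH st h unfolding s_def by (simp add: t_def)
   define z where "z = v k + (X t - X s)"
   have v: "v (Suc k) = step_map \<delta> b h z"
    unfolding v_def z_def s_def t_def by (simp add: increments_def)
   note sl = step_loss_bounds[OF \<delta> h(1) b, of z]
   have card0: "card (Q \<inter> {0<..s}) <= card (Q \<inter> {0<..t})" by (rule card_mono) (use Q st h in auto)
   have mono: "\<delta> * h * card (Q \<inter> {0<..s}) <= \<delta> * h * card (Q \<inter> {0<..t})"
    using card0 \<delta> h by (intro mult_left_mono) auto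
   have "v (Suc k) <= V t + e / 2 + \<delta> * h * card (Q \<inter> {0<..t})"
   proof (cases "v (Suc k) <= V t + e / 2")
    case True
    moreover have "0 <= \<delta> * h * card (Q \<inter> {0<..t})" using \<delta> h by simp
    ultimately show ?thesis by linarith
   next
    case False
    have Vt: "0 <= V t" using V_nonneg[of t] st h by simp
    \<comment> \<open>The chain ends above \<open>V t\<close>, hence above 0, so it was not
      reflected in this step.\<close>
    have z0: "0 < z" using False Vt e sl(6) v by linarith
    then have vz: "v (Suc k) = z - step_loss \<delta> b h z" unfolding v step_map_def by simp
    have step: "v (Suc k) - V t <= v k - V s + ((L t - L s) - step_loss \<delta> b h z)"
     using vz free_inc[of t s] push_mono[of s t] st h unfolding z_def by simp
    show ?thesis
    proof (cases "b < v (Suc k)")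
     case True
     then have "step_loss \<delta> b h z = \<delta> * h" using sl(4) v by simp
     then have "v (Suc k) - V t <= v k - V s" using step loss_inc(2)[of s t] st h by simp
     then show ?thesis using IH mono by linarith
    next
     case nb: False
     show ?thesis
     proof (cases "\<forall>u. s <= u --> u < t --> V u <= b")
      case True
      then have "L t = L s" using loss_inc(4)[of s t] st h by simp
      then show ?thesis using step IH mono sl(1) by linarith
     next
      case bad: False
      then obtain u where u: "s <= u" "u < t" "b < V u" by force
      \<comment> \<open>From \<open>u\<close> to \<open>t\<close> the path drops from above
        \<open>b\<close> to more than \<open>e / 2\<close> below the value of the chain, itself at
        most \<open>b\<close>; the loss explains at most \<open>e / 4\<close> of this.\<close>
      have "\<eta> t - \<eta> u <= V t - V u" using push_mono[of u t] u st by simp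
      moreover have "L t - L u <= \<delta> * h"
      proof -
       have "\<delta> * (t - u) <= \<delta> * h" using u st \<delta> by (intro mult_left_mono) auto
       then show ?thesis using loss_inc(2)[of u t] u st by linarith
      qed
      ultimately have "X u - X t > e / 4" using free_inc[of t u] False nb u dh(2)[OF h] by linarith
      then have "{u<..t} \<inter> Q \<noteq> {}" using Q(2)[of u t] u st by linarith
      then obtain p where p: "p \<in> Q" "u < p" "p <= t" by force
      have "card (insert p (Q \<inter> {0<..s})) <= card (Q \<inter> {0<..t})" by (rule card_mono) (use Q p u st h in auto)
      then have "card (Q \<inter> {0<..s}) + 1 <= card (Q \<inter> {0<..t})" using Q p u by simp
      then have "\<delta> * h * (card (Q \<inter> {0<..s}) + 1) <= \<delta> * h * card (Q \<inter> {0<..t})"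
       using \<delta> h by (intro mult_left_mono) auto
      moreover have "L t - L s <= \<delta> * h" using loss_inc(2)[of s t] st h by simp
      ultimately show ?thesis using step IH sl(1) by (simp add: distrib_left)
     qed
    qed
   qed
   then show ?case unfolding t_def .
  qed
  assume "real k * h <= T"
  have "card (Q \<inter> {0<..real k * h}) <= card Q" using Q by (intro card_mono) auto
  then have "\<delta> * h * card (Q \<inter> {0<..real k * h}) <= \<delta> * h * card Q" using \<delta> h by (intro mult_left_mono) auto
  then show "chain \<delta> b h (max x 0) (increments X h) k <= V (real k * h) + e"
   using main \<open>real k * h <= T\<close> dh(1)[OF h] e unfolding v_def by linarith
 qed
qed

section \<open>Pointwise limits of the chain\<close>

definition disc :: "nat => nat => real" where
 "disc N = chain \<delta> b (1 / real (Suc N)) (max x 0) (increments X (1 / real (Suc N)))"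

lemma disc_close:
 assumes "0 <= T" "0 < e"
 shows "\<forall>\<^sub>F N in sequentially. \<forall>k. real k * (1 / real (Suc N)) <= T --> \<bar>disc N k - V (real k * (1 / real (Suc N)))\<bar> <= e"
proof -
 obtain d1 where d1: "d1 > 0" "\<And>h k. 0 < h ==> h < d1 ==> real k * h <= T ==>
   V (real k * h) - e <= chain \<delta> b h (max x 0) (increments X h) k"
  by (rule chain_lower[OF assms]) blast
 obtain d2 where d2: "d2 > 0" "\<And>h k. 0 < h ==> h < d2 ==> real k * h <= T ==>
   chain \<delta> b h (max x 0) (increments X h) k <= V (real k * h) + e"
  by (rule chain_upper[OF assms]) blast
 have "(\<lambda>N. 1 / real (Suc N)) \<longlonglongrightarrow> 0" using LIMSEQ_inverse_real_of_nat by (simp add: inverse_eq_divide)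
 then have "\<forall>\<^sub>F N in sequentially. 1 / real (Suc N) < min d1 d2" using d1 d2 by (intro order_tendstoD) auto
 then show ?thesis
 proof eventually_elim
  case (elim N)
  show ?case
  proof (intro allI impI)
   fix k assume k: "real k * (1 / real (Suc N)) <= T"
   show "\<bar>disc N k - V (real k * (1 / real (Suc N)))\<bar> <= e"
    using d1(2)[OF _ _ k] d2(2)[OF _ _ k] elim unfolding disc_def by simp
  qed
 qed
qed

text \<open>The grid point after \<open>s\<close> is handled by right continuity and converges for
  every \<open>s\<close>; the one before \<open>s\<close> needs continuity there, whence the
  countable exception in \<open>disc_tendsto\<close>. Both are used: the state is read at the start
  of a step, its loss is decided at the end.\<close>

lemma disc_Suc_tendsto:
 assumes "0 <= s"
 shows "(\<lambda>N. disc N (Suc (grid_index N s))) \<longlonglongrightarrow> V s"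
proof (rule metric_LIMSEQ_I)
 fix e :: real assume e: "0 < e"
 obtain d where d: "d > 0" "\<And>t. s <= t ==> t < s + d ==> \<bar>V t - V s\<bar> < e / 2"
  using V_right_cont[OF assms, of "e/2"] e by auto
 have "\<forall>\<^sub>F N in sequentially. 1 / real (Suc N) < min d 1" using mesh_tendsto d by (intro order_tendstoD) auto
 moreover have "\<forall>\<^sub>F N in sequentially. \<forall>k. real k * (1 / real (Suc N)) <= s + 1 --> \<bar>disc N k - V (real k * (1 / real (Suc N)))\<bar> <= e / 3"
  by (rule disc_close) (use assms e in auto)
 ultimately have "\<forall>\<^sub>F N in sequentially. dist (disc N (Suc (grid_index N s))) (V s) < e"
 proof eventually_elim
  case (elim N)
  define t where "t = real (Suc (grid_index N s)) * (1 / real (Suc N))"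
  have t: "s < t" "t <= s + 1 / real (Suc N)" unfolding t_def by (rule grid_index_bounds[OF assms])+
  have "\<bar>disc N (Suc (grid_index N s)) - V t\<bar> <= e / 3"
  proof -
   have "t <= s + 1" using t(2) elim(1) by linarith
   then show ?thesis using elim(2)[rule_format, of "Suc (grid_index N s)"] unfolding t_def by blast
  qed
  moreover have "\<bar>V t - V s\<bar> < e / 2" using d(2)[of t] t elim(1) by simp
  ultimately show ?case using e unfolding dist_real_def by linarith
 qed
 then show "\<exists>no. \<forall>n\<ge>no. dist (disc n (Suc (grid_index n s))) (V s) < e" unfolding eventually_sequentially .
qed

lemma disc_tendsto:
 obtains C where "countable C" "\<And>s. 0 < s ==> s \<notin> C ==> (\<lambda>N. disc N (grid_index N s)) \<longlonglongrightarrow> V s"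
proof -
 obtain C where C: "countable C" "\<And>s e. 0 < s ==> s \<notin> C ==> 0 < e ==>
  \<exists>d>0. \<forall>t. 0 <= t --> s - d < t --> t < s + d --> \<bar>V t - V s\<bar> < e"
  using V_continuous_off_countable by blast
 show ?thesis
 proof (rule that[OF C(1)], rule metric_LIMSEQ_I)
  fix s e :: real assume s: "0 < s" "s \<notin> C" and e: "0 < e"
  obtain d where d: "d > 0" "\<And>t. 0 <= t ==> s - d < t ==> t < s + d ==> \<bar>V t - V s\<bar> < e / 2"
   using C(2)[OF s, of "e/2"] e by auto
  have "\<forall>\<^sub>F N in sequentially. 1 / real (Suc N) < min d 1" using mesh_tendsto d by (intro order_tendstoD) auto
  moreover have "\<forall>\<^sub>F N in sequentially. \<forall>k. real k * (1 / real (Suc N)) <= s + 1 --> \<bar>disc N k - V (real k * (1 / real (Suc N)))\<bar> <= e / 3"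
   by (rule disc_close) (use s e in auto)
  ultimately have "\<forall>\<^sub>F N in sequentially. dist (disc N (grid_index N s)) (V s) < e"
  proof eventually_elim
   case (elim N)
   define t where "t = real (grid_index N s) * (1 / real (Suc N))"
   have t: "t <= s" "s < t + 1 / real (Suc N)" "0 <= t"
    using grid_index_bounds(1,2)[of s N] s unfolding t_def by (auto simp: add_divide_distrib)
   have "\<bar>disc N (grid_index N s) - V t\<bar> <= e / 3" using elim(2) t unfolding t_def by simp
   moreover have "\<bar>V t - V s\<bar> < e / 2" using d(2)[of t] t elim(1) d(1) by simp
   ultimately show ?case using e unfolding dist_real_def by linarith
  qed
  then show "\<exists>no. \<forall>n\<ge>no. dist (disc n (grid_index n s)) (V s) < e" unfolding eventually_sequentially .
 qed
qed

definition disc_loss :: "nat => nat => real" where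
 "disc_loss N k = step_loss \<delta> b (1 / real (Suc N)) (disc N k + increments X (1 / real (Suc N)) k)"

text \<open>By the implicit rule the end of the step decides its loss, and the end converges to
  \<open>V s\<close>; off level \<open>b\<close> the loss is therefore eventually all or
  nothing.\<close>

lemma disc_loss_tendsto:
 assumes "0 <= s" "V s \<noteq> b" "0 < \<delta>"
 shows "(\<lambda>N. disc_loss N (grid_index N s) / (\<delta> * (1 / real (Suc N)))) \<longlonglongrightarrow> indicator {b<..} (V s)"
proof -
 note lim = disc_Suc_tendsto[OF assms(1)]
 have next_eq: "disc N (Suc k) = step_map \<delta> b (1 / real (Suc N)) (disc N k + increments X (1 / real (Suc N)) k)" for N k
  unfolding disc_def by simp
 have "\<forall>\<^sub>F N in sequentially. disc_loss N (grid_index N s) / (\<delta> * (1 / real (Suc N))) = indicator {b<..} (V s)"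
 proof (cases "b < V s")
  case True
  then have "\<forall>\<^sub>F N in sequentially. b < disc N (Suc (grid_index N s))" using lim order_tendstoD(1) by blast
  then show ?thesis
  proof eventually_elim
   case (elim N)
   then have "disc_loss N (grid_index N s) = \<delta> * (1 / real (Suc N))"
    unfolding disc_loss_def next_eq by (intro step_loss_bounds(4)[OF \<delta> _ b]) auto
   then show ?case using True assms(3) by (simp add: indicator_def)
  qed
 next
  case False
  then have "V s < b" using assms(2) by simp
  then have "\<forall>\<^sub>F N in sequentially. disc N (Suc (grid_index N s)) < b" using lim order_tendstoD(2) by blast
  then show ?thesis
  proof eventually_elim
   case (elim N)
   then have "disc_loss N (grid_index N s) = 0"
    unfolding disc_loss_def next_eq by (intro step_loss_bounds(5)[OF \<delta> _ b]) auto
   then show ?case using False by (simp add: indicator_def)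
  qed
 qed
 then show ?thesis by (rule tendsto_eventually)
qed

text \<open>The closeness of chain and path carries an error, which the gap between
  \<open>a'\<close> and \<open>a\<close> absorbs.\<close>

lemma disc_stays_below:
 assumes "0 <= s" "a' < a" "\<And>u. 0 <= u ==> u <= s ==> V u <= a'"
 shows "\<forall>\<^sub>F N in sequentially. \<forall>j\<le>grid_index N s. disc N j <= a"
proof -
 have "\<forall>\<^sub>F N in sequentially. \<forall>k. real k * (1 / real (Suc N)) <= s --> \<bar>disc N k - V (real k * (1 / real (Suc N)))\<bar> <= a - a'"
  by (rule disc_close) (use assms in auto)
 then show ?thesis
 proof eventually_elim
  case (elim N)
  show ?case
  proof (intro allI impI)
   fix j assume j: "j <= grid_index N s"
   have "real j * (1 / real (Suc N)) <= real (grid_index N s) * (1 / real (Suc N))"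
    using j by (intro mult_right_mono) auto
   then have "real j * (1 / real (Suc N)) <= s" using grid_index_bounds(1)[OF assms(1), of N] by linarith
   then show "disc N j <= a"
    using elim[rule_format, of j] assms(3)[of "real j * (1 / real (Suc N))"] by fastforce
  qed
 qed
qed

lemma disc_exceeds:
 assumes "0 <= u" "u < s" "a < V u"
 shows "\<forall>\<^sub>F N in sequentially. \<exists>j\<le>grid_index N s. a < disc N j"
proof -
 have "\<forall>\<^sub>F N in sequentially. a < disc N (Suc (grid_index N u))"
  using disc_Suc_tendsto[OF assms(1)] assms(3) order_tendstoD(1) by blast
 moreover have "\<forall>\<^sub>F N in sequentially. 1 / real (Suc N) < s - u" using mesh_tendsto assms by (intro order_tendstoD) auto
 ultimately show ?thesis
 proof eventually_elim
  case (elim N)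
  have "real (Suc (grid_index N u)) * (1 / real (Suc N)) <= s"
   using grid_index_bounds(3)[OF assms(1), of N] elim(2) by linarith
  then have "real (Suc (grid_index N u)) <= s * real (Suc N)" by (simp add: field_simps)
  then have "Suc (grid_index N u) <= grid_index N s" unfolding grid_index_def[of N s] by (rule le_nat_floor)
  then show ?case using elim(1) by blast
 qed
qed

end

section \<open>Functionals of the increments of a Levy process\<close>

text \<open>Common form of the random walk behind the exponential moments and of the stopped
  chain.\<close>

fun recur :: "(real => real => real) => real => (nat => real) => nat => real" where
 "recur \<phi> z \<Delta> 0 = z"
| "recur \<phi> z \<Delta> (Suc k) = \<phi> (recur \<phi> z \<Delta> k) (\<Delta> k)"

lemma recur_cong: "(\<And>i. i < k ==> \<Delta> i = \<Delta>' i) ==> recur \<phi> z \<Delta> k = recur \<phi> z \<Delta>' k"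
 by (induction k) auto

locale levy = prob_space M for M :: "'a measure" +
 fixes x :: real and X :: "real => 'a => real"
 assumes levy: "levy_process M x X"
begin

definition inc :: "real => nat => 'a => real" where
 "inc h k om = increments (\<lambda>t. X t om) h k"

definition \<mu> :: "real => real measure" where
 "\<mu> t = distr M borel (\<lambda>om. X t om - X 0 om)"

lemma X_meas[measurable]: "0 <= t ==> X t \<in> borel_measurable M"
 using levy unfolding levy_process_def by blast

lemma inc_meas: "0 <= h ==> inc h k \<in> borel_measurable M"
 unfolding inc_def increments_def by (intro borel_measurable_diff X_meas) auto

lemma inc_indep:
 assumes "0 <= h"
 shows "indep_vars (\<lambda>_. borel) (inc h) {..<n}"
proof -
 have m: "mono (\<lambda>i. real i * h)" using assms by (auto simp: mono_def intro: mult_right_mono)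
 have *: "\<forall>(n::nat) u. 0 <= u 0 \<and> mono u -->
    indep_vars (\<lambda>_. borel) (\<lambda>i om. X (u (Suc i)) om - X (u i) om) {..<n}"
  using levy unfolding levy_process_def by blast
 show ?thesis using *[rule_format, of "\<lambda>i. real i * h" n] m unfolding inc_def increments_def by simp
qed

lemma stationary: "0 <= s ==> 0 <= t ==> distr M borel (\<lambda>om. X (s + t) om - X s om) = \<mu> t"
 using levy unfolding levy_process_def \<mu>_def by blast

lemma inc_distr: "0 <= h ==> distr M borel (inc h k) = \<mu> h"
 using stationary[of "real k * h" h] unfolding inc_def increments_def by (simp add: algebra_simps)

lemma sets_\<mu>[simp, measurable_cong]: "sets (\<mu> t) = sets borel"
 unfolding \<mu>_def by simp

lemma space_\<mu>[simp]: "space (\<mu> t) = UNIV"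
 unfolding \<mu>_def by simp

lemma prob_\<mu>: "0 <= t ==> prob_space (\<mu> t)"
 unfolding \<mu>_def by (intro prob_space_distr) measurable

lemma recur_meas:
 assumes "0 <= h" and \<phi>: "case_prod \<phi> \<in> borel_measurable (borel \<Otimes>\<^sub>M borel)"
 shows "(\<lambda>om. recur \<phi> z (\<lambda>i. inc h i om) k) \<in> borel_measurable M"
proof (induction k)
 case (Suc k)
 have "(\<lambda>om. case_prod \<phi> (recur \<phi> z (\<lambda>i. inc h i om) k, inc h k om)) \<in> borel_measurable M"
  by (rule measurable_compose[OF measurable_Pair[OF Suc inc_meas[OF assms(1)]] \<phi>])
 then show ?case by simp
qed simp

lemma recur_indep:
 assumes "0 <= h" and \<phi>: "case_prod \<phi> \<in> borel_measurable (borel \<Otimes>\<^sub>M borel)"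
 shows "indep_var borel (\<lambda>om. recur \<phi> z (\<lambda>i. inc h i om) k) borel (inc h k)"
proof -
 have m: "(\<lambda>f. recur \<phi> z f j) \<in> borel_measurable (Pi\<^sub>M {..<k} (\<lambda>_. borel))" if "j <= k" for j
  using that
 proof (induction j)
  case (Suc j)
  have "(\<lambda>f. case_prod \<phi> (recur \<phi> z f j, f j)) \<in> borel_measurable (Pi\<^sub>M {..<k} (\<lambda>_. borel))"
   by (rule measurable_compose[OF measurable_Pair[OF Suc.IH measurable_component_singleton] \<phi>]) (use Suc in auto)
  then show ?case by simp
 qed simp
 have "indep_var (Pi\<^sub>M {..<k} (\<lambda>_. borel)) (\<lambda>om. restrict (\<lambda>i. inc h i om) {..<k})
   (Pi\<^sub>M {k} (\<lambda>_. borel)) (\<lambda>om. restrict (\<lambda>i. inc h i om) {k})"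
  by (rule indep_var_restrict[OF inc_indep[OF assms(1), of "Suc k"]]) auto
 then have "indep_var borel ((\<lambda>f. recur \<phi> z f k) \<circ> (\<lambda>om. restrict (\<lambda>i. inc h i om) {..<k}))
   borel ((\<lambda>f. f k) \<circ> (\<lambda>om. restrict (\<lambda>i. inc h i om) {k}))"
  by (rule indep_var_compose) (use m in auto)
 moreover have "(\<lambda>f. recur \<phi> z f k) \<circ> (\<lambda>om. restrict (\<lambda>i. inc h i om) {..<k}) = (\<lambda>om. recur \<phi> z (\<lambda>i. inc h i om) k)"
  by (rule ext) (auto intro!: recur_cong)
 moreover have "(\<lambda>f. f k) \<circ> (\<lambda>om. restrict (\<lambda>i. inc h i om) {k}) = inc h k" by auto
 ultimately show ?thesis by simp
qed

lemma recur_joint: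
 assumes "0 <= h" and \<phi>: "case_prod \<phi> \<in> borel_measurable (borel \<Otimes>\<^sub>M borel)"
 shows "distr M (borel \<Otimes>\<^sub>M borel) (\<lambda>om. (recur \<phi> z (\<lambda>i. inc h i om) k, inc h k om)) =
  distr M borel (\<lambda>om. recur \<phi> z (\<lambda>i. inc h i om) k) \<Otimes>\<^sub>M \<mu> h"
 using recur_indep[OF assms] unfolding indep_var_distribution_eq inc_distr[OF assms(1), of k, symmetric] by simp

text \<open>The Markov property in the form used throughout: the state after \<open>k\<close> steps
  depends on the first \<open>k\<close> increments, so the next one may be averaged out with the
  state frozen.\<close>

lemma recur_nn_integral:
 assumes "0 <= h" and \<phi>: "case_prod \<phi> \<in> borel_measurable (borel \<Otimes>\<^sub>M borel)"
  and \<Phi>: "case_prod \<Phi> \<in> borel_measurable (borel \<Otimes>\<^sub>M borel)"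
 shows "(\<integral>\<^sup>+om. \<Phi> (recur \<phi> z (\<lambda>i. inc h i om) k) (inc h k om) \<partial>M) =
  (\<integral>\<^sup>+om. (\<integral>\<^sup>+y. \<Phi> (recur \<phi> z (\<lambda>i. inc h i om) k) y \<partial>\<mu> h) \<partial>M)"
proof -
 interpret P: prob_space "\<mu> h" by (rule prob_\<mu>[OF assms(1)])
 let ?Z = "\<lambda>om. recur \<phi> z (\<lambda>i. inc h i om) k"
 note [measurable] = recur_meas[OF assms(1,2)] inc_meas[OF assms(1)]
 have "(\<integral>\<^sup>+om. \<Phi> (?Z om) (inc h k om) \<partial>M) = (\<integral>\<^sup>+p. case_prod \<Phi> p \<partial>distr M (borel \<Otimes>\<^sub>M borel) (\<lambda>om. (?Z om, inc h k om)))"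
  by (subst nn_integral_distr) (use \<Phi> in simp_all)
 also have "\<dots> = (\<integral>\<^sup>+z. \<integral>\<^sup>+y. \<Phi> z y \<partial>\<mu> h \<partial>distr M borel ?Z)"
  unfolding recur_joint[OF assms(1,2)] by (subst P.nn_integral_fst[symmetric]) (use \<Phi> in simp_all)
 also have "\<dots> = (\<integral>\<^sup>+om. (\<integral>\<^sup>+y. \<Phi> (?Z om) y \<partial>\<mu> h) \<partial>M)"
  by (subst nn_integral_distr) (use \<Phi> in "auto intro!: P.borel_measurable_nn_integral")
 finally show ?thesis .
qed

lemma recur_integral:
 fixes \<Phi> :: "real => real => real"
 assumes "0 <= h" and \<phi>: "case_prod \<phi> \<in> borel_measurable (borel \<Otimes>\<^sub>M borel)"
  and \<Phi>: "case_prod \<Phi> \<in> borel_measurable (borel \<Otimes>\<^sub>M borel)"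
  and int: "integrable M (\<lambda>om. \<Phi> (recur \<phi> z (\<lambda>i. inc h i om) k) (inc h k om))"
 shows "integrable M (\<lambda>om. \<integral>y. \<Phi> (recur \<phi> z (\<lambda>i. inc h i om) k) y \<partial>\<mu> h)"
  "(\<integral>om. \<Phi> (recur \<phi> z (\<lambda>i. inc h i om) k) (inc h k om) \<partial>M) =
   (\<integral>om. (\<integral>y. \<Phi> (recur \<phi> z (\<lambda>i. inc h i om) k) y \<partial>\<mu> h) \<partial>M)"
proof -
 interpret P: prob_space "\<mu> h" by (rule prob_\<mu>[OF assms(1)])
 let ?Z = "\<lambda>om. recur \<phi> z (\<lambda>i. inc h i om) k"
 note [measurable] = recur_meas[OF assms(1,2)] inc_meas[OF assms(1)]
 interpret Q: prob_space "distr M borel ?Z" by (rule prob_space_distr) simp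
 interpret PQ: pair_sigma_finite "distr M borel ?Z" "\<mu> h" ..
 have i: "integrable (distr M borel ?Z \<Otimes>\<^sub>M \<mu> h) (case_prod \<Phi>)"
  unfolding recur_joint[OF assms(1,2), symmetric] by (subst integrable_distr_eq) (use \<Phi> int in simp_all)
 have "(\<integral>om. \<Phi> (?Z om) (inc h k om) \<partial>M) = (\<integral>p. case_prod \<Phi> p \<partial>distr M (borel \<Otimes>\<^sub>M borel) (\<lambda>om. (?Z om, inc h k om)))"
  by (subst integral_distr) (use \<Phi> in simp_all)
 also have "\<dots> = (\<integral>z. \<integral>y. \<Phi> z y \<partial>\<mu> h \<partial>distr M borel ?Z)"
  unfolding recur_joint[OF assms(1,2)] by (rule PQ.integral_fst[OF i, symmetric])
 also have "\<dots> = (\<integral>om. (\<integral>y. \<Phi> (?Z om) y \<partial>\<mu> h) \<partial>M)"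
  by (subst integral_distr) (use \<Phi> in "auto intro!: P.borel_measurable_lebesgue_integral")
 finally show "(\<integral>om. \<Phi> (?Z om) (inc h k om) \<partial>M) = (\<integral>om. (\<integral>y. \<Phi> (?Z om) y \<partial>\<mu> h) \<partial>M)" .
 have "integrable (distr M borel ?Z) (\<lambda>z. \<integral>y. \<Phi> z y \<partial>\<mu> h)" using PQ.integrable_fst[OF i] by simp
 then show "integrable M (\<lambda>om. \<integral>y. \<Phi> (?Z om) y \<partial>\<mu> h)"
  by (subst (asm) integrable_distr_eq) (use \<Phi> in "auto intro!: P.borel_measurable_lebesgue_integral")
qed

end

section \<open>Exponential moments\<close>

text \<open>\<open>reach \<kappa> n y\<close> is the probability that a random walk with step law \<open>\<kappa>\<close>, truncated at \<open>1\<close> from above,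
 reaches level \<open>y\<close> within \<open>n\<close> steps.\<close>

fun reach :: "real measure => nat => real => ennreal" where
 "reach \<kappa> 0 y = (if y <= 0 then 1 else 0)"
| "reach \<kappa> (Suc n) y = (if y <= 0 then 1 else \<integral>\<^sup>+z. reach \<kappa> n (y - min z 1) \<partial>\<kappa>)"

lemma reach_0: "y <= 0 ==> reach \<kappa> n y = 1"
 by (cases n) auto

lemma reach_meas:
 assumes "prob_space \<kappa>" "sets \<kappa> = sets borel"
 shows "reach \<kappa> n \<in> borel_measurable borel"
proof (induction n)
 case (Suc n)
 interpret prob_space \<kappa> by fact
 note [measurable_cong] = assms(2)
 note [measurable] = Suc
 have "(\<lambda>y. \<integral>\<^sup>+z. reach \<kappa> n (y - min z 1) \<partial>\<kappa>) \<in> borel_measurable borel" by measurable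
 then show ?case unfolding reach.simps by measurable
qed simp

lemma reach_le1:
 assumes "prob_space \<kappa>"
 shows "reach \<kappa> n y <= 1"
proof (induction n arbitrary: y)
 case (Suc n)
 interpret prob_space \<kappa> by fact
 have "(\<integral>\<^sup>+z. reach \<kappa> n (y - min z 1) \<partial>\<kappa>) <= (\<integral>\<^sup>+z. 1 \<partial>\<kappa>)" by (intro nn_integral_mono Suc)
 then show ?case by (simp add: emeasure_space_1)
qed simp

lemma reach_antimono:
 assumes "prob_space \<kappa>" "y <= y'"
 shows "reach \<kappa> n y' <= reach \<kappa> n y"
 using assms(2)
proof (induction n arbitrary: y y')
 case (Suc n)
 have "(\<integral>\<^sup>+z. reach \<kappa> n (y' - min z 1) \<partial>\<kappa>) <= (\<integral>\<^sup>+z. reach \<kappa> n (y - min z 1) \<partial>\<kappa>)"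
  by (intro nn_integral_mono Suc.IH) (use Suc.prems in simp)
 then show ?case using reach_le1[OF assms(1), of "Suc n" y'] Suc.prems by auto
qed auto

lemma reach_mono:
 assumes "prob_space \<kappa>"
 shows "reach \<kappa> n y <= reach \<kappa> (Suc n) y"
proof (induction n arbitrary: y)
 case (Suc n)
 have "(\<integral>\<^sup>+z. reach \<kappa> n (y - min z 1) \<partial>\<kappa>) <= (\<integral>\<^sup>+z. reach \<kappa> (Suc n) (y - min z 1) \<partial>\<kappa>)"
  by (intro nn_integral_mono Suc)
 then show ?case by simp
qed simp

text \<open>The walk cannot jump over an interval of length \<open>1\<close>, so to reach \<open>y + u + 1\<close> it must first stop
 in \<open>[y, y + 1]\<close> and then climb by at least \<open>u\<close>.\<close>

lemma reach_mult:
 assumes \<kappa>: "prob_space \<kappa>" "sets \<kappa> = sets borel" and "n <= m" "-1 <= y" "0 <= u"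
 shows "reach \<kappa> n (y + u + 1) <= reach \<kappa> n y * reach \<kappa> m u"
 using assms(3-)
proof (induction n arbitrary: y)
 case 0
 then show ?case by (auto simp: reach_0)
next
 case (Suc n)
 note [measurable] = reach_meas[OF \<kappa>] and [measurable_cong] = \<kappa>(2)
 show ?case
 proof (cases "y <= 0")
  case True
  have "reach \<kappa> (Suc n) (y + u + 1) <= reach \<kappa> (Suc n) u" by (rule reach_antimono[OF \<kappa>(1)]) (use Suc.prems in simp)
  also have "\<dots> <= reach \<kappa> m u" 
   by (rule lift_Suc_mono_le[of "\<lambda>n. reach \<kappa> n u", OF reach_mono[OF \<kappa>(1)] Suc.prems(1)])
  finally show ?thesis using True by (simp add: reach_0)
 next
  case False
  have "reach \<kappa> (Suc n) (y + u + 1) = (\<integral>\<^sup>+z. reach \<kappa> n ((y - min z 1) + u + 1) \<partial>\<kappa>)"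
   using False Suc.prems by (simp add: algebra_simps)
  also have "\<dots> <= (\<integral>\<^sup>+z. reach \<kappa> n (y - min z 1) * reach \<kappa> m u \<partial>\<kappa>)"
   by (intro nn_integral_mono Suc.IH) (use False Suc.prems in auto)
  also have "\<dots> = (\<integral>\<^sup>+z. reach \<kappa> n (y - min z 1) \<partial>\<kappa>) * reach \<kappa> m u"
   by (rule nn_integral_multc) measurable
  finally show ?thesis using False by simp
 qed
qed

text \<open>Of each block of length 2, one unit is a climb and one is room for the largest
  overshoot, bounded by the truncation.\<close>

lemma reach_power:
 assumes \<kappa>: "prob_space \<kappa>" "sets \<kappa> = sets borel"
 shows "reach \<kappa> n (2 * real k) <= reach \<kappa> n 1 ^ k"
proof (induction k)
 case (Suc k)
 have "reach \<kappa> n (1 + 2 * real k + 1) <= reach \<kappa> n 1 * reach \<kappa> n (2 * real k)"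
  by (rule reach_mult[OF \<kappa>]) auto
 also have "\<dots> <= reach \<kappa> n 1 * reach \<kappa> n 1 ^ k" by (intro mult_left_mono Suc) auto
 finally show ?case by (simp add: algebra_simps)
qed (simp add: reach_0)

text \<open>Cauchy's functional equation with a one-sided local bound. After the linear part is
  subtracted, the function vanishes at nonnegative rationals, so the bound spreads to all times;
  additivity would amplify a negative value beyond it.\<close>

lemma additive_bounded_below_linear:
 fixes a :: "real => real"
 assumes add: "\<And>s t. 0 <= s ==> 0 <= t ==> a (s + t) = a s + a t"
  and d: "0 < d" and bd: "\<And>t. 0 <= t ==> t <= d ==> - C <= a t" and t: "0 <= t"
 shows "a t = t * a 1"
proof -
 define b where "b t = a t - t * a 1" for t
 have badd: "b (s + t) = b s + b t" if "0 <= s" "0 <= t" for s t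
  using add[OF that] unfolding b_def by (simp add: algebra_simps)
 have b0: "b 0 = 0" using badd[of 0 0] by simp
 have bn: "b (real n * t) = real n * b t" if "0 <= t" for n t
  by (induction n) (use that badd b0 in "auto simp: algebra_simps")
 have b1: "b 1 = 0" unfolding b_def by simp
 have br: "b (real j * (1 / real (Suc k))) = 0" for j k
  using bn[of "1 / real (Suc k)" "Suc k"] b1 bn[of "1 / real (Suc k)" j] by simp
 define C' where "C' = \<bar>C\<bar> + d * \<bar>a 1\<bar>"
 have low: "- C' <= b t" if t: "0 <= t" for t
 proof -
  obtain k where k: "1 / real (Suc k) < d" using nat_approx_posE[OF d] by auto
  define j where "j = nat \<lfloor>t * real (Suc k)\<rfloor>"
  have "real j = of_int \<lfloor>t * real (Suc k)\<rfloor>" unfolding j_def using t by simp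
  then have j: "real j <= t * real (Suc k)" "t * real (Suc k) < real j + 1" by linarith+
  define r where "r = t - real j * (1 / real (Suc k))"
  have r: "0 <= r" "r < 1 / real (Suc k)" 
  proof -
   have "t < (real j + 1) / real (Suc k)" using j(2) by (subst pos_less_divide_eq) auto
   moreover have "real j / real (Suc k) <= t" using j(1) by (subst pos_divide_le_eq) auto
   ultimately show "0 <= r" "r < 1 / real (Suc k)" unfolding r_def by (simp_all add: add_divide_distrib)
  qed
  have "b t = b (real j * (1 / real (Suc k)) + r)" unfolding r_def by simp
  also have "\<dots> = b r" by (subst badd) (use r br in auto)
  finally have "b t = a r - r * a 1" unfolding b_def .
  moreover have "- C <= a r" using bd r k by simp
  moreover have "\<bar>r * a 1\<bar> <= d * \<bar>a 1\<bar>" using r k by (simp add: abs_mult mult_right_mono)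
  ultimately show ?thesis unfolding C'_def by linarith
 qed
 have nonneg: "0 <= b t" if t: "0 <= t" for t
 proof (rule ccontr)
  assume "\<not> 0 <= b t"
  then obtain n where n: "C' < real n * (- b t)" using reals_Archimedean3[of "- b t"] by auto
  have "- C' <= b (real n * t)" using t by (intro low) simp
  then show False using n bn[OF t, of n] by simp
 qed
 \<comment> \<open>The values of \<open>b\<close> at \<open>t\<close> and at \<open>n - t\<close>
   are nonnegative and add up to \<open>b n = 0\<close>.\<close>
 obtain n where n: "t <= real n" using real_arch_simple by blast
 have "b (real n) = 0" using br[of n 0] by simp
 then have "b t + b (real n - t) = 0" using badd[of t "real n - t"] t n by simp
 then have "b t = 0" using nonneg[of t] nonneg[of "real n - t"] t n by linarith
 then show ?thesis unfolding b_def by simp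
qed

section \<open>Truncated walks and geometric tails of the increments\<close>

locale sn_levy = levy +
 assumes snl: "spectrally_negative_levy M x X"
begin

lemma AE_path: "AE om in M. cadlag (\<lambda>t. X t om) \<and> no_positive_jumps (\<lambda>t. X t om)"
 using snl unfolding spectrally_negative_levy_def levy_process_def by (auto intro: AE_conjI)

abbreviation walk :: "real => real => 'a => nat => real" where
 "walk y h om \<equiv> recur (\<lambda>t d. if y <= t then t else t + min d 1) 0 (\<lambda>i. inc h i om)"

lemma walk_step_meas: "case_prod (\<lambda>t d. if y <= t then t else t + min d (1::real)) \<in> borel_measurable (borel \<Otimes>\<^sub>M borel)"
 by measurable

text \<open>The mean of the probability still to reach \<open>y\<close> from the current position,
  in the remaining steps, is the same after every number of steps; the two sides are its values at 0
  and at \<open>n\<close>.\<close>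

lemma reach_walk:
 assumes h: "0 <= h"
 shows "reach (\<mu> h) n y = emeasure M {om \<in> space M. y <= walk y h om n}"
proof -
 note \<kappa> = prob_\<mu>[OF h] sets_\<mu>[of h]
 note [measurable] = reach_meas[OF \<kappa>] recur_meas[OF h walk_step_meas]
 have "(\<integral>\<^sup>+om. reach (\<mu> h) (n - k) (y - walk y h om k) \<partial>M) = reach (\<mu> h) n y" if "k <= n" for k
  using that
 proof (induction k)
  case 0 then show ?case by (simp add: emeasure_space_1)
 next
  case (Suc k)
  have eq: "n - k = Suc (n - Suc k)" using Suc.prems by simp
  interpret \<mu>: prob_space "\<mu> h" by fact
  define \<Phi> where "\<Phi> = (\<lambda>t d. reach (\<mu> h) (n - Suc k) (y - (if y <= t then t else t + min d 1)))"
  have m\<Phi>: "case_prod \<Phi> \<in> borel_measurable (borel \<Otimes>\<^sub>M borel)" 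
   unfolding \<Phi>_def case_prod_unfold
   by (rule measurable_compose[OF _ reach_meas[OF \<kappa>]])
    (use walk_step_meas[of y] in "auto intro!: borel_measurable_diff simp: case_prod_unfold")
  have "(\<integral>\<^sup>+om. reach (\<mu> h) (n - Suc k) (y - walk y h om (Suc k)) \<partial>M) = (\<integral>\<^sup>+om. \<Phi> (walk y h om k) (inc h k om) \<partial>M)"
   unfolding \<Phi>_def by simp
  also have "\<dots> = (\<integral>\<^sup>+om. (\<integral>\<^sup>+d. \<Phi> (walk y h om k) d \<partial>\<mu> h) \<partial>M)"
   by (rule recur_nn_integral[OF h walk_step_meas m\<Phi>])
  also have "\<dots> = (\<integral>\<^sup>+om. reach (\<mu> h) (n - k) (y - walk y h om k) \<partial>M)"
   by (rule nn_integral_cong) (simp add: eq \<Phi>_def reach_0 \<mu>.emeasure_space_1[simplified] diff_diff_eq)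
  finally show ?case using Suc by simp
 qed
 from this[of n] have "reach (\<mu> h) n y = (\<integral>\<^sup>+om. reach (\<mu> h) 0 (y - walk y h om n) \<partial>M)" by simp
 also have "\<dots> = (\<integral>\<^sup>+om. indicator {om \<in> space M. y <= walk y h om n} om \<partial>M)"
  by (rule nn_integral_cong) (auto simp: indicator_def)
 also have "\<dots> = emeasure M {om \<in> space M. y <= walk y h om n}" by (rule nn_integral_indicator) measurable
 finally show ?thesis .
qed

lemma sum_inc: "(\<Sum>i<k. inc h i om) = X (real k * h) om - X 0 om"
 unfolding inc_def increments_def
 using sum_lessThan_telescope[of "\<lambda>i. X (real i * h) om" k] by simp

text \<open>Truncation only lowers the walk. \<open>walk_ge\<close> is the converse when no
  increment exceeds 1.\<close>

lemma walk_le: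
 assumes "0 < y" "y <= walk y h om n"
 shows "\<exists>k\<le>n. y <= X (real k * h) om - X 0 om"
proof -
 define k where "k = (LEAST k. y <= walk y h om k)"
 have k: "y <= walk y h om k" "k <= n" unfolding k_def using assms(2) by (auto intro: LeastI Least_le)
 have "\<not> y <= walk y h om j" if "j < k" for j using that unfolding k_def by (rule not_less_Least)
 note nr = this
 have "j <= k ==> walk y h om j <= (\<Sum>i<j. inc h i om)" for j
 proof (induction j)
  case (Suc j)
  then have "walk y h om (Suc j) = walk y h om j + min (inc h j om) 1" using nr[of j] by simp
  then show ?case using Suc by simp
 qed simp
 from this[of k] have "walk y h om k <= X (real k * h) om - X 0 om" unfolding sum_inc by simp
 then show ?thesis using k by (intro exI[of _ k]) simp
qed

lemma walk_ge:
 assumes "\<And>k. k < n ==> inc h k om <= 1" "y <= X (real n * h) om - X 0 om"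
 shows "y <= walk y h om n"
proof (rule ccontr)
 assume n: "\<not> y <= walk y h om n"
 have "\<not> y <= walk y h om j" if "j <= n" for j
 proof
  assume j: "y <= walk y h om j"
  have "y <= walk y h om (j + i)" for i using j by (induction i) auto
  from this[of "n - j"] show False using n that by simp
 qed
 note nr = this
 have "j <= n ==> walk y h om j = (\<Sum>i<j. inc h i om)" for j
 proof (induction j)
  case (Suc j)
  then have "walk y h om (Suc j) = walk y h om j + min (inc h j om) 1" using nr[of j] by simp
  then show ?case using Suc assms(1)[of j] by simp
 qed simp
 from this[of n] show False using n assms(2) sum_inc[where h = h and k = n] by simp
qed

text \<open>Rational times make the event measurable and include every grid point that
  \<open>tail_bound\<close> uses.\<close>

definition early :: "nat => 'a set" where
 "early m = (\<Union>s\<in>\<rat> \<inter> {0..1 / real (Suc m)}. {om \<in> space M. 1 <= X s om - X 0 om})"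

lemma early_sets[measurable]: "early m \<in> sets M"
 unfolding early_def by (rule sets.countable_UN'') (auto intro: countable_subset[OF _ countable_rat])

lemma prob_early: "(\<lambda>m. prob (early m)) \<longlonglongrightarrow> 0"
proof -
 have "(\<lambda>m. \<integral>om. indicator (early m) om \<partial>M) \<longlonglongrightarrow> (\<integral>om. 0 \<partial>M :: real)"
 proof (rule integral_dominated_convergence[where w = "\<lambda>_. 1"])
  show "AE om in M. (\<lambda>m. indicator (early m) om :: real) \<longlonglongrightarrow> 0"
   using AE_path
  proof eventually_elim
   case (elim om)
   then have "((\<lambda>t. X t om) \<longlongrightarrow> X 0 om) (at_right 0)" unfolding cadlag_def by auto
   then have "eventually (\<lambda>t. X t om < X 0 om + 1) (at_right 0)" by (intro order_tendstoD) auto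
   then obtain r where r: "r > 0" "\<And>t. 0 < t ==> t < r ==> X t om < X 0 om + 1"
    unfolding eventually_at_right_field by blast
   have "(\<lambda>m. 1 / real (Suc m)) \<longlonglongrightarrow> 0" using LIMSEQ_inverse_real_of_nat by (simp add: inverse_eq_divide)
   then have "\<forall>\<^sub>F m in sequentially. 1 / real (Suc m) < r" using r by (intro order_tendstoD) auto
   then have "\<forall>\<^sub>F m in sequentially. indicator (early m) om = (0::real)"
   proof eventually_elim
    case (elim m)
    have "\<not> 1 <= X s om - X 0 om" if "0 <= s" "s <= 1 / real (Suc m)" for s
     using r(2)[of s] that elim by (cases "s = 0") auto
    then have "om \<notin> early m" unfolding early_def by auto
    then show ?case by simp
   qed
   then show ?case by (rule tendsto_eventually)
  qed
 qed auto
 then show ?thesis by simp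
qed

text \<open>A rise by \<open>2 k\<close> contains \<open>k\<close> successive rises by 1, each
  within the given time and so at the price of the probability of \<open>early m\<close>. This is
  proved for truncated walks on finer and finer grids.\<close>

lemma tail_bound:
 "emeasure M {om \<in> space M. 2 * real k <= X (1 / real (Suc m)) om - X 0 om} <= ennreal (prob (early m) ^ k)"
proof (cases "k = 0")
 case True then show ?thesis by (simp add: emeasure_space_1[symmetric] emeasure_mono)
next
 case False
 define t where "t = 1 / real (Suc m)"
 have t: "0 < t" unfolding t_def by simp
 \<comment> \<open>Increments above 1 are the only obstruction to replacing \<open>X\<close> by the
   truncated walk; without positive jumps their probability vanishes as the grid is refined.\<close>
 define A where "A n = {om \<in> space M. \<exists>i<Suc n. 1 < inc (t / real (Suc n)) i om}" for n
 have [measurable]: "inc (t / real (Suc n)) i \<in> borel_measurable M" for n i using t by (intro inc_meas) simp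
 have A[measurable]: "A n \<in> sets M" for n unfolding A_def by measurable
 have Xt[measurable]: "X t \<in> borel_measurable M" "X 0 \<in> borel_measurable M" using t by auto
 have lim: "(\<lambda>n. prob (A n)) \<longlonglongrightarrow> 0"
 proof -
  have "(\<lambda>n. \<integral>om. indicator (A n) om \<partial>M) \<longlonglongrightarrow> (\<integral>om. 0 \<partial>M :: real)"
  proof (rule integral_dominated_convergence[where w = "\<lambda>_. 1"])
   show "AE om in M. (\<lambda>n. indicator (A n) om :: real) \<longlonglongrightarrow> 0"
    using AE_path
   proof eventually_elim
    case (elim om)
    obtain d where d: "d > 0" "\<And>s u. 0 <= s ==> s <= u ==> u <= t ==> u < s + d ==> X u om - X s om < 1"
     using small_drawup[of "\<lambda>t. X t om" 1 t] elim t by auto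
    have "(\<lambda>n. t * (1 / real (Suc n))) \<longlonglongrightarrow> t * 0"
     by (intro tendsto_intros) (use LIMSEQ_inverse_real_of_nat in "simp add: inverse_eq_divide")
    then have "\<forall>\<^sub>F n in sequentially. t * (1 / real (Suc n)) < d" using d by (intro order_tendstoD(2)[of _ "t * 0"]) auto
    then have "\<forall>\<^sub>F n in sequentially. indicator (A n) om = (0::real)"
    proof eventually_elim
     case (elim n)
     have "inc (t / real (Suc n)) i om < 1" if "i < Suc n" for i
      unfolding inc_def increments_def
     proof (rule d(2))
      have "real (Suc i) * t <= real (Suc n) * t" using that t by (intro mult_right_mono) auto
      then show "real (Suc i) * (t / real (Suc n)) <= t" by (simp add: field_simps)
      show "real (Suc i) * (t / real (Suc n)) < real i * (t / real (Suc n)) + d"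
       using elim by (simp add: algebra_simps add_divide_distrib)
     qed (use t in "auto simp: divide_right_mono mult_right_mono")
     then have "om \<notin> A n" unfolding A_def by force
     then show ?case by simp
    qed
    then show ?case by (rule tendsto_eventually)
   qed
  qed auto
  then show ?thesis by simp
 qed
 have bound: "emeasure M {om \<in> space M. 2 * real k <= X t om - X 0 om} <= ennreal (prob (A n)) + ennreal (prob (early m) ^ k)" for n
 proof -
  define h where "h = t / real (Suc n)"
  have h: "0 <= h" "real (Suc n) * h = t" unfolding h_def using t by simp_all
  note [measurable] = recur_meas[OF h(1) walk_step_meas]
  have "reach (\<mu> h) (Suc n) 1 <= emeasure M (early m)"
   unfolding reach_walk[OF h(1)]
  proof (rule emeasure_mono)
   show "{om \<in> space M. 1 <= walk 1 h om (Suc n)} \<subseteq> early m"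
   proof
    fix om assume "om \<in> {om \<in> space M. 1 <= walk 1 h om (Suc n)}"
    then obtain j where j: "om \<in> space M" "j <= Suc n" "1 <= X (real j * h) om - X 0 om" using walk_le[of 1 h om "Suc n"] by auto
    have "real j * h <= real (Suc n) * h" using j h by (intro mult_right_mono) auto
    moreover have "real j * h \<in> \<rat>" unfolding h_def t_def by (intro Rats_mult Rats_divide) auto
    ultimately have "real j * h \<in> \<rat> \<inter> {0..1 / real (Suc m)}" using h by (simp add: t_def)
    then show "om \<in> early m" unfolding early_def using j by blast
   qed
  qed simp
  then have "reach (\<mu> h) (Suc n) 1 ^ k <= ennreal (prob (early m)) ^ k"
   by (intro power_mono) (simp_all add: emeasure_eq_measure)
  then have R: "reach (\<mu> h) (Suc n) (2 * real k) <= ennreal (prob (early m) ^ k)"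
   using reach_power[OF prob_\<mu>[OF h(1)] sets_\<mu>, of "Suc n" k] by (simp add: ennreal_power)
  define B where "B = {om \<in> space M. 2 * real k <= walk (2 * real k) h om (Suc n)}"
  have B: "B \<in> sets M" unfolding B_def by measurable
  have "emeasure M {om \<in> space M. 2 * real k <= X t om - X 0 om} <= emeasure M (A n \<union> B)"
  proof (rule emeasure_mono)
   show "{om \<in> space M. 2 * real k <= X t om - X 0 om} \<subseteq> A n \<union> B"
    using walk_ge[of "Suc n" h _ "2 * real k"] unfolding A_def B_def h(2) h_def[symmetric] by force
  qed (use A B in blast)
  also have "\<dots> <= emeasure M (A n) + emeasure M B" by (rule emeasure_subadditive[OF A B])
  also have "emeasure M B = reach (\<mu> h) (Suc n) (2 * real k)" unfolding reach_walk[OF h(1)] B_def ..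
  finally have "emeasure M {om \<in> space M. 2 * real k <= X t om - X 0 om} <= emeasure M (A n) + reach (\<mu> h) (Suc n) (2 * real k)" .
  from order_trans[OF this add_left_mono[OF R]] show ?thesis unfolding emeasure_eq_measure[of "A n"] .
 qed
 have "(\<lambda>n. ennreal (prob (A n)) + ennreal (prob (early m) ^ k)) \<longlonglongrightarrow> ennreal 0 + ennreal (prob (early m) ^ k)"
  by (intro tendsto_intros tendsto_ennrealI lim)
 then show ?thesis unfolding t_def[symmetric]
  by (intro LIMSEQ_le_const[of _ "ennreal (prob (early m) ^ k)"]) (use bound in auto)
qed

definition mgf :: "real => real => ennreal" where
 "mgf t th = (\<integral>\<^sup>+y. ennreal (exp (th * y)) \<partial>\<mu> t)"

lemma mgf_eq: "0 <= t ==> mgf t th = (\<integral>\<^sup>+om. ennreal (exp (th * (X t om - X 0 om))) \<partial>M)"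
 unfolding mgf_def \<mu>_def by (subst nn_integral_distr) (auto intro!: borel_measurable_diff X_meas)

lemma mgf_pos:
 assumes "0 <= t"
 shows "0 < mgf t th"
proof -
 interpret \<mu>: prob_space "\<mu> t" by (rule prob_\<mu>[OF assms])
 have "mgf t th \<noteq> 0"
 proof
  assume "mgf t th = 0"
  then have "AE y in \<mu> t. ennreal (exp (th * y)) = 0" unfolding mgf_def by (subst (asm) nn_integral_0_iff_AE) simp_all
  then have "AE y in \<mu> t. False" by simp
  then show False by simp
 qed
 then show ?thesis by (simp add: zero_less_iff_neq_zero)
qed

lemma mgf_add:
 assumes "0 <= s" "0 <= t"
 shows "mgf (s + t) th = mgf s th * mgf t th"
proof -
 define u where "u = (\<lambda>i::nat. if i = 0 then 0 else if i = 1 then s else s + t)"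
 have u: "mono u" "0 <= u 0" unfolding u_def using assms by (auto simp: mono_def)
 define D where "D = (\<lambda>i om. X (u (Suc i)) om - X (u i) om)"
 have "\<forall>(n::nat) u. 0 <= u 0 \<and> mono u -->
    indep_vars (\<lambda>_. borel) (\<lambda>i om. X (u (Suc i)) om - X (u i) om) {..<n}"
  using levy unfolding levy_process_def by blast
 then have "indep_vars (\<lambda>_. borel) D {..<2}" using u unfolding D_def by blast
 then have ind: "indep_vars (\<lambda>_. borel) (\<lambda>i. (\<lambda>y. ennreal (exp (th * y))) \<circ> D i) {..<2}"
  by (rule indep_vars_compose) auto
 have "(\<integral>\<^sup>+om. (\<Prod>i<2. ((\<lambda>y. ennreal (exp (th * y))) \<circ> D i) om) \<partial>M) = (\<Prod>i<2. \<integral>\<^sup>+om. ((\<lambda>y. ennreal (exp (th * y))) \<circ> D i) om \<partial>M)"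
  by (rule indep_vars_nn_integral[OF _ ind]) auto
 then have "(\<integral>\<^sup>+om. ennreal (exp (th * D 0 om)) * ennreal (exp (th * D 1 om)) \<partial>M) =
   (\<integral>\<^sup>+om. ennreal (exp (th * D 0 om)) \<partial>M) * (\<integral>\<^sup>+om. ennreal (exp (th * D 1 om)) \<partial>M)"
  by (simp add: numeral_2_eq_2)
 moreover have "ennreal (exp (th * D 0 om)) * ennreal (exp (th * D 1 om)) = ennreal (exp (th * (X (s + t) om - X 0 om)))" for om
  unfolding D_def u_def by (simp add: ennreal_mult[symmetric] exp_add[symmetric] algebra_simps)
 moreover have "(\<integral>\<^sup>+om. ennreal (exp (th * D 0 om)) \<partial>M) = mgf s th"
  unfolding mgf_eq[OF assms(1)] D_def u_def by simp
 moreover have "(\<integral>\<^sup>+om. ennreal (exp (th * D 1 om)) \<partial>M) = mgf t th"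
  unfolding mgf_def stationary[OF assms, symmetric] D_def u_def
  by (subst nn_integral_distr) (use assms in "auto intro!: borel_measurable_diff X_meas")
 ultimately show ?thesis using mgf_eq[of "s + t" th] assms by simp
qed

lemma mgf_0: "mgf 0 th = 1"
 by (simp add: mgf_eq emeasure_space_1)

lemma mgf_finite_small:
 assumes "0 <= th"
 shows "\<exists>m. mgf (1 / real (Suc m)) th < \<infinity>"
proof -
 have "\<forall>\<^sub>F m in sequentially. prob (early m) < exp (- (2 * th + 1))"
  using prob_early by (rule order_tendstoD) simp
 from eventually_happens'[OF sequentially_bot this] obtain m where m: "prob (early m) < exp (- (2 * th + 1))" by blast
 define t where "t = 1 / real (Suc m)"
 have t: "0 <= t" unfolding t_def by simp
 define A where "A k = {om \<in> space M. 2 * real k <= X t om - X 0 om}" for k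
 have [measurable]: "X t \<in> borel_measurable M" "X 0 \<in> borel_measurable M" using t by auto
 have A[measurable]: "A k \<in> sets M" for k unfolding A_def by measurable
 have pt: "ennreal (exp (th * (X t om - X 0 om))) <= 1 + (\<Sum>k. ennreal (exp (th * (2 * real k + 2))) * indicator (A k) om)" if "om \<in> space M" for om
 proof (cases "X t om - X 0 om < 0")
  case True
  then have "exp (th * (X t om - X 0 om)) <= 1" using assms by (simp add: mult_nonneg_nonpos)
  then have "ennreal (exp (th * (X t om - X 0 om))) <= 1" by simp
  then show ?thesis by (simp add: add_increasing2)
 next
  case False
  define y where "y = X t om - X 0 om"
  define k where "k = nat \<lfloor>y / 2\<rfloor>"
  have "real k = of_int \<lfloor>y / 2\<rfloor>" unfolding k_def using False y_def by simp
  then have k: "2 * real k <= y" "y < 2 * real k + 2" by linarith+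
  have "ennreal (exp (th * y)) <= ennreal (exp (th * (2 * real k + 2))) * indicator (A k) om"
   using k assms that unfolding A_def y_def by (auto intro!: mult_left_mono)
  also have "\<dots> <= (\<Sum>k. ennreal (exp (th * (2 * real k + 2))) * indicator (A k) om)"
   using sum_le_suminf[of "\<lambda>k. ennreal (exp (th * (2 * real k + 2))) * indicator (A k) om" "{k}"] by (simp only: sum.insert sum.empty finite.intros empty_iff not_False_eq_True add_0_right) simp
  finally show ?thesis unfolding y_def by (simp add: add_increasing)
 qed
 have "mgf t th <= (\<integral>\<^sup>+om. 1 + (\<Sum>k. ennreal (exp (th * (2 * real k + 2))) * indicator (A k) om) \<partial>M)"
  unfolding mgf_eq[OF t] by (rule nn_integral_mono) (rule pt)
 also have "\<dots> = 1 + (\<Sum>k. ennreal (exp (th * (2 * real k + 2))) * emeasure M (A k))"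
  by (subst nn_integral_add) (simp_all add: emeasure_space_1 nn_integral_suminf nn_integral_cmult)
 \<comment> \<open>The choice of \<open>m\<close> beats the growth \<open>exp (2 * th * k)\<close>
   of the weights with a factor \<open>exp (- k)\<close> to spare.\<close>
 also have "\<dots> <= 1 + (\<Sum>k. ennreal (exp (2 * th) * exp (-1) ^ k))"
 proof (intro add_left_mono suminf_le)
  fix k
  have "emeasure M (A k) <= ennreal (prob (early m) ^ k)"
   using tail_bound[of k m] unfolding A_def t_def .
  also have "\<dots> <= ennreal (exp (- (2 * th + 1)) ^ k)" using m by (intro ennreal_leI power_mono) auto
  finally have "ennreal (exp (th * (2 * real k + 2))) * emeasure M (A k) <= ennreal (exp (th * (2 * real k + 2))) * ennreal (exp (- (2 * th + 1)) ^ k)"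
   by (intro mult_left_mono) auto
  also have "\<dots> = ennreal (exp (2 * th) * exp (-1) ^ k)"
   by (simp add: ennreal_mult[symmetric] exp_of_nat_mult[symmetric] exp_add[symmetric] algebra_simps)
  finally show "ennreal (exp (th * (2 * real k + 2))) * emeasure M (A k) <= ennreal (exp (2 * th) * exp (-1) ^ k)" .
 qed auto
 also have "\<dots> < \<infinity>"
 proof -
  have "summable (\<lambda>k. exp (2 * th) * exp (-1) ^ k :: real)" by (intro summable_mult summable_geometric) simp
  then show ?thesis by (subst suminf_ennreal_eq[OF _ summable_sums]) (auto simp: less_top[symmetric])
 qed
 finally show ?thesis unfolding t_def by blast
qed

text \<open>The moment at a multiple of the short time factors into those at \<open>t\<close> and at
  the remaining time; the latter is positive, so the former is finite.\<close>

lemma mgf_finite: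
 assumes "0 <= th" "0 <= t"
 shows "mgf t th < \<infinity>"
proof -
 obtain m where m: "mgf (1 / real (Suc m)) th < \<infinity>" using mgf_finite_small[OF assms(1)] by blast
 have n: "mgf (real n * (1 / real (Suc m))) th < \<infinity>" for n
 proof (induction n)
  case (Suc n)
  have "real (Suc n) * (1 / real (Suc m)) = real n * (1 / real (Suc m)) + 1 / real (Suc m)" by (simp add: algebra_simps add_divide_distrib)
  then show ?case using Suc m mgf_add[of "real n * (1 / real (Suc m))" "1 / real (Suc m)" th]
   by (simp add: ennreal_mult_less_top)
 qed (simp add: mgf_0)
 obtain n where "t * real (Suc m) <= real n" using real_arch_simple by blast
 then have tn: "t <= real n * (1 / real (Suc m))" by (simp add: field_simps)
 define r where "r = real n * (1 / real (Suc m)) - t"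
 have r: "0 <= r" unfolding r_def using tn by simp
 have "mgf t th * mgf r th < \<infinity>" using n[of n] mgf_add[OF assms(2) r, of th] unfolding r_def by simp
 then show ?thesis using mgf_pos[OF r, of th] by (auto simp: ennreal_mult_less_top)
qed

section \<open>The exponential formula for all times\<close>

abbreviation "\<psi> \<equiv> laplace_exponent M X"

lemma integrable_exp: "0 <= th ==> 0 <= t ==> integrable (\<mu> t) (\<lambda>y. exp (th * y))"
 using mgf_finite[of th t] unfolding mgf_def by (intro integrableI_nonneg) auto

lemma mgf_integral: "0 <= th ==> 0 <= t ==> mgf t th = ennreal (\<integral>y. exp (th * y) \<partial>\<mu> t)"
 unfolding mgf_def by (intro nn_integral_eq_integral integrable_exp) auto

lemma integral_exp_pos: "0 <= th ==> 0 <= t ==> 0 < (\<integral>y. exp (th * y) \<partial>\<mu> t)"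
 using mgf_pos[of t th] mgf_integral[of th t] by (simp add: ennreal_less_zero_iff)

text \<open>The logarithm of the moment is additive in \<open>t\<close>; right continuity of the
  paths at 0 bounds it from below near 0, which makes it linear.\<close>

lemma integral_exp:
 assumes th: "0 <= th" and t: "0 <= t"
 shows "(\<integral>y. exp (th * y) \<partial>\<mu> t) = exp (t * \<psi> th)"
proof -
 define a where "a t = ln (\<integral>y. exp (th * y) \<partial>\<mu> t)" for t
 have add: "a (s + t) = a s + a t" if "0 <= s" "0 <= t" for s t
 proof -
  have "ennreal (\<integral>y. exp (th * y) \<partial>\<mu> (s + t)) = ennreal ((\<integral>y. exp (th * y) \<partial>\<mu> s) * (\<integral>y. exp (th * y) \<partial>\<mu> t))"
   using mgf_add[OF that, of th] mgf_integral[OF th] that integral_exp_pos[OF th] by (simp add: ennreal_mult less_imp_le)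
  then have "(\<integral>y. exp (th * y) \<partial>\<mu> (s + t)) = (\<integral>y. exp (th * y) \<partial>\<mu> s) * (\<integral>y. exp (th * y) \<partial>\<mu> t)"
   using integral_exp_pos[OF th] that by (subst (asm) ennreal_inj) (auto simp: less_imp_le)
  then show ?thesis unfolding a_def using integral_exp_pos[OF th] that by (simp only: ln_mult_pos)
 qed
 \<comment> \<open>For small times the increment is at least -1 with probability above 1/2, so the
   moment is at least \<open>exp (- th) / 2\<close>; this is where the constant comes from.\<close>
 have "\<exists>d>0. \<forall>t. 0 <= t --> t <= d --> - (th + ln 2) <= a t"
 proof (rule ccontr)
  assume "\<not> ?thesis"
  then have "\<forall>n::nat. \<exists>t. 0 <= t \<and> t <= 1 / real (Suc n) \<and> a t < - (th + ln 2)" by (force simp: not_le)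
  then obtain \<tau> where \<tau>: "\<And>n::nat. 0 <= \<tau> n" "\<And>n. \<tau> n <= 1 / real (Suc n)" "\<And>n. a (\<tau> n) < - (th + ln 2)" by metis
  have \<tau>0: "\<tau> \<longlonglongrightarrow> 0"
  proof (rule tendsto_sandwich[OF _ _ tendsto_const])
   show "(\<lambda>n. 1 / real (Suc n)) \<longlonglongrightarrow> 0" using LIMSEQ_inverse_real_of_nat by (simp add: inverse_eq_divide)
  qed (use \<tau> in auto)
  define B where "B n = {om \<in> space M. -1 <= X (\<tau> n) om - X 0 om}" for n
  have [measurable]: "X (\<tau> n) \<in> borel_measurable M" "X 0 \<in> borel_measurable M" for n using \<tau> by auto
  have [measurable]: "B n \<in> sets M" for n unfolding B_def by measurable
  have "(\<lambda>n. \<integral>om. indicator (B n) om \<partial>M) \<longlonglongrightarrow> (\<integral>om. 1 \<partial>M :: real)"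
  proof (rule integral_dominated_convergence[where w = "\<lambda>_. 1"])
   show "AE om in M. (\<lambda>n. indicator (B n) om :: real) \<longlonglongrightarrow> 1"
    using AE_path AE_space
   proof eventually_elim
    case (elim om)
    then have "((\<lambda>t. X t om) \<longlongrightarrow> X 0 om) (at_right 0)" unfolding cadlag_def by auto
    then have "eventually (\<lambda>t. X 0 om - 1 < X t om) (at_right 0)" by (intro order_tendstoD) auto
    then obtain r where r: "r > 0" "\<And>t. 0 < t ==> t < r ==> X 0 om - 1 < X t om"
     unfolding eventually_at_right_field by blast
    have "\<forall>\<^sub>F n in sequentially. \<tau> n < r" using \<tau>0 r by (intro order_tendstoD) auto
    then have "\<forall>\<^sub>F n in sequentially. indicator (B n) om = (1::real)"
    proof eventually_elim
     case (elim n)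
     then have "-1 <= X (\<tau> n) om - X 0 om" using r(2)[of "\<tau> n"] \<tau>(1)[of n] by (cases "\<tau> n = 0") auto
     then show ?case unfolding B_def using \<open>om \<in> space M\<close> by simp
    qed
    then show ?case by (rule tendsto_eventually)
   qed
  qed auto
  then have "(\<lambda>n. prob (B n)) \<longlonglongrightarrow> 1" by (simp add: prob_space)
  then have "\<forall>\<^sub>F n in sequentially. 1 / 2 < prob (B n)" by (rule order_tendstoD) simp
  from eventually_happens'[OF sequentially_bot this] obtain n where n: "1 / 2 < prob (B n)" by blast
  have "ennreal (exp (- th) * prob (B n)) = (\<integral>\<^sup>+om. ennreal (exp (- th)) * indicator (B n) om \<partial>M)"
   by (subst nn_integral_cmult_indicator) (simp_all add: emeasure_eq_measure ennreal_mult)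
  also have "\<dots> <= mgf (\<tau> n) th"
   unfolding mgf_eq[OF \<tau>(1)]
  proof (rule nn_integral_mono)
   fix om
   have "- th <= th * (X (\<tau> n) om - X 0 om)" if "om \<in> B n"
    using that mult_left_mono[OF _ th, of "-1" "X (\<tau> n) om - X 0 om"] unfolding B_def by simp
   then show "ennreal (exp (- th)) * indicator (B n) om <= ennreal (exp (th * (X (\<tau> n) om - X 0 om)))"
    by (auto simp: indicator_def)
  qed
  finally have "exp (- th) * prob (B n) <= (\<integral>y. exp (th * y) \<partial>\<mu> (\<tau> n))"
   unfolding mgf_integral[OF th \<tau>(1)] using integral_exp_pos[OF th \<tau>(1)[of n]] by (simp add: ennreal_le_iff)
  moreover have "exp (- th) * (1 / 2) <= exp (- th) * prob (B n)" using n by (intro mult_left_mono) auto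
  ultimately have "exp (- th) * (1 / 2) <= (\<integral>y. exp (th * y) \<partial>\<mu> (\<tau> n))" by linarith
  then have "ln (exp (- th) * (1 / 2)) <= a (\<tau> n)" unfolding a_def by (subst ln_le_cancel_iff) (use integral_exp_pos[OF th \<tau>(1)] in auto)
  then have "- th - ln 2 <= a (\<tau> n)" by (simp add: ln_mult ln_div)
  then show False using \<tau>(3)[of n] by simp
 qed
 then obtain d where d: "d > 0" "\<And>t. 0 <= t ==> t <= d ==> - (th + ln 2) <= a t" by blast
 have "a t = t * a 1" by (rule additive_bounded_below_linear[OF add d t])
 moreover have "a 1 = \<psi> th"
  unfolding a_def laplace_exponent_def \<mu>_def by (subst integral_distr) (auto intro!: borel_measurable_diff X_meas)
 ultimately have "ln (\<integral>y. exp (th * y) \<partial>\<mu> t) = t * \<psi> th" unfolding a_def by simp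
 then show ?thesis using integral_exp_pos[OF th t] by (metis exp_ln)
qed

end

section \<open>Growth of the Laplace exponent\<close>

definition lk_kernel :: "real => real => real" where
 "lk_kernel th y = exp (th * y) - 1 - th * y * indicator {-1<..} y"

lemma exp_second_order:
 fixes z :: real
 assumes "z <= 0"
 shows "0 <= exp z - 1 - z" "exp z - 1 - z <= z\<^sup>2"
proof -
 show "0 <= exp z - 1 - z" using exp_ge_add_one_self[of z] by linarith
 have "exp z <= 1 / (1 - z)"
 proof -
  have "1 - z <= exp (- z)" using exp_ge_add_one_self[of "- z"] by simp
  then show ?thesis using assms by (simp add: exp_minus field_simps)
 qed
 also have "1 / (1 - z) <= 1 + z + z\<^sup>2"
 proof -
  have "(1 + z + z\<^sup>2) * (1 - z) = 1 - z * (z * z)" by (simp add: algebra_simps power2_eq_square)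
  then have "1 <= (1 + z + z\<^sup>2) * (1 - z)" using mult_nonpos_nonneg[OF assms zero_le_square[of z]] by simp
  then show ?thesis using assms by (simp add: pos_divide_le_eq)
 qed
 finally show "exp z - 1 - z <= z\<^sup>2" by simp
qed

lemma lk_kernel_bound:
 assumes "0 <= th" "y < 0"
 shows "\<bar>lk_kernel th y\<bar> <= (1 + th\<^sup>2) * min 1 (y\<^sup>2)" "- 1 < y ==> 0 <= lk_kernel th y" "-1 <= lk_kernel th y"
proof -
 have neg: "th * y <= 0" using assms by (simp add: mult_nonneg_nonpos)
 note so = exp_second_order[OF neg]
 show pos: "0 <= lk_kernel th y" if "- 1 < y" using so that unfolding lk_kernel_def by simp
 have far: "-1 <= lk_kernel th y" "lk_kernel th y <= 0" if "\<not> - 1 < y" using that neg unfolding lk_kernel_def by simp_all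
 show "-1 <= lk_kernel th y" using pos far by fastforce
 show "\<bar>lk_kernel th y\<bar> <= (1 + th\<^sup>2) * min 1 (y\<^sup>2)"
 proof (cases "-1 < y")
  case True
  then have "\<bar>y\<bar> <= 1" using assms by simp
  then have "y\<^sup>2 <= 1" by (simp add: abs_square_le_1)
  have "\<bar>lk_kernel th y\<bar> = exp (th * y) - 1 - th * y" using so True unfolding lk_kernel_def by simp
  also have "\<dots> <= th\<^sup>2 * y\<^sup>2" using so(2) by (simp add: power_mult_distrib)
  also have "\<dots> <= (1 + th\<^sup>2) * y\<^sup>2" by (intro mult_right_mono) auto
  finally show ?thesis using \<open>y\<^sup>2 <= 1\<close> by simp
 next
  case False
  then have "1 <= \<bar>y\<bar>" by simp
  then have "1 <= y\<^sup>2" using power_mono[of 1 "\<bar>y\<bar>" 2] by simp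
  moreover have "\<bar>lk_kernel th y\<bar> <= 1" using far[OF False] by simp
  ultimately show ?thesis by (simp add: add_increasing2)
 qed
qed

lemma lk_ratio_mono:
 fixes t th y :: real
 assumes "0 < t" "t <= th" "y <= 0"
 shows "(exp (t * y) - 1) / t <= (exp (th * y) - 1) / th"
proof -
 have "convex_on UNIV (exp :: real => real)" by (rule exp_convex)
 then have "exp ((1 - t / th) *\<^sub>R 0 + (t / th) *\<^sub>R (th * y)) <= (1 - t / th) * exp 0 + (t / th) * exp (th * y)"
  by (rule convex_onD) (use assms in auto)
 then have "exp (t * y) - 1 <= (t / th) * (exp (th * y) - 1)" using assms by (simp add: algebra_simps)
 then show ?thesis using assms by (simp add: field_simps)
qed

locale levy_kh =
 fixes \<nu> :: "real measure" and \<gamma> \<sigma> :: real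
 assumes lm: "levy_measure_neg \<nu>"
begin

lemma sets_\<nu>[measurable_cong, simp]: "sets \<nu> = sets borel"
 using lm unfolding levy_measure_neg_def by blast

lemma int_min: "integrable \<nu> (\<lambda>y. min 1 (y\<^sup>2))"
 using lm unfolding levy_measure_neg_def by (intro integrableI_nonneg) auto

lemma lk_int: "0 <= th ==> integrable \<nu> (\<lambda>y. indicator {..<0} y * lk_kernel th y)"
proof (rule Bochner_Integration.integrable_bound)
 show "integrable \<nu> (\<lambda>y. (1 + th\<^sup>2) * min 1 (y\<^sup>2))" using int_min by simp
 show "(\<lambda>y. indicator {..<0} y * lk_kernel th y) \<in> borel_measurable \<nu>" unfolding lk_kernel_def by measurable
 assume "0 <= th"
 then show "AE y in \<nu>. norm (indicator {..<0} y * lk_kernel th y) <= norm ((1 + th\<^sup>2) * min 1 (y\<^sup>2))"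
  using lk_kernel_bound(1) by (intro AE_I2) (auto simp: indicator_def)
qed

lemma lk_eq: "levy_khintchine \<gamma> \<sigma> \<nu> th = \<gamma> * th + \<sigma>\<^sup>2 / 2 * th\<^sup>2 + (\<integral>y. indicator {..<0} y * lk_kernel th y \<partial>\<nu>)"
 unfolding levy_khintchine_def set_lebesgue_integral_def lk_kernel_def by simp

text \<open>Quadratic growth is what the exponentials in \<open>overshoot_small\<close> have to
  outrun.\<close>

lemma lk_quadratic: "\<exists>C\<ge>0. \<forall>th\<ge>0. levy_khintchine \<gamma> \<sigma> \<nu> th <= C * (1 + th\<^sup>2)"
proof (intro exI conjI allI impI)
 let ?m = "\<integral>y. min 1 (y\<^sup>2) \<partial>\<nu>"
 have m: "0 <= ?m" by (intro integral_nonneg_AE) auto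
 then show "0 <= \<bar>\<gamma>\<bar> + \<sigma>\<^sup>2 / 2 + ?m" by simp
 fix th :: real assume th: "0 <= th"
 have "(\<integral>y. indicator {..<0} y * lk_kernel th y \<partial>\<nu>) <= (\<integral>y. (1 + th\<^sup>2) * min 1 (y\<^sup>2) \<partial>\<nu>)"
 proof (rule integral_mono)
  show "integrable \<nu> (\<lambda>y. (1 + th\<^sup>2) * min 1 (y\<^sup>2))" using int_min by simp
  fix y show "indicator {..<0} y * lk_kernel th y <= (1 + th\<^sup>2) * min 1 (y\<^sup>2)"
   using lk_kernel_bound(1)[OF th, of y] by (cases "y < 0") auto
 qed (rule lk_int[OF th])
 also have "\<dots> = (1 + th\<^sup>2) * ?m" by simp
 finally have i: "(\<integral>y. indicator {..<0} y * lk_kernel th y \<partial>\<nu>) <= (1 + th\<^sup>2) * ?m" .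
 have "th <= 1 + th\<^sup>2" using zero_le_power2[of "th - 1/2"] by (simp add: power2_eq_square algebra_simps)
 then have "\<gamma> * th <= \<bar>\<gamma>\<bar> * (1 + th\<^sup>2)" using th by (intro mult_mono) auto
 moreover have "\<sigma>\<^sup>2 / 2 * th\<^sup>2 <= \<sigma>\<^sup>2 / 2 * (1 + th\<^sup>2)" by (intro mult_left_mono) auto
 ultimately show "levy_khintchine \<gamma> \<sigma> \<nu> th <= (\<bar>\<gamma>\<bar> + \<sigma>\<^sup>2 / 2 + ?m) * (1 + th\<^sup>2)"
  unfolding lk_eq using i unfolding distrib_right[of _ _ "1 + th\<^sup>2"] by (simp add: mult.commute)
qed

text \<open>Jumps of size at least 1 have kernel at least -1, and their mass is at most the integral
  of \<open>min 1 (y^2)\<close>.\<close>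

lemma lk_small_jump_part:
 assumes "0 < th"
 shows "(\<integral>y. indicator {-1<..<0} y * lk_kernel th y \<partial>\<nu>) - (\<integral>y. min 1 (y\<^sup>2) \<partial>\<nu>) <= (\<integral>y. indicator {..<0} y * lk_kernel th y \<partial>\<nu>)"
  "integrable \<nu> (\<lambda>y. indicator {-1<..<0} y * lk_kernel th y)"
proof -
 have th: "0 <= th" using assms by simp
 have pt: "indicator {-1<..<0} y * lk_kernel th y - min 1 (y\<^sup>2) <= indicator {..<0} y * lk_kernel th y" for y
 proof (cases "y < 0 \<and> \<not> -1 < y")
  case True
  then have "1 <= y\<^sup>2" using power_mono[of 1 "\<bar>y\<bar>" 2] by simp
  then show ?thesis using True lk_kernel_bound(3)[OF th, of y] by auto
 qed (auto simp: indicator_def)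
 show i: "integrable \<nu> (\<lambda>y. indicator {-1<..<0} y * lk_kernel th y)"
 proof (rule Bochner_Integration.integrable_bound[OF lk_int[OF th]])
  show "(\<lambda>y. indicator {-1<..<0} y * lk_kernel th y) \<in> borel_measurable \<nu>" unfolding lk_kernel_def by measurable
  show "AE y in \<nu>. norm (indicator {-1<..<0} y * lk_kernel th y) <= norm (indicator {..<0} y * lk_kernel th y)"
   by (intro AE_I2) (auto simp: indicator_def)
 qed
 have "(\<integral>y. indicator {-1<..<0} y * lk_kernel th y \<partial>\<nu>) - (\<integral>y. min 1 (y\<^sup>2) \<partial>\<nu>) =
   (\<integral>y. indicator {-1<..<0} y * lk_kernel th y - min 1 (y\<^sup>2) \<partial>\<nu>)"
  by (rule Bochner_Integration.integral_diff[symmetric, OF i int_min])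
 also have "\<dots> <= (\<integral>y. indicator {..<0} y * lk_kernel th y \<partial>\<nu>)"
  by (rule integral_mono) (use i int_min lk_int[OF th] pt in auto)
 finally show "(\<integral>y. indicator {-1<..<0} y * lk_kernel th y \<partial>\<nu>) - (\<integral>y. min 1 (y\<^sup>2) \<partial>\<nu>) <= (\<integral>y. indicator {..<0} y * lk_kernel th y \<partial>\<nu>)" .
qed

text \<open>For integrable small jumps, the ratio of their part to \<open>th\<close> is
  nondecreasing by convexity of \<open>exp\<close> and tends to the difference of drift and
  \<open>\<gamma>\<close>; so one large argument \<open>t\<close> already fixes a positive
  slope.\<close>

lemma lk_linear_lower:
 assumes "\<delta> < bv_drift \<gamma> \<nu>"
 shows "\<exists>k>0. \<exists>m th0. 0 < th0 \<and> (\<forall>th\<ge>th0. k * th - m <= levy_khintchine \<gamma> \<sigma> \<nu> th - \<delta> * th)"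
proof -
 let ?m = "\<integral>y. min 1 (y\<^sup>2) \<partial>\<nu>"
 define g where "g th = (\<integral>y. indicator {-1<..<0} y * lk_kernel th y \<partial>\<nu>)" for th
 have g0: "0 <= g th" if "0 < th" for th
  unfolding g_def
  by (intro integral_nonneg_AE AE_I2) (use lk_kernel_bound(2)[of th] that in "auto simp: indicator_def")
 have lower: "\<gamma> * th + g th - ?m <= levy_khintchine \<gamma> \<sigma> \<nu> th" if "0 < th" for th
 proof -
  have "0 <= \<sigma>\<^sup>2 / 2 * th\<^sup>2" by simp
  then show ?thesis using lk_small_jump_part(1)[OF that] unfolding lk_eq g_def by linarith
 qed
 show ?thesis
 proof (cases "set_integrable \<nu> {-1<..<0} (\<lambda>y. y)")
  \<comment> \<open>Here the Bochner integral in \<open>bv_drift\<close> takes its default value 0,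
    so the assumption reads \<open>\<delta> < \<gamma>\<close>; that is enough, because the kernel
    of the small jumps is nonnegative.\<close>
  case False
  then have "(LINT y:{-1<..<0}|\<nu>. y) = 0"
   unfolding set_lebesgue_integral_def set_integrable_def by (rule not_integrable_integral_eq)
  then have \<gamma>: "\<delta> < \<gamma>" using assms unfolding bv_drift_def by simp
  have "(\<gamma> - \<delta>) * th - ?m <= levy_khintchine \<gamma> \<sigma> \<nu> th - \<delta> * th" if "1 <= th" for th
   using lower[of th] g0[of th] that by (simp add: algebra_simps)
  moreover have "0 < \<gamma> - \<delta>" "0 < (1::real)" using \<gamma> by simp_all
  ultimately show ?thesis by blast
 next
  case True
  then have iy: "integrable \<nu> (\<lambda>y. indicator {-1<..<0} y * y)" unfolding set_integrable_def by simp
  have D: "bv_drift \<gamma> \<nu> = \<gamma> + (\<integral>y. - (indicator {-1<..<0} y * y) \<partial>\<nu>)"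
   unfolding bv_drift_def set_lebesgue_integral_def by simp
  have "(\<lambda>n. \<integral>y. indicator {-1<..<0} y * lk_kernel (real (Suc n)) y / real (Suc n) \<partial>\<nu>) \<longlonglongrightarrow> (\<integral>y. - (indicator {-1<..<0} y * y) \<partial>\<nu>)"
  proof (rule integral_dominated_convergence[where w = "\<lambda>y. norm (indicator {-1<..<0} y * y)"])
   show "integrable \<nu> (\<lambda>y. norm (indicator {-1<..<0} y * y))" using iy by (rule integrable_norm)
   have lim: "(\<lambda>n. (exp (real (Suc n) * y) - 1) * (1 / real (Suc n)) - y) \<longlonglongrightarrow> 0 - y" if "y < 0" for y :: real
   proof (rule tendsto_diff[OF _ tendsto_const], rule tendsto_sandwich)
    show "(\<lambda>n. - (1 / real (Suc n))) \<longlonglongrightarrow> 0" "(\<lambda>_. 0) \<longlonglongrightarrow> (0::real)"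
     using tendsto_minus[OF LIMSEQ_inverse_real_of_nat] by (simp_all add: inverse_eq_divide)
    have "exp (real (Suc n) * y) <= 1" for n using that by (simp add: mult_nonneg_nonpos)
    then show "\<forall>\<^sub>F n in sequentially. (exp (real (Suc n) * y) - 1) * (1 / real (Suc n)) <= 0"
     by (intro always_eventually allI mult_nonpos_nonneg) auto
    show "\<forall>\<^sub>F n in sequentially. - (1 / real (Suc n)) <= (exp (real (Suc n) * y) - 1) * (1 / real (Suc n))"
    proof (intro always_eventually allI)
     fix n
     have "(-1) * (1 / real (Suc n)) <= (exp (real (Suc n) * y) - 1) * (1 / real (Suc n))"
      by (intro mult_right_mono) auto
     then show "- (1 / real (Suc n)) <= (exp (real (Suc n) * y) - 1) * (1 / real (Suc n))" by simp
    qed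
   qed
   have form: "lk_kernel (real (Suc n)) y / real (Suc n) = (exp (real (Suc n) * y) - 1) * (1 / real (Suc n)) - y" if "-1 < y" for n y
    using that unfolding lk_kernel_def by (simp add: diff_divide_distrib del: of_nat_Suc)
   show "AE y in \<nu>. (\<lambda>n. indicator {-1<..<0} y * lk_kernel (real (Suc n)) y / real (Suc n)) \<longlonglongrightarrow> - (indicator {-1<..<0} y * y)"
   proof (intro AE_I2)
    fix y
    show "(\<lambda>n. indicator {-1<..<0} y * lk_kernel (real (Suc n)) y / real (Suc n)) \<longlonglongrightarrow> - (indicator {-1<..<0} y * y)"
    proof (cases "-1 < y \<and> y < 0")
     case True
     then show ?thesis using lim[of y] form[of y] by (simp del: of_nat_Suc)
    qed (auto simp: indicator_def)
   qed
   show "AE y in \<nu>. norm (indicator {-1<..<0} y * lk_kernel (real (Suc n)) y / real (Suc n)) <= norm (indicator {-1<..<0} y * y)" for n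
   proof (intro AE_I2)
    fix y :: real
    show "norm (indicator {-1<..<0} y * lk_kernel (real (Suc n)) y / real (Suc n)) <= norm (indicator {-1<..<0} y * y)"
    proof (cases "-1 < y \<and> y < 0")
     case True
     then have "0 <= lk_kernel (real (Suc n)) y / real (Suc n)" using lk_kernel_bound(2)[of "real (Suc n)" y] by simp
     moreover have "(exp (real (Suc n) * y) - 1) * (1 / real (Suc n)) <= 0"
      using True by (intro mult_nonpos_nonneg) (auto simp: mult_nonneg_nonpos)
     ultimately show ?thesis using True form[of y n] by (simp del: of_nat_Suc)
    qed (auto simp: indicator_def)
   qed
  qed (auto simp: lk_kernel_def)
  then have "(\<lambda>n. g (real (Suc n)) / real (Suc n)) \<longlonglongrightarrow> bv_drift \<gamma> \<nu> - \<gamma>" unfolding D g_def by simp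
  then have "\<forall>\<^sub>F n in sequentially. \<delta> - \<gamma> < g (real (Suc n)) / real (Suc n)" by (rule order_tendstoD) (use assms in simp)
  from eventually_happens'[OF sequentially_bot this] obtain n where n: "\<delta> - \<gamma> < g (real (Suc n)) / real (Suc n)" by blast
  define k t where "k = \<gamma> - \<delta> + g (real (Suc n)) / real (Suc n)" and "t = real (Suc n)"
  have t: "0 < t" unfolding t_def by simp
  have "0 < k" using n unfolding k_def by simp
  moreover have "k * th - ?m <= levy_khintchine \<gamma> \<sigma> \<nu> th - \<delta> * th" if th: "t <= th" for th
  proof -
   have "g t / t = (\<integral>y. indicator {-1<..<0} y * lk_kernel t y / t \<partial>\<nu>)" unfolding g_def by simp
   also have "\<dots> <= (\<integral>y. indicator {-1<..<0} y * lk_kernel th y / th \<partial>\<nu>)"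
   proof (rule integral_mono)
    show "integrable \<nu> (\<lambda>y. indicator {-1<..<0} y * lk_kernel t y / t)" "integrable \<nu> (\<lambda>y. indicator {-1<..<0} y * lk_kernel th y / th)"
     using lk_small_jump_part(2)[of t] lk_small_jump_part(2)[of th] t th by simp_all
    fix y :: real
    show "indicator {-1<..<0} y * lk_kernel t y / t <= indicator {-1<..<0} y * lk_kernel th y / th"
    proof (cases "-1 < y \<and> y < 0")
     case True
     have *: "lk_kernel s y / s = (exp (s * y) - 1) / s - y" if "0 < s" for s
      using True that unfolding lk_kernel_def by (simp add: diff_divide_distrib)
     show ?thesis using True lk_ratio_mono[OF t th, of y] *[of t] *[of th] t th by simp
    qed (auto simp: indicator_def)
   qed
   also have "\<dots> = g th / th" unfolding g_def by simp
   finally have "g t / t * th <= g th" using t th by (simp add: pos_le_divide_eq)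
   moreover have "k * th = \<gamma> * th - \<delta> * th + g t / t * th" unfolding k_def t_def by (simp only: distrib_right left_diff_distrib)
   ultimately show ?thesis using lower[of th] t th by linarith
  qed
  ultimately show ?thesis using t by blast
 qed
qed

end

text \<open>A Chernoff bound with \<open>th\<close> to infinity gives
  \<open>X (s + t) - X s <= \<delta> * t\<close> almost surely. Then \<open>X\<close> is a linear
  function minus a nondecreasing one.\<close>

lemma (in sn_levy) bounded_variation_if_decreasing:
 assumes \<delta>: "0 <= \<delta>" and c: "0 <= c" and small: "\<And>th0. \<exists>th\<ge>th0. \<psi> th - \<delta> * th <= c"
 shows "bounded_variation_paths M X"
proof -
 have null: "AE y in \<mu> t. y <= \<delta> * t" if t: "0 <= t" for t
 proof -
  interpret \<mu>: prob_space "\<mu> t" by (rule prob_\<mu>[OF t])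
  have "emeasure (\<mu> t) {y. \<delta> * t + 1 / real (Suc n) <= y} = 0" for n
  proof -
   define e where "e = 1 / real (Suc n)"
   have e: "0 < e" unfolding e_def by simp
   have bd: "\<mu>.prob {y. \<delta> * t + e <= y} <= exp (t * c - th * e)" if th: "0 <= th" "\<psi> th - \<delta> * th <= c" for th
   proof -
    have "\<mu>.prob {y. \<delta> * t + e <= y} * exp (th * (\<delta> * t + e)) = (\<integral>y. indicator {y. \<delta> * t + e <= y} y * exp (th * (\<delta> * t + e)) \<partial>\<mu> t)" by simp
    also have "\<dots> <= (\<integral>y. exp (th * y) \<partial>\<mu> t)"
    proof (rule integral_mono)
     show "integrable (\<mu> t) (\<lambda>y. indicator {y. \<delta> * t + e <= y} y * exp (th * (\<delta> * t + e)))"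
      by (intro integrable_mult_left integrable_real_indicator) (auto simp: \<mu>.emeasure_eq_measure)
     fix y show "indicator {y. \<delta> * t + e <= y} y * exp (th * (\<delta> * t + e)) <= exp (th * y)"
      using th by (auto simp: indicator_def intro: mult_left_mono)
    qed (rule integrable_exp[OF th(1) t])
    also have "\<dots> = exp (t * \<psi> th)" by (rule integral_exp[OF th(1) t])
    finally have "\<mu>.prob {y. \<delta> * t + e <= y} <= exp (t * \<psi> th) / exp (th * (\<delta> * t + e))" by (simp add: pos_le_divide_eq)
    also have "\<dots> = exp (t * (\<psi> th - \<delta> * th) - th * e)" by (simp add: exp_diff[symmetric] algebra_simps)
    also have "\<dots> <= exp (t * c - th * e)" using th(2) t by (simp add: mult_left_mono)
    finally show ?thesis .
   qed
   have "\<mu>.prob {y. \<delta> * t + e <= y} <= 0"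
   proof (rule field_le_epsilon)
    fix r :: real assume r: "0 < r"
    obtain th where th: "th \<ge> max 0 ((t * c - ln r) / e)" "\<psi> th - \<delta> * th <= c" using small by blast
    then have "t * c - ln r <= th * e" using e by (simp add: pos_divide_le_eq)
    then have "exp (t * c - th * e) <= exp (ln r)" by simp
    then show "\<mu>.prob {y. \<delta> * t + e <= y} <= 0 + r" using bd[of th] th r by simp
   qed
   then have "\<mu>.prob {y. \<delta> * t + e <= y} = 0" by (simp add: measure_le_0_iff)
   then show ?thesis unfolding e_def by (simp add: \<mu>.emeasure_eq_measure)
  qed
  then have "AE y in \<mu> t. \<forall>n. \<not> \<delta> * t + 1 / real (Suc n) <= y"
   unfolding AE_all_countable by (intro allI AE_I[where N = "{y. \<delta> * t + 1 / real (Suc _) <= y}"]) auto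
  then show ?thesis
  proof eventually_elim
   case (elim y)
   show ?case
   proof (rule field_le_epsilon)
    fix r :: real assume "0 < r"
    then obtain n where "1 / real (Suc n) < r" using nat_approx_posE by auto
    then show "y <= \<delta> * t + r" using elim[rule_format, of n] by linarith
   qed
  qed
 qed
 have inc: "AE om in M. X (s + t) om - X s om <= \<delta> * t" if "0 <= s" "0 <= t" for s t
 proof -
  have "AE y in distr M borel (\<lambda>om. X (s + t) om - X s om). y <= \<delta> * t" unfolding stationary[OF that] by (rule null[OF that(2)])
  then show ?thesis by (subst (asm) AE_distr_iff) (use that in "auto intro!: borel_measurable_diff X_meas")
 qed
 \<comment> \<open>Countably many rational times first; right continuity extends the inequality to
   all times in \<open>anti\<close>.\<close>
 have "AE om in M. \<forall>s\<in>\<rat> \<inter> {0..}. \<forall>t\<in>\<rat> \<inter> {0..}. X (s + t) om - X s om <= \<delta> * t"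
  by (intro AE_ball_countable[THEN iffD2] ballI inc) (auto intro: countable_subset[OF _ countable_rat])
 then show ?thesis unfolding bounded_variation_paths_def
  using AE_path
 proof eventually_elim
  case (elim om)
  define f where "f t = X t om" for t
  have f: "cadlag f" using elim unfolding f_def by simp
  have anti: "f t - f s <= \<delta> * (t - s)" if st: "0 <= s" "s <= t" for s t
  proof (rule field_le_epsilon)
   fix e :: real assume e: "0 < e"
   have right: "\<exists>r>u. \<forall>w. u < w --> w < r --> \<bar>f w - f u\<bar> < e / 4" if "0 <= u" for u
   proof -
    have "(f \<longlongrightarrow> f u) (at_right u)" using f that unfolding cadlag_def by auto
    then have "eventually (\<lambda>w. dist (f w) (f u) < e / 4) (at_right u)" using e by (intro tendstoD) auto
    then show ?thesis unfolding eventually_at_right_field dist_real_def by blast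
   qed
   obtain r1 where r1: "r1 > s" "\<And>w. s < w ==> w < r1 ==> \<bar>f w - f s\<bar> < e / 4" using right[of s] st by blast
   obtain r2 where r2: "r2 > t" "\<And>w. t < w ==> w < r2 ==> \<bar>f w - f t\<bar> < e / 4" using right[of t] st by auto
   obtain p where p: "p \<in> \<rat>" "t < p" "p < min r2 (t + e / (4 * (\<delta> + 1)))"
    using Rats_dense_in_real[of t "min r2 (t + e / (4 * (\<delta> + 1)))"] r2 e \<delta> by auto
   show "f t - f s <= \<delta> * (t - s) + e"
   proof (cases "s = t")
    case True then show ?thesis using e by simp
   next
    case False
    obtain p0 where p0: "p0 \<in> \<rat>" "s < p0" "p0 < min r1 t" using Rats_dense_in_real[of s "min r1 t"] r1 st False by auto
    have "X (p0 + (p - p0)) om - X p0 om <= \<delta> * (p - p0)"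
     using p0 p st Rats_diff[OF p(1) p0(1)] by (intro bspec[OF bspec[OF elim(1), of p0], of "p - p0"]) auto
    then have "f p - f p0 <= \<delta> * (p - p0)" unfolding f_def by simp
    also have "\<dots> <= \<delta> * (t + e / (4 * (\<delta> + 1)) - s)" using p0 p \<delta> by (intro mult_left_mono) auto
    also have "\<dots> = \<delta> * (t - s) + \<delta> * (e / (4 * (\<delta> + 1)))" by (simp add: algebra_simps)
    also have "\<delta> * (e / (4 * (\<delta> + 1))) <= (\<delta> + 1) * (e / (4 * (\<delta> + 1)))" using \<delta> e by (intro mult_right_mono) auto
    also have "(\<delta> + 1) * (e / (4 * (\<delta> + 1))) = e / 4" using \<delta> by (simp add: divide_simps)
    finally show ?thesis using r1(2)[of p0] r2(2)[of p] p0 p e by linarith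
   qed
  qed
  show ?case unfolding f_def[symmetric] locally_bounded_variation_def
  proof (intro allI impI)
   fix t :: real assume t: "0 <= t"
   define Y where "Y s = \<delta> * s - f s" for s
   have Y: "Y s <= Y u" if "0 <= s" "s <= u" for s u using anti[OF that] unfolding Y_def by (simp add: algebra_simps)
   show "\<exists>B. \<forall>n u. 0 <= u 0 \<and> mono u \<and> u n <= t --> (\<Sum>i<n. \<bar>f (u (Suc i)) - f (u i)\<bar>) <= B"
   proof (intro exI[of _ "\<delta> * t + (Y t - Y 0)"] allI impI)
    fix n and u :: "nat => real" assume u: "0 <= u 0 \<and> mono u \<and> u n <= t"
    have up: "0 <= u i" "u i <= u (Suc i)" for i using u monoD[of u 0 i] monoD[of u i "Suc i"] by auto
    have "(\<Sum>i<n. \<bar>f (u (Suc i)) - f (u i)\<bar>) <= (\<Sum>i<n. (\<delta> * u (Suc i) + Y (u (Suc i))) - (\<delta> * u i + Y (u i)))"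
    proof (rule sum_mono)
     fix i
     have "f (u (Suc i)) - f (u i) = \<delta> * u (Suc i) - \<delta> * u i - (Y (u (Suc i)) - Y (u i))" unfolding Y_def by simp
     moreover have "\<delta> * u i <= \<delta> * u (Suc i)" using up \<delta> by (intro mult_left_mono) auto
     ultimately show "\<bar>f (u (Suc i)) - f (u i)\<bar> <= (\<delta> * u (Suc i) + Y (u (Suc i))) - (\<delta> * u i + Y (u i))"
      using Y[OF up[of i]] by linarith
    qed
    also have "\<dots> = (\<delta> * u n + Y (u n)) - (\<delta> * u 0 + Y (u 0))"
     by (rule sum_lessThan_telescope)
    also have "\<dots> <= \<delta> * t + (Y t - Y 0)"
    proof -
     have "\<delta> * u n <= \<delta> * t" using u \<delta> by (intro mult_left_mono) auto
     moreover have "0 <= \<delta> * u 0" using up(1)[of 0] \<delta> by simp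
     ultimately show ?thesis using Y[of "u n" t] Y[of 0 "u 0"] up(1) u by (smt (verit))
    qed
    finally show "(\<Sum>i<n. \<bar>f (u (Suc i)) - f (u i)\<bar>) <= \<delta> * t + (Y t - Y 0)" .
   qed
  qed
 qed
qed

text \<open>If divergence failed, the paths would have bounded variation; then the drift condition
  applies and gives linear growth, a contradiction. Paths of unbounded variation are thus covered
  without a separate analysis of the exponent.\<close>

lemma (in sn_levy) exponent_diverges:
 assumes tr: "levy_triplet M X \<gamma> \<sigma> \<nu>" and \<delta>: "0 <= \<delta>"
  and bv: "bounded_variation_paths M X --> \<delta> < bv_drift \<gamma> \<nu>"
 shows "\<exists>th0. \<forall>th\<ge>th0. c < \<psi> th - \<delta> * th"
proof (rule ccontr)
 assume neg: "\<not> ?thesis"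
 then have "\<exists>th\<ge>th0. \<psi> th - \<delta> * th <= \<bar>c\<bar>" for th0 by (smt (verit))
 then have "bounded_variation_paths M X" by (intro bounded_variation_if_decreasing[OF \<delta>, of "\<bar>c\<bar>"]) auto
 then have d: "\<delta> < bv_drift \<gamma> \<nu>" using bv by blast
 have lm: "levy_measure_neg \<nu>" and eq: "\<And>th. 0 <= th ==> \<psi> th = levy_khintchine \<gamma> \<sigma> \<nu> th"
  using tr unfolding levy_triplet_def by blast+
 obtain k m th0 where k: "0 < k" "0 < th0" "\<And>th. th0 <= th ==> k * th - m <= levy_khintchine \<gamma> \<sigma> \<nu> th - \<delta> * th"
  using levy_kh.lk_linear_lower[OF levy_kh.intro[OF lm] d] by blast
 have "c < \<psi> th - \<delta> * th" if "max th0 ((c + m + 1) / k) <= th" for th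
 proof -
  have "c + m + 1 <= k * th" using that k(1) by (simp add: pos_divide_le_eq mult.commute)
  then show ?thesis using k(3)[of th] eq[of th] that k(2) by simp
 qed
 then show False using neg by blast
qed

lemma (in sn_levy) exponent_quadratic:
 assumes tr: "levy_triplet M X \<gamma> \<sigma> \<nu>"
 shows "\<exists>C\<ge>0. \<forall>th\<ge>0. \<psi> th <= C * (1 + th\<^sup>2)"
proof -
 have lm: "levy_measure_neg \<nu>" and eq: "\<And>th. 0 <= th ==> \<psi> th = levy_khintchine \<gamma> \<sigma> \<nu> th"
  using tr unfolding levy_triplet_def by blast+
 show ?thesis using levy_kh.lk_quadratic[OF levy_kh.intro[OF lm]] eq by auto
qed

section \<open>Uniqueness of two-sided Laplace transforms\<close>

lemma norm_exp_diff_quotient: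
 fixes w :: complex
 assumes "w \<noteq> 0"
 shows "norm ((exp (w * of_real x) - 1) / w) <= \<bar>x\<bar> * exp (norm w * \<bar>x\<bar>)"
proof -
 have *: "norm (exp z - 1) <= norm z * exp (norm z)" for z :: complex
 proof -
  have "norm (exp z - exp 0) <= exp (norm z) * norm (z - 0)"
  proof (rule field_differentiable_bound[where S = "cball 0 (norm z)" and f' = exp])
   show "(exp has_field_derivative exp y) (at y within cball 0 (norm z))" for y :: complex
    by (auto intro!: derivative_eq_intros)
   show "norm (exp y) <= exp (norm z)" if "y \<in> cball 0 (norm z)" for y :: complex
    by (rule order_trans[OF norm_exp]) (use that in simp)
  qed auto
  then show ?thesis by (simp add: mult.commute)
 qed
 have "norm ((exp (w * of_real x) - 1) / w) <= (norm (w * of_real x) * exp (norm (w * of_real x))) / norm w"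
  unfolding norm_divide by (intro divide_right_mono *) simp
 also have "\<dots> = \<bar>x\<bar> * exp (norm w * \<bar>x\<bar>)" using assms by (simp add: norm_mult)
 finally show ?thesis .
qed

lemma abs_exp_bound:
 fixes e x :: real
 assumes "0 < e"
 shows "\<bar>x\<bar> * exp (e * \<bar>x\<bar>) <= (exp (2 * e * x) + exp (- (2 * e * x))) / e"
proof -
 have "e * \<bar>x\<bar> <= exp (e * \<bar>x\<bar>)" using exp_ge_add_one_self[of "e * \<bar>x\<bar>"] by linarith
 then have "e * \<bar>x\<bar> * exp (e * \<bar>x\<bar>) <= exp (e * \<bar>x\<bar>) * exp (e * \<bar>x\<bar>)" by (intro mult_right_mono) auto
 also have "\<dots> = exp (2 * e * \<bar>x\<bar>)" by (simp add: exp_add[symmetric])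
 also have "\<dots> <= exp (2 * e * x) + exp (- (2 * e * x))" by (cases "0 <= x") auto
 finally show ?thesis using assms by (simp add: pos_le_divide_eq mult.assoc mult.commute mult.left_commute)
qed

text \<open>Differentiation under the integral. The difference quotient of the exponential is
  dominated by exponentials with abscissas \<open>Re z - 2 * e\<close> and
  \<open>Re z + 2 * e\<close>; taking \<open>e\<close> as a third of the distance to the boundary
  keeps both in the strip.\<close>

lemma laplace_holomorphic:
 fixes H :: "real => real"
 assumes H[measurable]: "H \<in> borel_measurable borel"
  and int: "\<And>t. t1 < t ==> t < t2 ==> integrable lborel (\<lambda>x. exp (- t * x) * H x)"
 shows "(\<lambda>z. \<integral>x. exp (- z * of_real x) * complex_of_real (H x) \<partial>lborel) holomorphic_on {z. t1 < Re z \<and> Re z < t2}"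
  (is "?f holomorphic_on ?S")
 unfolding holomorphic_on_def
proof
 fix z assume z: "z \<in> ?S"
 have intc: "integrable lborel (\<lambda>x. exp (- w * of_real x) * complex_of_real (H x))" if "t1 < Re w" "Re w < t2" for w
  by (rule Bochner_Integration.integrable_bound[OF int[OF that]]) (auto simp: norm_mult)
 define e where "e = min (Re z - t1) (t2 - Re z) / 3"
 have e: "0 < e" "t1 < Re z - 2 * e" "Re z + 2 * e < t2" using z unfolding e_def by (auto simp: min_def field_simps)
 define D where "D = (\<integral>x. - of_real x * exp (- z * of_real x) * complex_of_real (H x) \<partial>lborel)"
 have "((\<lambda>y. (?f y - ?f z) / (y - z)) \<longlongrightarrow> D) (at z)"
  unfolding tendsto_at_iff_sequentially comp_def
 proof (intro allI impI)
  fix Y :: "nat => complex" assume Y: "\<forall>i. Y i \<in> UNIV - {z}" "Y \<longlonglongrightarrow> z"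
  have "\<forall>\<^sub>F n in sequentially. dist (Y n) z < e" using Y(2) e(1) by (rule tendstoD)
  then obtain N where N: "\<And>n. n \<ge> N ==> dist (Y n) z < e" unfolding eventually_sequentially by blast
  have strip: "t1 < Re (Y n) \<and> Re (Y n) < t2" if "n \<ge> N" for n
   using N[OF that] abs_Re_le_cmod[of "Y n - z"] e unfolding dist_norm by auto
  have lim: "(\<lambda>n. \<integral>x. exp (- z * of_real x) * complex_of_real (H x) * ((exp (- (Y (n + N) - z) * of_real x) - 1) / (Y (n + N) - z)) \<partial>lborel) \<longlonglongrightarrow> D"
   unfolding D_def
  proof (rule integral_dominated_convergence[where
     w = "\<lambda>x. (exp (- (Re z - 2 * e) * x) * \<bar>H x\<bar> + exp (- (Re z + 2 * e) * x) * \<bar>H x\<bar>) / e"])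
   have "integrable lborel (\<lambda>x. norm (exp (- t * x) * H x))" if "t1 < t" "t < t2" for t
    by (rule integrable_norm[OF int[OF that]])
   then have I: "integrable lborel (\<lambda>x. exp (- t * x) * \<bar>H x\<bar>)" if "t1 < t" "t < t2" for t
    using that by (simp add: abs_mult)
   show "integrable lborel (\<lambda>x. (exp (- (Re z - 2 * e) * x) * \<bar>H x\<bar> + exp (- (Re z + 2 * e) * x) * \<bar>H x\<bar>) / e)"
    by (intro integrable_divide Bochner_Integration.integrable_add I) (use e in linarith)+
   show "AE x in lborel. norm (exp (- z * of_real x) * complex_of_real (H x) * ((exp (- (Y (n + N) - z) * of_real x) - 1) / (Y (n + N) - z)))
     <= (exp (- (Re z - 2 * e) * x) * \<bar>H x\<bar> + exp (- (Re z + 2 * e) * x) * \<bar>H x\<bar>) / e" for n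
   proof (rule AE_I2)
    fix x :: real
    define w where "w = - (Y (n + N) - z)"
    have w: "w \<noteq> 0" "norm w < e" using Y(1) N[of "n + N"] unfolding w_def by (auto simp: dist_norm norm_minus_commute)
    have "norm ((exp (w * of_real x) - 1) / (- w)) <= \<bar>x\<bar> * exp (norm w * \<bar>x\<bar>)"
     using norm_exp_diff_quotient[OF w(1), of x] by simp
    also have "\<dots> <= \<bar>x\<bar> * exp (e * \<bar>x\<bar>)" using w by (intro mult_left_mono) (auto intro: mult_right_mono)
    also have "\<dots> <= (exp (2 * e * x) + exp (- (2 * e * x))) / e" by (rule abs_exp_bound[OF e(1)])
    finally have "norm ((exp (w * of_real x) - 1) / (- w)) <= (exp (2 * e * x) + exp (- (2 * e * x))) / e" .
    then have "norm (exp (- z * of_real x) * complex_of_real (H x)) * norm ((exp (w * of_real x) - 1) / (- w)) <=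
      (exp (- Re z * x) * \<bar>H x\<bar>) * ((exp (2 * e * x) + exp (- (2 * e * x))) / e)"
     by (intro mult_mono) (auto simp: norm_mult)
    also have "\<dots> = (exp (- (Re z - 2 * e) * x) * \<bar>H x\<bar> + exp (- (Re z + 2 * e) * x) * \<bar>H x\<bar>) / e"
     by (simp add: algebra_simps exp_add[symmetric] exp_diff exp_minus add_divide_distrib) (simp add: field_simps exp_add exp_diff exp_minus)
    finally show "norm (exp (- z * of_real x) * complex_of_real (H x) * ((exp (- (Y (n + N) - z) * of_real x) - 1) / (Y (n + N) - z)))
     <= (exp (- (Re z - 2 * e) * x) * \<bar>H x\<bar> + exp (- (Re z + 2 * e) * x) * \<bar>H x\<bar>) / e"
     unfolding w_def norm_mult[symmetric] by simp
   qed
   show "AE x in lborel. (\<lambda>n. exp (- z * of_real x) * complex_of_real (H x) * ((exp (- (Y (n + N) - z) * of_real x) - 1) / (Y (n + N) - z)))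
     \<longlonglongrightarrow> - of_real x * exp (- z * of_real x) * complex_of_real (H x)"
   proof (rule AE_I2)
    fix x :: real
    have "((\<lambda>w. exp (- w * complex_of_real x)) has_field_derivative (- of_real x)) (at 0)"
     by (auto intro!: derivative_eq_intros)
    then have "(\<lambda>w. (exp (- w * complex_of_real x) - 1) / w) \<midarrow>0\<rightarrow> - of_real x"
     unfolding has_field_derivative_iff by simp
    moreover have "filterlim (\<lambda>n. Y (n + N) - z) (at 0) sequentially"
     unfolding filterlim_at
    proof
     show "(\<lambda>n. Y (n + N) - z) \<longlonglongrightarrow> 0" using LIMSEQ_ignore_initial_segment[OF Y(2), of N] by (simp add: LIM_zero)
     show "\<forall>\<^sub>F n in sequentially. Y (n + N) - z \<in> UNIV \<and> Y (n + N) - z \<noteq> 0" using Y(1) by (intro always_eventually) auto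
    qed
    ultimately have "(\<lambda>n. (exp (- (Y (n + N) - z) * complex_of_real x) - 1) / (Y (n + N) - z)) \<longlonglongrightarrow> - of_real x"
     by (rule filterlim_compose)
    then have "(\<lambda>n. (exp (- z * of_real x) * complex_of_real (H x)) * ((exp (- (Y (n + N) - z) * of_real x) - 1) / (Y (n + N) - z)))
     \<longlonglongrightarrow> (exp (- z * of_real x) * complex_of_real (H x)) * (- of_real x)" by (rule tendsto_mult_left)
    then show "(\<lambda>n. exp (- z * of_real x) * complex_of_real (H x) * ((exp (- (Y (n + N) - z) * of_real x) - 1) / (Y (n + N) - z)))
     \<longlonglongrightarrow> - of_real x * exp (- z * of_real x) * complex_of_real (H x)" by (simp add: mult_ac)
   qed
  qed measurable
  have eqn: "(\<integral>x. exp (- z * of_real x) * complex_of_real (H x) * ((exp (- (Y (n + N) - z) * of_real x) - 1) / (Y (n + N) - z)) \<partial>lborel)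
    = (?f (Y (n + N)) - ?f z) / (Y (n + N) - z)" for n
  proof -
   have "?f (Y (n + N)) - ?f z = (\<integral>x. exp (- Y (n + N) * of_real x) * complex_of_real (H x) - exp (- z * of_real x) * complex_of_real (H x) \<partial>lborel)"
    by (rule Bochner_Integration.integral_diff[symmetric]; rule intc) (use strip[of "n + N"] z in auto)
   also have "\<dots> / (Y (n + N) - z) = (\<integral>x. (exp (- Y (n + N) * of_real x) * complex_of_real (H x) - exp (- z * of_real x) * complex_of_real (H x)) / (Y (n + N) - z) \<partial>lborel)"
    by simp
   also have "\<dots> = (\<integral>x. exp (- z * of_real x) * complex_of_real (H x) * ((exp (- (Y (n + N) - z) * of_real x) - 1) / (Y (n + N) - z)) \<partial>lborel)"
   proof (rule Bochner_Integration.integral_cong[OF refl])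
    fix x
    have "exp (- z * of_real x) * exp (- (Y (n + N) - z) * of_real x) = exp (- Y (n + N) * complex_of_real x)"
     by (simp add: exp_add[symmetric] algebra_simps)
    then show "(exp (- Y (n + N) * of_real x) * complex_of_real (H x) - exp (- z * of_real x) * complex_of_real (H x)) / (Y (n + N) - z) =
      exp (- z * of_real x) * complex_of_real (H x) * ((exp (- (Y (n + N) - z) * of_real x) - 1) / (Y (n + N) - z))"
     by (simp add: algebra_simps diff_divide_distrib)
   qed
   finally show ?thesis ..
  qed
  from lim have "(\<lambda>n. (?f (Y (n + N)) - ?f z) / (Y (n + N) - z)) \<longlonglongrightarrow> D" unfolding eqn .
  then show "(\<lambda>n. (?f (Y n) - ?f z) / (Y n - z)) \<longlonglongrightarrow> D" by (rule LIMSEQ_offset)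
 qed
 then have "(?f has_field_derivative D) (at z)" unfolding has_field_derivative_iff .
 then show "?f field_differentiable at z within ?S"
  unfolding field_differentiable_def using has_field_derivative_at_within by blast
qed

text \<open>Equality on a real segment extends to the strip by analytic continuation. On a vertical
  line the transforms are, up to the factor \<open>m\<close>, characteristic functions of the tilted
  functions \<open>exp (- s * x) * F x / m\<close>, which nonnegativity makes probability densities
  and Levy's theorem separates.\<close>

lemma two_sided_laplace_unique:
 fixes F G :: "real => real"
 assumes F[measurable]: "F \<in> borel_measurable borel" and G[measurable]: "G \<in> borel_measurable borel"
  and nn: "\<And>x. 0 <= F x" "\<And>x. 0 <= G x" and t12: "t1 < t2"
  and intF: "\<And>t. t1 < t ==> t < t2 ==> integrable lborel (\<lambda>x. exp (- t * x) * F x)"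
  and intG: "\<And>t. t1 < t ==> t < t2 ==> integrable lborel (\<lambda>x. exp (- t * x) * G x)"
  and eq: "\<And>t. t1 < t ==> t < t2 ==> (\<integral>x. exp (- t * x) * F x \<partial>lborel) = (\<integral>x. exp (- t * x) * G x \<partial>lborel)"
 shows "AE x in lborel. F x = G x"
proof -
 define S where "S = {z. t1 < Re z \<and> Re z < t2}"
 define f where "f H z = (\<integral>x. exp (- z * of_real x) * complex_of_real (H x) \<partial>lborel)" for H :: "real => real" and z
 have S: "open S" "connected S"
 proof -
  have "S = {z. t1 < Re z} \<inter> {z. Re z < t2}" unfolding S_def by auto
  then show "open S" "connected S"
   using open_halfspace_Re_gt open_halfspace_Re_lt convex_halfspace_Re_gt convex_halfspace_Re_lt
   by (auto intro!: convex_connected convex_Int)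
 qed
 define s where "s = (t1 + t2) / 2"
 have s: "t1 < s" "s < t2" using t12 unfolding s_def by auto
 have fS: "f F z = f G z" if z: "z \<in> S" for z
 proof -
  have "(\<lambda>z. f F z - f G z) z = 0"
  proof (rule analytic_continuation[of "\<lambda>z. f F z - f G z" S "complex_of_real ` {t1<..<t2}" "of_real s"])
   show "(\<lambda>z. f F z - f G z) holomorphic_on S" unfolding f_def S_def
    by (intro holomorphic_on_diff laplace_holomorphic intF intG) simp_all
   show "complex_of_real ` {t1<..<t2} \<subseteq> S" "complex_of_real s \<in> S" using s unfolding S_def by auto
   show "complex_of_real s islimpt complex_of_real ` {t1<..<t2}"
    unfolding islimpt_sequential
   proof (intro exI conjI allI)
    define e where "e = t2 - s"
    have e: "0 < e" unfolding e_def using s by simp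
    show "complex_of_real (s + e / real (Suc (Suc n))) \<in> complex_of_real ` {t1<..<t2} - {complex_of_real s}" for n
    proof -
     define r where "r = e / real (Suc (Suc n))"
     have "0 < r" "r < e" unfolding r_def using e divide_strict_left_mono[of 1 "real (Suc (Suc n))" e] by auto
     then have "s + r \<in> {t1<..<t2}" "s + r \<noteq> s" using s unfolding e_def by auto
     then have "s + e / real (Suc (Suc n)) \<in> {t1<..<t2}" "s + e / real (Suc (Suc n)) \<noteq> s" unfolding r_def .
     then show ?thesis by (metis DiffI imageI of_real_eq_iff singletonD)
    qed
    have "(\<lambda>n. s + e * (1 / real (Suc (Suc n)))) \<longlonglongrightarrow> s + e * 0"
     by (intro tendsto_intros LIMSEQ_Suc[of "\<lambda>n. 1 / real (Suc n)"]) (use LIMSEQ_inverse_real_of_nat in "simp add: inverse_eq_divide")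
    then show "(\<lambda>n. complex_of_real (s + e / real (Suc (Suc n)))) \<longlonglongrightarrow> complex_of_real s"
     by (intro tendsto_of_real) simp
   qed
   show "f F w - f G w = 0" if w: "w \<in> complex_of_real ` {t1<..<t2}" for w
   proof -
    obtain t where t: "w = of_real t" "t1 < t" "t < t2" using w by auto
    have *: "f H w = of_real (\<integral>x. exp (- t * x) * H x \<partial>lborel)" for H
    proof -
     have "f H w = (\<integral>x. complex_of_real (exp (- t * x) * H x) \<partial>lborel)" unfolding f_def t(1)
      by (intro Bochner_Integration.integral_cong) (simp_all add: exp_of_real[symmetric])
     then show ?thesis by (simp only: integral_complex_of_real)
    qed
    show ?thesis unfolding * using eq[OF t(2,3)] by simp
   qed
  qed (use S z in auto)
  then show ?thesis by simp
 qed
 define m where "m = (\<integral>x. exp (- s * x) * F x \<partial>lborel)"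
 have mG: "m = (\<integral>x. exp (- s * x) * G x \<partial>lborel)" unfolding m_def by (rule eq[OF s])
 have m0: "0 <= m" unfolding m_def using nn by (intro integral_nonneg_AE) auto
 show ?thesis
 proof (cases "m = 0")
  case True
  have "AE x in lborel. exp (- s * x) * F x = 0" "AE x in lborel. exp (- s * x) * G x = 0"
   using integral_nonneg_eq_0_iff_AE[OF intF[OF s]] integral_nonneg_eq_0_iff_AE[OF intG[OF s]] True m_def mG nn by auto
  then show ?thesis by eventually_elim simp
 next
  case False
  then have mp: "0 < m" using m0 by simp
  define \<mu> where "\<mu> H = density lborel (\<lambda>x. ennreal (exp (- s * x) * H x / m))" for H
  have rd: "real_distribution (\<mu> H)" and ch: "char (\<mu> H) t = f H (of_real s - \<i> * of_real t) / of_real m"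
   if [measurable]: "H \<in> borel_measurable borel" and H: "\<And>x. 0 <= H x" "integrable lborel (\<lambda>x. exp (- s * x) * H x)"
    "m = (\<integral>x. exp (- s * x) * H x \<partial>lborel)" for H t
  proof -
   have "emeasure (\<mu> H) (space (\<mu> H)) = (\<integral>\<^sup>+x. ennreal (exp (- s * x) * H x / m) \<partial>lborel)"
    unfolding \<mu>_def by (simp add: emeasure_density)
   also have "\<dots> = ennreal (\<integral>x. exp (- s * x) * H x / m \<partial>lborel)"
    by (rule nn_integral_eq_integral) (use H m0 in "auto intro!: AE_I2")
   also have "\<dots> = 1" using H(3) mp by simp
   finally show "real_distribution (\<mu> H)" by (auto intro!: real_distribution.intro prob_spaceI real_distribution_axioms.intro simp: \<mu>_def)
   have "char (\<mu> H) t = (\<integral>x. (exp (- s * x) * H x / m) *\<^sub>R iexp (t * x) \<partial>lborel)"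
    unfolding char_def \<mu>_def by (rule integral_density) (use H m0 in auto)
   also have "\<dots> = (\<integral>x. (exp (- (of_real s - \<i> * of_real t) * of_real x) * complex_of_real (H x)) / of_real m \<partial>lborel)"
   proof (intro Bochner_Integration.integral_cong refl)
    fix x
    have "complex_of_real (exp (- s * x)) * iexp (t * x) = exp (- (of_real s - \<i> * of_real t) * of_real x)"
     by (simp add: exp_of_real[symmetric] exp_add[symmetric] algebra_simps)
    then show "(exp (- s * x) * H x / m) *\<^sub>R iexp (t * x) = (exp (- (of_real s - \<i> * of_real t) * of_real x) * complex_of_real (H x)) / of_real m"
     by (simp add: scaleR_conv_of_real)
   qed
   also have "\<dots> = f H (of_real s - \<i> * of_real t) / of_real m" unfolding f_def by simp
   finally show "char (\<mu> H) t = f H (of_real s - \<i> * of_real t) / of_real m" .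
  qed
  have "\<mu> F = \<mu> G"
  proof (rule Levy_uniqueness)
   show "real_distribution (\<mu> F)" by (rule rd) (use F nn intF[OF s] m_def in auto)
   show "real_distribution (\<mu> G)" by (rule rd) (use G nn intG[OF s] mG in auto)
   show "char (\<mu> F) = char (\<mu> G)"
   proof
    fix t
    have "of_real s - \<i> * of_real t \<in> S" unfolding S_def using s by simp
    then show "char (\<mu> F) t = char (\<mu> G) t"
     using ch[OF F nn(1) intF[OF s] m_def, of t] ch[OF G nn(2) intG[OF s] mG, of t] fS by simp
   qed
  qed
  then have "AE x in lborel. ennreal (exp (- s * x) * F x / m) = ennreal (exp (- s * x) * G x / m)"
   unfolding \<mu>_def by (subst (asm) sigma_finite_measure.density_unique_iff[OF lborel.sigma_finite_measure_axioms]) auto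
  then show ?thesis
  proof eventually_elim
   case (elim x)
   then have "exp (- s * x) * F x / m = exp (- s * x) * G x / m"
    by (subst (asm) ennreal_inj) (use nn mp in auto)
   then show ?case using mp by simp
  qed
 qed
qed

lemma continuous_AE_eq:
 fixes f g :: "real => real"
 assumes "continuous_on UNIV f" "continuous_on UNIV g" "AE x in lborel. f x = g x"
 shows "f x = g x"
proof (rule ccontr)
 assume "f x \<noteq> g x"
 then have ne: "{x. f x \<noteq> g x} \<noteq> {}" by blast
 have op: "open {x. f x \<noteq> g x}" by (rule open_Collect_neq[OF assms(1,2)])
 have "{x. f x \<noteq> g x} \<in> null_sets lborel"
  by (subst AE_iff_null_sets) (use assms(3) op in auto)
 then have "negligible {x. f x \<noteq> g x}" by (simp add: negligible_iff_null_sets null_sets_completionI)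
 then show False using open_not_negligible[OF op ne] by simp
qed

section \<open>Functions of exponential growth\<close>

definition exp_lip :: "real => real => (real => real) => bool" where
 "exp_lip be C u \<longleftrightarrow> 0 <= C \<and> (\<forall>x y. \<bar>u x - u y\<bar> <= C * \<bar>exp (be * x) - exp (be * y)\<bar>)"

lemma exp_shift_abs: "\<bar>exp (be * (x + y)) - exp (be * x)\<bar> = exp (be * x) * \<bar>exp (be * y) - 1\<bar>" for be x y :: real
proof -
 have "exp (be * (x + y)) - exp (be * x) = exp (be * x) * (exp (be * y) - 1)"
  by (simp add: distrib_left exp_add right_diff_distrib)
 then show ?thesis by (simp add: abs_mult)
qed

lemma exp_translate_abs: "\<bar>exp (be * (x + a)) - exp (be * (y + a))\<bar> = exp (be * a) * \<bar>exp (be * x) - exp (be * y)\<bar>"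
 for be x y a :: real
proof -
 have "exp (be * (x + a)) - exp (be * (y + a)) = exp (be * a) * (exp (be * x) - exp (be * y))"
  by (simp add: distrib_left exp_add right_diff_distrib)
 then show ?thesis by (simp add: abs_mult)
qed

lemma exp_lipD: "exp_lip be C u ==> \<bar>u x - u y\<bar> <= C * \<bar>exp (be * x) - exp (be * y)\<bar>"
 unfolding exp_lip_def by blast

lemma exp_lip_nonneg: "exp_lip be C u ==> 0 <= C"
 unfolding exp_lip_def by blast

lemma exp_lip_const: "exp_lip be 0 (\<lambda>_. c)"
 unfolding exp_lip_def by simp

lemma exp_lip_add: "exp_lip be C u ==> exp_lip be D v ==> exp_lip be (C + D) (\<lambda>x. u x + v x)"
 unfolding exp_lip_def distrib_right by (smt (verit))

lemma exp_lip_cmult: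
 assumes "exp_lip be C u"
 shows "exp_lip be (\<bar>c\<bar> * C) (\<lambda>x. c * u x)"
 unfolding exp_lip_def
proof (intro conjI allI)
 show "0 <= \<bar>c\<bar> * C" using exp_lip_nonneg[OF assms] by simp
 fix x y
 have "\<bar>c * u x - c * u y\<bar> = \<bar>c\<bar> * \<bar>u x - u y\<bar>" by (simp add: abs_mult[symmetric] right_diff_distrib)
 also have "\<dots> <= \<bar>c\<bar> * (C * \<bar>exp (be * x) - exp (be * y)\<bar>)" by (intro mult_left_mono exp_lipD[OF assms]) simp
 finally show "\<bar>c * u x - c * u y\<bar> <= \<bar>c\<bar> * C * \<bar>exp (be * x) - exp (be * y)\<bar>" by (simp add: mult.assoc)
qed

lemma exp_lip_shift:
 assumes "exp_lip be C u"
 shows "exp_lip be (C * exp (be * a)) (\<lambda>x. u (x + a))"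
 unfolding exp_lip_def
proof (intro conjI allI)
 show "0 <= C * exp (be * a)" using exp_lip_nonneg[OF assms] by simp
 fix x y
 show "\<bar>u (x + a) - u (y + a)\<bar> <= C * exp (be * a) * \<bar>exp (be * x) - exp (be * y)\<bar>"
  using exp_lipD[OF assms, of "x + a" "y + a"] by (simp add: mult.assoc exp_translate_abs)
qed

lemma exp_lip_continuous:
 assumes "exp_lip be C u"
 shows "continuous_on UNIV u"
 unfolding continuous_on_def
proof
 fix x
 have "((\<lambda>y. u y - u x) \<longlongrightarrow> 0) (at x within UNIV)"
 proof (rule Lim_null_comparison)
  show "\<forall>\<^sub>F y in at x within UNIV. norm (u y - u x) <= C * \<bar>exp (be * y) - exp (be * x)\<bar>"
   using exp_lipD[OF assms] by (intro always_eventually) simp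
  have "((\<lambda>y. C * \<bar>exp (be * y) - exp (be * x)\<bar>) \<longlongrightarrow> C * \<bar>exp (be * x) - exp (be * x)\<bar>) (at x within UNIV)"
   by (intro tendsto_intros)
  then show "((\<lambda>y. C * \<bar>exp (be * y) - exp (be * x)\<bar>) \<longlongrightarrow> 0) (at x within UNIV)" by simp
 qed
 then show "(u \<longlongrightarrow> u x) (at x within UNIV)" by (simp add: LIM_zero_iff)
qed

lemma exp_lip_meas: "exp_lip be C u ==> u \<in> borel_measurable borel"
 by (rule borel_measurable_continuous_onI[OF exp_lip_continuous])

section \<open>The semigroup of a spectrally negative Levy process\<close>

context sn_levy
begin

definition P :: "real => (real => real) => real => real" where
 "P t u v = (\<integral>y. u (v + y) \<partial>\<mu> t)"

lemma P_paths:
 assumes "0 <= t" "u \<in> borel_measurable borel"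
 shows "P t u v = (\<integral>om. u (v + (X t om - X 0 om)) \<partial>M)"
 unfolding P_def \<mu>_def by (subst integral_distr) (use assms in "auto intro!: borel_measurable_diff X_meas")

lemma two_increments:
 assumes st: "0 <= s" "0 <= t" and m: "f \<in> borel_measurable borel" "g \<in> borel_measurable borel"
 shows "(\<integral>\<^sup>+om. f (X s om - X 0 om) * g (X (s + t) om - X s om) \<partial>M) = (\<integral>\<^sup>+y. f y \<partial>\<mu> s) * (\<integral>\<^sup>+y. (g y :: ennreal) \<partial>\<mu> t)"
proof -
 define u where "u = (\<lambda>i::nat. if i = 0 then 0 else if i = 1 then s else s + t)"
 have u: "mono u" "0 <= u 0" unfolding u_def using st by (auto simp: mono_def)
 define D where "D = (\<lambda>i om. X (u (Suc i)) om - X (u i) om)"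
 define F where "F = (\<lambda>i::nat. if i = 0 then f else g)"
 have "\<forall>(n::nat) u. 0 <= u 0 \<and> mono u -->
    indep_vars (\<lambda>_. borel) (\<lambda>i om. X (u (Suc i)) om - X (u i) om) {..<n}"
  using levy unfolding levy_process_def by blast
 then have "indep_vars (\<lambda>_. borel) D {..<2}" using u unfolding D_def by blast
 then have ind: "indep_vars (\<lambda>_. borel) (\<lambda>i. F i \<circ> D i) {..<2}"
  by (rule indep_vars_compose) (use m in "auto simp: F_def")
 have "(\<integral>\<^sup>+om. (\<Prod>i<2. (F i \<circ> D i) om) \<partial>M) = (\<Prod>i<2. \<integral>\<^sup>+om. (F i \<circ> D i) om \<partial>M)"
  by (rule indep_vars_nn_integral[OF _ ind]) auto
 moreover have "(\<integral>\<^sup>+om. f (X s om - X 0 om) \<partial>M) = (\<integral>\<^sup>+y. f y \<partial>\<mu> s)"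
  unfolding \<mu>_def by (subst nn_integral_distr) (use st m in "auto intro!: borel_measurable_diff X_meas")
 moreover have "(\<integral>\<^sup>+om. g (X (s + t) om - X s om) \<partial>M) = (\<integral>\<^sup>+y. g y \<partial>\<mu> t)"
  unfolding stationary[OF st, symmetric] by (subst nn_integral_distr) (use st m in "auto intro!: borel_measurable_diff X_meas")
 ultimately show ?thesis by (simp add: numeral_2_eq_2 F_def D_def u_def)
qed

text \<open>The modulus of continuity in time of the semigroup on \<open>exp_lip\<close> functions,
  up to the weight \<open>exp (be * v)\<close>.\<close>

definition \<rho> :: "real => real => real" where
 "\<rho> be t = (\<integral>y. \<bar>exp (be * y) - 1\<bar> \<partial>\<mu> t)"

lemma int_exp_abs:
 assumes "0 <= be" "0 <= t"
 shows "integrable (\<mu> t) (\<lambda>y. \<bar>exp (be * y) - 1\<bar>)"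
proof -
 interpret \<mu>: prob_space "\<mu> t" by (rule prob_\<mu>[OF assms(2)])
 show ?thesis using integrable_exp[OF assms] by (intro integrable_abs Bochner_Integration.integrable_diff) simp_all
qed

lemma \<rho>_nonneg: "0 <= \<rho> be t"
 unfolding \<rho>_def by (intro integral_nonneg_AE) simp

lemma \<rho>_tendsto:
 assumes be: "0 <= be" and \<tau>: "\<And>n. 0 <= \<tau> n" "\<tau> \<longlonglongrightarrow> 0"
 shows "(\<lambda>n. \<rho> be (\<tau> n)) \<longlonglongrightarrow> 0"
proof -
 define vv where "vv t = exp (t * \<psi> (2 * be)) - 2 * exp (t * \<psi> be) + 1" for t
 \<comment> \<open>From \<open>z <= e + z^2 / (4 * e)\<close>: the mean of the square is the
   explicit \<open>vv t\<close>, which vanishes at \<open>t = 0\<close>.\<close>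
 have bd: "\<rho> be t <= e + vv t / (4 * e)" if "0 < e" "0 <= t" for e t
 proof -
  interpret \<mu>: prob_space "\<mu> t" by (rule prob_\<mu>[OF that(2)])
  have sq: "(exp (be * y) - 1)\<^sup>2 = exp (2 * be * y) - 2 * exp (be * y) + 1" for y
   by (simp add: power2_eq_square algebra_simps exp_add[symmetric])
  have i: "integrable (\<mu> t) (\<lambda>y. exp (2 * be * y) - 2 * exp (be * y) + 1)"
   using integrable_exp[of "2 * be" t] integrable_exp[of be t] be that by simp
  have vv: "(\<integral>y. exp (2 * be * y) - 2 * exp (be * y) + 1 \<partial>\<mu> t) = vv t"
   using integrable_exp[of "2 * be" t] integrable_exp[of be t] integral_exp[of "2 * be" t] integral_exp[of be t] be that
   unfolding vv_def by (simp add: \<mu>.prob_space[simplified])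
  have "\<rho> be t <= (\<integral>y. e + (exp (2 * be * y) - 2 * exp (be * y) + 1) / (4 * e) \<partial>\<mu> t)"
   unfolding \<rho>_def
  proof (rule integral_mono)
   show "integrable (\<mu> t) (\<lambda>y. e + (exp (2 * be * y) - 2 * exp (be * y) + 1) / (4 * e))" using i by simp
   fix y
   define z where "z = \<bar>exp (be * y) - 1\<bar>"
   have "0 <= (2 * e - z)\<^sup>2" by simp
   then have "4 * e * z <= 4 * e * e + z\<^sup>2" by (simp add: power2_eq_square algebra_simps)
   then have "z <= e + z\<^sup>2 / (4 * e)" using that(1) by (simp add: field_simps)
   then show "\<bar>exp (be * y) - 1\<bar> <= e + (exp (2 * be * y) - 2 * exp (be * y) + 1) / (4 * e)"
    unfolding z_def sq[symmetric] by simp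
  qed (rule int_exp_abs[OF be that(2)])
  also have "\<dots> = e + vv t / (4 * e)" using i vv by (simp add: \<mu>.prob_space[simplified])
  finally show ?thesis .
 qed
 show ?thesis
 proof (rule metric_LIMSEQ_I)
  fix r :: real assume r: "0 < r"
  have "(\<lambda>n. r / 2 + vv (\<tau> n) / (4 * (r / 2))) \<longlonglongrightarrow> r / 2 + (exp (0 * \<psi> (2 * be)) - 2 * exp (0 * \<psi> be) + 1) / (4 * (r / 2))"
   unfolding vv_def by (intro tendsto_intros \<tau>(2)) (use r in simp)
  then have "\<forall>\<^sub>F n in sequentially. r / 2 + vv (\<tau> n) / (4 * (r / 2)) < r" by (rule order_tendstoD) (use r in simp)
  then have "\<forall>\<^sub>F n in sequentially. dist (\<rho> be (\<tau> n)) 0 < r"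
  proof eventually_elim
   case (elim n)
   then have "\<rho> be (\<tau> n) < r" using bd[of "r/2" "\<tau> n"] r \<tau>(1)[of n] by linarith
   then show ?case using \<rho>_nonneg[of be "\<tau> n"] by (simp add: dist_real_def)
  qed
  then show "\<exists>no. \<forall>n\<ge>no. dist (\<rho> be (\<tau> n)) 0 < r" unfolding eventually_sequentially .
 qed
qed

lemma P_integrable:
 assumes u: "exp_lip be C u" and be: "0 <= be" and t: "0 <= t"
 shows "integrable (\<mu> t) (\<lambda>y. u (v + y))"
proof -
 interpret \<mu>: prob_space "\<mu> t" by (rule prob_\<mu>[OF t])
 note [measurable] = exp_lip_meas[OF u]
 show ?thesis
 proof (rule Bochner_Integration.integrable_bound[of _ "\<lambda>y. \<bar>u v\<bar> + C * exp (be * v) * \<bar>exp (be * y) - 1\<bar>"])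
  show "integrable (\<mu> t) (\<lambda>y. \<bar>u v\<bar> + C * exp (be * v) * \<bar>exp (be * y) - 1\<bar>)" using int_exp_abs[OF be t] by simp
  show "AE y in \<mu> t. norm (u (v + y)) <= norm (\<bar>u v\<bar> + C * exp (be * v) * \<bar>exp (be * y) - 1\<bar>)"
  proof (rule AE_I2)
   fix y
   have "\<bar>exp (be * (v + y)) - exp (be * v)\<bar> = exp (be * v) * \<bar>exp (be * y) - 1\<bar>"
    by (rule exp_shift_abs)
   then have "\<bar>u (v + y) - u v\<bar> <= C * exp (be * v) * \<bar>exp (be * y) - 1\<bar>"
    using exp_lipD[OF u, of "v + y" v] by (simp add: mult.assoc)
   then show "norm (u (v + y)) <= norm (\<bar>u v\<bar> + C * exp (be * v) * \<bar>exp (be * y) - 1\<bar>)" by simp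
  qed
 qed simp
qed

lemma P_near:
 assumes u: "exp_lip be C u" and be: "0 <= be" and t: "0 <= t"
 shows "\<bar>P t u v - u v\<bar> <= C * exp (be * v) * \<rho> be t"
proof -
 interpret \<mu>: prob_space "\<mu> t" by (rule prob_\<mu>[OF t])
 note I = P_integrable[OF u be t, of v]
 have "P t u v - u v = (\<integral>y. u (v + y) - u v \<partial>\<mu> t)" unfolding P_def using I by (simp add: \<mu>.prob_space[simplified])
 also have "\<bar>\<dots>\<bar> <= (\<integral>y. \<bar>u (v + y) - u v\<bar> \<partial>\<mu> t)" by (rule integral_abs_bound)
 also have "\<dots> <= (\<integral>y. C * exp (be * v) * \<bar>exp (be * y) - 1\<bar> \<partial>\<mu> t)"
 proof (rule integral_mono)
  show "integrable (\<mu> t) (\<lambda>y. \<bar>u (v + y) - u v\<bar>)" using I by simp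
  show "integrable (\<mu> t) (\<lambda>y. C * exp (be * v) * \<bar>exp (be * y) - 1\<bar>)" using int_exp_abs[OF be t] by simp
  fix y
  have "\<bar>exp (be * (v + y)) - exp (be * v)\<bar> = exp (be * v) * \<bar>exp (be * y) - 1\<bar>"
   by (rule exp_shift_abs)
  then show "\<bar>u (v + y) - u v\<bar> <= C * exp (be * v) * \<bar>exp (be * y) - 1\<bar>"
   using exp_lipD[OF u, of "v + y" v] by (simp add: mult.assoc)
 qed
 also have "\<dots> = C * exp (be * v) * \<rho> be t" unfolding \<rho>_def by simp
 finally show ?thesis .
qed

lemma P_exp_lip:
 assumes u: "exp_lip be C u" and be: "0 <= be" and t: "0 <= t"
 shows "exp_lip be (C * exp (t * \<psi> be)) (P t u)"
 unfolding exp_lip_def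
proof (intro conjI allI)
 show "0 <= C * exp (t * \<psi> be)" using exp_lip_nonneg[OF u] by simp
 fix v y
 have "P t u v - P t u y = (\<integral>z. u (v + z) - u (y + z) \<partial>\<mu> t)"
  unfolding P_def using P_integrable[OF u be t] by simp
 also have "\<bar>\<dots>\<bar> <= (\<integral>z. \<bar>u (v + z) - u (y + z)\<bar> \<partial>\<mu> t)" by (rule integral_abs_bound)
 also have "\<dots> <= (\<integral>z. C * \<bar>exp (be * v) - exp (be * y)\<bar> * exp (be * z) \<partial>\<mu> t)"
 proof (rule integral_mono)
  show "integrable (\<mu> t) (\<lambda>z. \<bar>u (v + z) - u (y + z)\<bar>)" using P_integrable[OF u be t] by simp
  show "integrable (\<mu> t) (\<lambda>z. C * \<bar>exp (be * v) - exp (be * y)\<bar> * exp (be * z))" using integrable_exp[OF be t] by simp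
  fix z
  have "\<bar>exp (be * (v + z)) - exp (be * (y + z))\<bar> = \<bar>exp (be * v) - exp (be * y)\<bar> * exp (be * z)"
   by (simp add: exp_translate_abs)
  then show "\<bar>u (v + z) - u (y + z)\<bar> <= C * \<bar>exp (be * v) - exp (be * y)\<bar> * exp (be * z)"
   using exp_lipD[OF u, of "v + z" "y + z"] by (simp add: mult.assoc)
 qed
 also have "\<dots> = C * exp (t * \<psi> be) * \<bar>exp (be * v) - exp (be * y)\<bar>" using integral_exp[OF be t] by (simp add: mult_ac)
 finally show "\<bar>P t u v - P t u y\<bar> <= C * exp (t * \<psi> be) * \<bar>exp (be * v) - exp (be * y)\<bar>" .
qed

text \<open>Independence splits off the increment over \<open>[s, s + t]\<close>; the weight at time
  \<open>s\<close> costs the factor \<open>exp (s * \<psi> be)\<close>.\<close>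

lemma P_time_diff:
 assumes u: "exp_lip be C u" and be: "0 <= be" and st: "0 <= s" "0 <= t"
 shows "\<bar>P (s + t) u v - P s u v\<bar> <= C * exp (be * v) * exp (s * \<psi> be) * \<rho> be t"
proof -
 note [measurable] = exp_lip_meas[OF u]
 have C: "0 <= C" by (rule exp_lip_nonneg[OF u])
 define K where "K = C * exp (be * v) * exp (s * \<psi> be) * \<rho> be t"
 have K: "0 <= K" unfolding K_def using C \<rho>_nonneg by simp
 have [measurable]: "X s \<in> borel_measurable M" "X 0 \<in> borel_measurable M" "X (s + t) \<in> borel_measurable M" using st by auto
 have I: "integrable M (\<lambda>om. u (v + (X r om - X 0 om)))" if "0 <= r" for r
  using P_integrable[OF u be that, of v] unfolding \<mu>_def
  by (subst (asm) integrable_distr_eq) (use that in "auto intro!: borel_measurable_diff X_meas")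
 have "P (s + t) u v - P s u v = (\<integral>om. u (v + (X (s + t) om - X 0 om)) - u (v + (X s om - X 0 om)) \<partial>M)"
  using I st by (simp add: P_paths)
 then have "ennreal \<bar>P (s + t) u v - P s u v\<bar> <= (\<integral>\<^sup>+om. ennreal \<bar>u (v + (X (s + t) om - X 0 om)) - u (v + (X s om - X 0 om))\<bar> \<partial>M)"
  using integral_norm_bound_ennreal[of M "\<lambda>om. u (v + (X (s + t) om - X 0 om)) - u (v + (X s om - X 0 om))"] I st by simp
 also have "\<dots> <= (\<integral>\<^sup>+om. ennreal (C * exp (be * v)) * (ennreal (exp (be * (X s om - X 0 om))) * ennreal \<bar>exp (be * (X (s + t) om - X s om)) - 1\<bar>) \<partial>M)"
 proof (rule nn_integral_mono)
  fix om
  define a d where "a = X s om - X 0 om" and "d = X (s + t) om - X s om"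
  have "\<bar>exp (be * (v + (a + d))) - exp (be * (v + a))\<bar> = exp (be * v) * (exp (be * a) * \<bar>exp (be * d) - 1\<bar>)"
   using exp_shift_abs[of be "v + a" d] by (simp add: distrib_left exp_add add.assoc mult.assoc)
  then have "\<bar>u (v + (a + d)) - u (v + a)\<bar> <= (C * exp (be * v)) * (exp (be * a) * \<bar>exp (be * d) - 1\<bar>)"
   using exp_lipD[OF u, of "v + (a + d)" "v + a"] by (simp add: mult.assoc)
  moreover have "X (s + t) om - X 0 om = a + d" unfolding a_def d_def by simp
  ultimately show "ennreal \<bar>u (v + (X (s + t) om - X 0 om)) - u (v + (X s om - X 0 om))\<bar> <=
    ennreal (C * exp (be * v)) * (ennreal (exp (be * (X s om - X 0 om))) * ennreal \<bar>exp (be * (X (s + t) om - X s om)) - 1\<bar>)"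
   unfolding a_def[symmetric] d_def[symmetric] using C by (simp add: ennreal_mult[symmetric])
 qed
 also have "\<dots> = ennreal (C * exp (be * v)) * ((\<integral>\<^sup>+y. ennreal (exp (be * y)) \<partial>\<mu> s) * (\<integral>\<^sup>+y. ennreal \<bar>exp (be * y) - 1\<bar> \<partial>\<mu> t))"
  by (subst nn_integral_cmult) (simp_all add: two_increments[OF st, of "\<lambda>y. ennreal (exp (be * y))" "\<lambda>y. ennreal \<bar>exp (be * y) - 1\<bar>"])
 also have "(\<integral>\<^sup>+y. ennreal (exp (be * y)) \<partial>\<mu> s) = ennreal (exp (s * \<psi> be))"
  using mgf_integral[OF be st(1)] integral_exp[OF be st(1)] unfolding mgf_def by simp
 also have "(\<integral>\<^sup>+y. ennreal \<bar>exp (be * y) - 1\<bar> \<partial>\<mu> t) = ennreal (\<rho> be t)"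
  unfolding \<rho>_def by (rule nn_integral_eq_integral[OF int_exp_abs[OF be st(2)]]) simp
 also have "ennreal (C * exp (be * v)) * (ennreal (exp (s * \<psi> be)) * ennreal (\<rho> be t)) = ennreal K"
  unfolding K_def using C \<rho>_nonneg by (simp add: ennreal_mult[symmetric] mult.assoc)
 finally show ?thesis using K unfolding K_def[symmetric] by (simp add: ennreal_le_iff)
qed

text \<open>Joint continuity provides the measurability for Fubini in
  \<open>dynkin_int_laplace\<close>.\<close>

lemma P_continuous:
 assumes u: "exp_lip be C u" and be: "0 <= be"
 shows "continuous_on (UNIV \<times> {0..}) (\<lambda>p. P (snd p) u (fst p))"
 unfolding continuous_on_sequentially comp_def
proof (intro allI ballI impI, elim conjE)
 fix Y :: "nat => real \<times> real" and p
 assume p: "p \<in> UNIV \<times> {0..}" "\<forall>n. Y n \<in> UNIV \<times> {0..}" "Y \<longlonglongrightarrow> p"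
 define y r v s where "y n = fst (Y n)" and "r n = snd (Y n)" and "v = fst p" and "s = snd p" for n
 have lim: "y \<longlonglongrightarrow> v" "r \<longlonglongrightarrow> s"
  using tendsto_fst[OF p(3)] tendsto_snd[OF p(3)] unfolding y_def r_def v_def s_def by simp_all
 have s: "0 <= s" "0 <= r n" for n using p(1) p(2)[rule_format, of n] unfolding r_def s_def by auto
 have C: "0 <= C" by (rule exp_lip_nonneg[OF u])
 have bd: "\<bar>P (r n) u (y n) - P s u v\<bar> <= C * exp (r n * \<psi> be) * \<bar>exp (be * y n) - exp (be * v)\<bar> +
   C * exp (be * v) * exp (min s (r n) * \<psi> be) * \<rho> be \<bar>r n - s\<bar>" for n
 proof -
  have "\<bar>P (r n) u v - P s u v\<bar> <= C * exp (be * v) * exp (min s (r n) * \<psi> be) * \<rho> be \<bar>r n - s\<bar>"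
  proof (cases "s <= r n")
   case True
   then show ?thesis using P_time_diff[OF u be s(1), of "r n - s" v] by (simp add: min_def)
  next
   case False
   then show ?thesis using P_time_diff[OF u be s(2)[of n], of "s - r n" v] by (simp add: min_def abs_minus_commute)
  qed
  then show ?thesis using exp_lipD[OF P_exp_lip[OF u be s(2)[of n]], of "y n" v] by linarith
 qed
 have "(\<lambda>n. \<rho> be \<bar>r n - s\<bar>) \<longlonglongrightarrow> 0"
  by (rule \<rho>_tendsto[OF be]) (use tendsto_rabs_zero[OF LIM_zero[OF lim(2)]] in simp_all)
 then have "(\<lambda>n. C * exp (r n * \<psi> be) * \<bar>exp (be * y n) - exp (be * v)\<bar> +
   C * exp (be * v) * exp (min s (r n) * \<psi> be) * \<rho> be \<bar>r n - s\<bar>) \<longlonglongrightarrow>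
   C * exp (s * \<psi> be) * \<bar>exp (be * v) - exp (be * v)\<bar> + C * exp (be * v) * exp (min s s * \<psi> be) * 0"
  by (intro tendsto_add tendsto_mult tendsto_rabs tendsto_diff tendsto_exp tendsto_min tendsto_const lim)
 then have lim0: "(\<lambda>n. C * exp (r n * \<psi> be) * \<bar>exp (be * y n) - exp (be * v)\<bar> +
   C * exp (be * v) * exp (min s (r n) * \<psi> be) * \<rho> be \<bar>r n - s\<bar>) \<longlonglongrightarrow> 0" by simp
 have "(\<lambda>n. P (r n) u (y n) - P s u v) \<longlonglongrightarrow> 0"
  by (rule Lim_null_comparison[OF _ lim0]) (simp add: bd)
 then show "(\<lambda>n. P (snd (Y n)) u (fst (Y n))) \<longlonglongrightarrow> P (snd p) u (fst p)"
  unfolding y_def r_def v_def s_def by (simp add: LIM_zero_iff)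
qed

end

section \<open>Dynkin's formula from Laplace transforms\<close>

context sn_levy
begin

lemma P_continuous_space: "exp_lip be C u ==> 0 <= be ==> 0 <= t ==> continuous_on UNIV (P t u)"
 by (rule exp_lip_continuous[OF P_exp_lip])

lemma P_continuous_time:
 assumes "exp_lip be C u" "0 <= be"
 shows "continuous_on {0..} (\<lambda>s. P s u v)"
proof -
 have "continuous_on {0..} (\<lambda>s. (\<lambda>p. P (snd p) u (fst p)) (v, s))"
  by (rule continuous_on_compose2[OF P_continuous[OF assms]]) (auto intro!: continuous_intros)
 then show ?thesis by simp
qed

lemma P_discounted_int:
 assumes "exp_lip be C u" "0 <= be"
 shows "set_integrable lborel {0..t} (\<lambda>s. exp (- q * s) * P s u v)"
 by (rule borel_integrable_atLeastAtMost') (intro continuous_intros continuous_on_subset[OF P_continuous_time[OF assms]], auto)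

definition dynkin_int :: "real => real => (real => real) => real => real" where
 "dynkin_int q t u v = (LBINT s:{0..t}. exp (- q * s) * P s u v)"

definition dynkin_pair :: "real => (real => real) => (real => real) => bool" where
 "dynkin_pair q F G \<longleftrightarrow> (\<forall>t\<ge>0. \<forall>v. exp (- q * t) * P t F v = F v + dynkin_int q t G v)"

text \<open>Translation invariance of Lebesgue measure diagonalises the semigroup: averaging
  \<open>u (v + y)\<close> over \<open>y\<close> multiplies the transform by the moment of order
  \<open>th\<close>. The transform is two-sided, since \<open>P t u\<close> need not vanish on the
  negative half-line where \<open>u\<close> does.\<close>

lemma P_laplace:
 assumes u: "exp_lip be C u" and be: "0 <= be" and nn: "\<And>v. 0 <= u v" and t: "0 <= t" and th: "0 <= th"
 shows "(\<integral>\<^sup>+v. ennreal (exp (- th * v) * P t u v) \<partial>lborel) = ennreal (exp (t * \<psi> th)) * (\<integral>\<^sup>+v. ennreal (exp (- th * v) * u v) \<partial>lborel)"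
proof -
 interpret \<mu>: prob_space "\<mu> t" by (rule prob_\<mu>[OF t])
 interpret pair_sigma_finite lborel "\<mu> t" ..
 note [measurable] = exp_lip_meas[OF u]
 have "ennreal (exp (- th * v) * P t u v) = (\<integral>\<^sup>+y. ennreal (exp (- th * v) * u (v + y)) \<partial>\<mu> t)" for v
 proof -
  have "ennreal (P t u v) = (\<integral>\<^sup>+y. ennreal (u (v + y)) \<partial>\<mu> t)"
   unfolding P_def by (rule nn_integral_eq_integral[symmetric, OF P_integrable[OF u be t]]) (simp add: nn)
  moreover have "0 <= P t u v" unfolding P_def by (intro integral_nonneg_AE) (simp add: nn)
  ultimately show ?thesis using nn by (simp add: ennreal_mult nn_integral_cmult)
 qed
 then have "(\<integral>\<^sup>+v. ennreal (exp (- th * v) * P t u v) \<partial>lborel) = (\<integral>\<^sup>+v. \<integral>\<^sup>+y. ennreal (exp (- th * v) * u (v + y)) \<partial>\<mu> t \<partial>lborel)" by simp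
 also have "\<dots> = (\<integral>\<^sup>+y. \<integral>\<^sup>+v. ennreal (exp (- th * v) * u (v + y)) \<partial>lborel \<partial>\<mu> t)"
  by (rule Fubini'[symmetric]) measurable
 also have "\<dots> = (\<integral>\<^sup>+y. ennreal (exp (th * y)) * (\<integral>\<^sup>+v. ennreal (exp (- th * v) * u v) \<partial>lborel) \<partial>\<mu> t)"
 proof (rule nn_integral_cong)
  fix y
  have "(\<integral>\<^sup>+v. ennreal (exp (- th * v) * u v) \<partial>lborel) = (\<integral>\<^sup>+v. ennreal (exp (- th * (y + 1 * v)) * u (y + 1 * v)) \<partial>lborel)"
   by (subst nn_integral_real_affine[where c = 1 and t = y]) simp_all
  also have "ennreal (exp (th * y)) * \<dots> = (\<integral>\<^sup>+v. ennreal (exp (- th * v) * u (v + y)) \<partial>lborel)"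
  proof (subst nn_integral_cmult[symmetric])
   have "exp (th * y) * (exp (- th * (y + 1 * v)) * u (y + 1 * v)) = exp (- th * v) * u (v + y)" for v
   proof -
    have "exp (th * y) * exp (- th * (y + v)) = exp (- th * v)" by (simp add: exp_add[symmetric] algebra_simps)
    then show ?thesis by (simp add: mult.assoc[symmetric] add.commute)
   qed
   then show "(\<integral>\<^sup>+v. ennreal (exp (th * y)) * ennreal (exp (- th * (y + 1 * v)) * u (y + 1 * v)) \<partial>lborel) = (\<integral>\<^sup>+v. ennreal (exp (- th * v) * u (v + y)) \<partial>lborel)"
    by (simp only: ennreal_mult'[symmetric] exp_ge_zero)
  qed simp
  finally show "(\<integral>\<^sup>+v. ennreal (exp (- th * v) * u (v + y)) \<partial>lborel) = ennreal (exp (th * y)) * (\<integral>\<^sup>+v. ennreal (exp (- th * v) * u v) \<partial>lborel)" ..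
 qed
 also have "\<dots> = (\<integral>\<^sup>+y. ennreal (exp (th * y)) \<partial>\<mu> t) * (\<integral>\<^sup>+v. ennreal (exp (- th * v) * u v) \<partial>lborel)"
  by (rule nn_integral_multc) simp
 also have "(\<integral>\<^sup>+y. ennreal (exp (th * y)) \<partial>\<mu> t) = ennreal (exp (t * \<psi> th))"
  using mgf_integral[OF th t] integral_exp[OF th t] unfolding mgf_def by simp
 finally show ?thesis .
qed

lemma dynkin_int_nonneg: "(\<And>v. 0 <= u v) ==> 0 <= dynkin_int q t u v"
 unfolding dynkin_int_def set_lebesgue_integral_def P_def
 by (intro Bochner_Integration.integral_nonneg scaleR_nonneg_nonneg mult_nonneg_nonneg) auto

lemma exp_integral:
 fixes k :: real
 assumes "k \<noteq> 0" "0 <= t"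
 shows "(\<integral>\<^sup>+s. ennreal (exp (k * s)) * indicator {0..t} s \<partial>lborel) = ennreal ((exp (k * t) - 1) / k)"
proof -
 have "(\<integral>\<^sup>+s. ennreal (exp (k * s)) * indicator {0..t} s \<partial>lborel) = ennreal (exp (k * t) / k - exp (k * 0) / k)"
  by (rule nn_integral_FTC_Icc) (use assms in "auto intro!: derivative_eq_intros")
 then show ?thesis by (simp add: diff_divide_distrib)
qed

lemma dynkin_int_laplace:
 assumes u: "exp_lip be C u" and be: "0 <= be" and nn: "\<And>v. 0 <= u v" and t: "0 <= t" and th: "0 <= th" "q < \<psi> th"
 shows "(\<integral>\<^sup>+v. ennreal (exp (- th * v) * dynkin_int q t u v) \<partial>lborel) =
   ennreal ((exp ((\<psi> th - q) * t) - 1) / (\<psi> th - q)) * (\<integral>\<^sup>+v. ennreal (exp (- th * v) * u v) \<partial>lborel)"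
proof -
 have Pnn: "0 <= P s u v" for s v unfolding P_def by (intro integral_nonneg_AE) (simp add: nn)
 \<comment> \<open>Extended by 0 to negative times, so that continuity on
   \<open>UNIV \<times> {0..}\<close> yields a function measurable on the whole plane.\<close>
 define K where "K p = exp (- q * snd p) * (indicator (UNIV \<times> {0..}) p *\<^sub>R P (snd p) u (fst p))" for p :: "real \<times> real"
 have mK: "K \<in> borel_measurable (borel \<Otimes>\<^sub>M borel)"
 proof -
  have cl: "closed ((UNIV :: real set) \<times> {0::real..})" by (rule closed_Times) auto
  have m1: "(\<lambda>p. indicator (UNIV \<times> {0..}) p *\<^sub>R P (snd p) u (fst p)) \<in> borel_measurable borel"
   by (rule borel_measurable_continuous_on_indicator[OF borel_closed[OF cl] P_continuous[OF u be]])
  have "continuous_on UNIV (\<lambda>p :: real \<times> real. exp (- q * snd p))" by (intro continuous_intros)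
  then have m2: "(\<lambda>p :: real \<times> real. exp (- q * snd p)) \<in> borel_measurable borel"
   by (rule borel_measurable_continuous_onI)
  have "K \<in> borel_measurable borel" using borel_measurable_times[OF m2 m1] unfolding K_def .
  then show ?thesis by (simp only: borel_prod)
 qed
 have mK': "case_prod (\<lambda>v s. ennreal (exp (- th * v) * K (v, s)) * indicator {0..t} s) \<in> borel_measurable (lborel \<Otimes>\<^sub>M lborel)"
 proof -
  note [measurable] = mK
  have "(\<lambda>p. ennreal (exp (- th * fst p) * K p) * indicator {0..t} (snd p)) \<in> borel_measurable (borel \<Otimes>\<^sub>M borel)" by measurable
  moreover have "sets (lborel \<Otimes>\<^sub>M lborel) = sets (borel \<Otimes>\<^sub>M (borel :: real measure))"
   by (rule sets_pair_measure_cong) simp_all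
  ultimately have "(\<lambda>p. ennreal (exp (- th * fst p) * K p) * indicator {0..t} (snd p)) \<in> borel_measurable (lborel \<Otimes>\<^sub>M lborel)"
   using measurable_cong_sets[of "lborel \<Otimes>\<^sub>M lborel" "borel \<Otimes>\<^sub>M (borel :: real measure)" "borel :: ennreal measure" borel] by blast
  then show ?thesis by (simp only: case_prod_unfold prod.collapse)
 qed
 have "ennreal (exp (- th * v) * dynkin_int q t u v) = (\<integral>\<^sup>+s. ennreal (exp (- th * v) * K (v, s)) * indicator {0..t} s \<partial>lborel)" for v
 proof -
  have "set_integrable lborel {0..t} (\<lambda>s. exp (- th * v) * (exp (- q * s) * P s u v))"
   by (rule set_integrable_mult_right) (rule P_discounted_int[OF u be])
  then have i: "integrable lborel (\<lambda>s. indicator {0..t} s * (exp (- th * v) * (exp (- q * s) * P s u v)))"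
   unfolding set_integrable_def real_scaleR_def .
  have "exp (- th * v) * dynkin_int q t u v = (LBINT s:{0..t}. exp (- th * v) * (exp (- q * s) * P s u v))"
   unfolding dynkin_int_def by (rule set_integral_mult_right[symmetric])
  then have eq: "exp (- th * v) * dynkin_int q t u v = (\<integral>s. indicator {0..t} s * (exp (- th * v) * (exp (- q * s) * P s u v)) \<partial>lborel)"
   unfolding set_lebesgue_integral_def real_scaleR_def .
  have "ennreal (exp (- th * v) * dynkin_int q t u v) = (\<integral>\<^sup>+s. ennreal (indicator {0..t} s * (exp (- th * v) * (exp (- q * s) * P s u v))) \<partial>lborel)"
   unfolding eq by (rule nn_integral_eq_integral[symmetric, OF i]) (auto intro!: AE_I2 simp: Pnn indicator_def)
  also have "\<dots> = (\<integral>\<^sup>+s. ennreal (exp (- th * v) * K (v, s)) * indicator {0..t} s \<partial>lborel)"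
   by (rule nn_integral_cong) (auto simp: K_def indicator_def)
  finally show ?thesis .
 qed
 then have "(\<integral>\<^sup>+v. ennreal (exp (- th * v) * dynkin_int q t u v) \<partial>lborel) = (\<integral>\<^sup>+v. \<integral>\<^sup>+s. ennreal (exp (- th * v) * K (v, s)) * indicator {0..t} s \<partial>lborel \<partial>lborel)" by simp
 also have "\<dots> = (\<integral>\<^sup>+s. \<integral>\<^sup>+v. ennreal (exp (- th * v) * K (v, s)) * indicator {0..t} s \<partial>lborel \<partial>lborel)"
  by (rule lborel_pair.Fubini'[OF mK', symmetric])
 also have "\<dots> = (\<integral>\<^sup>+s. (ennreal (exp ((\<psi> th - q) * s)) * indicator {0..t} s) * (\<integral>\<^sup>+v. ennreal (exp (- th * v) * u v) \<partial>lborel) \<partial>lborel)"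
 proof (rule nn_integral_cong)
  fix s :: real
  show "(\<integral>\<^sup>+v. ennreal (exp (- th * v) * K (v, s)) * indicator {0..t} s \<partial>lborel) =
    (ennreal (exp ((\<psi> th - q) * s)) * indicator {0..t} s) * (\<integral>\<^sup>+v. ennreal (exp (- th * v) * u v) \<partial>lborel)"
  proof (cases "s \<in> {0..t}")
   case True
   then have s: "0 <= s" by simp
   have "(\<integral>\<^sup>+v. ennreal (exp (- th * v) * K (v, s)) * indicator {0..t} s \<partial>lborel) = (\<integral>\<^sup>+v. ennreal (exp (- q * s)) * ennreal (exp (- th * v) * P s u v) \<partial>lborel)"
    by (rule nn_integral_cong) (use True Pnn in "simp add: K_def ennreal_mult[symmetric] mult_ac")
   also have "\<dots> = ennreal (exp (- q * s)) * (\<integral>\<^sup>+v. ennreal (exp (- th * v) * P s u v) \<partial>lborel)"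
    by (rule nn_integral_cmult) (use exp_lip_meas[OF P_exp_lip[OF u be s]] in measurable)
   also have "\<dots> = ennreal (exp (- q * s)) * ennreal (exp (s * \<psi> th)) * (\<integral>\<^sup>+v. ennreal (exp (- th * v) * u v) \<partial>lborel)"
    unfolding P_laplace[OF u be nn s th(1)] by (simp add: mult.assoc)
   also have "ennreal (exp (- q * s)) * ennreal (exp (s * \<psi> th)) = ennreal (exp ((\<psi> th - q) * s))"
    by (simp add: ennreal_mult[symmetric] exp_add[symmetric] algebra_simps)
   finally show ?thesis using True by simp
  qed simp
 qed
 also have "\<dots> = (\<integral>\<^sup>+s. ennreal (exp ((\<psi> th - q) * s)) * indicator {0..t} s \<partial>lborel) * (\<integral>\<^sup>+v. ennreal (exp (- th * v) * u v) \<partial>lborel)"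
  by (rule nn_integral_multc) simp
 also have "(\<integral>\<^sup>+s. ennreal (exp ((\<psi> th - q) * s)) * indicator {0..t} s \<partial>lborel) = ennreal ((exp ((\<psi> th - q) * t) - 1) / (\<psi> th - q))"
  by (rule exp_integral) (use th t in auto)
 finally show ?thesis .
qed

text \<open>Both sides of Dynkin's formula have the transform of \<open>I\<close> times
  \<open>exp ((\<psi> th - q) * t)\<close>. Uniqueness gives equality almost everywhere, continuity
  gives it everywhere.\<close>

lemma dynkin_pair_if_laplace:
 assumes I: "exp_lip be C I" and G: "exp_lip be D G" and be: "0 <= be" and nn: "\<And>v. 0 <= I v" "\<And>v. 0 <= G v"
  and th0: "0 <= th0" and lap: "\<And>th. th0 < th ==> q < \<psi> th \<and> integrable lborel (\<lambda>v. exp (- th * v) * I v) \<and> integrable lborel (\<lambda>v. exp (- th * v) * G v) \<and>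
    (\<psi> th - q) * (\<integral>v. exp (- th * v) * I v \<partial>lborel) = (\<integral>v. exp (- th * v) * G v \<partial>lborel)"
 shows "dynkin_pair q I G"
 unfolding dynkin_pair_def
proof (intro allI impI)
 fix t v :: real assume t: "0 <= t"
 define F1 where "F1 v = exp (- q * t) * P t I v" for v
 define F2 where "F2 v = I v + dynkin_int q t G v" for v
 have Pnn: "0 <= P s u v" if "\<And>v. 0 <= u v" for s v u unfolding P_def using that by (intro integral_nonneg_AE) simp
 have nn1: "0 <= F1 v" for v unfolding F1_def using Pnn[of I] nn by simp
 have nn2: "0 <= F2 v" for v unfolding F2_def using nn dynkin_int_nonneg[of G] by simp
 have c1: "continuous_on UNIV F1" unfolding F1_def
  by (intro continuous_intros P_continuous_space[OF I be t])
 have c2: "continuous_on UNIV F2" unfolding F2_def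
 proof (intro continuous_on_add exp_lip_continuous[OF I])
  have "exp_lip be (\<integral>s. indicator {0..t} s * (exp (- q * s) * (D * exp (s * \<psi> be))) \<partial>lborel) (dynkin_int q t G)"
   unfolding exp_lip_def
  proof (intro conjI allI)
   have D: "0 <= D" by (rule exp_lip_nonneg[OF G])
   have ci: "integrable lborel (\<lambda>s. indicator {0..t} s * (exp (- q * s) * (D * exp (s * \<psi> be))))"
    using borel_integrable_atLeastAtMost'[of 0 t "\<lambda>s. exp (- q * s) * (D * exp (s * \<psi> be))"]
    unfolding set_integrable_def by (simp add: continuous_intros)
   show "0 <= (\<integral>s. indicator {0..t} s * (exp (- q * s) * (D * exp (s * \<psi> be))) \<partial>lborel)"
    using D by (intro Bochner_Integration.integral_nonneg) auto
   fix v y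
   have eq: "dynkin_int q t G v - dynkin_int q t G y = (\<integral>s. indicator {0..t} s * (exp (- q * s) * (P s G v - P s G y)) \<partial>lborel)"
    unfolding dynkin_int_def using P_discounted_int[OF G be, of t q]
    by (subst set_integral_diff(2)[symmetric]) (simp_all add: set_lebesgue_integral_def right_diff_distrib)
   have "\<bar>dynkin_int q t G v - dynkin_int q t G y\<bar> <= (\<integral>s. \<bar>indicator {0..t} s * (exp (- q * s) * (P s G v - P s G y))\<bar> \<partial>lborel)" unfolding eq by (rule integral_abs_bound)
   also have "\<dots> <= (\<integral>s. indicator {0..t} s * (exp (- q * s) * (D * exp (s * \<psi> be))) * \<bar>exp (be * v) - exp (be * y)\<bar> \<partial>lborel)"
   proof (rule integral_mono)
    have "integrable lborel (\<lambda>s. indicator {0..t} s * (exp (- q * s) * P s G v) - indicator {0..t} s * (exp (- q * s) * P s G y))"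
     using P_discounted_int[OF G be, of t q] unfolding set_integrable_def by simp
    then show "integrable lborel (\<lambda>s. \<bar>indicator {0..t} s * (exp (- q * s) * (P s G v - P s G y))\<bar>)"
     by (intro integrable_abs) (simp add: right_diff_distrib)
    show "integrable lborel (\<lambda>s. indicator {0..t} s * (exp (- q * s) * (D * exp (s * \<psi> be))) * \<bar>exp (be * v) - exp (be * y)\<bar>)"
     using ci by simp
    fix s
    show "\<bar>indicator {0..t} s * (exp (- q * s) * (P s G v - P s G y))\<bar> <= indicator {0..t} s * (exp (- q * s) * (D * exp (s * \<psi> be))) * \<bar>exp (be * v) - exp (be * y)\<bar>"
     using exp_lipD[OF P_exp_lip[OF G be], of s v y] by (auto simp: indicator_def abs_mult mult.assoc)
   qed
   also have "\<dots> = (\<integral>s. indicator {0..t} s * (exp (- q * s) * (D * exp (s * \<psi> be))) \<partial>lborel) * \<bar>exp (be * v) - exp (be * y)\<bar>" by simp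
   finally show "\<bar>dynkin_int q t G v - dynkin_int q t G y\<bar> <= (\<integral>s. indicator {0..t} s * (exp (- q * s) * (D * exp (s * \<psi> be))) \<partial>lborel) * \<bar>exp (be * v) - exp (be * y)\<bar>" .
  qed
  then show "continuous_on UNIV (dynkin_int q t G)" by (rule exp_lip_continuous)
 qed
 have lapl: "integrable lborel (\<lambda>v. exp (- th * v) * F1 v) \<and> integrable lborel (\<lambda>v. exp (- th * v) * F2 v) \<and>
   (\<integral>v. exp (- th * v) * F1 v \<partial>lborel) = (\<integral>v. exp (- th * v) * F2 v \<partial>lborel)" if "th0 < th" for th
 proof -
  note L = lap[OF that]
  have th: "0 <= th" using that th0 by simp
  define i where "i = (\<integral>v. exp (- th * v) * I v \<partial>lborel)"
  define k where "k = \<psi> th - q"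
  have k: "0 < k" unfolding k_def using L by simp
  have i0: "0 <= i" unfolding i_def using nn by (intro Bochner_Integration.integral_nonneg) auto
  have mI[measurable]: "I \<in> borel_measurable borel" by (rule exp_lip_meas[OF I])
  have m2[measurable]: "F2 \<in> borel_measurable borel" "F1 \<in> borel_measurable borel" using c1 c2 by (auto intro: borel_measurable_continuous_onI)
  have lI: "(\<integral>\<^sup>+v. ennreal (exp (- th * v) * I v) \<partial>lborel) = ennreal i" unfolding i_def
   by (rule nn_integral_eq_integral) (use L nn in auto)
  have lG: "(\<integral>\<^sup>+v. ennreal (exp (- th * v) * G v) \<partial>lborel) = ennreal (k * i)" unfolding i_def k_def
   by (subst nn_integral_eq_integral) (use L nn in auto)
  have "(\<integral>\<^sup>+v. ennreal (exp (- th * v) * F1 v) \<partial>lborel) = (\<integral>\<^sup>+v. ennreal (exp (- q * t)) * ennreal (exp (- th * v) * P t I v) \<partial>lborel)"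
   unfolding F1_def using Pnn[of I] nn by (intro nn_integral_cong) (simp add: ennreal_mult[symmetric] mult_ac)
  also have "\<dots> = ennreal (exp (- q * t)) * (\<integral>\<^sup>+v. ennreal (exp (- th * v) * P t I v) \<partial>lborel)"
   by (rule nn_integral_cmult) (use exp_lip_meas[OF P_exp_lip[OF I be t]] in measurable)
  also have "\<dots> = ennreal (exp (- q * t)) * (ennreal (exp (t * \<psi> th)) * ennreal i)"
   unfolding P_laplace[OF I be nn(1) t th] lI ..
  also have "\<dots> = ennreal (exp (k * t) * i)" unfolding k_def using i0
   by (simp add: ennreal_mult[symmetric] exp_add[symmetric] mult.assoc[symmetric] algebra_simps)
  finally have e1: "(\<integral>\<^sup>+v. ennreal (exp (- th * v) * F1 v) \<partial>lborel) = ennreal (exp (k * t) * i)" .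
  have md: "(\<lambda>v. dynkin_int q t G v) \<in> borel_measurable borel"
   using borel_measurable_diff[OF m2(1) mI] unfolding F2_def by simp
  have "(\<integral>\<^sup>+v. ennreal (exp (- th * v) * F2 v) \<partial>lborel) = (\<integral>\<^sup>+v. ennreal (exp (- th * v) * I v) + ennreal (exp (- th * v) * dynkin_int q t G v) \<partial>lborel)"
   unfolding F2_def using nn dynkin_int_nonneg[of G] by (intro nn_integral_cong) (simp add: distrib_left)
  also have "\<dots> = (\<integral>\<^sup>+v. ennreal (exp (- th * v) * I v) \<partial>lborel) + (\<integral>\<^sup>+v. ennreal (exp (- th * v) * dynkin_int q t G v) \<partial>lborel)"
   by (rule nn_integral_add) (use md in measurable)
  also have "\<dots> = ennreal i + ennreal ((exp (k * t) - 1) / k) * ennreal (k * i)"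
   using dynkin_int_laplace[OF G be nn(2) t th, of q] L unfolding lI lG k_def by simp
  also have "\<dots> = ennreal (exp (k * t) * i)"
  proof -
   have ex: "0 <= exp (k * t) - 1" using k t by simp
   have "ennreal ((exp (k * t) - 1) / k) * ennreal (k * i) = ennreal ((exp (k * t) - 1) / k * (k * i))"
    by (rule ennreal_mult[symmetric]) (use ex k i0 in auto)
   also have "(exp (k * t) - 1) / k * (k * i) = (exp (k * t) - 1) * i" using k by simp
   finally have "ennreal i + ennreal ((exp (k * t) - 1) / k) * ennreal (k * i) = ennreal i + ennreal ((exp (k * t) - 1) * i)" by simp
   also have "\<dots> = ennreal (i + (exp (k * t) - 1) * i)" by (rule ennreal_plus[symmetric]) (use ex i0 in auto)
   also have "i + (exp (k * t) - 1) * i = exp (k * t) * i" by (simp add: algebra_simps)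
   finally show ?thesis .
  qed
  finally have e2: "(\<integral>\<^sup>+v. ennreal (exp (- th * v) * F2 v) \<partial>lborel) = ennreal (exp (k * t) * i)" .
  have "integrable lborel (\<lambda>v. exp (- th * v) * F1 v)" "integrable lborel (\<lambda>v. exp (- th * v) * F2 v)"
   by (rule integrableI_nonneg; use nn1 nn2 e1 e2 in simp)+
  moreover have "(\<integral>v. exp (- th * v) * F1 v \<partial>lborel) = exp (k * t) * i" "(\<integral>v. exp (- th * v) * F2 v \<partial>lborel) = exp (k * t) * i"
   by (rule integral_eq_nn_integral[THEN trans]; use nn1 nn2 e1 e2 i0 in simp)+
  ultimately show ?thesis by simp
 qed
 have "AE v in lborel. F1 v = F2 v"
  by (rule two_sided_laplace_unique[of F1 F2 th0 "th0 + 1"])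
   (use c1 c2 nn1 nn2 lapl in "auto intro: borel_measurable_continuous_onI")
 from continuous_AE_eq[OF c1 c2 this] show "exp (- q * t) * P t I v = I v + dynkin_int q t G v"
  unfolding F1_def F2_def .
qed

end

section \<open>One step of the discretised process\<close>

context sn_levy
begin

lemma P_lin:
 assumes "exp_lip be C u" "exp_lip be D w" "0 <= be" "0 <= t"
 shows "P t (\<lambda>y. c * u y + d * w y) v = c * P t u v + d * P t w v"
 unfolding P_def using P_integrable[OF assms(1,3,4)] P_integrable[OF assms(2-4)] by simp

lemma dynkin_pair_lin:
 assumes F: "exp_lip be C1 F" "exp_lip be C2 F'" and G: "exp_lip be D1 G" "exp_lip be D2 G'" and be: "0 <= be"
  and p: "dynkin_pair q F G" "dynkin_pair q F' G'"
 shows "dynkin_pair q (\<lambda>y. c * F y + d * F' y) (\<lambda>y. c * G y + d * G' y)"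
 unfolding dynkin_pair_def
proof (intro allI impI)
 fix t v :: real assume t: "0 <= t"
 have "dynkin_int q t (\<lambda>y. c * G y + d * G' y) v = (LBINT s:{0..t}. c * (exp (- q * s) * P s G v) + d * (exp (- q * s) * P s G' v))"
  unfolding dynkin_int_def by (rule set_lebesgue_integral_cong) (auto simp: P_lin[OF G be] algebra_simps)
 also have "\<dots> = c * dynkin_int q t G v + d * dynkin_int q t G' v"
  unfolding dynkin_int_def using P_discounted_int[OF G(1) be] P_discounted_int[OF G(2) be]
  by (subst set_integral_add(2)) simp_all
 finally have e: "dynkin_int q t (\<lambda>y. c * G y + d * G' y) v = c * dynkin_int q t G v + d * dynkin_int q t G' v" .
 have "exp (- q * t) * P t F v = F v + dynkin_int q t G v" "exp (- q * t) * P t F' v = F' v + dynkin_int q t G' v"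
  using p t unfolding dynkin_pair_def by blast+
 then have "c * (exp (- q * t) * P t F v) + d * (exp (- q * t) * P t F' v) = c * (F v + dynkin_int q t G v) + d * (F' v + dynkin_int q t G' v)" by simp
 then show "exp (- q * t) * P t (\<lambda>y. c * F y + d * F' y) v = c * F v + d * F' v + dynkin_int q t (\<lambda>y. c * G y + d * G' y) v"
  unfolding e P_lin[OF F be t] by (simp add: algebra_simps)
qed

lemma P_shift: "P t (\<lambda>y. u (y + r)) v = P t u (v + r)"
 unfolding P_def by (simp add: add.assoc add.commute add.left_commute)

lemma dynkin_pair_shift: "dynkin_pair q F G ==> dynkin_pair q (\<lambda>y. F (y + r)) (\<lambda>y. G (y + r))"
 unfolding dynkin_pair_def dynkin_int_def P_shift by simp

lemma dynkin_pair_const: "dynkin_pair q (\<lambda>_. c) (\<lambda>_. - q * c)"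
 unfolding dynkin_pair_def
proof (intro allI impI)
 fix t v :: real assume t: "0 <= t"
 have Pc: "P s (\<lambda>_. d) v = d" if "0 <= s" for s d
 proof -
  interpret \<mu>: prob_space "\<mu> s" by (rule prob_\<mu>[OF that])
  show ?thesis unfolding P_def by (simp add: \<mu>.prob_space[simplified])
 qed
 have "dynkin_int q t (\<lambda>_. - q * c) v = (LBINT s:{0..t}. exp (- q * s) * (- q * c))"
  unfolding dynkin_int_def by (rule set_lebesgue_integral_cong) (auto simp: Pc)
 also have "\<dots> = (\<integral>s. indicator {0..t} s *\<^sub>R (exp (- q * s) * (- q * c)) \<partial>lborel)" unfolding set_lebesgue_integral_def ..
 also have "\<dots> = c * exp (- q * t) - c * exp (- q * 0)"
  by (rule integral_FTC_Icc[OF t]) (auto intro!: derivative_eq_intros continuous_intros simp: has_real_derivative_iff_has_vector_derivative[symmetric])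
 finally show "exp (- q * t) * P t (\<lambda>_. c) v = c + dynkin_int q t (\<lambda>_. - q * c) v" by (simp add: Pc[OF t])
qed

text \<open>\<open>smooth_triple q be F g \<phi>\<close>: \<open>g\<close> is the image of \<open>F\<close> under the generator minus \<open>q\<close>, and \<open>\<phi>\<close> is the derivative of \<open>F\<close>.\<close>

definition smooth_triple :: "real => real => (real => real) => (real => real) => (real => real) => bool" where
 "smooth_triple q be F g \<phi> \<longleftrightarrow> dynkin_pair q F g \<and> (\<forall>v. (F has_real_derivative \<phi> v) (at v)) \<and>
   (\<exists>C. exp_lip be C F) \<and> (\<exists>C. exp_lip be C g) \<and> (\<exists>C. exp_lip be C \<phi>)"

lemma smooth_triple_lin:
 assumes "smooth_triple q be F g \<phi>" "smooth_triple q be F' g' \<phi>'" "0 <= be"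
 shows "smooth_triple q be (\<lambda>y. c * F y + d * F' y) (\<lambda>y. c * g y + d * g' y) (\<lambda>y. c * \<phi> y + d * \<phi>' y)"
proof -
 obtain C1 C2 C3 D1 D2 D3 where *: "exp_lip be C1 F" "exp_lip be C2 g" "exp_lip be C3 \<phi>" "exp_lip be D1 F'" "exp_lip be D2 g'" "exp_lip be D3 \<phi>'"
  using assms unfolding smooth_triple_def by blast
 have "dynkin_pair q (\<lambda>y. c * F y + d * F' y) (\<lambda>y. c * g y + d * g' y)"
  by (rule dynkin_pair_lin[OF *(1,4,2,5)]) (use assms in "auto simp: smooth_triple_def")
 moreover have "((\<lambda>y. c * F y + d * F' y) has_real_derivative c * \<phi> v + d * \<phi>' v) (at v)" for v
 proof -
  have "(F has_real_derivative \<phi> v) (at v)" "(F' has_real_derivative \<phi>' v) (at v)"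
   using assms unfolding smooth_triple_def by blast+
  then show ?thesis by (intro DERIV_add DERIV_cmult)
 qed
 ultimately show ?thesis unfolding smooth_triple_def
  using exp_lip_add[OF exp_lip_cmult[OF *(1), of c] exp_lip_cmult[OF *(4), of d]]
   exp_lip_add[OF exp_lip_cmult[OF *(2), of c] exp_lip_cmult[OF *(5), of d]]
   exp_lip_add[OF exp_lip_cmult[OF *(3), of c] exp_lip_cmult[OF *(6), of d]] by blast
qed

lemma smooth_triple_shift:
 assumes "smooth_triple q be F g \<phi>"
 shows "smooth_triple q be (\<lambda>y. F (y + r)) (\<lambda>y. g (y + r)) (\<lambda>y. \<phi> (y + r))"
proof -
 have "((\<lambda>y. F (y + r)) has_real_derivative \<phi> (v + r)) (at v)" for v
  using assms unfolding smooth_triple_def by (subst DERIV_shift[symmetric]) blast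
 then show ?thesis using assms dynkin_pair_shift exp_lip_shift unfolding smooth_triple_def by blast
qed

lemma smooth_triple_const: "smooth_triple q be (\<lambda>_. c) (\<lambda>_. - q * c) (\<lambda>_. 0)"
 unfolding smooth_triple_def using dynkin_pair_const[of q c] exp_lip_const by auto

text \<open>Averaging \<open>f\<close> over \<open>[y - e, y]\<close> supplies the derivative that
  the refraction term calls for; the pair passes to the quotient by linearity and
  translation.\<close>

lemma smooth_triple_mollify:
 assumes p: "dynkin_pair q I G" and I: "exp_lip be C I" and G: "exp_lip be D G" and f: "exp_lip be K f"
  and der: "\<And>v. (I has_real_derivative f v) (at v)" and be: "0 <= be"
 shows "smooth_triple q be (\<lambda>y. (I y - I (y - e)) / e) (\<lambda>y. (G y - G (y - e)) / e) (\<lambda>y. (f y - f (y - e)) / e)"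
proof -
 have "smooth_triple q be I G f" unfolding smooth_triple_def using assms by blast
 from smooth_triple_lin[OF this smooth_triple_shift[OF this, of "- e"] be, of "1 / e" "- (1 / e)"]
 show ?thesis by (simp add: diff_divide_distrib)
qed

lemma \<rho>_small:
 assumes "0 <= be" "0 < e"
 obtains d where "d > 0" "\<And>t. 0 <= t ==> t < d ==> \<rho> be t < e"
proof -
 have "\<exists>d>0. \<forall>t. 0 <= t --> t < d --> \<rho> be t < e"
 proof (rule ccontr)
  assume "\<not> ?thesis"
  then have "\<forall>n::nat. \<exists>t. 0 <= t \<and> t < 1 / real (Suc n) \<and> \<not> \<rho> be t < e"
   by (meson divide_pos_pos of_nat_0_less_iff zero_less_Suc zero_less_one)
  then obtain \<tau> where \<tau>: "\<And>n::nat. 0 <= \<tau> n" "\<And>n. \<tau> n < 1 / real (Suc n)" "\<And>n. \<not> \<rho> be (\<tau> n) < e" by metis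
  have "\<tau> \<longlonglongrightarrow> 0"
  proof (rule tendsto_sandwich[OF _ _ tendsto_const])
   show "(\<lambda>n. 1 / real (Suc n)) \<longlonglongrightarrow> 0" using LIMSEQ_inverse_real_of_nat by (simp add: inverse_eq_divide)
  qed (use \<tau> in "auto intro!: always_eventually less_imp_le")
  then have "\<forall>\<^sub>F n in sequentially. \<rho> be (\<tau> n) < e" by (intro order_tendstoD[OF \<rho>_tendsto] assms \<tau>(1))
  then show False using \<tau>(3) by (auto simp: eventually_sequentially)
 qed
 then show ?thesis using that by blast
qed

lemma dynkin_int_near:
 assumes g: "exp_lip be C g" and be: "0 <= be" and q: "0 <= q" and h: "0 <= h"
  and \<rho>: "\<And>s. 0 <= s ==> s <= h ==> \<rho> be s <= r"
 shows "\<bar>dynkin_int q h g v - h * g v\<bar> <= h * (C * exp (be * v) * r + q * h * \<bar>g v\<bar>)"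
proof -
 let ?B = "C * exp (be * v) * r + q * h * \<bar>g v\<bar>"
 have C: "0 <= C" by (rule exp_lip_nonneg[OF g])
 have i1: "set_integrable lborel {0..h} (\<lambda>s. exp (- q * s) * P s g v)" by (rule P_discounted_int[OF g be])
 have i2: "set_integrable lborel {0..h} (\<lambda>s. c)" for c :: real by (rule borel_integrable_atLeastAtMost') simp
 have ic: "(LBINT s:{0..h}. c) = h * c" for c :: real using h by (simp add: set_lebesgue_integral_def)
 have bd: "\<bar>exp (- q * s) * P s g v - g v\<bar> <= ?B" if s: "s \<in> {0..h}" for s
 proof -
  have e: "0 <= 1 - exp (- q * s)" "1 - exp (- q * s) <= q * h"
  proof -
   show "0 <= 1 - exp (- q * s)" using s q by simp
   have "1 - exp (- q * s) <= q * s" using exp_ge_add_one_self[of "- q * s"] by simp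
   also have "\<dots> <= q * h" using s q by (intro mult_left_mono) auto
   finally show "1 - exp (- q * s) <= q * h" .
  qed
  have "\<bar>P s g v - g v\<bar> <= C * exp (be * v) * \<rho> be s" by (rule P_near[OF g be]) (use s in simp)
  also have "\<dots> <= C * exp (be * v) * r" using \<rho>[of s] s C by (intro mult_left_mono) auto
  finally have 1: "\<bar>P s g v - g v\<bar> <= C * exp (be * v) * r" .
  have "exp (- q * s) * P s g v - g v = exp (- q * s) * (P s g v - g v) - (1 - exp (- q * s)) * g v" by (simp add: algebra_simps)
  then have "\<bar>exp (- q * s) * P s g v - g v\<bar> <= \<bar>exp (- q * s) * (P s g v - g v)\<bar> + \<bar>(1 - exp (- q * s)) * g v\<bar>" by linarith
  moreover have "\<bar>exp (- q * s) * (P s g v - g v)\<bar> <= 1 * \<bar>P s g v - g v\<bar>"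
   unfolding abs_mult using e by (intro mult_right_mono) auto
  moreover have "\<bar>(1 - exp (- q * s)) * g v\<bar> <= q * h * \<bar>g v\<bar>"
   unfolding abs_mult using e by (intro mult_right_mono) auto
  ultimately show ?thesis using 1 by linarith
 qed
 have "dynkin_int q h g v <= (LBINT s:{0..h}. g v + ?B)" unfolding dynkin_int_def
  by (rule set_integral_mono[OF i1 i2]) (use bd in "force simp: abs_le_iff")
 moreover have "(LBINT s:{0..h}. g v - ?B) <= dynkin_int q h g v" unfolding dynkin_int_def
  by (rule set_integral_mono[OF i2 i1]) (use bd in "force simp: abs_le_iff")
 ultimately show ?thesis unfolding ic by (simp add: abs_le_iff algebra_simps)
qed

end

text \<open>The Levy-Khintchine representation enters only through these two growth properties of
  the exponent.\<close>

locale refraction = sn_levy +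
 fixes \<delta> b q :: real
 assumes \<delta>: "0 <= \<delta>" and b: "0 < b" and q: "0 <= q"
  and quad: "\<exists>C\<ge>0. \<forall>th\<ge>0. \<psi> th <= C * (1 + th\<^sup>2)"
  and diverges: "\<exists>th0. \<forall>th\<ge>th0. q < \<psi> th - \<delta> * th"
begin

lemma step_loss_meas[measurable]: "step_loss \<delta> b h \<in> borel_measurable borel"
 unfolding step_loss_def by measurable

lemma step_map_meas[measurable]: "step_map \<delta> b h \<in> borel_measurable borel"
 unfolding step_map_def by measurable

lemma step_loss_int:
 assumes h: "0 < h"
 shows "integrable (\<mu> h) (\<lambda>y. step_loss \<delta> b h (c + y))" "0 <= (\<integral>y. step_loss \<delta> b h (c + y) \<partial>\<mu> h)"
  "(\<integral>y. step_loss \<delta> b h (c + y) \<partial>\<mu> h) <= \<delta> * h"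
proof -
 interpret \<mu>: prob_space "\<mu> h" by (rule prob_\<mu>) (use h in simp)
 note sl = step_loss_bounds[OF \<delta> h b]
 show i: "integrable (\<mu> h) (\<lambda>y. step_loss \<delta> b h (c + y))"
  by (rule \<mu>.integrable_const_bound[where B = "\<delta> * h"]) (use sl in "auto intro!: AE_I2")
 show "0 <= (\<integral>y. step_loss \<delta> b h (c + y) \<partial>\<mu> h)" using sl by (intro integral_nonneg_AE) auto
 show "(\<integral>y. step_loss \<delta> b h (c + y) \<partial>\<mu> h) <= \<delta> * h"
  by (rule \<mu>.integral_le_const[OF i]) (use sl in auto)
qed

lemma exp_lip_step_int:
 assumes u: "exp_lip be C u" and be: "0 <= be" and h: "0 < h"
 shows "integrable (\<mu> h) (\<lambda>y. u (step_map \<delta> b h (c + y)))"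
proof -
 interpret \<mu>: prob_space "\<mu> h" by (rule prob_\<mu>) (use h in simp)
 note [measurable] = exp_lip_meas[OF u]
 note sl = step_loss_bounds[OF \<delta> h b]
 have C: "0 <= C" by (rule exp_lip_nonneg[OF u])
 show ?thesis
 proof (rule Bochner_Integration.integrable_bound[of _ "\<lambda>y. \<bar>u 0\<bar> + C * (1 + exp (be * c) * exp (be * y))"])
  show "integrable (\<mu> h) (\<lambda>y. \<bar>u 0\<bar> + C * (1 + exp (be * c) * exp (be * y)))" using integrable_exp[OF be, of h] h by simp
  show "AE y in \<mu> h. norm (u (step_map \<delta> b h (c + y))) <= norm (\<bar>u 0\<bar> + C * (1 + exp (be * c) * exp (be * y)))"
  proof (rule AE_I2)
   fix y
   define w where "w = step_map \<delta> b h (c + y)"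
   have w: "0 <= w" "w <= max (c + y) 0" unfolding w_def using sl(3,6) by auto
   have "\<bar>u w - u 0\<bar> <= C * \<bar>exp (be * w) - exp (be * 0)\<bar>" by (rule exp_lipD[OF u])
   also have "\<dots> <= C * (1 + exp (be * c) * exp (be * y))"
   proof (rule mult_left_mono[OF _ C])
    have "exp (be * w) <= exp (be * max (c + y) 0)" using w be by (simp add: mult_left_mono)
    also have "\<dots> <= 1 + exp (be * (c + y))" by (auto simp: max_def)
    finally have "exp (be * w) <= 1 + exp (be * c) * exp (be * y)" by (simp add: distrib_left exp_add)
    then show "\<bar>exp (be * w) - exp (be * 0)\<bar> <= 1 + exp (be * c) * exp (be * y)" using w be by simp
   qed
   finally show "norm (u w) <= norm (\<bar>u 0\<bar> + C * (1 + exp (be * c) * exp (be * y)))" using C by (simp add: add_nonneg_nonneg)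
  qed
 qed simp
qed

definition step_error :: "real => real => real" where
 "step_error be h = \<rho> be h + exp (h * \<psi> be) * (1 - exp (- be * (\<delta> * h)))"

text \<open>Only a lower bound, since reflection is controlled by nothing but
  \<open>F v <= F 0\<close> for \<open>v <= 0\<close>; upper bounds come from negated functions. A
  loss is paid only when \<open>c + y\<close> lies above \<open>b\<close>, which is positive, so
  reflection and refraction never act in the same step.\<close>

lemma step_expectation:
 assumes F: "exp_lip be C F" and \<phi>: "exp_lip be K \<phi>" and der: "\<And>v. (F has_real_derivative \<phi> v) (at v)"
  and be: "0 <= be" and h: "0 < h" and inc: "\<And>v. v <= 0 ==> F v <= F 0"
 shows "P h F c - \<phi> c * (\<integral>y. step_loss \<delta> b h (c + y) \<partial>\<mu> h) - \<delta> * h * (K * exp (be * c) * step_error be h)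
  <= (\<integral>y. F (step_map \<delta> b h (c + y)) \<partial>\<mu> h)"
proof -
 interpret \<mu>: prob_space "\<mu> h" by (rule prob_\<mu>) (use h in simp)
 have K: "0 <= K" by (rule exp_lip_nonneg[OF \<phi>])
 note sl = step_loss_bounds[OF \<delta> h b]
 define E where "E y = K * exp (be * c) * (\<bar>exp (be * y) - 1\<bar> + exp (be * y) * (1 - exp (- be * (\<delta> * h))))" for y
 have e0: "0 <= 1 - exp (- be * (\<delta> * h))" using be \<delta> h by simp
 have iE: "integrable (\<mu> h) E" "(\<integral>y. E y \<partial>\<mu> h) = K * exp (be * c) * step_error be h"
  unfolding E_def step_error_def \<rho>_def
  using int_exp_abs[OF be, of h] integrable_exp[OF be, of h] integral_exp[OF be, of h] h by simp_all
 note iF = P_integrable[OF F be, of h c] and iL = step_loss_int(1)[OF h, of c]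
 have pt: "F (c + y) - \<phi> c * step_loss \<delta> b h (c + y) - \<delta> * h * E y <= F (step_map \<delta> b h (c + y))" for y
 proof -
  define z l where "z = c + y" and "l = step_loss \<delta> b h z"
  have E0: "0 <= E y" unfolding E_def using K e0 by simp
  show ?thesis
  proof (cases "l = 0")
   case True
   then have "step_map \<delta> b h z = max z 0" unfolding step_map_def l_def by simp
   moreover have "F z <= F (max z 0)" using inc[of z] by (auto simp: max_def)
   moreover have "0 <= \<delta> * h * E y" using \<delta> h E0 by simp
   ultimately show ?thesis using True unfolding z_def l_def by simp
  next
   case False
   then have l: "0 < l" "l <= \<delta> * h" using sl(1,2)[of z] unfolding l_def by auto
   have "0 <= \<delta> * h" using \<delta> h by simp
   then have "b < z" using False unfolding l_def step_loss_def by (auto simp: min_def max_def split: if_splits)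
   then have z: "step_map \<delta> b h z = z - l" unfolding step_map_def l_def using b by simp
   \<comment> \<open>The derivative is taken between \<open>z - l\<close> and \<open>z\<close>;
     \<open>E y\<close> bounds its distance from \<open>\<phi> c\<close>.\<close>
   obtain \<zeta> where \<zeta>: "z - l < \<zeta>" "\<zeta> < z" "F z - F (z - l) = (z - (z - l)) * \<phi> \<zeta>"
    using MVT2[of "z - l" z F \<phi>] der l by auto
   have "\<bar>exp (be * \<zeta>) - exp (be * c)\<bar> <= \<bar>exp (be * z) - exp (be * c)\<bar> + (exp (be * z) - exp (be * \<zeta>))"
   proof -
    have "exp (be * \<zeta>) <= exp (be * z)" using \<zeta> be by (simp add: mult_left_mono)
    then show ?thesis by linarith
   qed
   moreover have "exp (be * z) - exp (be * \<zeta>) <= exp (be * z) - exp (be * (z - \<delta> * h))"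
    using \<zeta> l be by (simp add: mult_left_mono)
   moreover have "exp (be * z) - exp (be * (z - \<delta> * h)) = exp (be * c) * (exp (be * y) * (1 - exp (- be * (\<delta> * h))))"
    unfolding z_def by (simp add: algebra_simps exp_add[symmetric])
   moreover have "\<bar>exp (be * z) - exp (be * c)\<bar> = exp (be * c) * \<bar>exp (be * y) - 1\<bar>" unfolding z_def by (rule exp_shift_abs)
   ultimately have le: "\<bar>exp (be * \<zeta>) - exp (be * c)\<bar> <= exp (be * c) * \<bar>exp (be * y) - 1\<bar> + exp (be * c) * (exp (be * y) * (1 - exp (- be * (\<delta> * h))))" by linarith
   have "\<bar>\<phi> \<zeta> - \<phi> c\<bar> <= K * \<bar>exp (be * \<zeta>) - exp (be * c)\<bar>" by (rule exp_lipD[OF \<phi>])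
   also have "\<dots> <= K * (exp (be * c) * \<bar>exp (be * y) - 1\<bar> + exp (be * c) * (exp (be * y) * (1 - exp (- be * (\<delta> * h)))))"
    by (rule mult_left_mono[OF le K])
   also have "\<dots> = E y" unfolding E_def by (simp add: algebra_simps)
   finally have "\<phi> \<zeta> <= \<phi> c + E y" by simp
   then have "l * \<phi> \<zeta> <= l * \<phi> c + l * E y" using l mult_left_mono[of "\<phi> \<zeta>" "\<phi> c + E y" l] by (simp add: distrib_left)
   moreover have "l * E y <= \<delta> * h * E y" using l E0 by (intro mult_right_mono) auto
   ultimately have "F z - \<phi> c * l - \<delta> * h * E y <= F (z - l)" using \<zeta>(3) by (simp add: mult.commute)
   then show ?thesis using z unfolding z_def l_def by simp
  qed
 qed
 have "P h F c - \<phi> c * (\<integral>y. step_loss \<delta> b h (c + y) \<partial>\<mu> h) - \<delta> * h * (K * exp (be * c) * step_error be h) =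
   (\<integral>y. F (c + y) - \<phi> c * step_loss \<delta> b h (c + y) - \<delta> * h * E y \<partial>\<mu> h)"
  unfolding P_def using iF iL iE h by simp
 also have "\<dots> <= (\<integral>y. F (step_map \<delta> b h (c + y)) \<partial>\<mu> h)"
  by (rule integral_mono) (use iF iL iE h exp_lip_step_int[OF F be h] pt in auto)
 finally show ?thesis .
qed

text \<open>The error must be \<open>o(h)\<close> uniformly in \<open>c\<close>, as about
  \<open>T / h\<close> steps are summed. \<open>r\<close> controls the moduli and \<open>d3\<close>
  the terms with a further factor \<open>h\<close>; together they use three quarters of
  \<open>e\<close>.\<close>

lemma step_estimate:
 assumes tr: "smooth_triple q be F g \<phi>" and be: "0 <= be" and inc: "\<And>v. v <= 0 ==> F v <= F 0" and e: "0 < e"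
 obtains d where "d > 0" "\<And>h c. 0 < h ==> h < d ==> 0 <= c ==> c <= a ==>
  F c + h * g c - \<phi> c * (\<integral>y. step_loss \<delta> b h (c + y) \<partial>\<mu> h) - h * e <= exp (- q * h) * (\<integral>y. F (step_map \<delta> b h (c + y)) \<partial>\<mu> h)"
proof -
 obtain CF C K where lip: "exp_lip be CF F" "exp_lip be C g" "exp_lip be K \<phi>"
  and der: "\<And>v. (F has_real_derivative \<phi> v) (at v)" and pair: "dynkin_pair q F g"
  using tr unfolding smooth_triple_def by blast
 have C: "0 <= C" "0 <= K" using lip exp_lip_nonneg by blast+
 define A where "A = exp (be * a)"
 define B where "B = \<bar>g 0\<bar> + C * A + \<bar>\<phi> 0\<bar> + K * A"
 have B: "\<bar>g c\<bar> <= B" "\<bar>\<phi> c\<bar> <= B" if "0 <= c" "c <= a" for c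
 proof -
  have "\<bar>exp (be * c) - exp (be * 0)\<bar> <= A" using that be unfolding A_def by (auto simp: abs_le_iff mult_left_mono intro: order_trans[of _ "exp (be * c)"])
  then have "\<bar>g c - g 0\<bar> <= C * A" "\<bar>\<phi> c - \<phi> 0\<bar> <= K * A"
   using exp_lipD[OF lip(2), of c 0] exp_lipD[OF lip(3), of c 0] C by (meson mult_left_mono order_trans)+
  moreover have "0 <= C * A" "0 <= K * A" using C unfolding A_def by auto
  ultimately show "\<bar>g c\<bar> <= B" "\<bar>\<phi> c\<bar> <= B" unfolding B_def by linarith+
 qed
 have A0: "0 < A" unfolding A_def by simp
 have B0: "0 <= B" unfolding B_def using C A0 by simp
 define r where "r = e / (4 * (C + \<delta> * K + 1) * A)"
 have r: "0 < r" unfolding r_def using e A0 C \<delta> by (intro divide_pos_pos mult_pos_pos) (auto simp: add_nonneg_pos)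
 obtain d1 where d1: "d1 > 0" "\<And>t. 0 <= t ==> t < d1 ==> \<rho> be t < r" using \<rho>_small[OF be r] by blast
 have "((\<lambda>h. exp (h * \<psi> be) * (1 - exp (- be * (\<delta> * h)))) \<longlongrightarrow> exp (0 * \<psi> be) * (1 - exp (- be * (\<delta> * 0)))) (at_right 0)"
  by (intro tendsto_intros)
 then have "\<forall>\<^sub>F h in at_right 0. exp (h * \<psi> be) * (1 - exp (- be * (\<delta> * h))) < r" by (rule order_tendstoD) (use r in simp)
 then obtain d2 where d2: "d2 > 0" "\<And>h. 0 < h ==> h < d2 ==> exp (h * \<psi> be) * (1 - exp (- be * (\<delta> * h))) < r"
  unfolding eventually_at_right_field by auto
 define d3 where "d3 = e / (4 * (B * q * (1 + \<delta>) + 1))"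
 have d3: "d3 > 0" unfolding d3_def using e B0 q \<delta> by (intro divide_pos_pos mult_pos_pos) (auto simp: add_nonneg_pos)
 show ?thesis
 proof (rule that[of "min d1 (min d2 d3)"])
  show "0 < min d1 (min d2 d3)" using d1 d2 d3 by simp
  fix h c assume h: "0 < h" "h < min d1 (min d2 d3)" and c: "0 <= c" "c <= a"
  have ec: "exp (be * c) <= A" unfolding A_def using c be by (simp add: mult_left_mono)
  have se: "0 <= step_error be h" "step_error be h <= 2 * r"
  proof -
   show "0 <= step_error be h" unfolding step_error_def using \<rho>_nonneg be \<delta> h by (intro add_nonneg_nonneg mult_nonneg_nonneg) auto
   show "step_error be h <= 2 * r" unfolding step_error_def using d1(2)[of h] d2(2)[of h] h by simp
  qed
  define L where "L = (\<integral>y. step_loss \<delta> b h (c + y) \<partial>\<mu> h)"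
  have L: "0 <= L" "L <= \<delta> * h" unfolding L_def using step_loss_int[OF h(1)] by auto
  define J where "J = (\<integral>y. F (step_map \<delta> b h (c + y)) \<partial>\<mu> h)"
  define x1 where "x1 = exp (- q * h)"
  have x1: "0 < x1" "x1 <= 1" "1 - x1 <= q * h"
   unfolding x1_def using q h exp_ge_add_one_self[of "- q * h"] by auto
  have s1: "P h F c - \<phi> c * L - \<delta> * h * (K * exp (be * c) * step_error be h) <= J"
   unfolding L_def J_def by (rule step_expectation[OF lip(1,3) der be h(1) inc])
  have "\<delta> * h * (K * exp (be * c) * step_error be h) <= \<delta> * h * (K * A * (2 * r))"
   using \<delta> h C ec se A0 by (intro mult_left_mono mult_mono) auto
  then have s2: "P h F c - \<phi> c * L - \<delta> * h * (K * A * (2 * r)) <= J" using s1 by linarith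
  have "x1 * (P h F c - \<phi> c * L - \<delta> * h * (K * A * (2 * r))) <= x1 * J" using s2 x1 by (intro mult_left_mono) auto
  moreover have "x1 * P h F c = F c + dynkin_int q h g c" using pair h unfolding dynkin_pair_def x1_def by simp
  moreover have "h * g c - h * (C * exp (be * c) * r + q * h * \<bar>g c\<bar>) <= dynkin_int q h g c"
   using dynkin_int_near[OF lip(2) be q, of h r c] d1(2) h by (force simp: abs_le_iff intro: less_imp_le)
  moreover have "x1 * (\<phi> c * L) <= \<phi> c * L + q * h * B * (\<delta> * h)"
  proof -
   have "x1 * (\<phi> c * L) - \<phi> c * L <= \<bar>(1 - x1) * (\<phi> c * L)\<bar>" by (simp add: algebra_simps abs_le_iff)
   also have "\<dots> = (1 - x1) * (\<bar>\<phi> c\<bar> * L)" using x1 L by (simp add: abs_mult)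
   also have "\<dots> <= (q * h) * (B * (\<delta> * h))" using x1 L B(2)[OF c] B0 by (intro mult_mono) auto
   finally show ?thesis by (simp add: mult_ac)
  qed
  moreover have "x1 * (\<delta> * h * (K * A * (2 * r))) <= 1 * (\<delta> * h * (K * A * (2 * r)))"
   using x1 \<delta> h C A0 r by (intro mult_right_mono) auto
  moreover have "h * (C * exp (be * c) * r + q * h * \<bar>g c\<bar>) <= h * (C * A * r + q * h * B)"
   using h C ec r q B(1)[OF c] by (intro mult_left_mono add_mono mult_right_mono) auto
  ultimately have "F c + h * g c - h * (C * A * r + q * h * B) - (\<phi> c * L + q * h * B * (\<delta> * h)) - \<delta> * h * (K * A * (2 * r)) <= x1 * J"
   unfolding right_diff_distrib by linarith
  moreover have "h * (C * A * r + q * h * B) + q * h * B * (\<delta> * h) + \<delta> * h * (K * A * (2 * r)) <= h * e"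
  proof -
   have "h * (C * A * r + q * h * B) + q * h * B * (\<delta> * h) + \<delta> * h * (K * A * (2 * r)) = h * ((C + 2 * \<delta> * K) * A * r + h * (B * q * (1 + \<delta>)))"
    by (simp add: algebra_simps)
   also have "\<dots> <= h * (e / 2 + e / 4)"
   proof (intro mult_left_mono add_mono)
    have "(C + 2 * \<delta> * K) * A * r <= (2 * (C + \<delta> * K + 1)) * A * r" using C \<delta> A0 r by (intro mult_right_mono) auto
    also have "\<dots> = e / 2" unfolding r_def using A0 C \<delta>
     by (simp add: divide_simps) (smt (verit) mult_nonneg_nonneg)
    finally show "(C + 2 * \<delta> * K) * A * r <= e / 2" .
    have "h * (B * q * (1 + \<delta>)) <= d3 * (B * q * (1 + \<delta>) + 1)" using h B0 q \<delta> by (intro mult_mono) auto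
    also have "\<dots> = e / 4"
    proof -
     have "0 <= B * q * (1 + \<delta>)" using B0 q \<delta> by simp
     then show ?thesis unfolding d3_def by (simp add: divide_simps)
    qed
    finally show "h * (B * q * (1 + \<delta>)) <= e / 4" .
   qed (use h in auto)
   also have "\<dots> <= h * e" using h e by (intro mult_left_mono) auto
   finally show ?thesis .
  qed
  ultimately show "F c + h * g c - \<phi> c * L - h * e <= exp (- q * h) * J" unfolding x1_def by linarith
 qed
qed

text \<open>Quantifies that upward jumps have no rate. The indicator is dominated by
  \<open>(exp (B * y) - 1)^2 / (exp (B * \<eta>) - 1)^2\<close>; the square vanishes at
  \<open>y = 0\<close>, so its weighted mean is of order \<open>h\<close>. The slope in
  \<open>h\<close> grows at most quadratically in \<open>B\<close> and the denominator
  exponentially, so a large \<open>B\<close> makes the rate small.\<close>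

lemma overshoot_small:
 assumes be: "0 <= be" and \<eta>: "0 < \<eta>" and e: "0 < e"
 obtains d where "d > 0" "\<And>h. 0 < h ==> h < d ==> (\<integral>y. exp (be * y) * indicator {\<eta><..} y \<partial>\<mu> h) <= h * e"
proof -
 obtain C where C: "0 <= C" "\<And>th. 0 <= th ==> \<psi> th <= C * (1 + th\<^sup>2)" using quad by blast
 obtain th0 where th0: "\<And>th. th0 <= th ==> q < \<psi> th - \<delta> * th" using diverges by blast
 have "((\<lambda>B. (C * (1 + (be + 2 * B)\<^sup>2) + \<bar>\<psi> be\<bar>) / (exp (B * \<eta>) - 1)\<^sup>2) \<longlongrightarrow> 0) at_top"
 proof -
  have "((\<lambda>B. (1 + (be + 2 * B)\<^sup>2) / (exp (B * \<eta>) - 1)\<^sup>2) \<longlongrightarrow> 0) at_top" using \<eta> by real_asymp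
  moreover have "((\<lambda>B. 1 / (exp (B * \<eta>) - 1)\<^sup>2) \<longlongrightarrow> 0) at_top" using \<eta> by real_asymp
  ultimately have "((\<lambda>B. C * ((1 + (be + 2 * B)\<^sup>2) / (exp (B * \<eta>) - 1)\<^sup>2) + \<bar>\<psi> be\<bar> * (1 / (exp (B * \<eta>) - 1)\<^sup>2)) \<longlongrightarrow> C * 0 + \<bar>\<psi> be\<bar> * 0) at_top"
   by (intro tendsto_add tendsto_mult tendsto_const)
  moreover have "C * ((1 + (be + 2 * B)\<^sup>2) / (exp (B * \<eta>) - 1)\<^sup>2) + \<bar>\<psi> be\<bar> * (1 / (exp (B * \<eta>) - 1)\<^sup>2) =
    (C * (1 + (be + 2 * B)\<^sup>2) + \<bar>\<psi> be\<bar>) / (exp (B * \<eta>) - 1)\<^sup>2" for B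
   by (simp add: add_divide_distrib[of "C * (1 + (be + 2 * B)\<^sup>2)" "\<bar>\<psi> be\<bar>"])
  ultimately show ?thesis by simp
 qed
 then have "\<forall>\<^sub>F B in at_top. (C * (1 + (be + 2 * B)\<^sup>2) + \<bar>\<psi> be\<bar>) / (exp (B * \<eta>) - 1)\<^sup>2 < e" by (rule order_tendstoD) (rule e)
 moreover have "\<forall>\<^sub>F B::real in at_top. max th0 1 <= B" by (rule eventually_ge_at_top)
 ultimately have "\<exists>B. (C * (1 + (be + 2 * B)\<^sup>2) + \<bar>\<psi> be\<bar>) / (exp (B * \<eta>) - 1)\<^sup>2 < e \<and> max th0 1 <= B"
  using eventually_happens'[OF trivial_limit_at_top_linorder] eventually_conj by fast
 then obtain B where B: "(C * (1 + (be + 2 * B)\<^sup>2) + \<bar>\<psi> be\<bar>) / (exp (B * \<eta>) - 1)\<^sup>2 < e" "th0 <= B" "1 <= B" by auto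
 define p1 p2 p3 where "p1 = \<psi> (be + 2 * B)" and "p2 = \<psi> (be + B)" and "p3 = \<psi> be"
 define S where "S = (exp (B * \<eta>) - 1)\<^sup>2"
 have S: "0 < S" unfolding S_def using B \<eta> by simp
 have "q < p2 - \<delta> * (be + B)" unfolding p2_def using th0[of "be + B"] be B by simp
 moreover have "0 <= \<delta> * (be + B)" using \<delta> be B by simp
 \<comment> \<open>Lets the middle term of the second difference be dropped, so that an upper bound
   on \<open>p1\<close> suffices.\<close>
 ultimately have p2: "0 < p2" using q by linarith
 have "p1 <= C * (1 + (be + 2 * B)\<^sup>2)" unfolding p1_def using C(2) be B by simp
 then have "p1 - 2 * p2 + p3 <= C * (1 + (be + 2 * B)\<^sup>2) + \<bar>\<psi> be\<bar>" using p2 unfolding p3_def by linarith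
 also have "\<dots> < e * S" using B(1) S unfolding S_def by (simp add: pos_divide_less_eq)
 finally have less: "p1 - 2 * p2 + p3 < e * S" .
 define f where "f h = exp (h * p1) - 2 * exp (h * p2) + exp (h * p3)" for h
 have "(f has_real_derivative (p1 - 2 * p2 + p3)) (at 0)" unfolding f_def by (auto intro!: derivative_eq_intros)
 then have "((\<lambda>h. (f h - f 0) / h) \<longlongrightarrow> p1 - 2 * p2 + p3) (at 0)" unfolding has_field_derivative_iff by simp
 then have "((\<lambda>h. f h / h) \<longlongrightarrow> p1 - 2 * p2 + p3) (at_right 0)"
  using tendsto_mono[OF at_le[of "{0<..}" UNIV]] by (simp add: f_def)
 then have "\<forall>\<^sub>F h in at_right 0. f h / h < e * S" using less by (rule order_tendstoD)
 then obtain d where d: "d > 0" "\<And>h. 0 < h ==> h < d ==> f h / h < e * S" unfolding eventually_at_right_field by auto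
 show ?thesis
 proof (rule that[OF d(1)])
  fix h assume h: "0 < h" "h < d"
  have h0: "0 <= h" using h by simp
  have ex: "integrable (\<mu> h) (\<lambda>y. exp ((be + 2 * B) * y))" "integrable (\<mu> h) (\<lambda>y. exp ((be + B) * y))" "integrable (\<mu> h) (\<lambda>y. exp (be * y))"
   using be B h0 by (intro integrable_exp; simp)+
  have val: "(\<integral>y. exp ((be + 2 * B) * y) \<partial>\<mu> h) = exp (h * p1)" "(\<integral>y. exp ((be + B) * y) \<partial>\<mu> h) = exp (h * p2)" "(\<integral>y. exp (be * y) \<partial>\<mu> h) = exp (h * p3)"
   unfolding p1_def p2_def p3_def using be B h0 by (intro integral_exp; simp)+
  have sq: "exp (be * y) * (exp (B * y) - 1)\<^sup>2 = exp ((be + 2 * B) * y) - 2 * exp ((be + B) * y) + exp (be * y)" for y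
   by (simp add: power2_eq_square algebra_simps exp_add[symmetric])
  have "(\<integral>y. exp (be * y) * indicator {\<eta><..} y \<partial>\<mu> h) <= (\<integral>y. (exp ((be + 2 * B) * y) - 2 * exp ((be + B) * y) + exp (be * y)) / S \<partial>\<mu> h)"
  proof (rule integral_mono)
   show "integrable (\<mu> h) (\<lambda>y. exp (be * y) * indicator {\<eta><..} y)"
    by (rule integrable_real_mult_indicator) (use ex in auto)
   show "integrable (\<mu> h) (\<lambda>y. (exp ((be + 2 * B) * y) - 2 * exp ((be + B) * y) + exp (be * y)) / S)" using ex by simp
   fix y
   show "exp (be * y) * indicator {\<eta><..} y <= (exp ((be + 2 * B) * y) - 2 * exp ((be + B) * y) + exp (be * y)) / S"
   proof (cases "\<eta> < y")
    case True
    have "S <= (exp (B * y) - 1)\<^sup>2" unfolding S_def using True B \<eta> by (intro power_mono) auto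
    then have "exp (be * y) * S <= exp (be * y) * (exp (B * y) - 1)\<^sup>2" by simp
    then show ?thesis unfolding sq using S True by (simp add: pos_le_divide_eq)
   next
    case False
    have "0 <= exp (be * y) * (exp (B * y) - 1)\<^sup>2" by simp
    then show ?thesis unfolding sq using S False by simp
   qed
  qed
  also have "\<dots> = f h / S" unfolding f_def using ex val by simp
  also have "\<dots> <= h * e"
  proof -
   have "f h < e * S * h" using d(2)[OF h] h by (simp add: pos_divide_less_eq)
   then show ?thesis using S by (simp add: pos_divide_le_eq mult_ac)
  qed
  finally show "(\<integral>y. exp (be * y) * indicator {\<eta><..} y \<partial>\<mu> h) <= h * e" .
 qed
qed

end

section \<open>The stopped discretisation\<close>

context refraction
begin

text \<open>The chain is frozen at its first value above \<open>a\<close>, so the overshoot stays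
  visible in the final state.\<close>

definition stop_map :: "real => real => real => real => real" where
 "stop_map a h z d = (if a < z then z else step_map \<delta> b h (z + d))"

definition Z :: "real => real => real => nat => 'a => real" where
 "Z a h w k om = recur (stop_map a h) w (\<lambda>i. inc h i om) k"

abbreviation alive :: "real => real => real => nat => 'a => real" where
 "alive a h w k om \<equiv> indicator {..a} (Z a h w k om)"

text \<open>The clock of the discount: it stops together with the chain.\<close>

definition steps :: "real => real => real => nat => 'a => real" where
 "steps a h w n om = (\<Sum>k<n. alive a h w k om)"

lemma stop_map_meas: "case_prod (stop_map a h) \<in> borel_measurable (borel \<Otimes>\<^sub>M borel)"
 unfolding stop_map_def case_prod_unfold by measurable

lemma Z_meas: "0 <= h ==> Z a h w k \<in> borel_measurable M"
 using recur_meas[OF _ stop_map_meas, of h a h w k] unfolding Z_def by simp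

lemma Z_0[simp]: "Z a h w 0 om = w"
 unfolding Z_def by simp

lemma Z_Suc: "Z a h w (Suc k) om = (if a < Z a h w k om then Z a h w k om else step_map \<delta> b h (Z a h w k om + inc h k om))"
 unfolding Z_def by (simp add: stop_map_def)

lemma Z_nonneg: "0 < h ==> 0 <= w ==> 0 <= Z a h w k om"
 by (induction k) (auto simp: Z_Suc step_loss_bounds(3)[OF \<delta> _ b])

lemma Z_stays: "a < Z a h w k om ==> k <= n ==> Z a h w n om = Z a h w k om"
proof (induction n)
 case (Suc n)
 then show ?case by (cases "k = Suc n") (auto simp: Z_Suc)
qed simp

lemma alive_before: "Z a h w n om <= a ==> k <= n ==> Z a h w k om <= a"
 using Z_stays[of a h w k om n] by force

lemma steps_alive: "Z a h w n om <= a ==> steps a h w n om = real n"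
 unfolding steps_def using alive_before[of a h w n om] by (simp add: indicator_def)

lemma steps_le: "steps a h w n om <= real n" "0 <= steps a h w n om"
proof -
 have "steps a h w n om <= (\<Sum>k<n. 1)" unfolding steps_def by (intro sum_mono) (auto simp: indicator_def)
 then show "steps a h w n om <= real n" by simp
 show "0 <= steps a h w n om" unfolding steps_def by (intro sum_nonneg) auto
qed

lemma Z_chain:
 "Z a h w k om <= a \<longleftrightarrow> (\<forall>j\<le>k. chain \<delta> b h w (increments (\<lambda>t. X t om) h) j <= a)"
 "Z a h w k om <= a ==> Z a h w k om = chain \<delta> b h w (increments (\<lambda>t. X t om) h) k"
proof (induction k)
 case 0 { case 1 show ?case by simp next case 2 show ?case by simp }
next
 case (Suc k)
 {
  case 1
  show ?case
  proof (cases "Z a h w k om <= a")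
   case True
   then have "Z a h w (Suc k) om = chain \<delta> b h w (increments (\<lambda>t. X t om) h) (Suc k)"
    using Suc.IH(2) by (simp add: Z_Suc inc_def)
   then show ?thesis using Suc.IH(1) True by (auto simp: le_Suc_eq)
  next
   case False
   then show ?thesis using Suc.IH(1) by (auto simp: Z_Suc le_Suc_eq)
  qed
 next
  case 2
  then have "Z a h w k om <= a" using alive_before[of a h w "Suc k" om k] by simp
  then show ?case using Suc.IH(2) by (simp add: Z_Suc inc_def)
 }
qed

definition payoff :: "real => real => real => (real => real) => nat => 'a => real" where
 "payoff a h w F n om = exp (- q * (h * steps a h w n om)) * F (Z a h w n om)"

lemma payoff_telescope:
 "payoff a h w F n om = F w + (\<Sum>k<n. exp (- q * (real k * h)) *
   (alive a h w k om * (exp (- q * h) * F (step_map \<delta> b h (Z a h w k om + inc h k om)) - F (Z a h w k om))))"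
proof (induction n)
 case 0 show ?case by (simp add: payoff_def steps_def)
next
 case (Suc n)
 have "payoff a h w F (Suc n) om = payoff a h w F n om + exp (- q * (real n * h)) *
   (alive a h w n om * (exp (- q * h) * F (step_map \<delta> b h (Z a h w n om + inc h n om)) - F (Z a h w n om)))"
 proof (cases "Z a h w n om <= a")
  case True
  then have s: "steps a h w n om = real n" "steps a h w (Suc n) om = real n + 1" using steps_alive[OF True] by (auto simp: steps_def)
  have z: "Z a h w (Suc n) om = step_map \<delta> b h (Z a h w n om + inc h n om)" using True by (simp add: Z_Suc)
  have "exp (- q * (h * (real n + 1))) = exp (- q * (real n * h)) * exp (- q * h)" by (simp add: exp_add[symmetric] algebra_simps)
  then show ?thesis unfolding payoff_def s z using True by (simp add: algebra_simps)
 next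
  case False
  then show ?thesis by (simp add: payoff_def steps_def Z_Suc)
 qed
 then show ?case using Suc by simp
qed

definition running :: "real => real => real => (real => real) => (real => real) => nat => 'a => real" where
 "running a h w g \<phi> n om = (\<Sum>k<n. exp (- q * (real k * h)) * (alive a h w k om *
   (h * g (Z a h w k om) - \<phi> (Z a h w k om) * step_loss \<delta> b h (Z a h w k om + inc h k om))))"

lemma exp_lip_bounded:
 assumes "exp_lip be C u" "0 <= be" "0 <= z" "z <= a"
 shows "\<bar>u z\<bar> <= \<bar>u 0\<bar> + C * exp (be * a)"
proof -
 have C: "0 <= C" by (rule exp_lip_nonneg[OF assms(1)])
 have "exp (be * z) <= exp (be * a)" "1 <= exp (be * z)" using assms by (simp_all add: mult_left_mono)
 then have "\<bar>exp (be * z) - 1\<bar> <= exp (be * a)" by linarith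
 then have "\<bar>exp (be * z) - exp (be * 0)\<bar> <= exp (be * a)" by (simp only: mult_zero_right exp_zero)
 then have "C * \<bar>exp (be * z) - exp (be * 0)\<bar> <= C * exp (be * a)" by (rule mult_left_mono[OF _ C])
 then show ?thesis using exp_lipD[OF assms(1), of z 0] by linarith
qed

lemma inc_exp_int: "0 <= be ==> 0 <= h ==> integrable M (\<lambda>om. exp (be * inc h k om))"
proof -
 assume *: "0 <= be" "0 <= h"
 then have "integrable (distr M borel (inc h k)) (\<lambda>y. exp (be * y))" unfolding inc_distr[OF *(2)] by (rule integrable_exp)
 then show ?thesis by (subst (asm) integrable_distr_eq) (use inc_meas[OF *(2)] in auto)
qed

lemma F_step_int:
 assumes F: "exp_lip be C F" and be: "0 <= be" and h: "0 < h" and w: "0 <= w"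
 shows "integrable M (\<lambda>om. alive a h w k om * F (step_map \<delta> b h (Z a h w k om + inc h k om)))"
proof (rule Bochner_Integration.integrable_bound[of _ "\<lambda>om. \<bar>F 0\<bar> + C * (1 + exp (be * a) * exp (be * inc h k om))"])
 have h0: "0 <= h" using h by simp
 have C: "0 <= C" by (rule exp_lip_nonneg[OF F])
 note [measurable] = exp_lip_meas[OF F] Z_meas[OF h0] inc_meas[OF h0]
 show "integrable M (\<lambda>om. \<bar>F 0\<bar> + C * (1 + exp (be * a) * exp (be * inc h k om)))" using inc_exp_int[OF be h0] by simp
 show "(\<lambda>om. alive a h w k om * F (step_map \<delta> b h (Z a h w k om + inc h k om))) \<in> borel_measurable M" by measurable
 show "AE om in M. norm (alive a h w k om * F (step_map \<delta> b h (Z a h w k om + inc h k om))) <= norm (\<bar>F 0\<bar> + C * (1 + exp (be * a) * exp (be * inc h k om)))"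
 proof (rule AE_I2)
  fix om
  define z y where "z = Z a h w k om" and "y = inc h k om"
  show "norm (indicator {..a} z * F (step_map \<delta> b h (z + y))) <= norm (\<bar>F 0\<bar> + C * (1 + exp (be * a) * exp (be * y)))"
  proof (cases "z <= a")
   case True
   define s where "s = step_map \<delta> b h (z + y)"
   have s: "0 <= s" "s <= max (z + y) 0" unfolding s_def using step_loss_bounds(3,6)[OF \<delta> h b] by auto
   have "exp (be * s) <= exp (be * max (z + y) 0)" using s be by (simp add: mult_left_mono)
   also have "\<dots> <= 1 + exp (be * (z + y))" by (auto simp: max_def)
   also have "exp (be * (z + y)) <= exp (be * (a + y))" using True be by (simp add: mult_left_mono)
   finally have "\<bar>exp (be * s) - exp (be * 0)\<bar> <= 1 + exp (be * a) * exp (be * y)"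
    using s be by (simp add: distrib_left exp_add)
   then have "C * \<bar>exp (be * s) - exp (be * 0)\<bar> <= C * (1 + exp (be * a) * exp (be * y))" by (rule mult_left_mono[OF _ C])
   then show ?thesis using exp_lipD[OF F, of s 0] True unfolding s_def[symmetric] by simp
  qed (use C in simp)
 qed
qed

lemma bounded_alive_int:
 assumes u: "exp_lip be C u" and be: "0 <= be" and h: "0 < h" and w: "0 <= w"
  and l: "l \<in> borel_measurable borel" "\<And>y. 0 <= l y" "\<And>y. l y <= B"
 shows "integrable M (\<lambda>om. alive a h w k om * (u (Z a h w k om) * l (Z a h w k om + inc h k om)))"
proof (rule integrable_const_bound[where B = "(\<bar>u 0\<bar> + C * exp (be * a)) * B"])
 have h0: "0 <= h" using h by simp
 note [measurable] = exp_lip_meas[OF u] Z_meas[OF h0] inc_meas[OF h0] l(1)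
 show "(\<lambda>om. alive a h w k om * (u (Z a h w k om) * l (Z a h w k om + inc h k om))) \<in> borel_measurable M" by measurable
 show "AE om in M. norm (alive a h w k om * (u (Z a h w k om) * l (Z a h w k om + inc h k om))) <= (\<bar>u 0\<bar> + C * exp (be * a)) * B"
 proof (rule AE_I2)
  fix om
  have C: "0 <= C" by (rule exp_lip_nonneg[OF u])
  have B: "0 <= B" using l(2,3) order_trans by blast
  show "norm (alive a h w k om * (u (Z a h w k om) * l (Z a h w k om + inc h k om))) <= (\<bar>u 0\<bar> + C * exp (be * a)) * B"
  proof (cases "Z a h w k om <= a")
   case True
   have "\<bar>u (Z a h w k om)\<bar> * l (Z a h w k om + inc h k om) <= (\<bar>u 0\<bar> + C * exp (be * a)) * B"
    using exp_lip_bounded[OF u be Z_nonneg[OF h w] True] l C by (intro mult_mono) auto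
   then show ?thesis using True l(2) by (simp add: abs_mult)
  qed (use C B in simp)
 qed
qed

text \<open>Freezing the current state turns \<open>step_estimate\<close> into a bound in
  expectation for every step. Up to the horizon the errors \<open>h * e'\<close> add up to at most
  \<open>T * e'\<close>, hence the choice of \<open>e'\<close>.\<close>

lemma discrete_dynkin:
 assumes tr: "smooth_triple q be F g \<phi>" and be: "0 <= be" and inc': "\<And>v. v <= 0 ==> F v <= F 0" and e: "0 < e"
  and T: "0 <= T" and w: "0 <= w"
 obtains d where "d > 0" "\<And>h n. 0 < h ==> h < d ==> real n * h <= T ==>
  integrable M (payoff a h w F n) \<and> integrable M (running a h w g \<phi> n) \<and>
  F w + (\<integral>om. running a h w g \<phi> n om \<partial>M) - e <= (\<integral>om. payoff a h w F n om \<partial>M)"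
proof -
 obtain CF C K where lip: "exp_lip be CF F" "exp_lip be C g" "exp_lip be K \<phi>"
  using tr unfolding smooth_triple_def by blast
 define e' where "e' = e / (T + 1)"
 have e': "0 < e'" unfolding e'_def using e T by simp
 obtain d where d: "d > 0" "\<And>h c. 0 < h ==> h < d ==> 0 <= c ==> c <= a ==>
  F c + h * g c - \<phi> c * (\<integral>y. step_loss \<delta> b h (c + y) \<partial>\<mu> h) - h * e' <= exp (- q * h) * (\<integral>y. F (step_map \<delta> b h (c + y)) \<partial>\<mu> h)"
  using step_estimate[OF tr be inc' e'] by blast
 show ?thesis
 proof (rule that[OF d(1)])
  fix h n assume h: "0 < h" "h < d" and n: "real n * h <= T"
  have h0: "0 <= h" using h by simp
  interpret \<mu>: prob_space "\<mu> h" by (rule prob_\<mu>[OF h0])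
  note sl = step_loss_bounds[OF \<delta> h(1) b]
  define D where "D k om = alive a h w k om * (exp (- q * h) * F (step_map \<delta> b h (Z a h w k om + inc h k om)) - F (Z a h w k om))" for k om
  define G where "G k om = alive a h w k om * (h * g (Z a h w k om) - \<phi> (Z a h w k om) * step_loss \<delta> b h (Z a h w k om + inc h k om))" for k om
  have one: "integrable M (\<lambda>om. alive a h w k om * u (Z a h w k om))" if "exp_lip be C' u" for u C' k
   using bounded_alive_int[OF that be h(1) w, of "\<lambda>_. 1" 1 a k] by simp
  have iD: "integrable M (D k)" for k
  proof -
   have "integrable M (\<lambda>om. exp (- q * h) * (alive a h w k om * F (step_map \<delta> b h (Z a h w k om + inc h k om))) - alive a h w k om * F (Z a h w k om))"
    by (intro Bochner_Integration.integrable_diff integrable_mult_right F_step_int[OF lip(1) be h(1) w] one[OF lip(1)])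
   then show ?thesis unfolding D_def by (simp add: algebra_simps)
  qed
  have iG: "integrable M (G k)" for k
  proof -
   have "integrable M (\<lambda>om. h * (alive a h w k om * g (Z a h w k om)) - alive a h w k om * (\<phi> (Z a h w k om) * step_loss \<delta> b h (Z a h w k om + inc h k om)))"
    by (intro Bochner_Integration.integrable_diff integrable_mult_right one[OF lip(2)] bounded_alive_int[OF lip(3) be h(1) w]) (use sl in auto)
   then show ?thesis unfolding G_def by (simp add: algebra_simps)
  qed
  have val: "payoff a h w F n om = F w + (\<Sum>k<n. exp (- q * (real k * h)) * D k om)" for om
   unfolding D_def by (rule payoff_telescope)
  have run: "running a h w g \<phi> n om = (\<Sum>k<n. exp (- q * (real k * h)) * G k om)" for om
   unfolding running_def G_def ..
  have iv: "integrable M (payoff a h w F n)" unfolding val using iD by simp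
  have ir: "integrable M (running a h w g \<phi> n)" unfolding run using iG by simp
  have step: "(\<integral>om. G k om \<partial>M) - h * e' <= (\<integral>om. D k om \<partial>M)" for k
  proof -
   note [measurable] = exp_lip_meas[OF lip(1)] exp_lip_meas[OF lip(2)] exp_lip_meas[OF lip(3)]
   define \<Phi> where "\<Phi> z y = indicator {..a} z * (exp (- q * h) * F (step_map \<delta> b h (z + y)) - F z) -
     indicator {..a} z * (h * g z - \<phi> z * step_loss \<delta> b h (z + y))" for z y
   have \<Phi>: "case_prod \<Phi> \<in> borel_measurable (borel \<Otimes>\<^sub>M borel)" unfolding \<Phi>_def case_prod_unfold by measurable
   have eq: "\<Phi> (recur (stop_map a h) w (\<lambda>i. inc h i om) k) (inc h k om) = D k om - G k om" for om
    unfolding \<Phi>_def D_def G_def Z_def ..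
   have i: "integrable M (\<lambda>om. \<Phi> (recur (stop_map a h) w (\<lambda>i. inc h i om) k) (inc h k om))" unfolding eq using iD iG by simp
   note ri = recur_integral[OF h0 stop_map_meas \<Phi> i]
   have ge: "- (h * e') <= (\<integral>y. \<Phi> z y \<partial>\<mu> h)" if z: "0 <= z" for z
   proof (cases "z <= a")
    case True
    have "(\<integral>y. \<Phi> z y \<partial>\<mu> h) = (\<integral>y. exp (- q * h) * F (step_map \<delta> b h (z + y)) - F z - h * g z + \<phi> z * step_loss \<delta> b h (z + y) \<partial>\<mu> h)"
     unfolding \<Phi>_def using True by (intro Bochner_Integration.integral_cong) (auto simp: algebra_simps)
    also have "\<dots> = exp (- q * h) * (\<integral>y. F (step_map \<delta> b h (z + y)) \<partial>\<mu> h) - F z - h * g z + \<phi> z * (\<integral>y. step_loss \<delta> b h (z + y) \<partial>\<mu> h)"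
     using exp_lip_step_int[OF lip(1) be h(1), of z] step_loss_int(1)[OF h(1), of z] by (simp add: \<mu>.prob_space[simplified])
    finally show ?thesis using d(2)[OF h z True] by linarith
   next
    case False
    then show ?thesis unfolding \<Phi>_def using h e' by simp
   qed
   have "- (h * e') = (\<integral>om. - (h * e') \<partial>M)" by (simp add: prob_space)
   also have "\<dots> <= (\<integral>om. (\<integral>y. \<Phi> (recur (stop_map a h) w (\<lambda>i. inc h i om) k) y \<partial>\<mu> h) \<partial>M)"
    by (rule integral_mono) (use ri(1) ge Z_nonneg[OF h(1) w, of a k] in "auto simp: Z_def")
   also have "\<dots> = (\<integral>om. D k om - G k om \<partial>M)" unfolding ri(2)[symmetric] eq ..
   also have "\<dots> = (\<integral>om. D k om \<partial>M) - (\<integral>om. G k om \<partial>M)" using iD iG by simp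
   finally show ?thesis by simp
  qed
  have "(\<integral>om. payoff a h w F n om \<partial>M) = F w + (\<Sum>k<n. exp (- q * (real k * h)) * (\<integral>om. D k om \<partial>M))"
   unfolding val using iD by (simp add: prob_space)
  moreover have "(\<integral>om. running a h w g \<phi> n om \<partial>M) = (\<Sum>k<n. exp (- q * (real k * h)) * (\<integral>om. G k om \<partial>M))"
   unfolding run using iG by simp
  moreover have "(\<Sum>k<n. exp (- q * (real k * h)) * (\<integral>om. G k om \<partial>M)) <= (\<Sum>k<n. exp (- q * (real k * h)) * (\<integral>om. D k om \<partial>M) + h * e')"
  proof (rule sum_mono)
   fix k
   have "exp (- q * (real k * h)) * (\<integral>om. G k om \<partial>M) <= exp (- q * (real k * h)) * ((\<integral>om. D k om \<partial>M) + h * e')"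
    using step[of k] by (intro mult_left_mono) auto
   also have "\<dots> = exp (- q * (real k * h)) * (\<integral>om. D k om \<partial>M) + exp (- q * (real k * h)) * (h * e')" by (simp add: distrib_left)
   also have "exp (- q * (real k * h)) * (h * e') <= 1 * (h * e')" using q h e' by (intro mult_right_mono) auto
   finally show "exp (- q * (real k * h)) * (\<integral>om. G k om \<partial>M) <= exp (- q * (real k * h)) * (\<integral>om. D k om \<partial>M) + h * e'" by simp
  qed
  moreover have "(\<Sum>k<n. exp (- q * (real k * h)) * (\<integral>om. D k om \<partial>M) + h * e') = (\<Sum>k<n. exp (- q * (real k * h)) * (\<integral>om. D k om \<partial>M)) + real n * h * e'"
   by (simp add: sum.distrib)
  moreover have "real n * h * e' <= e"
  proof -
   have "real n * h * e' <= T * e'" using n e' by (intro mult_right_mono) auto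
   also have "\<dots> <= e" unfolding e'_def using e T by (simp add: field_simps)
   finally show ?thesis .
  qed
  ultimately have "F w + (\<integral>om. running a h w g \<phi> n om \<partial>M) - e <= (\<integral>om. payoff a h w F n om \<partial>M)" by linarith
  then show "integrable M (payoff a h w F n) \<and> integrable M (running a h w g \<phi> n) \<and>
   F w + (\<integral>om. running a h w g \<phi> n om \<partial>M) - e <= (\<integral>om. payoff a h w F n om \<partial>M)" using iv ir by blast
 qed
qed

text \<open>The chain leaves from a point at most \<open>a\<close>, so the overshoot is at most the
  positive part of the last increment: at most \<open>\<eta>\<close>, or else a large increment. The
  large ones together contribute at most the horizon times a small rate.\<close>

lemma overshoot_vanishes:
 assumes be: "0 < be" and e: "0 < e" and T: "0 <= T" and w: "0 <= w" "w <= a"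
 obtains d where "d > 0" "\<And>h n. 0 < h ==> h < d ==> real n * h <= T ==>
  integrable M (\<lambda>om. exp (be * max (Z a h w n om) a) - exp (be * a)) \<and>
  (\<integral>om. exp (be * max (Z a h w n om) a) - exp (be * a) \<partial>M) <= e"
proof -
 have a: "0 <= a" using w by simp
 define A where "A = exp (be * a)"
 have A: "0 < A" unfolding A_def by simp
 have "((\<lambda>\<eta>. A * (exp (be * \<eta>) - 1)) \<longlongrightarrow> A * (exp (be * 0) - 1)) (at_right 0)" by (intro tendsto_intros)
 then have "\<forall>\<^sub>F \<eta> in at_right 0. A * (exp (be * \<eta>) - 1) < e / 2" by (rule order_tendstoD) (use e in simp)
 then obtain r where r: "r > 0" "\<And>\<eta>. 0 < \<eta> ==> \<eta> < r ==> A * (exp (be * \<eta>) - 1) < e / 2"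
  unfolding eventually_at_right_field by auto
 define \<eta> where "\<eta> = r / 2"
 have \<eta>: "0 < \<eta>" "A * (exp (be * \<eta>) - 1) < e / 2" using r(1) r(2)[of "r / 2"] unfolding \<eta>_def by auto
 \<comment> \<open>After multiplication by \<open>A\<close> and the horizon, the large increments
   contribute at most \<open>e / 2\<close>.\<close>
 define e' where "e' = e / (2 * A * (T + 1))"
 have e': "0 < e'" unfolding e'_def using e A T by simp
 obtain d where d: "d > 0" "\<And>h. 0 < h ==> h < d ==> (\<integral>y. exp (be * y) * indicator {\<eta><..} y \<partial>\<mu> h) <= h * e'"
  using overshoot_small[OF less_imp_le[OF be] \<eta>(1) e'] by blast
 show ?thesis
 proof (rule that[OF d(1)])
  fix h n assume h: "0 < h" "h < d" and n: "real n * h <= T"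
  have h0: "0 <= h" using h by simp
  note [measurable] = Z_meas[OF h0] inc_meas[OF h0]
  define J where "J k om = exp (be * inc h k om) * indicator {\<eta><..} (inc h k om)" for k om
  have J0: "0 <= J k om" for k om unfolding J_def by simp
  have pt: "exp (be * max (Z a h w n om) a) - A <= A * (exp (be * \<eta>) - 1) + A * (\<Sum>k<n. J k om)" for om
  proof (induction n)
   case 0
   have "max w a = a" using w by simp
   then show ?case using A \<eta> be unfolding A_def by simp
  next
   case (Suc n)
   have mono: "A * (\<Sum>k<n. J k om) <= A * (\<Sum>k<Suc n. J k om)" using J0[of n om] A by simp
   show ?case
   proof (cases "a < Z a h w n om")
    case True
    then show ?thesis using Suc mono by (simp add: Z_Suc)
   next
    case False
    define y where "y = inc h n om"
    have z: "Z a h w (Suc n) om = step_map \<delta> b h (Z a h w n om + y)" using False by (simp add: Z_Suc y_def)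
    have le: "max (Z a h w (Suc n) om) a <= a + max y 0"
     unfolding z using step_loss_bounds(6)[OF \<delta> h(1) b, of "Z a h w n om + y"] False a by simp
    then have "exp (be * max (Z a h w (Suc n) om) a) <= exp (be * (a + max y 0))" using be by simp
    also have "\<dots> = A * exp (be * max y 0)" unfolding A_def by (simp add: distrib_left exp_add)
    finally have ex: "exp (be * max (Z a h w (Suc n) om) a) <= A * exp (be * max y 0)" .
    have S0: "0 <= (\<Sum>k<n. J k om)" using J0 by (intro sum_nonneg) auto
    have "exp (be * max y 0) <= exp (be * \<eta>) + (\<Sum>k<Suc n. J k om)"
    proof (cases "\<eta> < y")
     case True
     then have "J n om = exp (be * max y 0)" using \<eta>(1) unfolding J_def y_def by (simp add: max_def)
     then show ?thesis using S0 by (simp add: add_increasing)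
    next
     case False
     then have "exp (be * max y 0) <= exp (be * \<eta>)" using \<eta>(1) be by simp
     then show ?thesis using S0 J0[of n om] by (simp add: add_increasing2)
    qed
    then have "A * exp (be * max y 0) <= A * (exp (be * \<eta>) + (\<Sum>k<Suc n. J k om))" using A by (intro mult_left_mono) auto
    then show ?thesis using ex by (simp add: algebra_simps)
   qed
  qed
  have iJ': "integrable (\<mu> h) (\<lambda>y. exp (be * y) * indicator {\<eta><..} y)"
   by (rule integrable_real_mult_indicator) (use integrable_exp[of be h] be h0 in auto)
  have iJ: "integrable M (J k)" "(\<integral>om. J k om \<partial>M) <= h * e'" for k
  proof -
   have "integrable (distr M borel (inc h k)) (\<lambda>y. exp (be * y) * indicator {\<eta><..} y)" unfolding inc_distr[OF h0] by (rule iJ')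
   then show "integrable M (J k)" unfolding J_def by (subst (asm) integrable_distr_eq) auto
   have "(\<integral>om. J k om \<partial>M) = (\<integral>y. exp (be * y) * indicator {\<eta><..} y \<partial>distr M borel (inc h k))"
    unfolding J_def by (subst integral_distr) auto
   then show "(\<integral>om. J k om \<partial>M) <= h * e'" unfolding inc_distr[OF h0] using d(2)[OF h] by simp
  qed
  have i2: "integrable M (\<lambda>om. A * (exp (be * \<eta>) - 1) + A * (\<Sum>k<n. J k om))" using iJ by simp
  have i1: "integrable M (\<lambda>om. exp (be * max (Z a h w n om) a) - exp (be * a))"
  proof (rule Bochner_Integration.integrable_bound[OF i2])
   show "AE om in M. norm (exp (be * max (Z a h w n om) a) - exp (be * a)) <= norm (A * (exp (be * \<eta>) - 1) + A * (\<Sum>k<n. J k om))"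
   proof (rule AE_I2)
    fix om
    have "0 <= exp (be * max (Z a h w n om) a) - A" unfolding A_def using be by simp
    then show "norm (exp (be * max (Z a h w n om) a) - exp (be * a)) <= norm (A * (exp (be * \<eta>) - 1) + A * (\<Sum>k<n. J k om))"
     using pt[of om] unfolding A_def[symmetric] by simp
   qed
  qed measurable
  have "(\<integral>om. exp (be * max (Z a h w n om) a) - exp (be * a) \<partial>M) <= (\<integral>om. A * (exp (be * \<eta>) - 1) + A * (\<Sum>k<n. J k om) \<partial>M)"
   by (rule integral_mono[OF i1 i2]) (use pt A_def in simp)
  also have "\<dots> = A * (exp (be * \<eta>) - 1) + A * (\<Sum>k<n. \<integral>om. J k om \<partial>M)" using iJ by (simp add: prob_space)
  also have "\<dots> <= A * (exp (be * \<eta>) - 1) + A * (\<Sum>k<n. h * e')"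
   using iJ(2) A by (intro add_left_mono mult_left_mono sum_mono) auto
  also have "\<dots> = A * (exp (be * \<eta>) - 1) + A * (real n * h * e')" by simp
  also have "A * (real n * h * e') <= A * ((T + 1) * e')" using n e' A by (intro mult_left_mono mult_right_mono) auto
  also have "A * ((T + 1) * e') = e / 2" unfolding e'_def using A T by (simp add: divide_simps)
  finally have "(\<integral>om. exp (be * max (Z a h w n om) a) - exp (be * a) \<partial>M) <= e" using \<eta>(2) by simp
  then show "integrable M (\<lambda>om. exp (be * max (Z a h w n om) a) - exp (be * a)) \<and>
   (\<integral>om. exp (be * max (Z a h w n om) a) - exp (be * a) \<partial>M) <= e" using i1 by blast
 qed
qed

end

section \<open>Scale functions\<close>

text \<open>Vanishing on the negative half-line makes one-sided and two-sided transforms coincide;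
  nonnegativity allows them to be computed with Tonelli.\<close>

definition growth :: "real => real => (real => real) => bool" where
 "growth be C u \<longleftrightarrow> u \<in> borel_measurable borel \<and> (\<forall>x<0. u x = 0) \<and> (\<forall>x. 0 <= u x \<and> u x <= C * exp (be * x))"

definition prim :: "(real => real) => real => real" where
 "prim u x = (\<integral>y. indicator {..x} y * u y \<partial>lborel)"

definition haslap :: "(real => real) => real => real => bool" where
 "haslap u th L \<longleftrightarrow> has_bochner_integral lborel (\<lambda>x. exp (- th * x) * u x) L"

lemma growthD:
 assumes "growth be C u"
 shows "u \<in> borel_measurable borel" "x < 0 ==> u x = 0" "0 <= u x" "u x <= C * exp (be * x)" "0 <= C"
proof -
 show "u \<in> borel_measurable borel" "x < 0 ==> u x = 0" "0 <= u x" "u x <= C * exp (be * x)"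
  using assms unfolding growth_def by blast+
 have "0 <= C * exp (be * 0)" using assms unfolding growth_def by (meson order_trans)
 then show "0 <= C" by simp
qed

lemma growth_raise:
 assumes "growth be C u" "be <= be'"
 shows "growth be' C u"
proof -
 note g = growthD[OF assms(1)]
 have "u x <= C * exp (be' * x)" for x
 proof (cases "x < 0")
  case True then show ?thesis using g(2)[OF True] g(5) by simp
 next
  case False
  then have "exp (be * x) <= exp (be' * x)" using assms(2) by (simp add: mult_right_mono)
  then have "C * exp (be * x) <= C * exp (be' * x)" by (rule mult_left_mono[OF _ g(5)])
  then show ?thesis using g(4)[of x] by linarith
 qed
 then show ?thesis using g unfolding growth_def by blast
qed

lemma exp_Icc_integral:
 fixes be :: real
 assumes "0 < be" "x <= y"
 shows "integrable lborel (\<lambda>z. indicator {x..y} z * exp (be * z))"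
  "(\<integral>z. indicator {x..y} z * exp (be * z) \<partial>lborel) = (exp (be * y) - exp (be * x)) / be"
proof -
 show "integrable lborel (\<lambda>z. indicator {x..y} z * exp (be * z))"
  using borel_integrable_atLeastAtMost'[of x y "\<lambda>z. exp (be * z)"] unfolding set_integrable_def by (simp add: continuous_intros)
 have "(\<integral>z. indicator {x..y} z *\<^sub>R exp (be * z) \<partial>lborel) = exp (be * y) / be - exp (be * x) / be"
  by (rule integral_FTC_Icc[OF assms(2)])
   (use assms in "auto intro!: derivative_eq_intros continuous_intros simp: has_real_derivative_iff_has_vector_derivative[symmetric]")
 then show "(\<integral>z. indicator {x..y} z * exp (be * z) \<partial>lborel) = (exp (be * y) - exp (be * x)) / be"
  by (simp add: diff_divide_distrib)
qed

lemma prim_int: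
 assumes u: "growth be C u" and be: "0 < be"
 shows "integrable lborel (\<lambda>y. indicator {..x} y * u y)"
proof (cases "0 <= x")
 case True
 note g = growthD[OF u]
 show ?thesis
 proof (rule Bochner_Integration.integrable_bound)
  show "integrable lborel (\<lambda>z. C * (indicator {0..x} z * exp (be * z)))" using exp_Icc_integral(1)[OF be True] by simp
  show "(\<lambda>y. indicator {..x} y * u y) \<in> borel_measurable lborel" using g(1) by measurable
  show "AE y in lborel. norm (indicator {..x} y * u y) <= norm (C * (indicator {0..x} y * exp (be * y)))"
   using g by (intro AE_I2) (auto simp: indicator_def abs_mult not_le)
 qed
next
 case False
 have "(\<lambda>y. indicator {..x} y * u y) = (\<lambda>y. 0)" using growthD(2)[OF u] False by (auto simp: indicator_def)
 then show ?thesis by simp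
qed

lemma prim_diff:
 assumes u: "growth be C u" and be: "0 < be" and xy: "x <= y"
 shows "prim u y - prim u x = (\<integral>z. indicator {x<..y} z * u z \<partial>lborel)"
  "0 <= prim u y - prim u x" "prim u y - prim u x <= C / be * (exp (be * y) - exp (be * x))"
proof -
 note g = growthD[OF u]
 have pt: "indicator {..y} z * u z - indicator {..x} z * u z = indicator {x<..y} z * u z" for z
  using xy by (auto simp: indicator_def)
 have i: "integrable lborel (\<lambda>z. indicator {x<..y} z * u z)"
  unfolding pt[symmetric] using prim_int[OF u be] by (intro Bochner_Integration.integrable_diff)
 show eq: "prim u y - prim u x = (\<integral>z. indicator {x<..y} z * u z \<partial>lborel)"
  unfolding prim_def pt[symmetric] using prim_int[OF u be] by (intro Bochner_Integration.integral_diff[symmetric])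
 show "0 <= prim u y - prim u x" unfolding eq using g by (intro Bochner_Integration.integral_nonneg) auto
 have "(\<integral>z. indicator {x<..y} z * u z \<partial>lborel) <= (\<integral>z. C * (indicator {x..y} z * exp (be * z)) \<partial>lborel)"
  by (rule integral_mono[OF i]) (use exp_Icc_integral(1)[OF be xy] g in "auto simp: indicator_def")
 then show "prim u y - prim u x <= C / be * (exp (be * y) - exp (be * x))"
  unfolding eq using exp_Icc_integral(2)[OF be xy] by simp
qed

lemma prim_neg:
 assumes "growth be C u" "x <= 0"
 shows "prim u x = 0"
proof -
 have "AE y in lborel. indicator {..x} y * u y = 0"
  by (rule AE_I[of _ _ "{0}"]) (use growthD(2)[OF assms(1)] assms(2) in "auto simp: indicator_def split: if_splits, metis linorder_neqE_linordered_idom order_trans not_le")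
 then show ?thesis unfolding prim_def by (rule integral_eq_zero_AE)
qed

lemma prim_exp_lip:
 assumes u: "growth be C u" and be: "0 < be"
 shows "exp_lip be (C / be) (prim u)"
 unfolding exp_lip_def
proof (intro conjI allI)
 show "0 <= C / be" using growthD(5)[OF u] be by simp
 fix x y
 have *: "\<bar>prim u x - prim u y\<bar> <= C / be * \<bar>exp (be * x) - exp (be * y)\<bar>" if "x <= y" for x y
 proof -
  have "exp (be * x) <= exp (be * y)" using that be by simp
  then have "\<bar>prim u x - prim u y\<bar> = prim u y - prim u x" "\<bar>exp (be * x) - exp (be * y)\<bar> = exp (be * y) - exp (be * x)"
   using prim_diff(2)[OF u be that] by linarith+
  then show ?thesis using prim_diff(3)[OF u be that] by simp
 qed
 show "\<bar>prim u x - prim u y\<bar> <= C / be * \<bar>exp (be * x) - exp (be * y)\<bar>"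
  using *[of x y] *[of y x] abs_minus_commute[of "prim u x"] abs_minus_commute[of "exp (be * x)"] by (cases "x <= y") auto
qed

lemma prim_growth:
 assumes u: "growth be C u" and be: "0 < be"
 shows "growth be (C / be) (prim u)"
 unfolding growth_def
proof (intro conjI allI impI)
 show "prim u \<in> borel_measurable borel" by (rule exp_lip_meas[OF prim_exp_lip[OF u be]])
 show "prim u x = 0" if "x < 0" for x using prim_neg[OF u] that by simp
 fix x
 show "0 <= prim u x" unfolding prim_def using growthD(3)[OF u] by (intro Bochner_Integration.integral_nonneg) auto
 have C: "0 <= C / be" using growthD(5)[OF u] be by simp
 show "prim u x <= C / be * exp (be * x)"
 proof (cases "0 <= x")
  case True
  then have "prim u x <= C / be * (exp (be * x) - exp (be * 0))" using prim_diff(3)[OF u be True] prim_neg[OF u] by simp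
  also have "\<dots> <= C / be * exp (be * x)" using C by (intro mult_left_mono) auto
  finally show ?thesis .
 next
  case False then show ?thesis using prim_neg[OF u, of x] mult_nonneg_nonneg[OF C, of "exp (be * x)"] by simp
 qed
qed

text \<open>Because of the continuity assumption it is applied to primitives and convolutions; a
  scale function itself may jump at 0.\<close>

lemma prim_deriv:
 assumes u: "growth be C u" and be: "0 < be" and c: "continuous_on UNIV u"
 shows "(prim u has_real_derivative u x) (at x)"
proof -
 define a where "a = - \<bar>x\<bar> - 1"
 have eq: "prim u y = integral {a..y} u" if "y \<in> {a..\<bar>x\<bar> + 1}" for y
 proof -
  have "set_integrable lborel {a..y} u" by (rule borel_integrable_atLeastAtMost'[OF continuous_on_subset[OF c]]) simp
  then have "(LBINT z:{a..y}. u z) = integral {a..y} u" by (rule set_borel_integral_eq_integral(2))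
  moreover have "(LBINT z:{a..y}. u z) = prim u y" unfolding prim_def set_lebesgue_integral_def
   by (rule Bochner_Integration.integral_cong) (use growthD(2)[OF u] in "auto simp: indicator_def a_def")
  ultimately show ?thesis by simp
 qed
 have "((\<lambda>y. integral {a..y} u) has_real_derivative u x) (at x within {a..\<bar>x\<bar> + 1})"
  by (rule integral_has_real_derivative[OF continuous_on_subset[OF c]]) (auto simp: a_def)
 then have "(prim u has_real_derivative u x) (at x within {a..\<bar>x\<bar> + 1})"
  by (rule has_field_derivative_transform_within[where d = 1]) (auto simp: eq a_def)
 moreover have "at x within {a..\<bar>x\<bar> + 1} = at x" by (rule at_within_Icc_at) (auto simp: a_def)
 ultimately show ?thesis by simp
qed

section \<open>Laplace transforms of primitives, shifts and convolutions\<close>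

lemma haslapI:
 assumes "u \<in> borel_measurable borel" "\<And>x. 0 <= u x" "(\<integral>\<^sup>+x. ennreal (exp (- th * x) * u x) \<partial>lborel) = ennreal L" "0 <= L"
 shows "haslap u th L"
 unfolding haslap_def by (rule has_bochner_integral_nn_integral) (use assms in auto)

lemma haslap_nn:
 assumes "haslap u th L" "\<And>x. 0 <= u x"
 shows "(\<integral>\<^sup>+x. ennreal (exp (- th * x) * u x) \<partial>lborel) = ennreal L" "0 <= L"
proof -
 have *: "integrable lborel (\<lambda>x. exp (- th * x) * u x)" "(\<integral>x. exp (- th * x) * u x \<partial>lborel) = L"
  using assms(1) unfolding haslap_def by (auto simp: has_bochner_integral_iff)
 show "(\<integral>\<^sup>+x. ennreal (exp (- th * x) * u x) \<partial>lborel) = ennreal L"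
  using nn_integral_eq_integral[OF *(1)] *(2) assms(2) by simp
 show "0 <= L" unfolding *(2)[symmetric] using assms(2) by (intro Bochner_Integration.integral_nonneg) auto
qed

lemma haslap_add: "haslap u th L ==> haslap v th K ==> haslap (\<lambda>x. u x + v x) th (L + K)"
 unfolding haslap_def distrib_left by (rule has_bochner_integral_add)

lemma haslap_cmult: "haslap u th L ==> haslap (\<lambda>x. c * u x) th (c * L)"
 unfolding haslap_def mult.left_commute[of _ c] by (rule has_bochner_integral_mult_right)

lemma haslap_shift:
 assumes "haslap u th L"
 shows "haslap (\<lambda>x. u (x - r)) th (exp (- th * r) * L)"
proof -
 have "has_bochner_integral lborel (\<lambda>x. exp (- th * (- r + 1 * x)) * u (- r + 1 * x)) (L /\<^sub>R \<bar>1\<bar>)"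
  by (rule lborel_has_bochner_integral_real_affine_iff[THEN iffD1]) (use assms haslap_def in auto)
 then have "has_bochner_integral lborel (\<lambda>x. exp (- th * r) * (exp (- th * (x - r)) * u (x - r))) (exp (- th * r) * L)"
  by (intro has_bochner_integral_mult_right) simp
 moreover have "exp (- th * r) * (exp (- th * (x - r)) * u (x - r)) = exp (- th * x) * u (x - r)" for x
  unfolding mult.assoc[symmetric] exp_add[symmetric] by (simp add: algebra_simps)
 ultimately show ?thesis unfolding haslap_def by (simp only:)
qed

lemma haslap_prim:
 assumes u: "growth be C u" and be: "0 < be" and L: "haslap u th L" and th: "0 < th"
 shows "haslap (prim u) th (L / th)"
proof (rule haslapI)
 note g = growthD[OF u] and pg = growthD[OF prim_growth[OF u be]]
 note [measurable] = g(1)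
 show "prim u \<in> borel_measurable borel" "\<And>x. 0 <= prim u x" "0 <= L / th" using pg haslap_nn(2)[OF L g(3)] th by auto
 have "(\<integral>\<^sup>+x. ennreal (exp (- th * x) * prim u x) \<partial>lborel) = (\<integral>\<^sup>+x. \<integral>\<^sup>+y. ennreal (exp (- th * x) * u y) * indicator {y..} x \<partial>lborel \<partial>lborel)"
 proof (rule nn_integral_cong)
  fix x :: real
  have "ennreal (exp (- th * x) * prim u x) = ennreal (exp (- th * x)) * (\<integral>\<^sup>+y. ennreal (indicator {..x} y * u y) \<partial>lborel)"
   unfolding prim_def using g(3) by (subst nn_integral_eq_integral[OF prim_int[OF u be]]) (auto simp: ennreal_mult)
  also have "\<dots> = (\<integral>\<^sup>+y. ennreal (exp (- th * x)) * ennreal (indicator {..x} y * u y) \<partial>lborel)"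
   by (rule nn_integral_cmult[symmetric]) measurable
  also have "\<dots> = (\<integral>\<^sup>+y. ennreal (exp (- th * x) * u y) * indicator {y..} x \<partial>lborel)"
   by (rule nn_integral_cong) (use g(3) in "auto simp: ennreal_mult indicator_def")
  finally show "ennreal (exp (- th * x) * prim u x) = (\<integral>\<^sup>+y. ennreal (exp (- th * x) * u y) * indicator {y..} x \<partial>lborel)" .
 qed
 also have "\<dots> = (\<integral>\<^sup>+y. \<integral>\<^sup>+x. ennreal (exp (- th * x) * u y) * indicator {y..} x \<partial>lborel \<partial>lborel)"
 proof (rule lborel_pair.Fubini'[symmetric])
  have m: "(\<lambda>p::real \<times> real. ennreal (exp (- th * fst p) * u (snd p)) * indicator {p. snd p <= fst p} p) \<in> borel_measurable (lborel \<Otimes>\<^sub>M lborel)"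
   by measurable
  have "(\<lambda>p::real \<times> real. ennreal (exp (- th * fst p) * u (snd p)) * indicator {p. snd p <= fst p} p) =
    (\<lambda>(x, y). ennreal (exp (- th * x) * u y) * indicator {y..} x)" by (auto simp: indicator_def fun_eq_iff)
  from m[unfolded this] show "(\<lambda>(x, y). ennreal (exp (- th * x) * u y) * indicator {y..} x) \<in> borel_measurable (lborel \<Otimes>\<^sub>M lborel)" .
 qed
 also have "\<dots> = (\<integral>\<^sup>+y. ennreal (1 / th) * ennreal (exp (- th * y) * u y) \<partial>lborel)"
 proof (rule nn_integral_cong)
  fix y :: real
  have "(\<integral>\<^sup>+x. ennreal (exp (- th * x) * u y) * indicator {y..} x \<partial>lborel) = (\<integral>\<^sup>+x. ennreal (u y) * (ennreal (exp (- th * x)) * indicator {y..} x) \<partial>lborel)"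
   by (rule nn_integral_cong) (use g(3) in "simp add: ennreal_mult mult_ac")
  also have "\<dots> = ennreal (u y) * (\<integral>\<^sup>+x. ennreal (exp (- th * x)) * indicator {y..} x \<partial>lborel)"
   by (rule nn_integral_cmult) measurable
  also have "(\<integral>\<^sup>+x. ennreal (exp (- th * x)) * indicator {y..} x \<partial>lborel) = ennreal (0 - (- (exp (- th * y) / th)))"
  proof (rule nn_integral_FTC_atLeast)
   show "((\<lambda>x. - (exp (- th * x) / th)) has_real_derivative exp (- th * x)) (at x)" for x
    using th by (auto intro!: derivative_eq_intros)
   show "((\<lambda>x. - (exp (- th * x) / th)) \<longlongrightarrow> 0) at_top" using th by real_asymp
  qed (use th in auto)
  also have "ennreal (u y) * ennreal (0 - (- (exp (- th * y) / th))) = ennreal (1 / th) * ennreal (exp (- th * y) * u y)"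
   using g(3) th by (simp add: ennreal_mult[symmetric] mult_ac)
  finally show "(\<integral>\<^sup>+x. ennreal (exp (- th * x) * u y) * indicator {y..} x \<partial>lborel) = ennreal (1 / th) * ennreal (exp (- th * y) * u y)" .
 qed
 also have "\<dots> = ennreal (1 / th) * ennreal L"
  by (subst nn_integral_cmult) (use haslap_nn(1)[OF L g(3)] in simp_all)
 also have "\<dots> = ennreal (L / th)" using th haslap_nn(2)[OF L g(3)] by (simp add: ennreal_mult[symmetric])
 finally show "(\<integral>\<^sup>+x. ennreal (exp (- th * x) * prim u x) \<partial>lborel) = ennreal (L / th)" .
qed

definition conv :: "(real => real) => (real => real) => real => real" where
 "conv u w x = (\<integral>y. u (x - y) * w y \<partial>lborel)"

lemma conv_int:
 assumes u: "growth be C u" and w: "growth be D w" and be: "0 < be"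
 shows "integrable lborel (\<lambda>y. u (x - y) * w y)" "0 <= conv u w x" "x < 0 ==> conv u w x = 0"
proof -
 note g = growthD[OF u] and k = growthD[OF w]
 note [measurable] = g(1) k(1)
 have z: "u (x - y) * w y = 0" if "y < 0 \<or> x < y" for y using that g(2)[of "x - y"] k(2)[of y] by auto
 show "0 <= conv u w x" unfolding conv_def using g(3) k(3) by (intro Bochner_Integration.integral_nonneg) auto
 show "conv u w x = 0" if "x < 0"
 proof -
  have "(\<lambda>y. u (x - y) * w y) = (\<lambda>y. 0)" by (rule ext, rule z) (use that in auto)
  then show ?thesis unfolding conv_def by simp
 qed
 show "integrable lborel (\<lambda>y. u (x - y) * w y)"
 proof (rule Bochner_Integration.integrable_bound)
  show "integrable lborel (\<lambda>y. C * D * exp (be * x) * indicator {0..x} y)"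
   by (intro integrable_mult_right integrable_real_indicator) (auto simp: emeasure_lborel_Icc_eq)
  show "AE y in lborel. norm (u (x - y) * w y) <= norm (C * D * exp (be * x) * indicator {0..x} y)"
  proof (rule AE_I2)
   fix y
   show "norm (u (x - y) * w y) <= norm (C * D * exp (be * x) * indicator {0..x} y)"
   proof (cases "0 <= y \<and> y <= x")
    case True
    have "u (x - y) * w y <= (C * exp (be * (x - y))) * (D * exp (be * y))" using g k by (intro mult_mono) auto
    also have "\<dots> = C * D * exp (be * x)" by (simp add: algebra_simps exp_add[symmetric])
    finally show ?thesis using True g k by simp
   next
    case False then show ?thesis using z[of y] by force
   qed
  qed
 qed measurable
qed

lemma haslap_conv:
 assumes u: "growth be C u" and w: "growth be D w" and be: "0 < be" and L: "haslap u th L" "haslap w th K" and m: "conv u w \<in> borel_measurable borel"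
 shows "haslap (conv u w) th (L * K)"
proof (rule haslapI)
 note g = growthD[OF u] and k = growthD[OF w]
 note [measurable] = g(1) k(1)
 note l = haslap_nn[OF L(1) g(3)] haslap_nn[OF L(2) k(3)]
 show "conv u w \<in> borel_measurable borel" "\<And>x. 0 <= conv u w x" "0 <= L * K" using m conv_int(2)[OF u w be] l by auto
 have "(\<integral>\<^sup>+x. ennreal (exp (- th * x) * conv u w x) \<partial>lborel) = (\<integral>\<^sup>+x. \<integral>\<^sup>+y. ennreal (exp (- th * x) * (u (x - y) * w y)) \<partial>lborel \<partial>lborel)"
 proof (rule nn_integral_cong)
  fix x :: real
  have "ennreal (exp (- th * x) * conv u w x) = ennreal (exp (- th * x)) * (\<integral>\<^sup>+y. ennreal (u (x - y) * w y) \<partial>lborel)"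
   unfolding conv_def using g(3) k(3) by (subst nn_integral_eq_integral[OF conv_int(1)[OF u w be]]) (auto simp: ennreal_mult)
  also have "\<dots> = (\<integral>\<^sup>+y. ennreal (exp (- th * x)) * ennreal (u (x - y) * w y) \<partial>lborel)"
   by (rule nn_integral_cmult[symmetric]) measurable
  also have "\<dots> = (\<integral>\<^sup>+y. ennreal (exp (- th * x) * (u (x - y) * w y)) \<partial>lborel)"
   by (rule nn_integral_cong) (use g(3) k(3) in "simp add: ennreal_mult")
  finally show "ennreal (exp (- th * x) * conv u w x) = (\<integral>\<^sup>+y. ennreal (exp (- th * x) * (u (x - y) * w y)) \<partial>lborel)" .
 qed
 also have "\<dots> = (\<integral>\<^sup>+y. \<integral>\<^sup>+x. ennreal (exp (- th * x) * (u (x - y) * w y)) \<partial>lborel \<partial>lborel)"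
  by (rule lborel_pair.Fubini'[symmetric]) measurable
 also have "\<dots> = (\<integral>\<^sup>+y. ennreal L * ennreal (exp (- th * y) * w y) \<partial>lborel)"
 proof (rule nn_integral_cong)
  fix y :: real
  have "(\<integral>\<^sup>+x. ennreal (exp (- th * x) * (u (x - y) * w y)) \<partial>lborel) = (\<integral>\<^sup>+x. ennreal (w y) * ennreal (exp (- th * x) * u (x - y)) \<partial>lborel)"
   by (rule nn_integral_cong) (use g(3) k(3) in "simp add: ennreal_mult[symmetric] mult_ac")
  also have "\<dots> = ennreal (w y) * (\<integral>\<^sup>+x. ennreal (exp (- th * x) * u (x - y)) \<partial>lborel)"
   by (rule nn_integral_cmult) measurable
  also have "(\<integral>\<^sup>+x. ennreal (exp (- th * x) * u (x - y)) \<partial>lborel) = ennreal (exp (- th * y) * L)"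
   by (rule haslap_nn(1)[OF haslap_shift[OF L(1)]]) (rule g(3))
  also have "ennreal (w y) * ennreal (exp (- th * y) * L) = ennreal L * ennreal (exp (- th * y) * w y)"
   using k(3) l by (simp add: ennreal_mult[symmetric] mult_ac)
  finally show "(\<integral>\<^sup>+x. ennreal (exp (- th * x) * (u (x - y) * w y)) \<partial>lborel) = ennreal L * ennreal (exp (- th * y) * w y)" .
 qed
 also have "\<dots> = ennreal L * ennreal K" by (subst nn_integral_cmult) (use l in simp_all)
 also have "\<dots> = ennreal (L * K)" using l by (simp add: ennreal_mult)
 finally show "(\<integral>\<^sup>+x. ennreal (exp (- th * x) * conv u w x) \<partial>lborel) = ennreal (L * K)" .
qed

text \<open>For monotone factors the increment of the convolution is at most \<open>w y\<close> times an increment of the primitive of \<open>u\<close>.\<close>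

lemma conv_exp_lip:
 assumes u: "growth be C u" and w: "growth be D w" and be: "0 < be" and m: "mono u"
 shows "exp_lip (2 * be) (D * (C / be)) (conv u w)"
proof -
 note g = growthD[OF u] and k = growthD[OF w]
 have CD: "0 <= D * (C / be)" using g(5) k(5) be by simp
 have p: "(\<integral>z. indicator {0..} z * u (y - z) \<partial>lborel) = prim u y \<and> integrable lborel (\<lambda>z. indicator {0..} z * u (y - z))" for y
  proof -
   have e: "indicator {..y} (y + - 1 * z) * u (y + - 1 * z) = indicator {0..} z * u (y - z)" for z by (auto simp: indicator_def)
   have "prim u y = \<bar>-1\<bar> *\<^sub>R (\<integral>z. indicator {..y} (y + - 1 * z) * u (y + - 1 * z) \<partial>lborel)"
    unfolding prim_def by (rule lborel_integral_real_affine) simp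
   then show ?thesis using lborel_integrable_real_affine[OF prim_int[OF u be, of y], of "-1" y] unfolding e by simp
  qed
 have *: "\<bar>conv u w y - conv u w x\<bar> <= D * (C / be) * (exp (2 * be * y) - exp (2 * be * x))" if xy: "x <= y" for x y
 proof -
  define v where "v z = C / be * (exp (be * y) - exp (be * x)) * z" for z :: real
  have "conv u w y - conv u w x = (\<integral>z. (u (y - z) - u (x - z)) * w z \<partial>lborel)"
   unfolding conv_def left_diff_distrib using conv_int(1)[OF u w be] by (intro Bochner_Integration.integral_diff[symmetric])
  moreover have "0 <= (\<integral>z. (u (y - z) - u (x - z)) * w z \<partial>lborel)"
   using m xy k(3) by (intro Bochner_Integration.integral_nonneg mult_nonneg_nonneg) (auto simp: mono_def)
  moreover have "(\<integral>z. (u (y - z) - u (x - z)) * w z \<partial>lborel) <= (\<integral>z. (D * exp (be * y)) * (indicator {0..} z * (u (y - z) - u (x - z))) \<partial>lborel)"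
  proof (rule integral_mono)
   show "integrable lborel (\<lambda>z. (u (y - z) - u (x - z)) * w z)"
    unfolding left_diff_distrib using conv_int(1)[OF u w be] by (intro Bochner_Integration.integrable_diff)
   show "integrable lborel (\<lambda>z. (D * exp (be * y)) * (indicator {0..} z * (u (y - z) - u (x - z))))"
    unfolding right_diff_distrib using p by (intro Bochner_Integration.integrable_diff integrable_mult_right) auto
   fix z
   have up: "0 <= u (y - z) - u (x - z)" using m xy by (simp add: mono_def)
   show "(u (y - z) - u (x - z)) * w z <= (D * exp (be * y)) * (indicator {0..} z * (u (y - z) - u (x - z)))"
   proof (cases "0 <= z \<and> z <= y")
    case True
    have "w z <= D * exp (be * y)"
     using k(4)[of z] k(5) True be by (meson exp_le_cancel_iff less_imp_le mult_left_mono order_trans)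
    moreover have "indicator {0..} z = (1 :: real)" using True by simp
    ultimately show ?thesis using mult_right_mono[OF _ up] by (simp only: mult_1_left mult.commute[of "u (y - z) - u (x - z)" "w z"])
   next
    case False
    then have "u (y - z) - u (x - z) = 0 \<or> w z = 0" using g(2)[of "y - z"] g(2)[of "x - z"] k(2)[of z] xy by auto
    then show ?thesis using up k(5) by auto
   qed
  qed
  moreover have "(\<integral>z. (D * exp (be * y)) * (indicator {0..} z * (u (y - z) - u (x - z))) \<partial>lborel) = D * exp (be * y) * (prim u y - prim u x)"
   unfolding right_diff_distrib[of "indicator _ _"] using p by simp
  moreover have "D * exp (be * y) * (prim u y - prim u x) <= D * exp (be * y) * (C / be * (exp (be * y) - exp (be * x)))"
   using prim_diff(3)[OF u be xy] k(5) by (intro mult_left_mono) auto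
  moreover have "D * exp (be * y) * (C / be * (exp (be * y) - exp (be * x))) <= D * (C / be) * (exp (2 * be * y) - exp (2 * be * x))"
  proof -
   have "exp (be * x) <= exp (be * y)" using xy be by simp
   then have "exp (be * y) * (exp (be * y) - exp (be * x)) <= (exp (be * y) + exp (be * x)) * (exp (be * y) - exp (be * x))"
    by (intro mult_right_mono) auto
   also have "\<dots> = exp (2 * be * y) - exp (2 * be * x)" by (simp add: algebra_simps exp_add[symmetric])
   finally have "D * (C / be) * (exp (be * y) * (exp (be * y) - exp (be * x))) <= D * (C / be) * (exp (2 * be * y) - exp (2 * be * x))"
    by (rule mult_left_mono[OF _ CD])
   then show ?thesis by (simp add: mult_ac)
  qed
  ultimately show ?thesis by linarith
 qed
 show ?thesis unfolding exp_lip_def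
 proof (intro conjI CD allI)
  fix x y
  have "x <= y ==> exp (2 * be * x) <= exp (2 * be * y)" "y <= x ==> exp (2 * be * y) <= exp (2 * be * x)" using be by auto
  then show "\<bar>conv u w x - conv u w y\<bar> <= D * (C / be) * \<bar>exp (2 * be * x) - exp (2 * be * y)\<bar>"
   using *[of x y] *[of y x] by (cases "x <= y") (auto simp: abs_minus_commute)
 qed
qed

text \<open>A scale function is nonnegative because its Laplace transform is positive at large arguments, which
 would fail for \<open>W 0 < 0\<close>.\<close>

lemma scale_function_growth:
 assumes W: "is_scale_function \<psi> q W" and large: "\<And>th. th0 <= th ==> q < \<psi> th"
 obtains be C where "0 < be" "growth be C W" "mono W" "\<And>th. be < th ==> haslap W th (1 / (\<psi> th - q))"
proof -
 have neg: "\<And>x. x < 0 ==> W x = 0" and cont: "continuous_on {0..} W" and mon: "mono_on {0..} W"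
  using W unfolding is_scale_function_def by blast+
 define be where "be = max (max 1 th0) (right_inverse \<psi> q + 1)"
 have lap: "haslap W th (1 / (\<psi> th - q))" if "be <= th" for th
 proof -
  have "has_bochner_integral lborel (\<lambda>x. indicator {0..} x *\<^sub>R (exp (- th * x) * W x)) (1 / (\<psi> th - q))"
   using W that unfolding is_scale_function_def be_def by auto
  moreover have "indicator {0..} x *\<^sub>R (exp (- th * x) * W x) = exp (- th * x) * W x" for x
   using neg[of x] by (auto simp: indicator_def)
  ultimately show ?thesis unfolding haslap_def by (simp only:)
 qed
 have be: "0 < be" unfolding be_def by simp
 have int: "integrable lborel (\<lambda>x. exp (- th * x) * W x)" "0 < (\<integral>x. exp (- th * x) * W x \<partial>lborel)" if "be <= th" for th
 proof -
  show "integrable lborel (\<lambda>x. exp (- th * x) * W x)" using lap[OF that] unfolding haslap_def by (auto simp: has_bochner_integral_iff)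
  have "(\<integral>x. exp (- th * x) * W x \<partial>lborel) = 1 / (\<psi> th - q)" using lap[OF that] unfolding haslap_def by (auto simp: has_bochner_integral_iff)
  moreover have "q < \<psi> th" using large[of th] that unfolding be_def by simp
  ultimately show "0 < (\<integral>x. exp (- th * x) * W x \<partial>lborel)" by simp
 qed
 have W0: "0 <= W 0"
 proof (rule ccontr)
  assume "\<not> 0 <= W 0"
  define c where "c = W 0 / 2"
  have c: "c < 0" "W 0 < c" using \<open>\<not> 0 <= W 0\<close> unfolding c_def by auto
  have "(W \<longlongrightarrow> W 0) (at 0 within {0..})" using cont unfolding continuous_on_def by auto
  then have "\<forall>\<^sub>F x in at 0 within {0..}. W x < c" using c(2) by (rule order_tendstoD)
  then obtain d where d: "d > 0" "\<And>x. x \<in> {0..} ==> x \<noteq> 0 ==> dist x 0 < d ==> W x < c"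
   unfolding eventually_at by auto
  define e where "e = d / 3"
  have e: "0 < e" using d unfolding e_def by simp
  have near: "W x < c" if "0 <= x" "x <= 2 * e" for x
   using d(2)[of x] that c(2) d(1) unfolding e_def by (cases "x = 0") auto
  \<comment> \<open>After multiplication by \<open>exp (2 * th * e)\<close>, the part of the
    transform beyond \<open>2 * e\<close> is at most \<open>K\<close> for all large
    \<open>th\<close>, while the part on \<open>[0, e]\<close> is at most
    \<open>c * e * exp (th * e)\<close> with \<open>c < 0\<close>.\<close>
  define K where "K = (\<integral>x. exp (- be * (x - 2 * e)) * \<bar>W x\<bar> \<partial>lborel)"
  have iK: "integrable lborel (\<lambda>x. exp (- be * (x - 2 * e)) * \<bar>W x\<bar>)"
  proof -
   have "integrable lborel (\<lambda>x. exp (2 * be * e) * \<bar>exp (- be * x) * W x\<bar>)" using int(1)[of be] by simp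
   moreover have "exp (2 * be * e) * \<bar>exp (- be * x) * W x\<bar> = exp (- be * (x - 2 * e)) * \<bar>W x\<bar>" for x
    unfolding abs_mult abs_exp_cancel mult.assoc[symmetric] exp_add[symmetric] by (simp add: algebra_simps)
   ultimately show ?thesis by (simp only:)
  qed
  have bd: "0 < K + c * e * exp (th * e)" if th: "be <= th" for th
  proof -
   have eq: "exp (2 * th * e) * (exp (- th * x) * W x) = exp (- th * (x - 2 * e)) * W x" for x
    unfolding mult.assoc[symmetric] exp_add[symmetric] by (simp add: algebra_simps)
   have "0 < exp (2 * th * e) * (\<integral>x. exp (- th * x) * W x \<partial>lborel)" using int(2)[OF th] by simp
   also have "\<dots> = (\<integral>x. exp (- th * (x - 2 * e)) * W x \<partial>lborel)" unfolding eq[symmetric] by simp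
   also have "\<dots> <= (\<integral>x. exp (- be * (x - 2 * e)) * \<bar>W x\<bar> + c * exp (th * e) * indicator {0..e} x \<partial>lborel)"
   proof (rule integral_mono)
    show "integrable lborel (\<lambda>x. exp (- th * (x - 2 * e)) * W x)" unfolding eq[symmetric] using int(1)[OF th] by simp
    show "integrable lborel (\<lambda>x. exp (- be * (x - 2 * e)) * \<bar>W x\<bar> + c * exp (th * e) * indicator {0..e} x)"
     using iK e by (intro Bochner_Integration.integrable_add integrable_mult_right integrable_real_indicator) auto
    fix x
    show "exp (- th * (x - 2 * e)) * W x <= exp (- be * (x - 2 * e)) * \<bar>W x\<bar> + c * exp (th * e) * indicator {0..e} x"
    proof -
     consider "x < 0" | "0 <= x" "x <= e" | "e < x" "x <= 2 * e" | "2 * e < x" by linarith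
     then show ?thesis
     proof cases
      case 1 then show ?thesis using neg[of x] by simp
     next
      case 2
      have "th * e <= - th * (x - 2 * e)" using mult_left_mono[of x e th] 2 th be by (simp add: algebra_simps)
      then have "exp (th * e) * (- c) <= exp (- th * (x - 2 * e)) * (- W x)" using near[of x] 2 e c by (intro mult_mono) auto
      moreover have "0 <= exp (- be * (x - 2 * e)) * \<bar>W x\<bar>" by simp
      moreover have "indicator {0..e} x = (1 :: real)" using 2 by simp
      ultimately show ?thesis by (simp only: mult_1_right mult.commute[of c] mult_minus_right)
     next
      case 3
      then have "W x < 0" using near[of x] c e by simp
      then have "exp (- th * (x - 2 * e)) * W x <= 0" by (intro mult_nonneg_nonpos) auto
      moreover have "0 <= exp (- be * (x - 2 * e)) * \<bar>W x\<bar>" by simp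
      moreover have "indicator {0..e} x = (0 :: real)" using 3 by simp
      ultimately show ?thesis by (simp only: mult_zero_right)
     next
      case 4
      have "exp (- th * (x - 2 * e)) * W x <= exp (- be * (x - 2 * e)) * \<bar>W x\<bar>"
       using 4 th by (intro order_trans[OF mult_left_mono[OF abs_ge_self] mult_right_mono]) (auto intro: mult_right_mono)
      then show ?thesis using 4 e by (simp add: indicator_def)
     qed
    qed
   qed
   also have "\<dots> = K + c * e * exp (th * e)" unfolding K_def using iK e by (simp add: mult_ac)
   finally show ?thesis .
  qed
  \<comment> \<open>Large enough for the negative part to outweigh \<open>K\<close>, by
    \<open>th * e <= exp (th * e)\<close>.\<close>
  define th where "th = max be (\<bar>K\<bar> / (- c * e * e))"
  have "\<bar>K\<bar> <= th * (- c * e * e)" unfolding th_def using c e by (subst pos_divide_le_eq[symmetric]) (auto simp: mult_neg_pos)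
  also have "\<dots> = (- c * e) * (th * e)" by simp
  also have "\<dots> <= (- c * e) * exp (th * e)" 
  proof (rule mult_left_mono)
   show "th * e <= exp (th * e)" using exp_ge_add_one_self[of "th * e"] by linarith
  qed (use c e in "simp add: mult_nonpos_nonneg less_imp_le")
  finally have "K + c * e * exp (th * e) <= 0" by simp
  then show False using bd[of th] unfolding th_def by simp
 qed
 have nn: "0 <= W x" for x using W0 mono_onD[OF mon, of 0 x] neg[of x] by (cases "x < 0") auto
 have mono: "mono W"
 proof (rule monoI)
  fix x y :: real assume "x <= y"
  then show "W x <= W y" using mono_onD[OF mon, of x y] neg[of x] nn[of y] by (cases "x < 0") auto
 qed
 have [measurable]: "W \<in> borel_measurable borel" by (rule borel_measurable_mono[OF mono])
 define C where "C = exp be * (\<integral>x. exp (- be * x) * W x \<partial>lborel)"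
 have "W x <= C * exp (be * x)" for x
 proof (cases "x < 0")
  case True then show ?thesis using neg[of x] int(2)[of be] unfolding C_def by simp
 next
  case False
  \<comment> \<open>Monotonicity turns the finite transform into a pointwise bound: on
    \<open>[x, x + 1]\<close> the function is at least \<open>W x\<close>.\<close>
  have "exp (- be * (x + 1)) * W x = (\<integral>y. indicator {x..x+1} y * (exp (- be * (x + 1)) * W x) \<partial>lborel)" by simp
  also have "\<dots> <= (\<integral>y. exp (- be * y) * W y \<partial>lborel)"
  proof (rule integral_mono[OF _ int(1)])
   fix y
   show "indicator {x..x+1} y * (exp (- be * (x + 1)) * W x) <= exp (- be * y) * W y"
   proof (cases "y \<in> {x..x+1}")
    case True
    then show ?thesis using mono nn be by (auto intro!: mult_mono simp: mono_def)
   qed (use nn in simp)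
  qed auto
  finally have "exp (be * (x + 1)) * (exp (- be * (x + 1)) * W x) <= exp (be * (x + 1)) * (\<integral>y. exp (- be * y) * W y \<partial>lborel)"
   by (intro mult_left_mono) auto
  moreover have "exp (be * (x + 1)) * (exp (- be * (x + 1)) * W x) = W x" unfolding mult.assoc[symmetric] exp_add[symmetric] by simp
  moreover have "exp (be * (x + 1)) = exp be * exp (be * x)" by (simp add: exp_add[symmetric] algebra_simps)
  ultimately show ?thesis unfolding C_def by (simp only: mult_ac)
 qed
 then have "growth be C W" unfolding growth_def using neg nn by auto
 then show ?thesis using that[OF be _ mono] lap by simp
qed

lemma exp_lip_growth:
 assumes u: "exp_lip be C u" and z: "\<And>x. x <= 0 ==> u x = 0" and nn: "\<And>x. 0 <= u x" and be: "0 < be"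
 shows "growth be C u"
 unfolding growth_def
proof (intro conjI allI impI)
 show "u \<in> borel_measurable borel" by (rule exp_lip_meas[OF u])
 note C = exp_lip_nonneg[OF u]
 fix x show "x < 0 ==> u x = 0" "0 <= u x" using z nn by auto
 show "u x <= C * exp (be * x)"
 proof (cases "0 <= x")
  case True
  then have "1 <= exp (be * x)" using be by simp
  then have "\<bar>exp (be * x) - exp (be * 0)\<bar> <= exp (be * x)" by simp
  then have "C * \<bar>exp (be * x) - exp (be * 0)\<bar> <= C * exp (be * x)" by (rule mult_left_mono[OF _ C])
  then show ?thesis using exp_lipD[OF u, of x 0] z[of 0] by simp
 qed (use z[of x] C in simp)
qed

lemma prim_mono: "growth be C u ==> 0 < be ==> mono (prim u)"
 using prim_diff(2) by (intro monoI) (smt (verit))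

lemma conv_mono:
 assumes u: "growth be C u" and w: "growth be D w" and be: "0 < be" and m: "mono u"
 shows "mono (conv u w)"
proof (rule monoI)
 fix x y :: real assume "x <= y"
 then show "conv u w x <= conv u w y" unfolding conv_def using m growthD(3)[OF w]
  by (intro integral_mono conv_int(1)[OF u w be] mult_right_mono) (auto simp: mono_def)
qed

section \<open>Scale functions as Dynkin pairs\<close>

context refraction
begin

lemma smooth_triple_prim:
 assumes f: "growth be C f" "exp_lip be K f" and G: "\<And>x. 0 <= G x" "exp_lip be D G" and be: "0 < be"
  and lap: "\<And>th. be < th ==> q < \<psi> th \<and> haslap f th (L th) \<and> haslap G th ((\<psi> th - q) * (L th / th))"
 shows "smooth_triple q be (prim f) G f"
proof -
 have "dynkin_pair q (prim f) G"
 proof (rule dynkin_pair_if_laplace[OF prim_exp_lip[OF f(1) be] G(2)])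
  show "0 <= prim f v" for v using growthD(3)[OF prim_growth[OF f(1) be]] by blast
  fix th assume th: "be < th"
  then have "haslap (prim f) th (L th / th)" using lap[OF th] be by (intro haslap_prim[OF f(1) be]) auto
  then show "q < \<psi> th \<and> integrable lborel (\<lambda>v. exp (- th * v) * prim f v) \<and> integrable lborel (\<lambda>v. exp (- th * v) * G v) \<and>
    (\<psi> th - q) * (\<integral>v. exp (- th * v) * prim f v \<partial>lborel) = (\<integral>v. exp (- th * v) * G v \<partial>lborel)"
   using lap[OF th] unfolding haslap_def has_bochner_integral_iff by simp
 qed (use be G in auto)
 then show ?thesis unfolding smooth_triple_def
  using prim_exp_lip[OF f(1) be] f(2) G(2) prim_deriv[OF f(1) be exp_lip_continuous[OF f(2)]] by blast
qed

text \<open>The function \<open>r\<close> without its constant 1, so that it vanishes on the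
  negative half-line and has a Laplace transform; the constant returns through
  \<open>smooth_triple_const\<close>.\<close>

definition r0 :: "(real => real) => (real => real) => real => real" where
 "r0 W WY v = q * prim W v + q * \<delta> * conv WY (\<lambda>y. indicator {b<..} y * W y) v"

text \<open>Differentiate formally, with \<open>L\<close> the generator of \<open>X\<close>. On the
  positive half-line \<open>L - q\<close> sends the primitive of \<open>W\<close> to 1, the shifted
  primitive of \<open>WY\<close> to \<open>1{x > b}\<close> plus \<open>\<delta>\<close> times its
  derivative, and \<open>1 + r0\<close> to \<open>\<delta> * 1{x > b}\<close> times its derivative.
  Subtracting the refraction term, \<open>\<delta> * 1{x > b}\<close> times the derivative, leaves 1
  above \<open>b\<close> in the second case and 0 in the third.\<close>

lemma scale_triples:
 assumes W: "is_scale_function \<psi> q W" and WY: "is_scale_function (\<lambda>th. \<psi> th - \<delta> * th) q WY"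
 obtains be where "0 < be" "smooth_triple q be (prim (prim W)) (\<lambda>x. max x 0) (prim W)"
  "smooth_triple q be (prim (\<lambda>x. prim WY (x - b))) (\<lambda>x. \<delta> * prim WY (x - b) + max (x - b) 0) (\<lambda>x. prim WY (x - b))"
  "smooth_triple q be (prim (r0 W WY)) (\<lambda>x. q * max x 0 + \<delta> * (r0 W WY (max x b) - r0 W WY b)) (r0 W WY)"
  "mono (prim W)" "mono (prim WY)" "mono (r0 W WY)" "\<And>x. x <= 0 ==> prim W x = 0 \<and> prim WY x = 0 \<and> r0 W WY x = 0"
  "W \<in> borel_measurable borel" "WY \<in> borel_measurable borel"
proof -
 obtain th0 where th0: "\<And>th. th0 <= th ==> q < \<psi> th - \<delta> * th" using diverges by blast
 have big: "q < \<psi> th" "q < \<psi> th - \<delta> * th" if "max th0 0 <= th" for th using th0[of th] mult_nonneg_nonneg[OF \<delta>, of th] that by auto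
 obtain be1 C1 where W1: "0 < be1" "growth be1 C1 W" "mono W" "\<And>th. be1 < th ==> haslap W th (1 / (\<psi> th - q))"
  using scale_function_growth[OF W big(1)] by blast
 obtain be2 C2 where Y1: "0 < be2" "growth be2 C2 WY" "mono WY" "\<And>th. be2 < th ==> haslap WY th (1 / (\<psi> th - \<delta> * th - q))"
  using scale_function_growth[OF WY big(2)] by blast
 \<comment> \<open>\<open>\<alpha>\<close> serves both scale functions at once; \<open>be\<close> is
   twice as large because \<open>conv_exp_lip\<close> doubles the exponent.\<close>
 define \<alpha> where "\<alpha> = max (max be1 be2) (max th0 0)"
 define be where "be = 2 * \<alpha>"
 have \<alpha>: "0 < \<alpha>" "be1 <= \<alpha>" "be2 <= \<alpha>" using W1(1) unfolding \<alpha>_def by auto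
 have be: "0 < be" "\<alpha> <= be" using \<alpha> unfolding be_def by auto
 note gW = growth_raise[OF W1(2) \<alpha>(2)] and gY = growth_raise[OF Y1(2) \<alpha>(3)]
 note gW' = growth_raise[OF gW be(2)] and gY' = growth_raise[OF gY be(2)]
 define Wb where "Wb y = indicator {b<..} y * W y" for y
 have Wb: "growth \<alpha> C1 Wb"
 proof -
  have "0 <= C1 * exp (\<alpha> * x)" for x using growthD(5)[OF gW] by simp
  then show ?thesis using gW unfolding growth_def Wb_def by (auto simp: indicator_def)
 qed
 note Wb' = growth_raise[OF Wb be(2)]
 define H where "H = (indicator {0..} :: real => real)"
 have H: "growth be 1 H" unfolding growth_def H_def using be by (auto simp: indicator_def)
 define A where "A = conv WY Wb"
 have Alip: "exp_lip be (C1 * (C2 / \<alpha>)) A" unfolding A_def be_def by (rule conv_exp_lip[OF gY Wb \<alpha>(1) Y1(3)])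
 have A0: "A x = 0" if "x <= b" for x
 proof -
  have "(\<lambda>y. WY (x - y) * Wb y) = (\<lambda>y. 0)" using that growthD(2)[OF gY] unfolding Wb_def by (auto simp: indicator_def)
  then show ?thesis unfolding A_def conv_def by simp
 qed
 have Ann: "0 <= A x" for x unfolding A_def by (rule conv_int(2)[OF gY Wb \<alpha>(1)])
 have A: "growth be (C1 * (C2 / \<alpha>)) A" by (rule exp_lip_growth[OF Alip A0 Ann be(1)]) (use b in simp)
 have Amono: "mono A" unfolding A_def by (rule conv_mono[OF gY Wb \<alpha>(1) Y1(3)])
 define B where "B th = (\<integral>x. exp (- th * x) * Wb x \<partial>lborel)" for th
 define K where "K th = \<psi> th - \<delta> * th - q" for th
 have lap: "q < \<psi> th" "0 < K th" "haslap W th (1 / (\<psi> th - q))" "haslap WY th (1 / K th)" "haslap Wb th (B th)" "haslap A th (1 / K th * B th)"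
  "haslap H th (1 / th)" "0 < th" if th: "be < th" for th
 proof -
  have th': "0 < th" "be1 < th" "be2 < th" "max th0 0 <= th" using th be \<alpha> unfolding \<alpha>_def by auto
  show "q < \<psi> th" "0 < K th" "0 < th" using big[OF th'(4)] th' unfolding K_def by auto
  show w: "haslap W th (1 / (\<psi> th - q))" and y: "haslap WY th (1 / K th)" using W1(4) Y1(4) th' unfolding K_def by auto
  have "integrable lborel (\<lambda>x. exp (- th * x) * Wb x)"
  proof (rule Bochner_Integration.integrable_bound)
   show "integrable lborel (\<lambda>x. exp (- th * x) * W x)" using w unfolding haslap_def has_bochner_integral_iff by blast
   show "(\<lambda>x. exp (- th * x) * Wb x) \<in> borel_measurable lborel" using growthD(1)[OF Wb] by measurable
  qed (auto simp: Wb_def indicator_def)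
  then show wb: "haslap Wb th (B th)" unfolding haslap_def B_def by (rule has_bochner_integral_integrable)
  show "haslap A th (1 / K th * B th)" using haslap_conv[OF gY Wb \<alpha>(1) y wb] growthD(1)[OF A] unfolding A_def by blast
  show "haslap H th (1 / th)"
  proof (rule haslapI)
   have "(\<integral>\<^sup>+x. ennreal (exp (- th * x) * H x) \<partial>lborel) = (\<integral>\<^sup>+x. ennreal (exp (- th * x)) * indicator {0..} x \<partial>lborel)"
    by (rule nn_integral_cong) (auto simp: H_def indicator_def)
   also have "\<dots> = ennreal (0 - (- (exp (- th * 0) / th)))"
   proof (rule nn_integral_FTC_atLeast)
    show "((\<lambda>x. - (exp (- th * x) / th)) has_real_derivative exp (- th * x)) (at x)" for x
     using th' by (auto intro!: derivative_eq_intros)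
    show "((\<lambda>x. - (exp (- th * x) / th)) \<longlongrightarrow> 0) at_top" using th' by real_asymp
   qed auto
   finally show "(\<integral>\<^sup>+x. ennreal (exp (- th * x) * H x) \<partial>lborel) = ennreal (1 / th)" by simp
  qed (use H th' in "auto simp: growth_def")
 qed
 have primH: "prim H x = max x 0" for x
 proof -
  have "prim H x = (\<integral>y. indicator {0..x} y \<partial>lborel)"
   unfolding prim_def H_def by (rule Bochner_Integration.integral_cong) (auto simp: indicator_def)
  then show ?thesis using prim_neg[OF H, of x] by (auto simp: max_def)
 qed
 let ?wb = "\<lambda>x. prim WY (x - b)"
 have sh: "growth be D (\<lambda>x. u (x - b))" if "growth be D u" for D u
 proof -
  have D: "0 <= D" by (rule growthD(5)[OF that])
  have "u (x - b) <= D * exp (be * x)" for x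
  proof -
   have "exp (be * (x - b)) <= exp (be * x)" using be b by simp
   then show ?thesis using growthD(4)[OF that, of "x - b"] mult_left_mono[OF _ D] by fastforce
  qed
  then show ?thesis using that b unfolding growth_def by auto
 qed
 have lip: "\<exists>D. exp_lip be D (\<lambda>x. c * prim u x)" "\<exists>D. exp_lip be D (\<lambda>x. c * prim u (x - b))" if "growth be D' u" for D' u c
  using exp_lip_cmult[OF prim_exp_lip[OF that be(1)]] exp_lip_shift[OF exp_lip_cmult[OF prim_exp_lip[OF that be(1)]], of _ "- b"] by auto
 note pW = prim_growth[OF gW' be(1)] and pY = prim_growth[OF gY' be(1)]
 have prims: "prim W x = 0 \<and> prim WY x = 0" if "x <= 0" for x using prim_neg[OF gW] prim_neg[OF gY] that by auto
 have t1: "smooth_triple q be (prim (prim W)) (\<lambda>x. max x 0) (prim W)"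
 proof (rule smooth_triple_prim[OF pW prim_exp_lip[OF gW' be(1)] _ _ be(1)])
  show "exp_lip be (1 / be) (\<lambda>x. max x 0)" using prim_exp_lip[OF H be(1)] unfolding primH .
  fix th assume "be < th"
  note l = lap[OF this]
  have "haslap (\<lambda>x. max x 0) th (1 / th / th)" using haslap_prim[OF H be(1) l(7,8)] unfolding primH .
  moreover have "1 / th / th = (\<psi> th - q) * (1 / (\<psi> th - q) / th / th)" using l(1,8) by (simp add: field_simps)
  ultimately show "q < \<psi> th \<and> haslap (prim W) th (1 / (\<psi> th - q) / th) \<and> haslap (\<lambda>x. max x 0) th ((\<psi> th - q) * (1 / (\<psi> th - q) / th / th))"
   using l(1) haslap_prim[OF gW' be(1) l(3,8)] by simp
 qed auto
 have t2: "smooth_triple q be (prim ?wb) (\<lambda>x. \<delta> * prim WY (x - b) + max (x - b) 0) ?wb"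
 proof -
  obtain D1 where D1: "exp_lip be D1 ?wb" using lip(2)[OF gY', of 1] by auto
  obtain D2 where D2: "exp_lip be D2 (\<lambda>x. max (x - b) 0)" using lip(2)[OF H, of 1] unfolding primH by auto
  show ?thesis
  proof (rule smooth_triple_prim[OF sh[OF pY] D1 _ exp_lip_add[OF exp_lip_cmult[OF D1] D2] be(1)])
   show "0 <= \<delta> * ?wb x + max (x - b) 0" for x using \<delta> growthD(3)[OF pY] by simp
   fix th assume "be < th"
   note l = lap[OF this]
   let ?e = "exp (- th * b)"
   have w: "haslap ?wb th (?e * (1 / K th / th))" by (rule haslap_shift[OF haslap_prim[OF gY' be(1) l(4,8)]])
   have "haslap (\<lambda>x. max (x - b) 0) th (?e * (1 / th / th))" using haslap_shift[OF haslap_prim[OF H be(1) l(7,8)], of b] unfolding primH .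
   from haslap_add[OF haslap_cmult[OF w, of \<delta>] this]
   have "haslap (\<lambda>x. \<delta> * ?wb x + max (x - b) 0) th (\<delta> * (?e * (1 / K th / th)) + ?e * (1 / th / th))" .
   moreover have "\<delta> * (?e * (1 / K th / th)) + ?e * (1 / th / th) = (\<psi> th - q) * (?e * (1 / K th / th) / th)"
   proof -
    have "\<psi> th - q = K th + \<delta> * th" unfolding K_def by simp
    then show ?thesis using l(2,8) by (simp add: field_simps)
   qed
   ultimately show "q < \<psi> th \<and> haslap ?wb th (?e * (1 / K th / th)) \<and> haslap (\<lambda>x. \<delta> * ?wb x + max (x - b) 0) th ((\<psi> th - q) * (?e * (1 / K th / th) / th))"
    using w l(1) by simp
  qed
 qed
 have r0: "r0 W WY x = q * prim W x + q * \<delta> * A x" for x unfolding r0_def A_def Wb_def ..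
 have qd: "0 <= q * \<delta>" using q \<delta> by simp
 have r0z: "r0 W WY x = 0" if "x <= 0" for x using that prims A0[of x] b unfolding r0 by simp
 have r0m: "mono (r0 W WY)"
 proof (rule monoI)
  fix x y :: real assume "x <= y"
  then have "prim W x <= prim W y" "A x <= A y" using prim_mono[OF gW \<alpha>(1)] Amono by (auto simp: mono_def)
  then show "r0 W WY x <= r0 W WY y" unfolding r0 using q qd by (intro add_mono mult_left_mono) auto
 qed
 obtain D3 where D3: "exp_lip be D3 (r0 W WY)"
  using lip(1)[OF gW', of q] exp_lip_add[OF _ exp_lip_cmult[OF Alip, of "q * \<delta>"]] unfolding r0[abs_def] by blast
 have r0nn: "0 <= r0 W WY x" for x using r0z[of 0] r0z[of x] monoD[OF r0m, of 0 x] by (cases "x <= 0") auto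
 \<comment> \<open>Expresses the increment of \<open>r0\<close> above \<open>b\<close> by functions
   whose transforms are available.\<close>
 have jump: "r0 W WY (max x b) - r0 W WY b = q * prim Wb x + q * \<delta> * A x" for x
 proof (cases "x <= b")
  case True
  then have "(\<lambda>y. indicator {..x} y * Wb y) = (\<lambda>y. 0)" unfolding Wb_def by (auto simp: indicator_def)
  then have "prim Wb x = 0" unfolding prim_def by simp
  then show ?thesis using True A0[of x] by (simp add: max_def)
 next
  case False
  have "prim Wb x = (\<integral>z. indicator {b<..x} z * W z \<partial>lborel)"
   unfolding prim_def Wb_def by (rule Bochner_Integration.integral_cong) (auto simp: indicator_def)
  then have "prim Wb x = prim W x - prim W b" using prim_diff(1)[OF gW \<alpha>(1), of b x] False by simp
  then show ?thesis using False A0[of b] unfolding r0 by (simp add: max_def right_diff_distrib)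
 qed
 have t3: "smooth_triple q be (prim (r0 W WY)) (\<lambda>x. q * max x 0 + \<delta> * (r0 W WY (max x b) - r0 W WY b)) (r0 W WY)"
 proof -
  let ?G = "\<lambda>x. q * max x 0 + \<delta> * (r0 W WY (max x b) - r0 W WY b)"
  obtain D4 where D4: "exp_lip be D4 (\<lambda>x. q * max x 0)" using lip(1)[OF H, of q] unfolding primH by blast
  obtain D5 where D5: "exp_lip be D5 (\<lambda>x. q * prim Wb x)" using lip(1)[OF Wb'] by blast
  have G: "exp_lip be (D4 + \<bar>\<delta>\<bar> * (D5 + \<bar>q * \<delta>\<bar> * (C1 * (C2 / \<alpha>)))) ?G"
   unfolding jump by (intro exp_lip_add[OF D4] exp_lip_cmult exp_lip_add[OF D5] Alip)
  show ?thesis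
  proof (rule smooth_triple_prim[OF exp_lip_growth[OF D3 r0z r0nn be(1)] D3 _ G be(1)])
   show "0 <= ?G x" for x using q \<delta> monoD[OF r0m, of b "max x b"] by simp
   fix th assume "be < th"
   note l = lap[OF this]
   define L where "L = q * (1 / (\<psi> th - q) / th) + q * \<delta> * (1 / K th * B th)"
   have r: "haslap (r0 W WY) th L" unfolding r0[abs_def] L_def
    by (intro haslap_add haslap_cmult haslap_prim[OF gW' be(1) l(3,8)] l(6))
   have m: "haslap (\<lambda>x. max x 0) th (1 / th / th)" using haslap_prim[OF H be(1) l(7,8)] unfolding primH .
   have "haslap ?G th (q * (1 / th / th) + \<delta> * (q * (B th / th) + q * \<delta> * (1 / K th * B th)))"
    unfolding jump by (intro haslap_add haslap_cmult m haslap_prim[OF Wb' be(1) l(5,8)] l(6))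
   \<comment> \<open>The transform \<open>B th\<close> is not explicit, but it matches on both
     sides; the identity rests on \<open>\<psi> th - q = K th + \<delta> * th\<close>.\<close>
   moreover have "q * (1 / th / th) + \<delta> * (q * (B th / th) + q * \<delta> * (1 / K th * B th)) = (\<psi> th - q) * (L / th)"
   proof -
    have "\<psi> th - q \<noteq> 0" "K th \<noteq> 0" "th \<noteq> 0" "\<psi> th - q = K th + \<delta> * th" using l(1,2,8) unfolding K_def by auto
    then have "K th + \<delta> * th \<noteq> 0" by simp
    then show ?thesis using \<open>K th \<noteq> 0\<close> \<open>th \<noteq> 0\<close> unfolding L_def \<open>\<psi> th - q = K th + \<delta> * th\<close> by (simp add: divide_simps) (simp add: algebra_simps)
   qed
   ultimately show "q < \<psi> th \<and> haslap (r0 W WY) th L \<and> haslap ?G th ((\<psi> th - q) * (L / th))"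
    using r l(1) by simp
  qed
 qed
 show ?thesis
  by (rule that[OF be(1) t1 t2 t3 prim_mono[OF gW \<alpha>(1)] prim_mono[OF gY \<alpha>(1)] r0m _ growthD(1)[OF gW] growthD(1)[OF gY]]) (use prims r0z in auto)
qed

end

section \<open>The limit of vanishing mesh\<close>

abbreviation mesh :: "nat => real" where "mesh N \<equiv> 1 / real (Suc N)"

text \<open>Normalised to a probability, so that time acts as an independent variable and bounded
  convergence applies on the product space.\<close>

abbreviation uniform :: "nat => real measure" where "uniform t \<equiv> uniform_measure lborel {0..real t}"

lemma prob_uniform: "0 < t ==> prob_space (uniform t)"
 by (rule prob_space_uniform_measure) (auto simp: emeasure_lborel_Icc_eq)

lemma uniform_integral:
 assumes t: "0 < t" and f: "f \<in> borel_measurable borel"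
 shows "real t * (\<integral>s. f s \<partial>uniform t) = (\<integral>s. indicator {0..real t} s * f s \<partial>lborel)"
proof -
 have "uniform t = density lborel (\<lambda>s. ennreal (indicator {0..real t} s / real t))"
  unfolding uniform_measure_def by (rule density_cong) (auto simp: indicator_def divide_ennreal[symmetric] ennreal_1[symmetric] t simp del: ennreal_1)
 then have "(\<integral>s. f s \<partial>uniform t) = (\<integral>s. indicator {0..real t} s / real t * f s \<partial>lborel)"
  using f integral_density[of f lborel "\<lambda>s. indicator {0..real t} s / real t"] by simp
 also have "\<dots> = (\<integral>s. indicator {0..real t} s * f s / real t \<partial>lborel)" by simp
 also have "\<dots> = (\<integral>s. indicator {0..real t} s * f s \<partial>lborel) / real t" by (rule integral_divide_zero)
 finally show ?thesis using t by simp
qed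

lemma grid_index_meas[measurable]: "grid_index N \<in> borel \<rightarrow>\<^sub>M count_space UNIV"
 unfolding grid_index_def by measurable

text \<open>Turns a sum over steps into a time integral of a step function, so that discrete and
  continuous functionals live on one space.\<close>

lemma grid_integral:
 assumes "0 < t"
 shows "real t * (\<integral>s. c (grid_index N s) \<partial>uniform t) = (\<Sum>k<t * Suc N. mesh N * c k)"
proof -
 define J where "J k = {real k * mesh N..<real (Suc k) * mesh N}" for k
 have Jm[measurable]: "J k \<in> sets borel" for k unfolding J_def by simp
 have Je: "emeasure lborel (J k) = ennreal (mesh N)" for k
  unfolding J_def by (subst emeasure_lborel_Ico) (simp_all add: left_diff_distrib[symmetric] divide_right_mono diff_divide_distrib[symmetric])
 have "indicator {0..real t} s * c (grid_index N s) = (\<Sum>k<t * Suc N. c k * indicator (J k) s)" if "s \<noteq> real t" for s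
 proof -
  have J: "s \<in> J k \<longleftrightarrow> 0 <= s \<and> k = grid_index N s" for k
  proof
   assume k: "s \<in> J k"
   then have "0 <= s" unfolding J_def by (auto intro: order_trans[rotated])
   moreover have "real k <= s * real (Suc N)" "s * real (Suc N) < real k + 1" using k unfolding J_def by (simp_all add: field_simps)
   then have "\<lfloor>s * real (Suc N)\<rfloor> = int k" by linarith
   ultimately show "0 <= s \<and> k = grid_index N s" unfolding grid_index_def by simp
  next
   assume "0 <= s \<and> k = grid_index N s"
   then show "s \<in> J k" using grid_index_bounds[of s N] unfolding J_def by auto
  qed
  have lt: "grid_index N s < t * Suc N \<longleftrightarrow> s < real t" if "0 <= s"
  proof
   assume "grid_index N s < t * Suc N"
   then have "real (Suc (grid_index N s)) <= real (t * Suc N)" by (simp only: of_nat_le_iff Suc_le_eq)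
   then have "real (Suc (grid_index N s)) * mesh N <= real (t * Suc N) * mesh N" by (intro mult_right_mono) auto
   moreover have "real (t * Suc N) * mesh N = real t" unfolding of_nat_mult by (simp del: of_nat_Suc)
   ultimately show "s < real t" using grid_index_bounds(2)[OF that, of N] by linarith
  next
   assume "s < real t"
   then have "real (grid_index N s) * mesh N < real t" using grid_index_bounds(1)[OF that, of N] by linarith
   then have "real (grid_index N s) < real t * real (Suc N)" by (simp add: field_simps)
   then show "grid_index N s < t * Suc N" by (simp only: of_nat_mult[symmetric] of_nat_less_iff)
  qed
  have "(\<Sum>k<t * Suc N. c k * indicator (J k) s) = (\<Sum>k<t * Suc N. if k = grid_index N s then indicator {0..} s * c k else 0)"
   by (rule sum.cong) (auto simp: J indicator_def)
  also have "\<dots> = (if grid_index N s < t * Suc N then indicator {0..} s * c (grid_index N s) else 0)"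
   by (subst sum.delta) auto
  finally show ?thesis using lt that by (cases "0 <= s") (auto simp: indicator_def)
 qed
 then have "AE s in lborel. indicator {0..real t} s * c (grid_index N s) = (\<Sum>k<t * Suc N. c k * indicator (J k) s)"
  by (intro AE_I[of _ _ "{real t}"]) auto
 then have "(\<integral>s. indicator {0..real t} s * c (grid_index N s) \<partial>lborel) = (\<integral>s. (\<Sum>k<t * Suc N. c k * indicator (J k) s) \<partial>lborel)"
  by (intro integral_cong_AE) measurable
 also have "\<dots> = (\<Sum>k<t * Suc N. \<integral>s. c k * indicator (J k) s \<partial>lborel)"
  by (intro Bochner_Integration.integral_sum integrable_mult_right integrable_real_indicator) (auto simp: Je)
 also have "\<dots> = (\<Sum>k<t * Suc N. mesh N * c k)"
 proof (rule sum.cong[OF refl])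
  fix k
  show "(\<integral>s. c k * indicator (J k) s \<partial>lborel) = mesh N * c k" by (simp add: measure_def Je)
 qed
 finally show ?thesis by (subst uniform_integral[OF assms]) measurable
qed

lemma average_bounds:
 fixes f :: "real => real"
 assumes der: "\<And>v. (I has_real_derivative f v) (at v)" and m: "mono f" and e: "0 < e"
 shows "f (y - e) <= (I y - I (y - e)) / e" "(I y - I (y - e)) / e <= f y"
proof -
 obtain z where z: "y - e < z" "z < y" "I y - I (y - e) = (y - (y - e)) * f z"
  using MVT2[of "y - e" y I f] der e by auto
 then have "(I y - I (y - e)) / e = f z" using e by simp
 then show "f (y - e) <= (I y - I (y - e)) / e" "(I y - I (y - e)) / e <= f y"
  using m z unfolding mono_def by simp_all
qed

text \<open>The losses are normalised by \<open>\<delta> * h\<close>, hence the strict positivity;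
  the case \<open>\<delta> = 0\<close> is treated in the final theorem.\<close>

locale refracted_levy = refraction +
 fixes V :: "real => 'a => real"
 assumes paths: "AE om in M. regulated_process (\<lambda>t. X t om) \<delta> b x (\<lambda>t. V t om)" and \<delta>_pos: "0 < \<delta>"
begin

abbreviation start :: real where "start \<equiv> max x 0"

abbreviation approx :: "nat => nat => 'a => real" where "approx N k om \<equiv> chain \<delta> b (mesh N) start (increments (\<lambda>t. X t om) (mesh N)) k"

abbreviation surv :: "real => nat => real => 'a => real" where "surv a N s om \<equiv> alive a (mesh N) start (grid_index N s) om"

text \<open>\<open>V\<close> is not assumed measurable in \<open>om\<close>, let alone jointly.
  \<open>U\<close> is a jointly measurable substitute that agrees with it, on almost every path, at
  all but countably many positive times.\<close>

definition U :: "'a \<times> real => real" where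
 "U p = lim (\<lambda>N. approx N (grid_index N (snd p)) (fst p))"

abbreviation cut :: "real => real => real" where "cut a y \<equiv> max 0 (min y a)"

text \<open>The expected discounted occupation while the stopped chain is alive. \<open>cut\<close>
  confines the argument to \<open>[0, a]\<close>, where the inequalities for \<open>m\<close> are
  available; \<open>max\<close> keeps the discount at most 1 also at negative times.\<close>

definition occ :: "real => nat => nat => (real => real) => real" where
 "occ a N t m = real t * (\<integral>p. surv a N (snd p) (fst p) * (exp (- q * max (snd p) 0) * m (cut a (U p))) \<partial>(M \<Otimes>\<^sub>M uniform t))"

lemma approx_meas: "approx N k \<in> borel_measurable M"
proof (induction k)
 case (Suc k)
 have "approx N (Suc k) = (\<lambda>om. step_map \<delta> b (mesh N) (approx N k om + inc (mesh N) k om))" by (simp add: inc_def)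
 moreover have "inc (mesh N) k \<in> borel_measurable M" by (rule inc_meas) simp
 ultimately show ?case using Suc by (simp only:) measurable
qed simp

lemma grid_joint:
 assumes "\<And>k. f k \<in> borel_measurable M"
 shows "(\<lambda>p. f (grid_index N (snd p)) (fst p)) \<in> borel_measurable (M \<Otimes>\<^sub>M borel)"
proof (rule measurable_compose_countable[where g = "\<lambda>p. grid_index N (snd p)"])
 show "(\<lambda>p. f k (fst p)) \<in> borel_measurable (M \<Otimes>\<^sub>M borel)" for k using assms[of k] by measurable
qed measurable

lemma U_meas[measurable]: "U \<in> borel_measurable (M \<Otimes>\<^sub>M borel)"
 unfolding U_def by (intro borel_measurable_lim_metric grid_joint approx_meas)

lemma Z_joint[measurable]: "(\<lambda>p. Z a (mesh N) start (grid_index N (snd p)) (fst p)) \<in> borel_measurable (M \<Otimes>\<^sub>M borel)"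
 by (rule grid_joint[OF Z_meas]) simp

lemma joint_sets: "measurable (M \<Otimes>\<^sub>M uniform t) N = measurable (M \<Otimes>\<^sub>M borel) N"
 by (intro measurable_cong_sets sets_pair_measure_cong) auto

lemma joint_integrable:
 assumes t: "0 < t" and f: "f \<in> borel_measurable (M \<Otimes>\<^sub>M borel)" and B: "\<And>p. \<bar>f p\<bar> <= (B :: real)"
 shows "integrable (M \<Otimes>\<^sub>M uniform t) f"
  "(\<integral>p. f p \<partial>(M \<Otimes>\<^sub>M uniform t)) = (\<integral>om. \<integral>s. f (om, s) \<partial>uniform t \<partial>M)"
  "integrable M (\<lambda>om. \<integral>s. f (om, s) \<partial>uniform t)"
proof -
 interpret T: prob_space "uniform t" by (rule prob_uniform[OF t])
 interpret P: pair_prob_space M "uniform t" ..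
 have m: "f \<in> borel_measurable (M \<Otimes>\<^sub>M uniform t)" using f unfolding joint_sets .
 show i: "integrable (M \<Otimes>\<^sub>M uniform t) f" by (rule P.integrable_const_bound[where B = B]) (use B m in auto)
 show "(\<integral>p. f p \<partial>(M \<Otimes>\<^sub>M uniform t)) = (\<integral>om. \<integral>s. f (om, s) \<partial>uniform t \<partial>M)" by (rule P.integral_fst'[OF i, symmetric])
 show "integrable M (\<lambda>om. \<integral>s. f (om, s) \<partial>uniform t)" by (rule P.integrable_fst'[OF i])
qed

text \<open>The exceptional times depend on the path, so convergence is assumed section by section
  and domination is applied twice.\<close>

lemma joint_tendsto:
 assumes t: "0 < t" and f: "\<And>N. f N \<in> borel_measurable (M \<Otimes>\<^sub>M borel)" and B: "\<And>N p. \<bar>f N p\<bar> <= (B :: real)"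
  and lim: "AE om in M. AE s in uniform t. (\<lambda>N. f N (om, s)) \<longlonglongrightarrow> 0"
 shows "(\<lambda>N::nat. \<integral>p. f N p \<partial>(M \<Otimes>\<^sub>M uniform t)) \<longlonglongrightarrow> 0"
proof -
 interpret T: prob_space "uniform t" by (rule prob_uniform[OF t])
 note j = joint_integrable[OF t f B]
 have sec: "(\<lambda>s. f N (om, s)) \<in> borel_measurable (uniform t)" if "om \<in> space M" for N om
  using measurable_Pair2[OF f that, of N] by simp
 have "(\<lambda>N. \<integral>om. \<integral>s. f N (om, s) \<partial>uniform t \<partial>M) \<longlonglongrightarrow> (\<integral>om. 0 \<partial>M)"
 proof (rule integral_dominated_convergence[where w = "\<lambda>_. B"])
  show "AE om in M. (\<lambda>N. \<integral>s. f N (om, s) \<partial>uniform t) \<longlonglongrightarrow> 0"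
   using lim AE_space
  proof eventually_elim
   case (elim om)
   have "(\<lambda>N. \<integral>s. f N (om, s) \<partial>uniform t) \<longlonglongrightarrow> (\<integral>s. 0 \<partial>uniform t)"
    by (rule integral_dominated_convergence[where w = "\<lambda>_. B"]) (use elim sec B in "auto intro!: T.integrable_const")
   then show ?case by simp
  qed
  show "AE om in M. norm (\<integral>s. f N (om, s) \<partial>uniform t) <= B" for N
  proof (rule AE_I2)
   fix om assume "om \<in> space M"
   have "norm (\<integral>s. f N (om, s) \<partial>uniform t) <= (\<integral>s. B \<partial>uniform t)"
    by (rule Bochner_Integration.integral_norm_bound_integral) (use B sec[OF \<open>om \<in> space M\<close>] in "auto intro!: T.integrable_const_bound[where B = B]")
   then show "norm (\<integral>s. f N (om, s) \<partial>uniform t) <= B" using T.prob_space by simp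
  qed
 qed (use borel_measurable_integrable[OF j(3)] in auto)
 then show ?thesis using j(2) by simp
qed

lemma AE_uniform_countable:
 assumes "countable C" "\<And>s. 0 < s ==> s \<notin> C ==> Q s"
 shows "AE s in uniform t. Q s"
proof (rule AE_uniform_measureI)
 have "AE s in lborel. s \<notin> insert 0 C" using assms(1) by (intro AE_not_in countable_imp_null_set_lborel) auto
 then show "AE s in lborel. s \<in> {0..real t} --> Q s" by eventually_elim (use assms(2) in auto)
qed simp

lemma good_paths:
 "AE om in M. regulated_process (\<lambda>t. X t om) \<delta> b x (\<lambda>t. V t om) \<and>
   (\<exists>C. countable C \<and> (\<forall>s>0. s \<notin> C --> (\<lambda>N. approx N (grid_index N s) om) \<longlonglongrightarrow> V s om \<and> U (om, s) = V s om))"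
 using paths
proof eventually_elim
 case (elim om)
 then interpret r: regulated_process "\<lambda>t. X t om" \<delta> b x "\<lambda>t. V t om" .
 obtain C where C: "countable C" "\<And>s. 0 < s ==> s \<notin> C ==> (\<lambda>N. r.disc N (grid_index N s)) \<longlonglongrightarrow> V s om"
  by (rule r.disc_tendsto) blast
 have "(\<lambda>N. approx N (grid_index N s) om) \<longlonglongrightarrow> V s om \<and> U (om, s) = V s om" if "s > 0" "s \<notin> C" for s
  using C(2)[OF that] limI[OF C(2)[OF that]] unfolding r.disc_def U_def by simp
 then show ?case using elim C(1) by blast
qed

lemma grid_time_tendsto:
 assumes "0 < s"
 shows "(\<lambda>N. real (grid_index N s) * mesh N) \<longlonglongrightarrow> s"
proof (rule tendsto_sandwich)
 show "(\<lambda>N. s - mesh N) \<longlonglongrightarrow> s" using tendsto_diff[OF tendsto_const mesh_tendsto, of s] by simp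
 have "s - mesh N <= real (grid_index N s) * mesh N" for N
  using grid_index_bounds(2)[of s N] assms by (simp add: algebra_simps add_divide_distrib)
 then show "\<forall>\<^sub>F N in sequentially. s - mesh N <= real (grid_index N s) * mesh N" by (intro always_eventually allI)
 show "\<forall>\<^sub>F N in sequentially. real (grid_index N s) * mesh N <= s"
  using grid_index_bounds(1)[of s] assms by (intro always_eventually allI) simp
qed simp

lemma exp_discount_le: "exp (- q * max s 0) <= 1"
 using q by simp

text \<open>At the level \<open>b\<close> the limit of the discretized losses is unknown, but it lies between \<open>0\<close> and \<open>\<delta>\<close>.\<close>

lemma dynkin_limit:
 assumes tr: "smooth_triple q be F g \<phi>" and be: "0 <= be" and inc': "\<And>v. v <= 0 ==> F v <= F 0" and t: "0 < t" and a: "b < a"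
  and m: "m \<in> borel_measurable borel" "\<And>y. \<bar>m y\<bar> <= B"
  and low: "\<And>y. 0 <= y ==> y <= a ==> m y <= g y - \<delta> * (\<phi> y * indicator {b<..} y) - \<delta> * (max 0 (\<phi> b) * indicator {b} y)"
  and e: "0 < e"
 shows "\<forall>\<^sub>F N in sequentially. F start + occ a N t m - e <= (\<integral>om. payoff a (mesh N) start F (t * Suc N) om \<partial>M)"
proof -
 obtain C K where lip: "exp_lip be C g" "exp_lip be K \<phi>" using tr unfolding smooth_triple_def by blast
 define Bg Bp where "Bg = \<bar>g 0\<bar> + C * exp (be * a)" and "Bp = \<bar>\<phi> 0\<bar> + K * exp (be * a)"
 have bd: "\<bar>g y\<bar> <= Bg" "\<bar>\<phi> y\<bar> <= Bp" if "0 <= y" "y <= a" for y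
  using exp_lip_bounded[OF lip(1) be that] exp_lip_bounded[OF lip(2) be that] unfolding Bg_def Bp_def by auto
 have a0: "0 <= a" using a b by simp
 have cut: "0 <= cut a y" "cut a y <= a" for y using a0 by auto
 note [measurable] = exp_lip_meas[OF lip(1)] exp_lip_meas[OF lip(2)] m(1)
 define z where "z N p = cut a (Z a (mesh N) start (grid_index N (snd p)) (fst p))" for N and p :: "'a \<times> real"
 define l where "l N p = step_loss \<delta> b (mesh N) (Z a (mesh N) start (grid_index N (snd p)) (fst p) + inc (mesh N) (grid_index N (snd p)) (fst p)) / mesh N" for N and p :: "'a \<times> real"
 define R where "R N p = exp (- q * (real (grid_index N (snd p)) * mesh N)) * (surv a N (snd p) (fst p) * (g (z N p) - \<phi> (z N p) * l N p))" for N and p :: "'a \<times> real"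
 define S where "S N p = surv a N (snd p) (fst p) * (exp (- q * max (snd p) 0) * m (cut a (U p)))" for N and p :: "'a \<times> real"
 \<comment> \<open>Only the deficit matters: \<open>S <= R + d\<close> is enough for a lower bound,
   and \<open>d\<close> tends to 0 although \<open>R\<close> need not converge.\<close>
 define d where "d N p = max 0 (S N p - R N p)" for N p
 have inc_m[measurable]: "(\<lambda>p. inc (mesh N) (grid_index N (snd p)) (fst p)) \<in> borel_measurable (M \<Otimes>\<^sub>M borel)" for N
  by (rule grid_joint[OF inc_meas]) simp
 have zm[measurable]: "z N \<in> borel_measurable (M \<Otimes>\<^sub>M borel)" for N unfolding z_def by measurable
 have lm[measurable]: "l N \<in> borel_measurable (M \<Otimes>\<^sub>M borel)" for N unfolding l_def by measurable
 have Rm[measurable]: "R N \<in> borel_measurable (M \<Otimes>\<^sub>M borel)" and Sm[measurable]: "S N \<in> borel_measurable (M \<Otimes>\<^sub>M borel)" for N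
  unfolding R_def S_def by measurable
 have dm: "d N \<in> borel_measurable (M \<Otimes>\<^sub>M borel)" for N unfolding d_def by measurable
 have lb: "0 <= step_loss \<delta> b (mesh N) y / mesh N" "step_loss \<delta> b (mesh N) y / mesh N <= \<delta>" for N y
  using step_loss_bounds(1,2)[OF \<delta> _ b, of "mesh N" y] by (simp_all add: field_simps)
 have Rb: "\<bar>R N p\<bar> <= Bg + Bp * \<delta>" for N p
 proof -
  have "\<bar>g (z N p) - \<phi> (z N p) * l N p\<bar> <= \<bar>g (z N p)\<bar> + \<bar>\<phi> (z N p)\<bar> * \<bar>l N p\<bar>" by (simp add: abs_mult[symmetric])
  also have "\<dots> <= Bg + Bp * \<delta>"
  proof (intro add_mono mult_mono)
   show "\<bar>g (z N p)\<bar> <= Bg" "\<bar>\<phi> (z N p)\<bar> <= Bp" unfolding z_def by (rule bd[OF cut])+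
   then show "0 <= Bp" by linarith
   show "\<bar>l N p\<bar> <= \<delta>" unfolding l_def using lb[of N] by (simp only: abs_of_nonneg)
  qed simp
  finally have *: "\<bar>g (z N p) - \<phi> (z N p) * l N p\<bar> <= Bg + Bp * \<delta>" .
  have "\<bar>R N p\<bar> = (exp (- q * (real (grid_index N (snd p)) * mesh N)) * surv a N (snd p) (fst p)) * \<bar>g (z N p) - \<phi> (z N p) * l N p\<bar>"
   unfolding R_def by (simp add: abs_mult mult.assoc)
  also have "\<dots> <= 1 * \<bar>g (z N p) - \<phi> (z N p) * l N p\<bar>"
   using q by (intro mult_right_mono mult_le_one) (auto simp: indicator_def)
  finally show ?thesis using * by simp
 qed
 have Sb: "\<bar>S N p\<bar> <= B" for N p
 proof -
  have "\<bar>S N p\<bar> = (surv a N (snd p) (fst p) * exp (- q * max (snd p) 0)) * \<bar>m (cut a (U p))\<bar>" unfolding S_def by (simp add: abs_mult mult.assoc)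
  also have "\<dots> <= 1 * \<bar>m (cut a (U p))\<bar>" by (intro mult_right_mono mult_le_one exp_discount_le) (auto simp: indicator_def)
  finally show ?thesis using m(2)[of "cut a (U p)"] by simp
 qed
 define D where "D = B + (Bg + Bp * \<delta>)"
 have db: "\<bar>d N p\<bar> <= D" for N p using Rb[of N p] Sb[of N p] unfolding d_def D_def by linarith
 have "AE om in M. AE s in uniform t. (\<lambda>N. d N (om, s)) \<longlonglongrightarrow> 0"
  using good_paths
 proof eventually_elim
  case (elim om)
  then obtain C where C: "countable C" "\<And>s. s > 0 ==> s \<notin> C ==> (\<lambda>N. approx N (grid_index N s) om) \<longlonglongrightarrow> V s om \<and> U (om, s) = V s om" by blast
  from elim interpret r: regulated_process "\<lambda>t. X t om" \<delta> b x "\<lambda>t. V t om" by blast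
  show ?case
  proof (rule AE_uniform_countable[OF C(1)])
   fix s :: real assume s: "0 < s" "s \<notin> C"
   define u where "u = V s om"
   define y where "y = cut a u"
   define w where "w N = cut a (approx N (grid_index N s) om)" for N
   define k where "k N = exp (- q * (real (grid_index N s) * mesh N))" for N
   define j where "j N = step_loss \<delta> b (mesh N) (approx N (grid_index N s) om + inc (mesh N) (grid_index N s) om) / mesh N" for N
   \<comment> \<open>An upper bound of \<open>S - R\<close> while the chain is alive. For
     \<open>u = b\<close> the loss, whose limit is unknown, is replaced by its largest possible
     effect.\<close>
   define y' where "y' N = exp (- q * s) * m y - k N * (g (w N)) + (if u = b then k N * (\<delta> * max 0 (\<phi> (w N))) else k N * (\<phi> (w N) * j N))" for N
   have wl: "w \<longlonglongrightarrow> y" unfolding w_def[abs_def] y_def u_def using C(2)[OF s] by (intro tendsto_max tendsto_min tendsto_const) blast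
   have kl: "k \<longlonglongrightarrow> exp (- q * s)" unfolding k_def[abs_def] by (intro tendsto_intros grid_time_tendsto s)
   have gl: "(\<lambda>N. g (w N)) \<longlonglongrightarrow> g y" "(\<lambda>N. \<phi> (w N)) \<longlonglongrightarrow> \<phi> y"
    using exp_lip_continuous[OF lip(1)] exp_lip_continuous[OF lip(2)] by (auto intro!: isCont_tendsto_compose[OF _ wl] simp: continuous_on_eq_continuous_at)
   define L where "L = exp (- q * s) * (m y - g y + (if u = b then \<delta> * max 0 (\<phi> y) else \<phi> y * (\<delta> * indicator {b<..} u)))"
   have "y' \<longlonglongrightarrow> L"
   proof (cases "u = b")
    case True
    have "(\<lambda>N. exp (- q * s) * m y - k N * g (w N) + k N * (\<delta> * max 0 (\<phi> (w N)))) \<longlonglongrightarrow> exp (- q * s) * m y - exp (- q * s) * g y + exp (- q * s) * (\<delta> * max 0 (\<phi> y))"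
     by (intro tendsto_intros kl gl)
    then show ?thesis using True unfolding y'_def[abs_def] L_def by (simp add: algebra_simps)
   next
    case False
    have "(\<lambda>N. \<delta> * (r.disc_loss N (grid_index N s) / (\<delta> * mesh N))) \<longlonglongrightarrow> \<delta> * indicator {b<..} u"
     using r.disc_loss_tendsto[of s] s False \<delta>_pos unfolding u_def by (intro tendsto_intros) auto
    moreover have "\<delta> * (r.disc_loss N (grid_index N s) / (\<delta> * mesh N)) = j N" for N
     using \<delta>_pos unfolding j_def r.disc_loss_def r.disc_def inc_def by simp
    ultimately have jl: "j \<longlonglongrightarrow> \<delta> * indicator {b<..} u" by simp
    have "(\<lambda>N. exp (- q * s) * m y - k N * g (w N) + k N * (\<phi> (w N) * j N)) \<longlonglongrightarrow> exp (- q * s) * m y - exp (- q * s) * g y + exp (- q * s) * (\<phi> y * (\<delta> * indicator {b<..} u))"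
     by (intro tendsto_intros kl gl jl)
    then show ?thesis using False unfolding y'_def[abs_def] L_def by (simp add: algebra_simps)
   qed
   then have up: "(\<lambda>N. max 0 (y' N)) \<longlonglongrightarrow> max 0 L" by (intro tendsto_max tendsto_const)
   \<comment> \<open>This is \<open>low\<close> at \<open>y\<close>; since \<open>0 < b < a\<close>,
     cutting does not change the side of \<open>b\<close> on which the point lies.\<close>
   have "m y - g y + (if u = b then \<delta> * max 0 (\<phi> y) else \<phi> y * (\<delta> * indicator {b<..} u)) <= 0"
    using low[of y] cut[of u] a b unfolding y_def by (cases "u = b"; cases "b < u") (auto simp: max_def min_def indicator_def mult.commute split: if_splits)
   then have "L <= 0" unfolding L_def by (intro mult_nonneg_nonpos) auto
   then have up: "(\<lambda>N. max 0 (y' N)) \<longlonglongrightarrow> 0" using up by (simp only: max_absorb1)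
   have "d N (om, s) <= max 0 (y' N)" for N
   proof (cases "Z a (mesh N) start (grid_index N s) om <= a")
    case True
    have Z: "Z a (mesh N) start (grid_index N s) om = approx N (grid_index N s) om" by (rule Z_chain(2)[OF True])
    have "S N (om, s) = exp (- q * s) * m y" using True C(2)[OF s] s unfolding S_def y_def u_def by (simp add: max_def)
    moreover have "R N (om, s) = k N * (g (w N) - \<phi> (w N) * j N)" using True unfolding R_def z_def l_def k_def w_def j_def fst_conv snd_conv Z by simp
    moreover have "\<phi> (w N) * j N <= \<delta> * max 0 (\<phi> (w N))"
    proof -
     have "\<phi> (w N) * j N <= max 0 (\<phi> (w N)) * j N" using lb(1)[of N] unfolding j_def by (intro mult_right_mono) auto
     also have "\<dots> <= max 0 (\<phi> (w N)) * \<delta>" using lb(2)[of N] unfolding j_def by (intro mult_left_mono) auto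
     finally show ?thesis by (simp add: mult.commute)
    qed
    then have "k N * (\<phi> (w N) * j N) <= k N * (\<delta> * max 0 (\<phi> (w N)))" unfolding k_def by (intro mult_left_mono) auto
    ultimately have "S N (om, s) - R N (om, s) <= y' N" unfolding y'_def by (simp add: right_diff_distrib)
    then show ?thesis unfolding d_def by simp
   next
    case False then show ?thesis unfolding d_def S_def R_def by simp
   qed
   moreover have "0 <= d N (om, s)" for N unfolding d_def by simp
   ultimately show "(\<lambda>N. d N (om, s)) \<longlonglongrightarrow> 0" by (intro tendsto_sandwich[OF _ _ tendsto_const up] always_eventually allI)
  qed
 qed
 then have "(\<lambda>N. \<integral>p. d N p \<partial>(M \<Otimes>\<^sub>M uniform t)) \<longlonglongrightarrow> 0" by (rule joint_tendsto[OF t dm db])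
 then have "(\<lambda>N. real t * (\<integral>p. d N p \<partial>(M \<Otimes>\<^sub>M uniform t))) \<longlonglongrightarrow> real t * 0" by (intro tendsto_mult tendsto_const)
 then have small: "\<forall>\<^sub>F N in sequentially. real t * (\<integral>p. d N p \<partial>(M \<Otimes>\<^sub>M uniform t)) < e / 2" by (rule order_tendstoD) (use e in simp)
 obtain h where h: "h > 0" "\<And>h' n. 0 < h' ==> h' < h ==> real n * h' <= real t ==>
  integrable M (payoff a h' start F n) \<and> integrable M (running a h' start g \<phi> n) \<and>
  F start + (\<integral>om. running a h' start g \<phi> n om \<partial>M) - e / 2 <= (\<integral>om. payoff a h' start F n om \<partial>M)"
  by (rule discrete_dynkin[OF tr be inc', of "e / 2" "real t" start a]) (use e in auto)
 have "\<forall>\<^sub>F N in sequentially. mesh N < h" using mesh_tendsto h(1) by (rule order_tendstoD)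
 with small show ?thesis
 proof eventually_elim
  case (elim N)
  have tm: "real (t * Suc N) * mesh N = real t" unfolding of_nat_mult by (simp del: of_nat_Suc)
  have hh: "F start + (\<integral>om. running a (mesh N) start g \<phi> (t * Suc N) om \<partial>M) - e / 2 <= (\<integral>om. payoff a (mesh N) start F (t * Suc N) om \<partial>M)"
   using h(2)[of "mesh N" "t * Suc N"] elim(2) unfolding tm by simp
  have "running a (mesh N) start g \<phi> (t * Suc N) om = real t * (\<integral>s. R N (om, s) \<partial>uniform t)" for om
  proof -
   let ?z = "\<lambda>k. Z a (mesh N) start k om"
   let ?c = "\<lambda>k. exp (- q * (real k * mesh N)) * (alive a (mesh N) start k om * (g (cut a (?z k)) - \<phi> (cut a (?z k)) * (step_loss \<delta> b (mesh N) (?z k + inc (mesh N) k om) / mesh N)))"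
   have "running a (mesh N) start g \<phi> (t * Suc N) om = (\<Sum>k<t * Suc N. mesh N * ?c k)"
    unfolding running_def
   proof (rule sum.cong[OF refl])
    fix k
    have "cut a (?z k) = ?z k" if "?z k <= a" using Z_nonneg[of "mesh N" start a k om] that by simp
    then show "exp (- q * (real k * mesh N)) * (alive a (mesh N) start k om * (mesh N * g (?z k) - \<phi> (?z k) * step_loss \<delta> b (mesh N) (?z k + inc (mesh N) k om))) = mesh N * ?c k"
     by (cases "?z k <= a") (simp_all add: field_simps del: of_nat_Suc)
   qed
   also have "\<dots> = real t * (\<integral>s. ?c (grid_index N s) \<partial>uniform t)" by (rule grid_integral[OF t, symmetric])
   finally show ?thesis unfolding R_def z_def l_def fst_conv snd_conv .
  qed
  then have run: "(\<integral>om. running a (mesh N) start g \<phi> (t * Suc N) om \<partial>M) = real t * (\<integral>p. R N p \<partial>(M \<Otimes>\<^sub>M uniform t))"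
   unfolding joint_integrable(2)[OF t Rm Rb] by simp
  have "(\<integral>p. S N p \<partial>(M \<Otimes>\<^sub>M uniform t)) <= (\<integral>p. R N p + d N p \<partial>(M \<Otimes>\<^sub>M uniform t))"
   by (intro integral_mono Bochner_Integration.integrable_add joint_integrable(1)[OF t Rm Rb] joint_integrable(1)[OF t Sm Sb] joint_integrable(1)[OF t dm db]) (simp add: d_def)
  also have "\<dots> = (\<integral>p. R N p \<partial>(M \<Otimes>\<^sub>M uniform t)) + (\<integral>p. d N p \<partial>(M \<Otimes>\<^sub>M uniform t))"
   by (intro Bochner_Integration.integral_add joint_integrable(1)[OF t Rm Rb] joint_integrable(1)[OF t dm db])
  finally have "real t * (\<integral>p. S N p \<partial>(M \<Otimes>\<^sub>M uniform t)) <= real t * ((\<integral>p. R N p \<partial>(M \<Otimes>\<^sub>M uniform t)) + (\<integral>p. d N p \<partial>(M \<Otimes>\<^sub>M uniform t)))"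
   by (rule mult_left_mono) simp
  then have "occ a N t m <= real t * (\<integral>p. R N p \<partial>(M \<Otimes>\<^sub>M uniform t)) + real t * (\<integral>p. d N p \<partial>(M \<Otimes>\<^sub>M uniform t))"
   unfolding occ_def S_def distrib_left .
  then show ?case using elim(1) hh unfolding run by linarith
 qed
qed

end

section \<open>Terminal payoffs, and the lower and upper estimates\<close>

context refracted_levy
begin

abbreviation pay :: "real => nat => nat => (real => real) => real" where
 "pay a N t F \<equiv> \<integral>om. payoff a (mesh N) start F (t * Suc N) om \<partial>M"

abbreviation moment :: "real => real => nat => nat => 'a => real" where
 "moment be a N t om \<equiv> exp (be * Z a (mesh N) start (t * Suc N) om)"

lemma horizon: "real (t * Suc N) * mesh N = real t"
 unfolding of_nat_mult by (simp del: of_nat_Suc)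

lemma overshoot_limit:
 assumes "0 < be" "start <= a" "0 < e"
 shows "\<forall>\<^sub>F N in sequentially. integrable M (\<lambda>om. exp (be * max (Z a (mesh N) start (t * Suc N) om) a) - exp (be * a)) \<and>
  (\<integral>om. exp (be * max (Z a (mesh N) start (t * Suc N) om) a) - exp (be * a) \<partial>M) <= e"
proof -
 obtain d where d: "d > 0" "\<And>h n. 0 < h ==> h < d ==> real n * h <= real t ==>
  integrable M (\<lambda>om. exp (be * max (Z a h start n om) a) - exp (be * a)) \<and>
  (\<integral>om. exp (be * max (Z a h start n om) a) - exp (be * a) \<partial>M) <= e"
  by (rule overshoot_vanishes[OF assms(1,3), of "real t" start a]) (use assms(2) in auto)
 have "\<forall>\<^sub>F N in sequentially. mesh N < d" using mesh_tendsto d(1) by (rule order_tendstoD)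
 then show ?thesis by eventually_elim (rule d(2), simp_all only: horizon order_refl, simp)
qed

text \<open>Controls errors weighted by \<open>exp (be * y)\<close> at the final state, with a bound
  independent of the mesh and of the horizon.\<close>

lemma moment_bound:
 assumes be: "0 < be" and a: "start <= a"
 shows "\<forall>\<^sub>F N in sequentially. integrable M (moment be a N t) \<and> (\<integral>om. moment be a N t om \<partial>M) <= exp (be * a) + 1"
 using overshoot_limit[OF assms zero_less_one, of t]
proof eventually_elim
 case (elim N)
 let ?E = "\<lambda>om. exp (be * max (Z a (mesh N) start (t * Suc N) om) a) - exp (be * a)"
 have le: "moment be a N t om <= ?E om + exp (be * a)" for om using be by simp
 have i: "integrable M (\<lambda>om. ?E om + exp (be * a))" using elim by (intro Bochner_Integration.integrable_add) auto
 have [measurable]: "Z a (mesh N) start (t * Suc N) \<in> borel_measurable M" by (rule Z_meas) simp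
 have m: "integrable M (moment be a N t)"
 proof (rule Bochner_Integration.integrable_bound[OF i])
  show "moment be a N t \<in> borel_measurable M" by measurable
  show "AE om in M. norm (moment be a N t om) <= norm (?E om + exp (be * a))"
   unfolding real_norm_def abs_exp_cancel by (intro AE_I2 order_trans[OF le abs_ge_self])
 qed
 have "(\<integral>om. moment be a N t om \<partial>M) <= (\<integral>om. ?E om + exp (be * a) \<partial>M)" by (rule integral_mono[OF m i le])
 also have "\<dots> = (\<integral>om. ?E om \<partial>M) + exp (be * a)"
  using elim by (subst Bochner_Integration.integral_add) (auto simp: prob_space)
 finally show ?case using m elim by simp
qed

lemma steps_meas: "0 <= h ==> steps a h w n \<in> borel_measurable M"
 unfolding steps_def[abs_def] using Z_meas by measurable

lemma discount_bounds: "0 <= exp (- q * (mesh N * steps a (mesh N) start n om))" "exp (- q * (mesh N * steps a (mesh N) start n om)) <= 1"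
 using q steps_le(2)[of a "mesh N" start n om] by simp_all

lemma exp_lip_le:
 assumes F: "exp_lip be C F" and y: "0 <= y" "0 < be"
 shows "\<bar>F y - F 0\<bar> <= C * exp (be * y)"
proof -
 have "1 <= exp (be * y)" using y by simp
 then have "\<bar>exp (be * y) - exp (be * 0)\<bar> <= exp (be * y)" by simp
 then show ?thesis using exp_lipD[OF F, of y 0] mult_left_mono[OF _ exp_lip_nonneg[OF F]] by (meson order_trans)
qed

lemma payoff_integrable:
 assumes F: "exp_lip be C F" and be: "0 < be" and i: "integrable M (moment be a N t)"
 shows "integrable M (payoff a (mesh N) start F (t * Suc N))"
proof (rule Bochner_Integration.integrable_bound)
 show "integrable M (\<lambda>om. \<bar>F 0\<bar> + C * moment be a N t om)" using i by simp
 note [measurable] = exp_lip_meas[OF F] Z_meas[of "mesh N"] steps_meas[of "mesh N"]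
 show "payoff a (mesh N) start F (t * Suc N) \<in> borel_measurable M" unfolding payoff_def[abs_def] by measurable
 show "AE om in M. norm (payoff a (mesh N) start F (t * Suc N) om) <= norm (\<bar>F 0\<bar> + C * moment be a N t om)"
 proof (rule AE_I2)
  fix om
  let ?z = "Z a (mesh N) start (t * Suc N) om"
  have "\<bar>payoff a (mesh N) start F (t * Suc N) om\<bar> <= 1 * \<bar>F ?z\<bar>"
   unfolding payoff_def abs_mult using discount_bounds by (intro mult_right_mono) auto
  moreover have "\<bar>F ?z\<bar> <= \<bar>F 0\<bar> + C * exp (be * ?z)" using exp_lip_le[OF F _ be, of ?z] Z_nonneg[of "mesh N" start a] by force
  ultimately show "norm (payoff a (mesh N) start F (t * Suc N) om) <= norm (\<bar>F 0\<bar> + C * moment be a N t om)"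
   unfolding real_norm_def by linarith
 qed
qed

lemma payoff_le:
 assumes F: "exp_lip be C F" "exp_lip be D F'" and be: "0 < be" and i: "integrable M (moment be a N t)" "(\<integral>om. moment be a N t om \<partial>M) <= B"
  and \<eta>: "0 <= \<eta>" "\<And>y. 0 <= y ==> F y <= F' y + \<eta> * exp (be * y)"
 shows "pay a N t F <= pay a N t F' + \<eta> * B"
proof -
 note p = payoff_integrable[OF F(1) be i(1)] payoff_integrable[OF F(2) be i(1)]
 have "pay a N t F <= (\<integral>om. payoff a (mesh N) start F' (t * Suc N) om + \<eta> * moment be a N t om \<partial>M)"
 proof (rule integral_mono[OF p(1)])
  show "integrable M (\<lambda>om. payoff a (mesh N) start F' (t * Suc N) om + \<eta> * moment be a N t om)" using p(2) i(1) by simp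
  fix om
  define z D where "z = Z a (mesh N) start (t * Suc N) om" and "D = exp (- q * (mesh N * steps a (mesh N) start (t * Suc N) om))"
  have "D * F z <= D * (F' z + \<eta> * exp (be * z))"
   using \<eta>(2)[of z] Z_nonneg[of "mesh N" start a] unfolding z_def D_def by (intro mult_left_mono) auto
  moreover have "D * (\<eta> * exp (be * z)) <= 1 * (\<eta> * exp (be * z))" using \<eta>(1) discount_bounds unfolding D_def by (intro mult_right_mono) auto
  ultimately show "payoff a (mesh N) start F (t * Suc N) om <= payoff a (mesh N) start F' (t * Suc N) om + \<eta> * moment be a N t om"
   unfolding payoff_def z_def[symmetric] D_def[symmetric] by (simp add: distrib_left)
 qed
 also have "\<dots> = pay a N t F' + \<eta> * (\<integral>om. moment be a N t om \<partial>M)"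
  using p(2) i(1) by (subst Bochner_Integration.integral_add) auto
 finally show ?thesis using mult_left_mono[OF i(2) \<eta>(1)] by linarith
qed

lemma exp_lip_shift_le:
 assumes f: "exp_lip be C f" and be: "0 < be" and e: "0 <= e"
 shows "f (y + e) <= f y + C * (exp (be * e) - 1) * exp (be * y)" "f y <= f (y - e) + C * (exp (be * e) - 1) * exp (be * y)"
proof -
 have x: "1 <= exp (be * e)" using be e by simp
 have "\<bar>f (y + e) - f y\<bar> <= C * (exp (be * y) * (exp (be * e) - 1))"
  using exp_lipD[OF f, of "y + e" y] x unfolding exp_shift_abs by simp
 then show "f (y + e) <= f y + C * (exp (be * e) - 1) * exp (be * y)" by (simp add: mult_ac)
 have "\<bar>exp (be * (y + - e)) - exp (be * y)\<bar> <= exp (be * y) * (exp (be * e) - 1)"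
 proof -
  have "1 - exp (be * - e) = exp (be * - e) * (exp (be * e) - 1)" by (simp add: right_diff_distrib exp_add[symmetric])
  also have "\<dots> <= 1 * (exp (be * e) - 1)" using x be e by (intro mult_right_mono) auto
  finally show ?thesis unfolding exp_shift_abs using be e by (intro mult_left_mono) auto
 qed
 from order_trans[OF exp_lipD[OF f] mult_left_mono[OF this exp_lip_nonneg[OF f]]]
 show "f y <= f (y - e) + C * (exp (be * e) - 1) * exp (be * y)" by (simp add: mult_ac)
qed

lemma small_shift:
 assumes "0 < \<epsilon>"
 obtains e where "0 < e" "e < 1" "K * (exp (be * e) - 1) < (\<epsilon> :: real)"
proof -
 have "((\<lambda>e. K * (exp (be * e) - 1)) \<longlongrightarrow> K * (exp (be * 0) - 1)) (at_right 0)" by (intro tendsto_intros)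
 then have "\<forall>\<^sub>F e in at_right 0. K * (exp (be * e) - 1) < \<epsilon>" by (rule order_tendstoD) (use assms in simp)
 moreover have "\<forall>\<^sub>F e in at_right (0 :: real). e < 1" unfolding eventually_at_right_field by (intro exI[of _ 1]) auto
 moreover have "\<forall>\<^sub>F e in at_right (0 :: real). 0 < e" by (rule eventually_at_right_less)
 ultimately have "\<forall>\<^sub>F e in at_right 0. 0 < e \<and> e < 1 \<and> K * (exp (be * e) - 1) < \<epsilon>" by eventually_elim auto
 then show ?thesis using that eventually_happens'[OF trivial_limit_at_right_real] by blast
qed

text \<open>Averaging \<open>f\<close> over \<open>[y, y + e]\<close> gives lower bounds and averaging over \<open>[y - e, y]\<close> gives upper bounds, because
 the loss at the level \<open>b\<close> is then on the right side.\<close>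

lemma dynkin_lower:
 assumes tr: "smooth_triple q be I G f" and be: "0 < be" and f: "mono f" and t: "0 < t" and a: "b < a" "start <= a"
  and m: "m \<in> borel_measurable borel" "\<And>y. \<bar>m y\<bar> <= B" and \<epsilon>: "0 < \<epsilon>"
  and low: "\<And>e y. 0 < e ==> e < 1 ==> 0 <= y ==> y <= a ==>
   m y <= (G (y + e) - G y) / e - q * c - \<delta> * ((f (y + e) - f y) / e * indicator {b..} y)"
 shows "\<forall>\<^sub>F N in sequentially. c + f start + occ a N t m - \<epsilon> <= pay a N t (\<lambda>y. c + f y)"
proof -
 obtain CI C K where lip: "exp_lip be CI I" "exp_lip be C G" "exp_lip be K f" and der: "\<And>v. (I has_real_derivative f v) (at v)" and pair: "dynkin_pair q I G"
  using tr unfolding smooth_triple_def by blast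
 obtain e where e: "0 < e" "e < 1" "K * (exp (be * a) + 1) * (exp (be * e) - 1) < \<epsilon> / 2" by (rule small_shift[of "\<epsilon> / 2"]) (use \<epsilon> in auto)
 \<comment> \<open>The mean of \<open>c + f\<close> over \<open>[y, y + e]\<close>. It is at least
   \<open>c + f\<close> at the start, and at the end exceeds it by at most a small multiple of
   \<open>exp (be * y)\<close>.\<close>
 define F where "F y = c + (I (y + e) - I y) / e" for y
 have be0: "0 <= be" using be by simp
 note mo = smooth_triple_shift[OF smooth_triple_mollify[OF pair lip der be0, of e], of e]
 have trF: "smooth_triple q be F (\<lambda>y. (G (y + e) - G y) / e - q * c) (\<lambda>y. (f (y + e) - f y) / e)"
  using smooth_triple_lin[OF smooth_triple_const[of q be c] mo be0, of 1 1] unfolding F_def by simp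
 then obtain CF where CF: "exp_lip be CF F" unfolding smooth_triple_def by blast
 have up: "0 <= (f (y + e) - f y) / e" for y using f e unfolding mono_def by simp
 have inc': "F v <= F 0" if "v <= 0" for v
  by (rule DERIV_nonneg_imp_nondecreasing[OF that]) (use trF up in "auto simp: smooth_triple_def")
 have "\<forall>\<^sub>F N in sequentially. F start + occ a N t m - \<epsilon> / 2 <= pay a N t F"
 proof (rule dynkin_limit[OF trF _ inc' t a(1) m])
  fix y assume "0 <= y" "y <= a"
  from low[OF e(1,2) this] up[of b] show "m y <= (G (y + e) - G y) / e - q * c - \<delta> * ((f (y + e) - f y) / e * indicator {b<..} y) - \<delta> * (max 0 ((f (b + e) - f b) / e) * indicator {b} y)"
   by (cases "y = b"; cases "b < y") (auto simp: indicator_def)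
 qed (use be \<epsilon> in auto)
 with moment_bound[OF be a(2), of t] show ?thesis
 proof eventually_elim
  case (elim N)
  have "exp_lip be (0 + K) (\<lambda>y. c + f y)" by (intro exp_lip_add exp_lip_const lip)
  then have "pay a N t F <= pay a N t (\<lambda>y. c + f y) + K * (exp (be * e) - 1) * (exp (be * a) + 1)"
  proof (rule payoff_le[OF CF _ be elim(1)[THEN conjunct1] elim(1)[THEN conjunct2]])
   show "0 <= K * (exp (be * e) - 1)" using exp_lip_nonneg[OF lip(3)] be e by simp
   fix y
   show "F y <= c + f y + K * (exp (be * e) - 1) * exp (be * y)"
    using average_bounds(2)[OF der f e(1), of "y + e"] exp_lip_shift_le(1)[OF lip(3) be, of e y] e unfolding F_def by simp
  qed
  moreover have "c + f start <= F start" using average_bounds(1)[OF der f e(1), of "start + e"] unfolding F_def by simp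
  moreover have "K * (exp (be * e) - 1) * (exp (be * a) + 1) < \<epsilon> / 2" using e(3) by (simp only: mult_ac)
  ultimately show ?case using elim(2) by linarith
 qed
qed

lemma dynkin_upper:
 assumes tr: "smooth_triple q be I G f" and be: "0 < be" and f: "mono f" "\<And>y. y <= 0 ==> f y = 0" and t: "0 < t" and a: "b < a" "start <= a"
  and m: "m \<in> borel_measurable borel" "\<And>y. \<bar>m y\<bar> <= B" and \<epsilon>: "0 < \<epsilon>"
  and up: "\<And>e y. 0 < e ==> e < 1 ==> 0 <= y ==> y <= a ==>
   (G y - G (y - e)) / e - q * c - \<delta> * ((f y - f (y - e)) / e * indicator {b<..} y) <= m y"
 shows "\<forall>\<^sub>F N in sequentially. pay a N t (\<lambda>y. c + f y) <= c + f start + occ a N t m + \<epsilon>"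
proof -
 obtain CI C K where lip: "exp_lip be CI I" "exp_lip be C G" "exp_lip be K f" and der: "\<And>v. (I has_real_derivative f v) (at v)" and pair: "dynkin_pair q I G"
  using tr unfolding smooth_triple_def by blast
 obtain e where e: "0 < e" "e < 1" "K * (exp (be * a) + 1) * (exp (be * e) - 1) < \<epsilon> / 2" by (rule small_shift[of "\<epsilon> / 2"]) (use \<epsilon> in auto)
 \<comment> \<open>Minus the mean of \<open>c + f\<close> over \<open>[y - e, y]\<close>. As
   \<open>f\<close> vanishes on the negative half-line, \<open>F\<close> is constant there and
   reflection leaves it unchanged.\<close>
 define F where "F y = - c - (I y - I (y - e)) / e" for y
 have be0: "0 <= be" using be by simp
 have trF: "smooth_triple q be F (\<lambda>y. q * c - (G y - G (y - e)) / e) (\<lambda>y. - ((f y - f (y - e)) / e))"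
  using smooth_triple_lin[OF smooth_triple_const[of q be c] smooth_triple_mollify[OF pair lip der be0, of e] be0, of "- 1" "- 1"] unfolding F_def by (simp add: diff_divide_distrib algebra_simps)
 then obtain CF where CF: "exp_lip be CF F" unfolding smooth_triple_def by blast
 have inc': "F v <= F 0" if "v <= 0" for v
  using average_bounds[OF der f(1) e(1), of v] average_bounds[OF der f(1) e(1), of 0] f(2)[of v] f(2)[of "v - e"] f(2)[of "- e"] f(2)[of 0] that e
  unfolding F_def by simp
 have "\<forall>\<^sub>F N in sequentially. F start + occ a N t (\<lambda>y. - m y) - \<epsilon> / 2 <= pay a N t F"
 proof (rule dynkin_limit[OF trF _ inc' t a(1)])
  fix y assume "0 <= y" "y <= a"
  \<comment> \<open>\<open>F\<close> is nonincreasing, so the largest effect of an unknown loss at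
    \<open>b\<close> is 0 and \<open>b\<close> drops out of the indicator.\<close>
  moreover have "max 0 (- ((f b - f (b - e)) / e)) = 0" using f(1) e unfolding mono_def by simp
  ultimately show "- m y <= q * c - (G y - G (y - e)) / e - \<delta> * (- ((f y - f (y - e)) / e) * indicator {b<..} y) - \<delta> * (max 0 (- ((f b - f (b - e)) / e)) * indicator {b} y)"
   using up[OF e(1,2), of y] by simp
 qed (use be \<epsilon> m in auto)
 with moment_bound[OF be a(2), of t] show ?thesis
 proof eventually_elim
  case (elim N)
  have "exp_lip be (0 + K) (\<lambda>y. c + f y)" by (intro exp_lip_add exp_lip_const lip)
  then have le: "pay a N t (\<lambda>y. c + f y) <= pay a N t (\<lambda>y. - 1 * F y) + K * (exp (be * e) - 1) * (exp (be * a) + 1)"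
  proof (rule payoff_le[OF _ exp_lip_cmult[OF CF] be elim(1)[THEN conjunct1] elim(1)[THEN conjunct2]])
   show "0 <= K * (exp (be * e) - 1)" using exp_lip_nonneg[OF lip(3)] be e by simp
   fix y
   show "c + f y <= - 1 * F y + K * (exp (be * e) - 1) * exp (be * y)"
    using average_bounds(1)[OF der f(1) e(1), of y] exp_lip_shift_le(2)[OF lip(3) be, of e y] e unfolding F_def by simp
  qed
  have p: "pay a N t (\<lambda>y. - 1 * F y) = - pay a N t F" unfolding payoff_def by simp
  have oc: "occ a N t (\<lambda>y. - m y) = - occ a N t m" unfolding occ_def by simp
  have "- (c + f start) <= F start" using average_bounds(2)[OF der f(1) e(1), of start] unfolding F_def by simp
  moreover have "K * (exp (be * e) - 1) * (exp (be * a) + 1) < \<epsilon> / 2" using e(3) by (simp only: mult_ac)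
  ultimately show ?case using elim(2) le unfolding p oc by linarith
 qed
qed

text \<open>A path surviving to the horizon contributes at least \<open>t * exp (- q * t)\<close> to
  the occupation. Together with \<open>occ_bounded\<close>, the discounted survival probability is
  at most a constant over \<open>t\<close>, which disposes of the horizon even for
  \<open>q = 0\<close>.\<close>

lemma survival_le_occ:
 assumes t: "0 < t"
 shows "real t * (exp (- q * real t) * prob {om \<in> space M. Z a (mesh N) start (t * Suc N) om <= a}) <= occ a N t (\<lambda>_. 1)"
proof -
 interpret T: prob_space "uniform t" by (rule prob_uniform[OF t])
 define E where "E = {om \<in> space M. Z a (mesh N) start (t * Suc N) om <= a}"
 have [measurable]: "Z a (mesh N) start (t * Suc N) \<in> borel_measurable M" by (rule Z_meas) simp
 have E: "E \<in> sets M" unfolding E_def by measurable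
 define f where "f p = surv a N (snd p) (fst p) * (exp (- q * max (snd p) 0) * 1)" for p :: "'a \<times> real"
 have fm: "f \<in> borel_measurable (M \<Otimes>\<^sub>M borel)" unfolding f_def by measurable
 have fb: "\<bar>f p\<bar> <= 1" for p
  using mult_le_one[OF _ _ exp_discount_le, of "surv a N (snd p) (fst p)" "snd p"] unfolding f_def by (simp add: abs_mult indicator_def)
 note j = joint_integrable[OF t fm fb]
 have "exp (- q * real t) * indicator E om <= (\<integral>s. f (om, s) \<partial>uniform t)" if "om \<in> space M" for om
 proof -
  have "(\<integral>s. exp (- q * real t) * indicator E om \<partial>uniform t) <= (\<integral>s. f (om, s) \<partial>uniform t)"
  proof (rule integral_mono_AE)
   have "(\<lambda>s. f (om, s)) \<in> borel_measurable (uniform t)" using measurable_Pair2[OF fm that] by simp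
   then show "integrable (uniform t) (\<lambda>s. f (om, s))" by (rule T.integrable_const_bound[rotated, where B = 1]) (use fb in auto)
   show "AE s in uniform t. exp (- q * real t) * indicator E om <= f (om, s)"
   proof (rule AE_uniform_measureI, simp, rule AE_I2, rule impI)
    fix s assume s: "s \<in> {0..real t}"
    show "exp (- q * real t) * indicator E om <= f (om, s)"
    proof (cases "om \<in> E")
     case True
     have "real (grid_index N s) <= s * real (Suc N)" using grid_index_bounds(1)[of s N] s by (simp add: field_simps del: of_nat_Suc)
     also have "\<dots> <= real (t * Suc N)" unfolding of_nat_mult using s by (intro mult_right_mono) auto
     finally have "grid_index N s <= t * Suc N" by (simp only: of_nat_le_iff)
     then have "Z a (mesh N) start (grid_index N s) om <= a" using alive_before True unfolding E_def by blast
     moreover have "exp (- q * real t) <= exp (- q * max s 0)" using s q by (simp add: mult_left_mono)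
     ultimately show ?thesis using True unfolding f_def by simp
    qed (simp add: f_def)
   qed
  qed simp
  then show ?thesis using T.prob_space by simp
 qed
 then have "(\<integral>om. exp (- q * real t) * indicator E om \<partial>M) <= (\<integral>om. \<integral>s. f (om, s) \<partial>uniform t \<partial>M)"
  using E by (intro integral_mono j(3) integrable_mult_right integrable_real_indicator) (auto simp: less_top[symmetric])
 then have "exp (- q * real t) * prob E <= (\<integral>p. f p \<partial>(M \<Otimes>\<^sub>M uniform t))" unfolding j(2) using E by simp
 then show ?thesis unfolding occ_def f_def E_def[symmetric] by (intro mult_left_mono) auto
qed

end

lemma quotient_bounds:
 fixes e :: real
 assumes "0 < e"
 shows "A <= e * k + d * (D * i) + e * m ==> A / e - k - d * (D / e * i) <= m"
  "e * k + d * (D * i) + e * m <= A ==> m <= A / e - k - d * (D / e * i)"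
proof -
 have eq: "(e * k + d * (D * i) + e * m) / e = k + d * (D / e * i) + m" using assms by (simp add: add_divide_distrib)
 show "A / e - k - d * (D / e * i) <= m" if "A <= e * k + d * (D * i) + e * m" using divide_right_mono[OF that, of e] assms unfolding eq by simp
 show "m <= A / e - k - d * (D / e * i)" if "e * k + d * (D * i) + e * m <= A" using divide_right_mono[OF that, of e] assms unfolding eq by simp
qed

section \<open>Bounded occupation, and its limit\<close>

context refracted_levy
begin

text \<open>Time spent up to passage is bounded uniformly in the horizon: the function \<open>w + K wY\<close> gains at
 least one per unit of time.\<close>

lemma occ_bounded:
 assumes w: "smooth_triple q be I (\<lambda>y. max y 0) w" "mono w" "\<And>y. y <= 0 ==> w y = 0"
  and wY: "smooth_triple q be J (\<lambda>y. \<delta> * wY (y - b) + max (y - b) 0) (\<lambda>y. wY (y - b))" "mono wY" "\<And>y. y <= 0 ==> wY y = 0"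
  and be: "0 < be" and a: "b < a" "start <= a"
 obtains C where "\<And>t. 0 < t ==> \<forall>\<^sub>F N in sequentially. occ a N t (\<lambda>_. 1) <= C"
proof -
 obtain D where D: "exp_lip be D w" using w unfolding smooth_triple_def by blast
 note D0 = exp_lip_nonneg[OF D]
 \<comment> \<open>\<open>l\<close> bounds the difference quotients of \<open>w\<close> on
   \<open>[0, a]\<close> for \<open>e < 1\<close>. Above \<open>b\<close> the refraction consumes at
   most \<open>K = \<delta> * l\<close> of the gain per unit of time, and \<open>K * wY\<close> pays
   this back there.\<close>
 define l where "l = D * exp (be * a) * (be * exp be)"
 define K where "K = \<delta> * l"
 have K: "0 <= K" unfolding K_def l_def using \<delta> D0 be by simp
 have lw: "(w (y + e) - w y) / e <= l" if "0 < e" "e < 1" "0 <= y" "y <= a" for e y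
 proof -
  have "exp (be * e) - 1 <= be * e * exp (be * e)"
   using mult_right_mono[OF exp_ge_add_one_self[of "- (be * e)"], of "exp (be * e)"] by (simp add: exp_add[symmetric] algebra_simps)
  also have "\<dots> <= be * e * exp be" using be that by (intro mult_left_mono) auto
  finally have "D * (exp (be * e) - 1) * exp (be * y) <= D * (be * e * exp be) * exp (be * a)"
   using D0 be that by (intro mult_mono mult_left_mono) auto
  then have "w (y + e) - w y <= l * e" using exp_lip_shift_le(1)[OF D be, of e y] that unfolding l_def by (simp add: mult_ac)
  then show ?thesis using that by (simp add: divide_le_eq)
 qed
 define f where "f y = 1 * w y + K * wY (y - b)" for y
 define G where "G y = 1 * max y 0 + K * (\<delta> * wY (y - b) + max (y - b) 0)" for y
 have tr: "smooth_triple q be (\<lambda>y. 1 * I y + K * J y) G f" unfolding f_def G_def by (rule smooth_triple_lin[OF w(1) wY(1)]) (use be in simp)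
 obtain C where C: "exp_lip be C f" using tr unfolding smooth_triple_def by blast
 have f: "mono f" using w(2) wY(2) K unfolding f_def mono_def by (auto intro!: add_mono mult_left_mono)
 have f0: "f y = 0" if "y <= 0" for y using w(3) wY(3) b that unfolding f_def by simp
 have low: "1 <= (G (y + e) - G y) / e - q * 0 - \<delta> * ((f (y + e) - f y) / e * indicator {b..} y)" if e: "0 < e" "e < 1" and y: "0 <= y" "y <= a" for e y
 proof (cases "b <= y")
  case True
  have "\<delta> * ((w (y + e) - w y) / e) <= K" unfolding K_def by (rule mult_left_mono[OF lw[OF e y] \<delta>])
  moreover have "(G (y + e) - G y) / e - \<delta> * ((f (y + e) - f y) / e) = 1 + K - \<delta> * ((w (y + e) - w y) / e)"
   using True e y unfolding G_def f_def by (simp add: field_simps)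
  ultimately show ?thesis using True by simp
 next
  case False
  have "0 <= K * (\<delta> * (wY (y + e - b) - wY (y - b)) + (max (y + e - b) 0 - max (y - b) 0))"
   using K \<delta> wY(2) e unfolding mono_def by (intro mult_nonneg_nonneg add_nonneg_nonneg) auto
  then have "e <= G (y + e) - G y" using y e unfolding G_def by (simp add: algebra_simps)
  then show ?thesis using False e by (simp add: le_divide_eq)
 qed
 have "\<forall>\<^sub>F N in sequentially. occ a N t (\<lambda>_. 1) <= C * (exp (be * a) + 1) + 1" if t: "0 < t" for t
 proof -
  have "\<forall>\<^sub>F N in sequentially. 0 + f start + occ a N t (\<lambda>_. 1) - 1 <= pay a N t (\<lambda>y. 0 + f y)"
   by (rule dynkin_lower[OF tr be f t a _ _ zero_less_one]) (use low in auto)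
  with moment_bound[OF be a(2), of t] show ?thesis
 proof eventually_elim
  case (elim N)
  have "pay a N t f <= pay a N t (\<lambda>_. 0) + C * (exp (be * a) + 1)"
  proof (rule payoff_le[OF C exp_lip_const be])
   show "f y <= 0 + C * exp (be * y)" if "0 <= y" for y using exp_lip_le[OF C that be] f0[of 0] by simp
  qed (use elim exp_lip_nonneg[OF C] in auto)
  moreover have "0 <= f start" using monoD[OF f, of 0 start] f0[of 0] by simp
  moreover have "pay a N t (\<lambda>_. 0) = 0" unfolding payoff_def by simp
  ultimately show ?case using elim(2) by simp
 qed
 qed
 then show ?thesis using that by blast
qed

text \<open>The term \<open>C / t\<close> is what paths surviving to the horizon can contribute:
  \<open>h\<close> is at most \<open>B\<close> in absolute value on \<open>[0, a]\<close>, and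
  survival has discounted probability at most \<open>\<bar>C1\<bar> / t\<close>.\<close>

lemma occ_limit:
 assumes W: "is_scale_function \<psi> q W" and WY: "is_scale_function (\<lambda>th. \<psi> th - \<delta> * th) q WY" and a: "b < a" "start <= a"
 obtains C where "0 <= C" "\<And>\<epsilon> t. 0 < \<epsilon> ==> 0 < t ==> \<forall>\<^sub>F N in sequentially.
  \<bar>prim WY (a - b) / (1 + r0 W WY a) * (1 + r0 W WY start) - prim WY (start - b) - occ a N t (indicator {b<..})\<bar> <= \<epsilon> + C / real t"
proof -
 obtain be where be: "0 < be" and T: "smooth_triple q be (prim (prim W)) (\<lambda>x. max x 0) (prim W)"
  "smooth_triple q be (prim (\<lambda>x. prim WY (x - b))) (\<lambda>x. \<delta> * prim WY (x - b) + max (x - b) 0) (\<lambda>x. prim WY (x - b))"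
  "smooth_triple q be (prim (r0 W WY)) (\<lambda>x. q * max x 0 + \<delta> * (r0 W WY (max x b) - r0 W WY b)) (r0 W WY)"
  and mon: "mono (prim W)" "mono (prim WY)" "mono (r0 W WY)" and z: "\<And>x. x <= 0 ==> prim W x = 0 \<and> prim WY x = 0 \<and> r0 W WY x = 0"
  by (rule scale_triples[OF W WY]) blast
 define wb where "wb y = prim WY (y - b)" for y
 define r where "r = r0 W WY"
 define Gb where "Gb y = \<delta> * wb y + max (y - b) 0" for y
 define Gr where "Gr y = q * max y 0 + \<delta> * (r (max y b) - r b)" for y
 have Tb: "smooth_triple q be (prim wb) Gb wb" and Tr: "smooth_triple q be (prim r) Gr r" using T unfolding wb_def r_def Gb_def Gr_def by auto
 have mb: "mono wb" and mr: "mono r" and zb: "\<And>y. y <= b ==> wb y = 0" and zr: "\<And>y. y <= 0 ==> r y = 0"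
  using mon z unfolding wb_def r_def mono_def by auto
 have rnn: "0 <= r y" for y using monoD[OF mr, of 0 y] zr[of 0] zr[of y] by (cases "y <= 0") auto
 have wnn: "0 <= wb y" for y using monoD[OF mb, of b y] zb[of b] zb[of y] by (cases "y <= b") auto
 obtain C1 where C1: "\<And>t. 0 < t ==> \<forall>\<^sub>F N in sequentially. occ a N t (\<lambda>_. 1) <= C1"
  by (rule occ_bounded[OF T(1) mon(1) _ T(2) mon(2) _ be a]) (use z in auto)
 define \<kappa> where "\<kappa> = wb a / (1 + r a)"
 have \<kappa>: "0 <= \<kappa>" unfolding \<kappa>_def using rnn[of a] wnn[of a] by simp
 define h where "h y = \<kappa> * (1 + r y) + - 1 * wb y" for y
 have ha: "h a = 0" unfolding h_def \<kappa>_def using rnn[of a] by simp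
 obtain Cr Cb where lip: "exp_lip be Cr r" "exp_lip be Cb wb" using Tr Tb unfolding smooth_triple_def by blast
 obtain Ch where Ch: "exp_lip be Ch h"
  using exp_lip_add[OF exp_lip_cmult[OF exp_lip_add[OF exp_lip_const[of be 1] lip(1)], of \<kappa>] exp_lip_cmult[OF lip(2), of "- 1"]] unfolding h_def[abs_def] by blast
 note Ch0 = exp_lip_nonneg[OF Ch]
 define B where "B = \<bar>h 0\<bar> + Ch * exp (be * a)"
 have B: "0 <= B" unfolding B_def using Ch0 by simp
 define C where "C = B * \<bar>C1\<bar>"
 have main: "\<forall>\<^sub>F N in sequentially. \<bar>h start - occ a N t (indicator {b<..})\<bar> <= \<epsilon> + C / real t" if \<epsilon>: "0 < \<epsilon>" and t: "0 < t" for \<epsilon> t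
 proof -
  \<comment> \<open>The estimate for \<open>1 + r\<close> enters with weight
    \<open>\<kappa>\<close>, those for \<open>wb\<close> and for the terminal payoff of
    \<open>h\<close> once each.\<close>
  define \<epsilon>1 where "\<epsilon>1 = \<epsilon> / (\<kappa> + 2)"
  define \<epsilon>2 where "\<epsilon>2 = \<epsilon>1 / (Ch + 1)"
  have \<epsilon>1: "0 < \<epsilon>1" "(\<kappa> + 2) * \<epsilon>1 = \<epsilon>" and \<epsilon>2: "0 < \<epsilon>2" unfolding \<epsilon>1_def \<epsilon>2_def using \<epsilon> \<kappa> Ch0 by auto
  have "Ch * \<epsilon>2 <= (Ch + 1) * \<epsilon>2" using \<epsilon>2 by (intro mult_right_mono) auto
  then have \<epsilon>2': "Ch * \<epsilon>2 <= \<epsilon>1" unfolding \<epsilon>2_def using Ch0 by simp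
  let ?m = "indicator {b<..} :: real => real"
  have m: "?m \<in> borel_measurable borel" "\<And>y. \<bar>?m y\<bar> <= 1" by (auto simp: indicator_def)
  have "\<forall>\<^sub>F N in sequentially. pay a N t (\<lambda>y. 0 + wb y) <= 0 + wb start + occ a N t ?m + \<epsilon>1"
  proof (rule dynkin_upper[OF Tb be mb _ t a m \<epsilon>1(1)])
   show "wb y = 0" if "y <= 0" for y using zb that b by simp
   fix e y :: real assume *: "0 < e"
   show "(Gb y - Gb (y - e)) / e - q * 0 - \<delta> * ((wb y - wb (y - e)) / e * ?m y) <= ?m y"
    by (rule quotient_bounds(1)[OF *]) (use * zb[of y] zb[of "y - e"] in "auto simp: Gb_def indicator_def right_diff_distrib max_def")
  qed
  moreover have "\<forall>\<^sub>F N in sequentially. 0 + wb start + occ a N t ?m - \<epsilon>1 <= pay a N t (\<lambda>y. 0 + wb y)"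
  proof (rule dynkin_lower[OF Tb be mb t a m \<epsilon>1(1)])
   fix e y :: real assume *: "0 < e"
   show "?m y <= (Gb (y + e) - Gb y) / e - q * 0 - \<delta> * ((wb (y + e) - wb y) / e * indicator {b..} y)"
   proof (rule quotient_bounds(2)[OF *])
    have "0 <= \<delta> * (wb (y + e) - wb y)" using mb * \<delta> unfolding mono_def by simp
    then show "e * (q * 0) + \<delta> * ((wb (y + e) - wb y) * indicator {b..} y) + e * ?m y <= Gb (y + e) - Gb y"
     using * unfolding Gb_def by (auto simp: indicator_def right_diff_distrib)
   qed
  qed
  moreover have "\<forall>\<^sub>F N in sequentially. pay a N t (\<lambda>y. 1 + r y) <= 1 + r start + occ a N t (\<lambda>_. 0) + \<epsilon>1"
  proof (rule dynkin_upper[OF Tr be mr zr t a _ _ \<epsilon>1(1)])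
   fix e y :: real assume *: "0 < e" "0 <= y"
   have "q * max y 0 - q * max (y - e) 0 <= q * e" using q * unfolding right_diff_distrib[symmetric] by (intro mult_left_mono) auto
   moreover have "\<delta> * (r (max y b) - r (max (y - e) b)) <= \<delta> * ((r y - r (y - e)) * ?m y)"
    using monoD[OF mr, of "y - e" "max (y - e) b"] * \<delta> by (cases "b < y") (auto intro!: mult_left_mono simp: max_def)
   ultimately have "Gr y - Gr (y - e) <= q * e + \<delta> * ((r y - r (y - e)) * ?m y)" unfolding Gr_def by (simp add: algebra_simps)
   then show "(Gr y - Gr (y - e)) / e - q * 1 - \<delta> * ((r y - r (y - e)) / e * ?m y) <= 0" by (intro quotient_bounds(1) *) (simp add: mult.commute)
  qed auto
  moreover have "\<forall>\<^sub>F N in sequentially. 1 + r start + occ a N t (\<lambda>_. 0) - \<epsilon>1 <= pay a N t (\<lambda>y. 1 + r y)"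
  proof (rule dynkin_lower[OF Tr be mr t a _ _ \<epsilon>1(1)])
   fix e y :: real assume *: "0 < e" "0 <= y"
   have "\<delta> * ((r (y + e) - r y) * indicator {b..} y) <= \<delta> * (r (max (y + e) b) - r (max y b))"
    using monoD[OF mr, of b "max (y + e) b"] * \<delta> by (cases "b <= y") (auto intro!: mult_left_mono simp: max_def)
   then have "q * e + \<delta> * ((r (y + e) - r y) * indicator {b..} y) <= Gr (y + e) - Gr y" using * unfolding Gr_def by (simp add: algebra_simps)
   then show "0 <= (Gr (y + e) - Gr y) / e - q * 1 - \<delta> * ((r (y + e) - r y) / e * indicator {b..} y)" by (intro quotient_bounds(2) *) (simp add: mult.commute)
  qed auto
  moreover note C1[OF t] overshoot_limit[OF be a(2) \<epsilon>2, of t] moment_bound[OF be a(2), of t]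
  ultimately show ?thesis
  proof eventually_elim
   case (elim N)
   let ?Z = "Z a (mesh N) start (t * Suc N)"
   let ?E = "\<lambda>om. exp (be * max (?Z om) a) - exp (be * a)"
   define A where "A = {om \<in> space M. ?Z om <= a}"
   have [measurable]: "?Z \<in> borel_measurable M" by (rule Z_meas) simp
   have A: "A \<in> sets M" unfolding A_def by measurable
   note int = payoff_integrable[OF _ be elim(7)[THEN conjunct1]]
   have o0: "occ a N t (\<lambda>_. 0) = 0" unfolding occ_def by simp
   have i: "integrable M (payoff a (mesh N) start wb (t * Suc N))" "integrable M (payoff a (mesh N) start (\<lambda>y. 1 + r y) (t * Suc N))"
    "integrable M (payoff a (mesh N) start h (t * Suc N))"
    using int[OF lip(2)] int[OF exp_lip_add[OF exp_lip_const[of be 1] lip(1)]] int[OF Ch] by auto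
   have "payoff a (mesh N) start h (t * Suc N) om = \<kappa> * payoff a (mesh N) start (\<lambda>y. 1 + r y) (t * Suc N) om - payoff a (mesh N) start wb (t * Suc N) om" for om
    unfolding payoff_def h_def by (simp add: algebra_simps)
   then have ph: "pay a N t h = \<kappa> * pay a N t (\<lambda>y. 1 + r y) - pay a N t wb" using i by simp
   \<comment> \<open>Surviving paths give the bounded part; stopped ones give only the overshoot,
     because \<open>h a = 0\<close>.\<close>
   have pb: "norm (payoff a (mesh N) start h (t * Suc N) om) <= exp (- q * real t) * B * indicator A om + Ch * ?E om" if om: "om \<in> space M" for om
   proof (cases "?Z om <= a")
    case True
    have "mesh N * steps a (mesh N) start (t * Suc N) om = real t" unfolding steps_alive[OF True] mult.commute[of "mesh N"] by (rule horizon)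
    then have "\<bar>payoff a (mesh N) start h (t * Suc N) om\<bar> = exp (- q * real t) * \<bar>h (?Z om)\<bar>" unfolding payoff_def by (simp only: abs_mult abs_exp_cancel)
    also have "\<dots> <= exp (- q * real t) * B" unfolding B_def using be Z_nonneg[of "mesh N" start a] True by (intro mult_left_mono exp_lip_bounded[OF Ch]) auto
    finally show ?thesis using True om unfolding A_def by (simp add: max_def)
   next
    case False
    have "\<bar>payoff a (mesh N) start h (t * Suc N) om\<bar> <= 1 * \<bar>h (?Z om)\<bar>" unfolding payoff_def abs_mult using discount_bounds by (intro mult_right_mono) auto
    also have "\<dots> <= Ch * (exp (be * ?Z om) - exp (be * a))" using exp_lipD[OF Ch, of "?Z om" a] False be unfolding ha by simp
    finally show ?thesis using False unfolding A_def by (simp add: max_def)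
   qed
   have iE: "integrable M (\<lambda>om. exp (- q * real t) * B * indicator A om + Ch * ?E om)"
    using elim(6) A by (intro Bochner_Integration.integrable_add integrable_mult_right integrable_real_indicator) (auto simp: less_top[symmetric])
   have "norm (pay a N t h) <= (\<integral>om. exp (- q * real t) * B * indicator A om + Ch * ?E om \<partial>M)"
    by (rule order_trans[OF integral_norm_bound integral_mono[OF integrable_norm[OF i(3)] iE pb]])
   also have "\<dots> = exp (- q * real t) * B * prob A + Ch * (\<integral>om. ?E om \<partial>M)"
    using elim(6) A by (subst Bochner_Integration.integral_add) (auto intro!: integrable_real_indicator simp: less_top[symmetric])
   also have "\<dots> <= C / real t + \<epsilon>1"
   proof (rule add_mono)
    have "real t * (exp (- q * real t) * prob A) <= \<bar>C1\<bar>" using survival_le_occ[OF t, of a N] elim(5) unfolding A_def by linarith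
    then have "exp (- q * real t) * prob A <= \<bar>C1\<bar> / real t" using t by (simp add: le_divide_eq mult.commute)
    from mult_left_mono[OF this B] show "exp (- q * real t) * B * prob A <= C / real t" unfolding C_def by (simp add: mult_ac)
    show "Ch * (\<integral>om. ?E om \<partial>M) <= \<epsilon>1" using mult_left_mono[OF elim(6)[THEN conjunct2] Ch0] \<epsilon>2' by linarith
   qed
   finally have ph': "\<bar>pay a N t h\<bar> <= C / real t + \<epsilon>1" unfolding real_norm_def .
   define P p where "P = pay a N t (\<lambda>y. 1 + r y)" and "p = pay a N t wb"
   have "\<kappa> * P <= \<kappa> * (1 + r start + \<epsilon>1)" "\<kappa> * (1 + r start - \<epsilon>1) <= \<kappa> * P"
    using elim(3,4) \<kappa> unfolding o0 P_def by (auto intro!: mult_left_mono)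
   moreover have "p <= wb start + occ a N t ?m + \<epsilon>1" "wb start + occ a N t ?m - \<epsilon>1 <= p" using elim(1,2) unfolding p_def by auto
   moreover have "\<bar>\<kappa> * P - p\<bar> <= C / real t + \<epsilon>1" using ph' unfolding ph P_def p_def .
   ultimately show ?case unfolding h_def \<epsilon>1(2)[symmetric] by (simp only: distrib_left distrib_right right_diff_distrib)
  qed
 qed
 show ?thesis
 proof (rule that[of C])
  show "0 <= C" unfolding C_def using B by simp
  show "\<forall>\<^sub>F N in sequentially. \<bar>prim WY (a - b) / (1 + r0 W WY a) * (1 + r0 W WY start) - prim WY (start - b) - occ a N t (indicator {b<..})\<bar> <= \<epsilon> + C / real t"
   if "0 < \<epsilon>" "0 < t" for \<epsilon> t using main[OF that] unfolding h_def \<kappa>_def wb_def r_def by simp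
 qed
qed

end

section \<open>Passage above a level\<close>

context refracted_levy
begin

definition gain :: "real => nat => 'a \<times> real => ennreal" where
 "gain a N p = ennreal (surv a N (snd p) (fst p) * (exp (- q * max (snd p) 0) * indicator {b<..} (cut a (U p))))"

text \<open>Stated with \<open>V\<close> itself. Its time integral is nowhere shown measurable in
  \<open>om\<close>; it is sandwiched by monotonicity of the integral between measurable functions
  of \<open>U\<close>.\<close>

definition discounted :: "real => 'a => real => ennreal" where
 "discounted a om s = ennreal (exp (- q * s) * indicator {b<..} (V s om)) * indicator {s. 0 <= s \<and> ereal s <= passage_above V a om} s"

lemma gain_meas[measurable]: "gain a N \<in> borel_measurable (M \<Otimes>\<^sub>M borel)"
 unfolding gain_def by measurable

lemma gain_le_1: "gain a N p <= 1"
proof -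
 have "gain a N p <= ennreal 1" unfolding gain_def using exp_discount_le[of "snd p"] by (intro ennreal_leI) (auto simp: indicator_def)
 then show ?thesis by simp
qed

lemma gain_integral:
 assumes "0 < t"
 shows "(\<integral>\<^sup>+p. gain a N p \<partial>(M \<Otimes>\<^sub>M uniform t)) = ennreal (occ a N t (indicator {b<..}) / real t)"
proof -
 let ?f = "\<lambda>p. surv a N (snd p) (fst p) * (exp (- q * max (snd p) 0) * indicator {b<..} (cut a (U p)))"
 have "integrable (M \<Otimes>\<^sub>M uniform t) ?f"
 proof (rule joint_integrable(1)[OF assms, where B = 1])
  show "\<bar>?f p\<bar> <= 1" for p using exp_discount_le[of "snd p"] by (auto simp: abs_mult indicator_def)
 qed measurable
 then show ?thesis unfolding occ_def gain_def using assms by (subst nn_integral_eq_integral) auto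
qed

lemma joint_nn_integral:
 assumes t: "0 < t" and f: "f \<in> borel_measurable (M \<Otimes>\<^sub>M borel)"
 shows "ennreal (real t) * (\<integral>\<^sup>+p. f p \<partial>(M \<Otimes>\<^sub>M uniform t)) = (\<integral>\<^sup>+p. f p * indicator {0..real t} (snd p) \<partial>(M \<Otimes>\<^sub>M lborel))"
proof -
 interpret T: prob_space "uniform t" by (rule prob_uniform[OF t])
 have fT: "f \<in> borel_measurable (M \<Otimes>\<^sub>M uniform t)" using f unfolding joint_sets .
 have fl[measurable]: "f \<in> borel_measurable (M \<Otimes>\<^sub>M lborel)" using f by (simp cong: measurable_cong_sets sets_pair_measure_cong)
 have sec: "(\<lambda>s. f (om, s)) \<in> borel_measurable lborel" if "om \<in> space M" for om using measurable_Pair2[OF f that] by simp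
 have "(\<integral>\<^sup>+p. f p \<partial>(M \<Otimes>\<^sub>M uniform t)) = (\<integral>\<^sup>+om. \<integral>\<^sup>+s. f (om, s) \<partial>uniform t \<partial>M)" by (rule T.nn_integral_fst[OF fT, symmetric])
 also have "\<dots> = (\<integral>\<^sup>+om. (\<integral>\<^sup>+s. f (om, s) * indicator {0..real t} s \<partial>lborel) / ennreal (real t) \<partial>M)"
  by (rule nn_integral_cong) (use sec in "simp add: nn_integral_uniform_measure")
 also have "\<dots> = (\<integral>\<^sup>+om. \<integral>\<^sup>+s. f (om, s) * indicator {0..real t} s \<partial>lborel \<partial>M) / ennreal (real t)"
  by (rule nn_integral_divide) measurable
 finally have "ennreal (real t) * (\<integral>\<^sup>+p. f p \<partial>(M \<Otimes>\<^sub>M uniform t)) = (\<integral>\<^sup>+om. \<integral>\<^sup>+s. f (om, s) * indicator {0..real t} s \<partial>lborel \<partial>M)"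
  using t by (simp only: ennreal_times_divide mult.commute[of "ennreal (real t)"]) (rule ennreal_mult_divide_eq, auto)
 moreover have "(\<lambda>p. f p * indicator {0..real t} (snd p)) \<in> borel_measurable (M \<Otimes>\<^sub>M lborel)" by measurable
 from lborel.nn_integral_fst[OF this]
 have "(\<integral>\<^sup>+om. \<integral>\<^sup>+s. f (om, s) * indicator {0..real t} s \<partial>lborel \<partial>M) = (\<integral>\<^sup>+p. f p * indicator {0..real t} (snd p) \<partial>(M \<Otimes>\<^sub>M lborel))"
  by (simp only: snd_conv)
 ultimately show ?thesis by (rule trans)
qed

text \<open>Before passage above \<open>a\<close> the path stays at or below \<open>a\<close>, so
  chains stopped at \<open>a' > a\<close> eventually survive; after it, chains stopped at
  \<open>a\<close> are eventually dead. The passage time itself is a single instant and is left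
  out.\<close>

lemma gain_limits:
 assumes a: "b < a" "start <= a" "a < a'"
 shows "AE om in M. AE s in lborel. limsup (\<lambda>N. gain a N (om, s)) * indicator {0..} s <= discounted a om s \<and>
  discounted a om s <= liminf (\<lambda>N. gain a' N (om, s)) * indicator {0..} s"
 using good_paths
proof eventually_elim
 case (elim om)
 then interpret r: regulated_process "\<lambda>t. X t om" \<delta> b x "\<lambda>t. V t om" by blast
 define T where "T = passage_above V a om"
 obtain C where C: "countable C" "\<And>s. s > 0 ==> s \<notin> C ==> U (om, s) = V s om" using elim by blast
 \<comment> \<open>For an infinite passage time \<open>real_of_ereal\<close> returns 0, which is
   excluded anyway.\<close>
 have "AE s in lborel. s \<notin> insert 0 (insert (real_of_ereal T) C)" using C(1) by (intro AE_not_in countable_imp_null_set_lborel) auto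
 then show ?case
 proof eventually_elim
  case (elim s)
  let ?v = "ennreal (exp (- q * s) * indicator {b<..} (V s om))"
  show ?case
  proof (cases "0 < s")
   case s: True
   have g: "gain c N (om, s) = ennreal (surv c N s om * (exp (- q * s) * indicator {b<..} (V s om)))" if "b < c" for c N
   proof -
    have "cut c (V s om) \<in> {b<..} \<longleftrightarrow> V s om \<in> {b<..}" using that b by auto
    then show ?thesis using s elim C(2)[of s] unfolding gain_def by (simp add: indicator_def)
   qed
   show ?thesis
   proof (cases "ereal s <= T")
    case True
    have "gain a N (om, s) <= ?v" for N unfolding g[OF a(1)] by (rule ennreal_leI) (simp add: indicator_def)
    then have "limsup (\<lambda>N. gain a N (om, s)) <= ?v" by (intro Limsup_bounded) auto
    moreover have "ereal s < T" using True elim by (cases T) auto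
    have below: "V u om <= a" if "0 <= u" "u <= s" for u
    proof (rule ccontr)
     assume V: "\<not> V u om <= a"
     then have "0 < u" using that a(2) r.V_start(1) by (cases "u = 0") auto
     then have "T <= ereal u" using V unfolding T_def passage_above_def first_after_def by (intro Inf_lower) auto
     then show False using \<open>ereal s < T\<close> that by (metis ereal_less_eq(3) leD order_trans)
    qed
    have "\<forall>\<^sub>F N in sequentially. \<forall>j\<le>grid_index N s. approx N j om <= a'"
     using r.disc_stays_below[OF _ a(3) below] s unfolding r.disc_def by simp
    then have "\<forall>\<^sub>F N in sequentially. surv a' N s om = 1" by eventually_elim (simp add: Z_chain(1))
    then have "\<forall>\<^sub>F N in sequentially. ?v <= gain a' N (om, s)" by eventually_elim (use a in "simp add: g")
    then have "?v <= liminf (\<lambda>N. gain a' N (om, s))" by (rule Liminf_bounded)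
    ultimately show ?thesis using s True unfolding T_def discounted_def by simp
   next
    case False
    then obtain u where u: "0 < u" "a < V u om" "u < s" unfolding T_def passage_above_def first_after_def not_le Inf_less_iff by auto
    have "\<forall>\<^sub>F N in sequentially. \<exists>j\<le>grid_index N s. a < approx N j om"
     using r.disc_exceeds[OF _ u(3,2)] u(1) unfolding r.disc_def by simp
    then have "\<forall>\<^sub>F N in sequentially. gain a N (om, s) <= 0"
     by eventually_elim (auto simp: gain_def Z_chain(1) indicator_def not_le)
    then have "limsup (\<lambda>N. gain a N (om, s)) <= 0" by (rule Limsup_bounded)
    then show ?thesis using False unfolding T_def discounted_def by simp
   qed
  qed (use elim in "simp add: discounted_def")
 qed
qed

text \<open>Reverse Fatou at level \<open>a\<close> bounds the integral from below, Fatou at levels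
  \<open>a' > a\<close> from above, and the value depends continuously on the level.\<close>

lemma discounted_time:
 assumes W: "is_scale_function \<psi> q W" and WY: "is_scale_function (\<lambda>th. \<psi> th - \<delta> * th) q WY" and a: "b < a" "start <= a"
 shows "(\<integral>\<^sup>+om. \<integral>\<^sup>+s. discounted a om s \<partial>lborel \<partial>M) =
  ennreal (prim WY (a - b) / (1 + r0 W WY a) * (1 + r0 W WY start) - prim WY (start - b))"
proof -
 define k where "k c = prim WY (c - b) / (1 + r0 W WY c) * (1 + r0 W WY start) - prim WY (start - b)" for c
 have lim: "(\<lambda>n. ennreal (y + c * mesh n)) \<longlonglongrightarrow> ennreal y" for y c
  using tendsto_add[OF tendsto_const tendsto_mult[OF tendsto_const mesh_tendsto], of y c] by (intro tendsto_ennrealI) simp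
 have nest: "(\<integral>\<^sup>+om. \<integral>\<^sup>+s. f (om, s) * indicator A s \<partial>lborel \<partial>M) = (\<integral>\<^sup>+p. f p * indicator A (snd p) \<partial>(M \<Otimes>\<^sub>M lborel))"
  if "f \<in> borel_measurable (M \<Otimes>\<^sub>M borel)" "A \<in> sets borel" for f :: "_ => ennreal" and A :: "real set"
 proof -
  have [measurable]: "f \<in> borel_measurable (M \<Otimes>\<^sub>M lborel)" using that by (simp cong: measurable_cong_sets sets_pair_measure_cong)
  have "(\<lambda>p. f p * indicator A (snd p)) \<in> borel_measurable (M \<Otimes>\<^sub>M lborel)" using that by measurable
  from lborel.nn_integral_fst[OF this] show ?thesis by (simp only: snd_conv)
 qed
 have sup_m: "(\<lambda>p. limsup (\<lambda>N. gain c N p)) \<in> borel_measurable (M \<Otimes>\<^sub>M borel)" and inf_m: "(\<lambda>p. liminf (\<lambda>N. gain c N p)) \<in> borel_measurable (M \<Otimes>\<^sub>M borel)" for c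
  by measurable
 have bounds: "\<exists>C. \<forall>n. ennreal (k c + - C * mesh n) <= (\<integral>\<^sup>+om. \<integral>\<^sup>+s. limsup (\<lambda>N. gain c N (om, s)) * indicator {0..real (Suc n)} s \<partial>lborel \<partial>M) \<and>
  (\<integral>\<^sup>+om. \<integral>\<^sup>+s. liminf (\<lambda>N. gain c N (om, s)) * indicator {0..real (Suc n)} s \<partial>lborel \<partial>M) <= ennreal (k c + C * mesh n)"
  if c: "b < c" "start <= c" for c
 proof -
  obtain C where C: "\<And>\<epsilon> t. 0 < \<epsilon> ==> 0 < t ==> \<forall>\<^sub>F N in sequentially. \<bar>k c - occ c N t (indicator {b<..})\<bar> <= \<epsilon> + C / real t"
   by (rule occ_limit[OF W WY c, folded k_def]) blast
  have "ennreal (k c + - (C + 1) * mesh n) <= (\<integral>\<^sup>+om. \<integral>\<^sup>+s. limsup (\<lambda>N. gain c N (om, s)) * indicator {0..real (Suc n)} s \<partial>lborel \<partial>M) \<and>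
   (\<integral>\<^sup>+om. \<integral>\<^sup>+s. liminf (\<lambda>N. gain c N (om, s)) * indicator {0..real (Suc n)} s \<partial>lborel \<partial>M) <= ennreal (k c + (C + 1) * mesh n)" for n
  proof -
   define t where "t = Suc n"
   define e where "e = (C + 1) * mesh n"
   have t: "0 < t" unfolding t_def by simp
   interpret T: prob_space "uniform t" by (rule prob_uniform[OF t])
   interpret P: pair_prob_space M "uniform t" ..
   have gm: "gain c N \<in> borel_measurable (M \<Otimes>\<^sub>M uniform t)" for N unfolding joint_sets by (rule gain_meas)
   have scale: "ennreal (real t) * ennreal (y / real t) = ennreal y" for y
    using t by (subst ennreal_mult'[symmetric]) auto
   \<comment> \<open>Accuracy \<open>1 / t\<close> and survival term \<open>C / t\<close> together;
     both vanish as the horizon grows.\<close>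
   have ed: "1 / real t + C / real t = e" unfolding e_def t_def by (simp only: add_divide_distrib[symmetric] times_divide_eq_right mult_1_right add.commute)
   have "0 < 1 / real t" using t by simp
   from C[OF this t] have "\<forall>\<^sub>F N in sequentially. \<bar>k c - occ c N t (indicator {b<..})\<bar> <= e" unfolding ed .
   moreover have "k c - e <= z \<and> z <= k c + e" if "\<bar>k c - z\<bar> <= e" for z using that by linarith
   ultimately have ev: "\<forall>\<^sub>F N in sequentially. k c - e <= occ c N t (indicator {b<..}) \<and> occ c N t (indicator {b<..}) <= k c + e"
    by (rule eventually_mono)
   have "\<forall>\<^sub>F N in sequentially. ennreal ((k c - e) / real t) <= (\<integral>\<^sup>+p. gain c N p \<partial>(M \<Otimes>\<^sub>M uniform t))"
    using ev unfolding gain_integral[OF t] by eventually_elim (intro ennreal_leI divide_right_mono, auto)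
   then have "ennreal ((k c - e) / real t) <= limsup (\<lambda>N. \<integral>\<^sup>+p. gain c N p \<partial>(M \<Otimes>\<^sub>M uniform t))"
    by (rule order_trans[OF Liminf_bounded Liminf_le_Limsup[OF sequentially_bot]])
   also have "\<dots> <= (\<integral>\<^sup>+p. limsup (\<lambda>N. gain c N p) \<partial>(M \<Otimes>\<^sub>M uniform t))"
    by (rule nn_integral_limsup[OF gm, where w = "\<lambda>_. 1"]) (simp_all add: P.emeasure_space_1 gain_le_1)
   finally have lo: "ennreal (real t) * ennreal ((k c - e) / real t) <= ennreal (real t) * (\<integral>\<^sup>+p. limsup (\<lambda>N. gain c N p) \<partial>(M \<Otimes>\<^sub>M uniform t))"
    by (rule mult_left_mono) simp
   have "\<forall>\<^sub>F N in sequentially. (\<integral>\<^sup>+p. gain c N p \<partial>(M \<Otimes>\<^sub>M uniform t)) <= ennreal ((k c + e) / real t)"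
    using ev unfolding gain_integral[OF t] by eventually_elim (intro ennreal_leI divide_right_mono, auto)
   then have "liminf (\<lambda>N. \<integral>\<^sup>+p. gain c N p \<partial>(M \<Otimes>\<^sub>M uniform t)) <= ennreal ((k c + e) / real t)"
    by (rule order_trans[OF Liminf_le_Limsup[OF sequentially_bot] Limsup_bounded])
   with nn_integral_liminf[OF gm]
   have "(\<integral>\<^sup>+p. liminf (\<lambda>N. gain c N p) \<partial>(M \<Otimes>\<^sub>M uniform t)) <= ennreal ((k c + e) / real t)" by (rule order_trans)
   then have hi: "ennreal (real t) * (\<integral>\<^sup>+p. liminf (\<lambda>N. gain c N p) \<partial>(M \<Otimes>\<^sub>M uniform t)) <= ennreal (real t) * ennreal ((k c + e) / real t)"
    by (rule mult_left_mono) simp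
   note eq = trans[OF joint_nn_integral[OF t sup_m] nest[OF sup_m atLeastAtMost_borel, symmetric]]
    trans[OF joint_nn_integral[OF t inf_m] nest[OF inf_m atLeastAtMost_borel, symmetric]]
   show ?thesis using lo hi unfolding eq scale unfolding e_def t_def mult_minus_left diff_conv_add_uminus by blast
  qed
  then show ?thesis by blast
 qed
 let ?I = "\<integral>\<^sup>+om. \<integral>\<^sup>+s. discounted a om s \<partial>lborel \<partial>M"
 have low: "ennreal (k a) <= ?I"
 proof -
  obtain C where C: "\<And>n. ennreal (k a + - C * mesh n) <= (\<integral>\<^sup>+om. \<integral>\<^sup>+s. limsup (\<lambda>N. gain a N (om, s)) * indicator {0..real (Suc n)} s \<partial>lborel \<partial>M)"
   using bounds[OF a] by blast
  have "(\<integral>\<^sup>+om. \<integral>\<^sup>+s. limsup (\<lambda>N. gain a N (om, s)) * indicator {0..real (Suc n)} s \<partial>lborel \<partial>M) <= ?I" for n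
  proof (rule nn_integral_mono_AE)
   show "AE om in M. (\<integral>\<^sup>+s. limsup (\<lambda>N. gain a N (om, s)) * indicator {0..real (Suc n)} s \<partial>lborel) <= (\<integral>\<^sup>+s. discounted a om s \<partial>lborel)"
    using gain_limits[OF a less_add_one]
   proof eventually_elim
    case (elim om)
    then have "AE s in lborel. limsup (\<lambda>N. gain a N (om, s)) * indicator {0..real (Suc n)} s <= discounted a om s"
     by eventually_elim (auto simp: indicator_def split: if_splits)
    then show ?case by (rule nn_integral_mono_AE)
   qed
  qed
  from LIMSEQ_le_const2[OF lim[of "k a" "- C"]] order_trans[OF C this] show ?thesis by blast
 qed
 have up: "?I <= ennreal (k a')" if a': "a < a'" for a'
 proof -
  obtain C where C: "\<And>n. (\<integral>\<^sup>+om. \<integral>\<^sup>+s. liminf (\<lambda>N. gain a' N (om, s)) * indicator {0..real (Suc n)} s \<partial>lborel \<partial>M) <= ennreal (k a' + C * mesh n)"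
   using bounds[of a'] a a' by auto
  let ?F = "\<lambda>p. liminf (\<lambda>N. gain a' N p)"
  have [measurable]: "?F \<in> borel_measurable (M \<Otimes>\<^sub>M lborel)" using inf_m[of a'] by (simp cong: measurable_cong_sets sets_pair_measure_cong)
  \<comment> \<open>The upper bound needs the whole half-line, hence monotone convergence in the
    horizon; for the lower bound every truncated integral was already below the full one.\<close>
  have "(\<lambda>n. \<integral>\<^sup>+p. ?F p * indicator {0..real (Suc n)} (snd p) \<partial>(M \<Otimes>\<^sub>M lborel)) \<longlonglongrightarrow> (\<integral>\<^sup>+p. ?F p * indicator {0..} (snd p) \<partial>(M \<Otimes>\<^sub>M lborel))"
  proof (rule nn_integral_LIMSEQ)
   show "incseq (\<lambda>n p. ?F p * indicator {0..real (Suc n)} (snd p))" by (auto simp: incseq_def le_fun_def indicator_def)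
   fix p :: "'a \<times> real"
   have "\<forall>\<^sub>F n in sequentially. snd p <= real (Suc n)"
    using eventually_ge_at_top[of "nat \<lceil>snd p\<rceil>"] by eventually_elim (simp add: nat_le_iff ceiling_le_iff)
   then have "\<forall>\<^sub>F n in sequentially. ?F p * indicator {0..real (Suc n)} (snd p) = ?F p * indicator {0..} (snd p)"
    by eventually_elim (auto simp: indicator_def)
   then show "(\<lambda>n. ?F p * indicator {0..real (Suc n)} (snd p)) \<longlonglongrightarrow> ?F p * indicator {0..} (snd p)" by (rule tendsto_eventually)
  qed measurable
  from LIMSEQ_le[OF this lim[of "k a'" C]] C have "(\<integral>\<^sup>+om. \<integral>\<^sup>+s. ?F (om, s) * indicator {0..} s \<partial>lborel \<partial>M) <= ennreal (k a')"
   unfolding nest[OF inf_m atLeast_borel] nest[OF inf_m atLeastAtMost_borel] by blast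
  moreover have "?I <= (\<integral>\<^sup>+om. \<integral>\<^sup>+s. ?F (om, s) * indicator {0..} s \<partial>lborel \<partial>M)"
  proof (rule nn_integral_mono_AE)
   show "AE om in M. (\<integral>\<^sup>+s. discounted a om s \<partial>lborel) <= (\<integral>\<^sup>+s. ?F (om, s) * indicator {0..} s \<partial>lborel)"
    using gain_limits[OF a a']
   proof eventually_elim
    case (elim om)
    then have "AE s in lborel. discounted a om s <= ?F (om, s) * indicator {0..} s" by eventually_elim (erule conjunct2)
    then show ?case by (rule nn_integral_mono_AE)
   qed
  qed
  ultimately show ?thesis by (rule order_trans[rotated])
 qed
 have "(\<lambda>n. ennreal (k (a + mesh n))) \<longlonglongrightarrow> ennreal (k a)"
 proof -
  obtain be where T: "smooth_triple q be (prim (\<lambda>x. prim WY (x - b))) (\<lambda>x. \<delta> * prim WY (x - b) + max (x - b) 0) (\<lambda>x. prim WY (x - b))"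
   "smooth_triple q be (prim (r0 W WY)) (\<lambda>x. q * max x 0 + \<delta> * (r0 W WY (max x b) - r0 W WY b)) (r0 W WY)"
   and r: "mono (r0 W WY)" "\<And>x. x <= 0 ==> r0 W WY x = 0"
   by (rule scale_triples[OF W WY]) blast
  have "continuous_on UNIV (\<lambda>x. prim WY (x - b))" "continuous_on UNIV (r0 W WY)"
   using T exp_lip_continuous unfolding smooth_triple_def by blast+
  then have c: "isCont (\<lambda>x. prim WY (x - b)) a" "isCont (r0 W WY) a" by (auto simp: continuous_on_eq_continuous_at)
  have "0 <= r0 W WY a" using monoD[OF r(1), of 0 a] r(2)[of 0] a b by simp
  then have "isCont k a" unfolding k_def by (intro isCont_diff isCont_mult isCont_divide isCont_add c continuous_const) simp
  moreover have "(\<lambda>n. a + mesh n) \<longlonglongrightarrow> a" using tendsto_add[OF tendsto_const mesh_tendsto, of a] by simp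
  ultimately show ?thesis by (rule tendsto_ennrealI[OF isCont_tendsto_compose])
 qed
 then have "?I <= ennreal (k a)" by (rule LIMSEQ_le_const) (use up in simp)
 then show ?thesis using low unfolding k_def by (intro antisym)
qed

end

text \<open>The loss is the primitive of \<open>\<delta>\<close> times an indicator, and agreement
  on half-open intervals determines the measure. At negative times the loss is 0, as
  \<open>{0..t}\<close> is empty.\<close>

lemma (in regulated_process) interval_measure_refraction_loss:
 "interval_measure (\<lambda>t. \<delta> * (LBINT s:{0..t}. indicator {b<..} (V s))) =
  density lborel (\<lambda>s. ennreal (\<delta> * indicator {s. 0 <= s \<and> b < V s} s))"
proof -
 define D where "D = {s. 0 <= s \<and> b < V s}"
 have "D = (\<Union>n::nat. {u. 0 <= u \<and> u < real n \<and> b < V u})" unfolding D_def using reals_Archimedean2 by auto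
 then have D[measurable]: "D \<in> sets borel" using level_meas by (simp only:) auto
 define g :: "real => real" where "g = indicator D"
 have g: "growth 1 1 g"
 proof -
  have "g y <= exp y" "y < 0 ==> g y = 0" for y using one_le_exp_iff[of y] unfolding g_def D_def by (auto simp: indicator_def)
  then show ?thesis unfolding growth_def g_def by auto
 qed
 let ?F = "\<lambda>t. \<delta> * prim g t"
 have eq: "(\<lambda>t. \<delta> * (LBINT s:{0..t}. indicator {b<..} (V s))) = ?F"
  unfolding prim_def set_lebesgue_integral_def g_def D_def by (intro ext arg_cong[of _ _ "(*) \<delta>"] Bochner_Integration.integral_cong) (auto simp: indicator_def)
 have mono: "?F s <= ?F t" if "s <= t" for s t using monoD[OF prim_mono[OF g] that] \<delta> by (intro mult_left_mono) auto
 have "continuous_on UNIV (prim g)" using exp_lip_continuous[OF prim_exp_lip[OF g]] by simp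
 then have cont: "continuous (at_right t) ?F" for t
  by (intro continuous_intros) (auto simp: continuous_on_eq_continuous_at intro: continuous_at_imp_continuous_at_within)
 have E: "emeasure (interval_measure ?F) {s<..t} = emeasure (density lborel (\<lambda>s. ennreal (\<delta> * g s))) {s<..t}"
  "emeasure (interval_measure ?F) {s<..t} \<noteq> \<infinity>" for s t
 proof -
  show "emeasure (interval_measure ?F) {s<..t} = emeasure (density lborel (\<lambda>s. ennreal (\<delta> * g s))) {s<..t}"
  proof (cases "s <= t")
   case True
   have i: "integrable lborel (\<lambda>u. \<delta> * (indicator {s<..t} u * g u))"
    unfolding g_def by (intro integrable_mult_right Bochner_Integration.integrable_bound[OF integrable_real_indicator[of "{s<..t}"]]) (use True in "auto simp: indicator_def")
   have "emeasure (interval_measure ?F) {s<..t} = ennreal (\<delta> * (\<integral>u. indicator {s<..t} u * g u \<partial>lborel))"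
    using emeasure_interval_measure_Ioc[OF True mono cont] prim_diff(1)[OF g zero_less_one True] by (simp add: right_diff_distrib[symmetric])
   also have "\<dots> = (\<integral>\<^sup>+u. ennreal (\<delta> * (indicator {s<..t} u * g u)) \<partial>lborel)"
    using i \<delta> by (subst nn_integral_eq_integral) (auto simp: g_def)
   also have "\<dots> = emeasure (density lborel (\<lambda>s. ennreal (\<delta> * g s))) {s<..t}"
    unfolding g_def by (subst emeasure_density) (auto intro!: nn_integral_cong simp: indicator_def)
   finally show ?thesis .
  qed simp
  show "emeasure (interval_measure ?F) {s<..t} \<noteq> \<infinity>" using emeasure_interval_measure_Ioc[OF _ mono cont, of s t] by (cases "s <= t") auto
 qed
 have "interval_measure ?F = density lborel (\<lambda>s. ennreal (\<delta> * g s))"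
 proof (rule measure_eqI_generator_eq[where \<Omega> = UNIV and E = "range (\<lambda>(s, t). {s<..t})" and A = "\<lambda>i. {- real i<..real i}"])
  show "(\<Union>i. {- real i<..real i}) = UNIV" by (rule UN_Ioc_eq_UNIV)
  show "emeasure (interval_measure ?F) {- real i<..real i} \<noteq> \<infinity>" for i by (rule E(2))
 qed (auto simp: E(1) borel_sigma_sets_Ioc Int_stable_def)
 then show ?thesis unfolding eq g_def D_def .
qed

section \<open>Passing to the integrals and scale functions of the statement\<close>

lemma nn_integral_cmult_ge: "c * (\<integral>\<^sup>+x. f x \<partial>M) <= (\<integral>\<^sup>+x. c * f x \<partial>M)"
 unfolding nn_integral_def[of M f] SUP_mult_left_ennreal
proof (rule SUP_least)
 fix g assume g: "g \<in> {g. simple_function M g \<and> g <= f}"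
 have "c * integral\<^sup>S M g = (\<integral>\<^sup>+x. c * g x \<partial>M)"
  using g by (subst nn_integral_cmult) (auto simp: nn_integral_eq_simple_integral borel_measurable_simple_function)
 also have "\<dots> <= (\<integral>\<^sup>+x. c * f x \<partial>M)" using g by (intro nn_integral_mono mult_left_mono) (auto simp: le_fun_def)
 finally show "c * integral\<^sup>S M g <= (\<integral>\<^sup>+x. c * f x \<partial>M)" .
qed

text \<open>Unlike \<open>nn_integral_cmult\<close>, the following does not require measurability.\<close>

lemma nn_integral_cmult_pos:
 assumes "0 < c"
 shows "(\<integral>\<^sup>+x. ennreal c * f x \<partial>M) = ennreal c * (\<integral>\<^sup>+x. f x \<partial>M)"
proof (rule antisym[OF _ nn_integral_cmult_ge])
 have inv: "ennreal c * (ennreal (1 / c) * y) = y" "ennreal (1 / c) * (ennreal c * y) = y" for y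
  using assms by (simp_all add: mult.assoc[symmetric] ennreal_mult[symmetric])
 have "ennreal c * (ennreal (1 / c) * (\<integral>\<^sup>+x. ennreal c * f x \<partial>M)) <= ennreal c * (\<integral>\<^sup>+x. ennreal (1 / c) * (ennreal c * f x) \<partial>M)"
  by (intro mult_left_mono nn_integral_cmult_ge) simp
 then show "(\<integral>\<^sup>+x. ennreal c * f x \<partial>M) <= ennreal c * (\<integral>\<^sup>+x. f x \<partial>M)" unfolding inv .
qed

text \<open>\<open>ennreal\<close> sends negative reals to 0, so \<open>discounted_time\<close>
  alone does not exclude a negative value.\<close>

lemma (in refracted_levy) discounted_time_nonneg:
 assumes "is_scale_function \<psi> q W" "is_scale_function (\<lambda>th. \<psi> th - \<delta> * th) q WY" "b < a" "start <= a"
 shows "0 <= prim WY (a - b) / (1 + r0 W WY a) * (1 + r0 W WY start) - prim WY (start - b)" (is "0 <= ?k")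
proof -
 obtain C where C: "\<And>\<epsilon> t. 0 < \<epsilon> ==> 0 < t ==> \<forall>\<^sub>F N in sequentially. \<bar>?k - occ a N t (indicator {b<..})\<bar> <= \<epsilon> + C / real t"
  by (rule occ_limit[OF assms]) blast
 have "0 <= ?k + (mesh n + C * mesh n)" for n
 proof -
  obtain N where "\<bar>?k - occ a N (Suc n) (indicator {b<..})\<bar> <= mesh n + C / real (Suc n)"
   using eventually_happens'[OF sequentially_bot C[of "mesh n" "Suc n"]] by auto
  moreover have "0 <= occ a N (Suc n) (indicator {b<..})"
   unfolding occ_def by (intro mult_nonneg_nonneg Bochner_Integration.integral_nonneg) auto
  ultimately have "- ?k <= mesh n + C / real (Suc n)" by (simp only: abs_le_iff) linarith
  then show ?thesis by simp
 qed
 moreover have "(\<lambda>n. ?k + (mesh n + C * mesh n)) \<longlonglongrightarrow> ?k + (0 + C * 0)" by (intro tendsto_intros mesh_tendsto)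
 ultimately show ?thesis using LIMSEQ_le_const[of _ _ 0] by fastforce
qed

text \<open>For \<open>y < 0\<close> the oriented integral runs over negative arguments, where the
  scale function vanishes.\<close>

lemma scale_W_bar_eq_prim:
 assumes "\<And>y. y < 0 ==> W y = 0"
 shows "scale_W_bar W y = prim W y"
proof (cases "0 <= y")
 case True
 have "(LBINT z:{0..y}. W z) = prim W y" unfolding set_lebesgue_integral_def prim_def
  by (rule Bochner_Integration.integral_cong) (use assms in "auto simp: indicator_def")
 then show ?thesis unfolding scale_W_bar_def zero_ereal_def using interval_integral_Icc[OF True, of W] by simp
next
 case False
 have "(LBINT z:{y<..<0}. W z) = 0" "prim W y = 0" unfolding set_lebesgue_integral_def prim_def
  by (rule integral_eq_zero_AE, rule AE_I2, use assms False in "simp add: indicator_def")+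
 then show ?thesis unfolding scale_W_bar_def zero_ereal_def interval_lebesgue_integral_def einterval_eq using False by simp
qed

lemma (in refraction) scale_r_eq:
 assumes W: "\<And>y. y < 0 ==> W y = 0" "\<And>y. y < 0 ==> WY y = 0"
 shows "scale_r q \<delta> b W WY v = 1 + r0 W WY v"
proof -
 have "(LBINT y=b..v. WY (v - y) * W y) = conv WY (\<lambda>y. indicator {b<..} y * W y) v"
 proof (cases "b <= v")
  case True
  have "(LBINT y:{b<..v}. WY (v - y) * W y) = conv WY (\<lambda>y. indicator {b<..} y * W y) v"
   unfolding set_lebesgue_integral_def conv_def by (rule Bochner_Integration.integral_cong) (use W in "auto simp: indicator_def")
  then show ?thesis using interval_integral_Ioc[OF True, of "\<lambda>y. WY (v - y) * W y"] by simp
 next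
  case False
  have "(LBINT y:{v<..<b}. WY (v - y) * W y) = 0" "conv WY (\<lambda>y. indicator {b<..} y * W y) v = 0" unfolding set_lebesgue_integral_def conv_def
   by (rule integral_eq_zero_AE, rule AE_I2, use W False in "simp add: indicator_def")+
  then show ?thesis unfolding interval_lebesgue_integral_def einterval_eq using False by simp
 qed
 then show ?thesis using scale_W_bar_eq_prim[of W v, OF W(1)] unfolding scale_r_def scale_Z_def scale_W_bar_def r0_def by simp
qed

theorem corollary4p3:
  fixes M :: "'a measure" and X V :: "real \<Rightarrow> 'a \<Rightarrow> real" and \<nu> :: "real measure"
    and \<gamma> \<sigma> \<delta> b q a x :: real and W WY :: "real \<Rightarrow> real"
  assumes "spectrally_negative_levy M x X"
    and "levy_triplet M X \<gamma> \<sigma> \<nu>"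
    and "0 < b" and "0 \<le> \<delta>"
    and "bounded_variation_paths M X \<longrightarrow> \<delta> < bv_drift \<gamma> \<nu>"
    and "refracted_reflected M X \<delta> b x V"
    and "0 \<le> q" and "0 < a" and "x \<le> a"
    and "is_scale_function (laplace_exponent M X) q W"
    and "is_scale_function (\<lambda>\<theta>. laplace_exponent M X \<theta> - \<delta> * \<theta>) q WY"
  shows "enn2ereal (\<integral>\<^sup>+ \<omega>. (\<integral>\<^sup>+ t \<in> {t. 0 \<le> t \<and> ereal t \<le> passage_above V a \<omega>}.
             ennreal (exp (- q * t)) \<partial>interval_measure (refraction_loss \<delta> b V \<omega>)) \<partial>M)
    = ereal (\<delta> * scale_W_bar WY (a - b) * (scale_r q \<delta> b W WY x / scale_r q \<delta> b W WY a)
             - \<delta> * scale_W_bar WY (x - b))"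
proof -
 have levy: "levy_process M x X" using assms(1) unfolding spectrally_negative_levy_def by blast
 then interpret sn_levy M x X by (intro sn_levy.intro levy.intro levy_axioms.intro sn_levy_axioms.intro assms(1)) (simp add: levy_process_def)
 interpret refraction M x X \<delta> b q
  by unfold_locales (use assms(3,4,7) exponent_quadratic[OF assms(2)] exponent_diverges[OF assms(2,4,5)] in auto)
 have neg: "W y = 0" "WY y = 0" if "y < 0" for y using assms(10,11) that unfolding is_scale_function_def by auto
 have prim: "scale_W_bar WY y = prim WY y" for y by (rule scale_W_bar_eq_prim) (rule neg)
 have r: "scale_r q \<delta> b W WY y = 1 + r0 W WY y" for y by (rule scale_r_eq) (rule neg, assumption)+
 define J where "J \<omega> = (\<integral>\<^sup>+s. ennreal (exp (- q * s) * indicator {b<..} (V s \<omega>)) * indicator {s. 0 <= s \<and> ereal s <= passage_above V a \<omega>} s \<partial>lborel)" for \<omega>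
 let ?inner = "\<lambda>\<omega>. \<integral>\<^sup>+t\<in>{t. 0 <= t \<and> ereal t <= passage_above V a \<omega>}. ennreal (exp (- q * t)) \<partial>interval_measure (refraction_loss \<delta> b V \<omega>)"
 \<comment> \<open>The construction of \<open>V\<close> is used only here; from now on the regulated
   equation stands for it.\<close>
 have paths: "AE \<omega> in M. regulated_process (\<lambda>t. X t \<omega>) \<delta> b x (\<lambda>t. V t \<omega>)"
  using AE_path assms(6)[unfolded refracted_reflected_def]
  by eventually_elim (intro regulated_process.intro regulated_all, use assms(3,4) in auto)
 have inner: "AE \<omega> in M. ?inner \<omega> = ennreal \<delta> * J \<omega>"
  using paths
 proof eventually_elim
  case (elim \<omega>)
  then interpret r: regulated_process "\<lambda>t. X t \<omega>" \<delta> b x "\<lambda>t. V t \<omega>" .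
  define A where "A = {t. 0 <= t \<and> ereal t <= passage_above V a \<omega>}"
  have A[measurable]: "A \<in> sets borel" unfolding A_def by measurable
  let ?D = "{s. 0 <= s \<and> b < V s \<omega>}"
  have "?D = (\<Union>n::nat. {u. 0 <= u \<and> u < real n \<and> b < V u \<omega>})" using reals_Archimedean2 by auto
  then have D[measurable]: "?D \<in> sets borel" using r.level_meas by (simp only:) auto
  have "?inner \<omega> = (\<integral>\<^sup>+s. ennreal (\<delta> * indicator ?D s) * (ennreal (exp (- q * s)) * indicator A s) \<partial>lborel)"
   unfolding refraction_loss_def[abs_def] r.interval_measure_refraction_loss A_def[symmetric] by (rule nn_integral_density) measurable
  also have "\<dots> = (\<integral>\<^sup>+s. ennreal \<delta> * (ennreal (exp (- q * s) * indicator ?D s) * indicator A s) \<partial>lborel)"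
   using assms(4) by (intro nn_integral_cong) (auto simp: ennreal_mult indicator_def)
  also have "\<dots> = ennreal \<delta> * (\<integral>\<^sup>+s. ennreal (exp (- q * s) * indicator ?D s) * indicator A s \<partial>lborel)"
   by (rule nn_integral_cmult) measurable
  also have "(\<integral>\<^sup>+s. ennreal (exp (- q * s) * indicator ?D s) * indicator A s \<partial>lborel) = J \<omega>"
   unfolding J_def A_def[symmetric] by (rule nn_integral_cong) (auto simp: A_def indicator_def)
  finally show ?case .
 qed
 define k where "k = prim WY (a - b) / (1 + r0 W WY a) * (1 + r0 W WY (max x 0)) - prim WY (max x 0 - b)"
 obtain \<beta> where mono: "mono (prim WY)" and zero: "\<And>y. y <= 0 ==> prim WY y = 0 \<and> r0 W WY y = 0"
  by (rule scale_triples[OF assms(10,11)]) blast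
 \<comment> \<open>For \<open>x < 0\<close> the process starts from 0, and the formula agrees: on
   nonpositive arguments \<open>r\<close> is 1 and the primitive of \<open>WY\<close> is 0.\<close>
 have k: "\<delta> * k = \<delta> * scale_W_bar WY (a - b) * (scale_r q \<delta> b W WY x / scale_r q \<delta> b W WY a) - \<delta> * scale_W_bar WY (x - b)"
  unfolding k_def prim r using zero[of x] zero[of 0] zero[of "x - b"] zero[of "- b"] b by (cases "0 <= x") (auto simp: max_def right_diff_distrib)
 have main: "(\<integral>\<^sup>+\<omega>. ?inner \<omega> \<partial>M) = ennreal (\<delta> * k) \<and> 0 <= \<delta> * k"
 proof (cases "\<delta> = 0")
  case True
  then have "(\<integral>\<^sup>+\<omega>. ?inner \<omega> \<partial>M) = (\<integral>\<^sup>+\<omega>. 0 \<partial>M)" using inner by (intro nn_integral_cong_AE) (auto elim: eventually_mono)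
  then show ?thesis using True by simp
 next
  case False
  \<comment> \<open>For \<open>a <= b\<close> the path does not exceed \<open>b\<close> before
    passage, so a loss could accrue only at the passage time or at time 0, a null set.\<close>
  have J: "AE \<omega> in M. J \<omega> = 0" if ab: "a <= b"
  proof (rule AE_I2)
   fix \<omega>
   define T where "T = passage_above V a \<omega>"
   have "AE s in lborel. s \<notin> {0, real_of_ereal T}" by (intro AE_not_in countable_imp_null_set_lborel) auto
   then have "AE s in lborel. ennreal (exp (- q * s) * indicator {b<..} (V s \<omega>)) * indicator {s. 0 <= s \<and> ereal s <= passage_above V a \<omega>} s = 0"
   proof eventually_elim
    case (elim s)
    have False if s: "0 <= s" "ereal s <= T" "b < V s \<omega>"
    proof -
     have "T <= ereal s" using s elim ab unfolding T_def passage_above_def first_after_def by (intro Inf_lower) auto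
     then have "T = ereal s" using s(2) by (rule antisym)
     then show False using elim by simp
    qed
    then show ?case unfolding T_def[symmetric] by (auto simp: indicator_def)
   qed
   then show "J \<omega> = 0" unfolding J_def by (subst nn_integral_cong_AE) auto
  qed
  \<comment> \<open>\<open>J\<close> has not been shown measurable, hence the scaling rule for
    arbitrary functions.\<close>
  have I: "(\<integral>\<^sup>+\<omega>. ?inner \<omega> \<partial>M) = ennreal \<delta> * (\<integral>\<^sup>+\<omega>. J \<omega> \<partial>M)"
   using False assms(4) inner by (subst nn_integral_cmult_pos[symmetric]) (auto intro: nn_integral_cong_AE)
  show ?thesis
  proof (cases "a <= b")
   case True
   then have "(\<integral>\<^sup>+\<omega>. J \<omega> \<partial>M) = (\<integral>\<^sup>+\<omega>. 0 \<partial>M)" by (intro nn_integral_cong_AE J)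
   moreover have "k = 0" unfolding k_def using True zero[of "a - b"] zero[of "max x 0 - b"] assms(8,9) by simp
   ultimately show ?thesis unfolding I by simp
  next
   case ba: False
   interpret refracted_levy M x X \<delta> b q V by unfold_locales (use paths False assms(4) in auto)
   have "b < a" "start <= a" using ba assms(8,9) by auto
   note d = discounted_time[OF assms(10,11) this] and nn = discounted_time_nonneg[OF assms(10,11) this]
   have "(\<integral>\<^sup>+\<omega>. J \<omega> \<partial>M) = ennreal k" using d unfolding discounted_def J_def k_def .
   then show ?thesis unfolding I using nn assms(4) unfolding k_def[symmetric] by (simp add: ennreal_mult)
  qed
 qed
 then show ?thesis unfolding k by (simp add: enn2ereal_ennreal)
qed


end
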